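(* Let $X$ be a Gorenstein minimal complex projective $3$-fold of general type with locally factorial terminal singularities and let $\varphi: X\longrightarrow\mathbb{P}^3$ be an abelian cover. If $\varphi=\phi_X$ is the canonical map of $X$, then the canonical degree $\deg \phi_X$ can only be $2^m$ with $1\leqslant m\leqslant 5$; that is, $\deg\phi_X\in\{2,4,8,16,32\}$.
   Context: Minimal means that the canonical divisor $K_X$ is nef. An abelian cover $\varphi:X\to Y$ associated to a finite abelian group $G$ is a finite surjective morphism from a normal variety $X$ to $Y$ such that the function field extension $\mathbb{C}(X)/\mathbb{C}(Y)$ is Galois with Galois group $G$. The canonical map $\phi_X: X\dashrightarrow\mathbb{P}^{p_g(X)-1}$, where $p_g(X)=h^0(X,\mathcal{O}_X(K_X))$, is the map defined by the complete linear system $|K_X|$. The condition $\varphi=\phi_X$ means that $p_g(X)=4$ and $|K_X|$ defines the morphism $\varphi$, so that $\mathcal{O}_X(K_X)\cong\varphi^*\mathcal{O}_{\mathbb{P}^3}(1)$. The canonical degree is the degree of $\phi_X$. *)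

theory Defs
  imports
    "HOL-Algebra.Algebra"
    "HOL-Algebra.Algebraic_Closure_Type"
    "HOL-Combinatorics.Permutations"
    "HOL-Library.Function_Algebras"
    Complex_Main
begin

no_notation var (\<open>X\<index>\<close>)

text \<open>
  Complex varieties are treated in the language of Zariski and Chevalley: an integral separated
  scheme \<open>X\<close> of finite type over the complex numbers with function field \<open>K\<close> is identified with the
  set of its local rings \<open>O_{X,P}\<close> (\<open>P\<close> a scheme point, the generic point included), which are
  subrings of \<open>K\<close>. A point \<open>P\<close> lies in the closure of \<open>Q\<close> iff \<open>O_P\<close> is contained in \<open>O_Q\<close>, and the
  image of \<open>P\<close> under a dominant morphism is the local ring dominated by \<open>O_P\<close>. Varieties with the
  same function field are birational models of one another. The function field is a type of the
  following class, which fixes the embedding of the complex numbers.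
\<close>

class complex_extension_field = field +
  fixes of_cplx :: "complex \<Rightarrow> 'a"
  assumes of_cplx_add: "of_cplx (a + b) = of_cplx a + of_cplx b"
    and of_cplx_mult: "of_cplx (a * b) = of_cplx a * of_cplx b"
    and of_cplx_one: "of_cplx 1 = 1"

instantiation complex :: complex_extension_field
begin
definition of_cplx_complex :: "complex \<Rightarrow> complex" where "of_cplx_complex c = c"
instance by standard (simp_all add: of_cplx_complex_def)
end

definition cplx_scale :: "complex \<Rightarrow> 'k::complex_extension_field \<Rightarrow> 'k" where
  "cplx_scale c x = of_cplx c * x"

abbreviation whole_field :: "'k::field ring" where
  "whole_field \<equiv> ring_of_type_algebra"

abbreviation sub :: "'k::field set \<Rightarrow> 'k ring" where
  "sub A \<equiv> whole_field\<lparr>carrier := A\<rparr>"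


section \<open>Commutative algebra of subrings of a field\<close>

text \<open>For a local subring this is its maximal ideal.\<close>

definition max_ideal :: "'k::field set \<Rightarrow> 'k set" where
  "max_ideal R = {x \<in> R. x = 0 \<or> inverse x \<notin> R}"

definition localization :: "'k::field set \<Rightarrow> 'k set \<Rightarrow> 'k set" where
  "localization A p = {a / b | a b. a \<in> A \<and> b \<in> A - p}"

definition spec :: "'k::field set \<Rightarrow> 'k set set" where
  "spec A = {localization A p | p. primeideal p (sub A)}"

definition dominates :: "'k::field set \<Rightarrow> 'k set \<Rightarrow> bool" where
  "dominates R Q \<longleftrightarrow> Q \<subseteq> R \<and> max_ideal Q = Q \<inter> max_ideal R"

definition krull_dim :: "'k::field set \<Rightarrow> nat" where
  "krull_dim R = Sup {card C - 1 | C. finite C \<and> (\<forall>p\<in>C. primeideal p (sub R)) \<and> chain\<^sub>\<subseteq> C}"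

definition integrally_closed :: "'k::field set \<Rightarrow> bool" where
  "integrally_closed R \<longleftrightarrow>
     (\<forall>x m c. m > 0 \<and> (\<forall>i<m. c i \<in> R) \<and> x ^ m + (\<Sum>i<m. c i * x ^ i) = 0 \<longrightarrow> x \<in> R)"

definition regular_local :: "'k::field set \<Rightarrow> bool" where
  "regular_local R \<longleftrightarrow>
     (\<exists>a :: nat \<Rightarrow> 'k. a ` {..<krull_dim R} \<subseteq> R \<and>
        max_ideal R = genideal (sub R) (a ` {..<krull_dim R}))"

text \<open>Existence of a regular sequence of length \<open>krull_dim R\<close> in the maximal ideal.\<close>

definition cohen_macaulay_local :: "'k::field set \<Rightarrow> bool" where
  "cohen_macaulay_local R \<longleftrightarrow>
     (\<exists>a :: nat \<Rightarrow> 'k. \<forall>i<krull_dim R. a i \<in> max_ideal R \<and>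
        (\<forall>x\<in>R. a i * x \<in> genideal (sub R) (a ` {..<i}) \<longrightarrow> x \<in> genideal (sub R) (a ` {..<i})))"

text \<open>The length of the \<open>A\<close>-module \<open>A / I\<close>: a chain \<open>J\<^sub>0 \<subset> ... \<subset> J\<^sub>l = A\<close> of ideals starting above
  \<open>I\<close> is counted by its \<open>l\<close> proper members.\<close>

definition length_quotient :: "'k::field set \<Rightarrow> 'k set \<Rightarrow> nat" where
  "length_quotient A I =
     Sup {card C | C. finite C \<and> (\<forall>J\<in>C. ideal J (sub A) \<and> I \<subseteq> J \<and> J \<noteq> A) \<and> chain\<^sub>\<subseteq> C}"

text \<open>Order of vanishing of the residue class of \<open>g\<close> in the fraction field of the one-dimensional
  local domain \<open>A / p\<close>, that is \<open>length (A / (p + a A)) - length (A / (p + b A))\<close> for \<open>g = a / b\<close>.\<close>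

definition vanishing_order :: "'k::field set \<Rightarrow> 'k set \<Rightarrow> 'k \<Rightarrow> int" where
  "vanishing_order A p g =
     (THE d. \<exists>a\<in>A - p. \<exists>b\<in>A - p. g = a / b \<and>
        d = int (length_quotient A (genideal (sub A) (insert a p)))
          - int (length_quotient A (genideal (sub A) (insert b p))))"

definition ord_along :: "'k::field set \<Rightarrow> 'k \<Rightarrow> int" where
  "ord_along S f = vanishing_order S {0} f"


section \<open>Projective varieties\<close>

text \<open>A point \<open>(x\<^sub>0 : ... : x\<^sub>N)\<close> of projective space with values in a field \<open>K\<close> is the same as an
  integral closed subscheme of complex projective space together with an embedding of its function
  field into \<open>K\<close>: the closure of the image of the point. Its intersection with the standard chart
  \<open>D\<^sub>+(T\<^sub>i)\<close> is the spectrum of the algebra generated by the \<open>x\<^sub>j / x\<^sub>i\<close>, and it is empty if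
  \<open>x\<^sub>i = 0\<close>.\<close>

definition chart_ring :: "nat \<Rightarrow> (nat \<Rightarrow> 'k::complex_extension_field) \<Rightarrow> nat \<Rightarrow> 'k set" where
  "chart_ring N x i = generate_ring whole_field (range of_cplx \<union> (\<lambda>j. x j / x i) ` {..N})"

definition proj_closure :: "nat \<Rightarrow> (nat \<Rightarrow> 'k::complex_extension_field) \<Rightarrow> 'k set set" where
  "proj_closure N x = (\<Union>i\<in>{i. i \<le> N \<and> x i \<noteq> 0}. spec (chart_ring N x i))"

definition coordinate_field :: "nat \<Rightarrow> (nat \<Rightarrow> 'k::complex_extension_field) \<Rightarrow> 'k set" where
  "coordinate_field N x =
     generate_field whole_field (range of_cplx \<union> {x j / x i | i j. i \<le> N \<and> j \<le> N \<and> x i \<noteq> 0})"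

text \<open>Projective varieties whose function field is the whole type.\<close>

definition projective_variety :: "'k::complex_extension_field set set \<Rightarrow> bool" where
  "projective_variety X \<longleftrightarrow>
     (\<exists>N x. (\<exists>i\<le>N. x i \<noteq> 0) \<and> coordinate_field N x = UNIV \<and> X = proj_closure N x)"

definition variety_dim :: "'k::field set set \<Rightarrow> nat" where
  "variety_dim X = Sup (krull_dim ` X)"

definition normal_variety :: "'k::field set set \<Rightarrow> bool" where
  "normal_variety X \<longleftrightarrow> (\<forall>P\<in>X. integrally_closed P)"

definition smooth_variety :: "'k::field set set \<Rightarrow> bool" where
  "smooth_variety X \<longleftrightarrow> (\<forall>P\<in>X. regular_local P)"

definition locally_factorial :: "'k::field set set \<Rightarrow> bool" where
  "locally_factorial X \<longleftrightarrow> (\<forall>P\<in>X. factorial_domain (sub P))"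

text \<open>Birational morphism \<open>Y \<rightarrow> X\<close> inducing the identity of the common function field.\<close>

definition birational_morphism :: "'k::field set set \<Rightarrow> 'k set set \<Rightarrow> bool" where
  "birational_morphism Y X \<longleftrightarrow> (\<forall>R\<in>Y. \<exists>P\<in>X. dominates R P)"

definition prime_divisors :: "'k::field set set \<Rightarrow> 'k set set" where
  "prime_divisors X = {S \<in> X. krull_dim S = 1}"

definition closed_points :: "'k::field set set \<Rightarrow> 'k set set" where
  "closed_points X = {P \<in> X. krull_dim P = variety_dim X}"

text \<open>Generic points of the irreducible curves in \<open>X\<close>.\<close>

definition curves :: "'k::field set set \<Rightarrow> 'k set set" where
  "curves X = {R \<in> X. krull_dim R + 1 = variety_dim X}"


section \<open>Divisors\<close>

text \<open>A Weil divisor is the function of its coefficients at the prime divisors. A local equation at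
  \<open>P\<close> defines the divisor near \<open>P\<close>: only the prime divisors through \<open>P\<close> matter.\<close>

definition local_equation ::
    "'k::field set set \<Rightarrow> ('k set \<Rightarrow> int) \<Rightarrow> 'k set \<Rightarrow> 'k \<Rightarrow> bool" where
  "local_equation X D P g \<longleftrightarrow>
     g \<noteq> 0 \<and> (\<forall>S\<in>prime_divisors X. P \<subseteq> S \<longrightarrow> ord_along S g = D S)"

definition cartier :: "'k::field set set \<Rightarrow> ('k set \<Rightarrow> int) \<Rightarrow> bool" where
  "cartier X D \<longleftrightarrow> (\<forall>P\<in>X. \<exists>g. local_equation X D P g)"

definition some_equation :: "'k::field set set \<Rightarrow> ('k set \<Rightarrow> int) \<Rightarrow> 'k set \<Rightarrow> 'k" where
  "some_equation X D P = (SOME g. local_equation X D P g)"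

text \<open>Contribution of \<open>P\<close> to the intersection number of the Cartier divisor \<open>D\<close> with the curve \<open>C\<close>
  whose generic point has local ring \<open>R\<close>. Subtracting the principal divisor of a local equation at
  \<open>R\<close> makes \<open>D\<close> intersect \<open>C\<close> properly; \<open>P \<inter> max_ideal R\<close> is the ideal of \<open>C\<close> at \<open>P\<close>.\<close>

definition local_intersection ::
    "'k::field set set \<Rightarrow> ('k set \<Rightarrow> int) \<Rightarrow> 'k set \<Rightarrow> 'k set \<Rightarrow> int" where
  "local_intersection X D R P =
     vanishing_order P (P \<inter> max_ideal R) (some_equation X D P / some_equation X D R)"

definition intersection_number :: "'k::field set set \<Rightarrow> ('k set \<Rightarrow> int) \<Rightarrow> 'k set \<Rightarrow> int" where
  "intersection_number X D R =
     (\<Sum>P | P \<in> closed_points X \<and> P \<subseteq> R \<and> local_intersection X D R P \<noteq> 0.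
        local_intersection X D R P)"

definition nef :: "'k::field set set \<Rightarrow> ('k set \<Rightarrow> int) \<Rightarrow> bool" where
  "nef X D \<longleftrightarrow> cartier X D \<and> (\<forall>R\<in>curves X. intersection_number X D R \<ge> 0)"


section \<open>Differential forms\<close>

definition derivations :: "('k::complex_extension_field \<Rightarrow> 'k) set" where
  "derivations = {D. (\<forall>x y. D (x + y) = D x + D y) \<and> (\<forall>x y. D (x * y) = x * D y + D x * y) \<and>
     (\<forall>c. D (of_cplx c) = 0)}"

text \<open>As the function field \<open>K\<close> is finitely generated over the complex numbers, its module of
  differentials is finite-dimensional with dual the space of derivations, so that rational \<open>n\<close>-forms
  are the alternating \<open>K\<close>-multilinear functions of \<open>n\<close> derivations. They are extended by zero to
  arguments that are not \<open>n\<close>-tuples of derivations.\<close>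

type_synonym 'k form = "(nat \<Rightarrow> 'k \<Rightarrow> 'k) \<Rightarrow> 'k"

definition rational_forms :: "nat \<Rightarrow> 'k::complex_extension_field form set" where
  "rational_forms n = {\<omega>.
     (\<forall>D. D \<notin> {..<n} \<rightarrow>\<^sub>E derivations \<longrightarrow> \<omega> D = 0) \<and>
     (\<forall>D \<in> {..<n} \<rightarrow>\<^sub>E derivations. \<forall>i<n. \<forall>E\<in>derivations. \<forall>F\<in>derivations. \<forall>a.
        \<omega> (D(i := (\<lambda>x. a * E x + F x))) = a * \<omega> (D(i := E)) + \<omega> (D(i := F))) \<and>
     (\<forall>D \<in> {..<n} \<rightarrow>\<^sub>E derivations. \<forall>i<n. \<forall>j<n. i \<noteq> j \<and> D i = D j \<longrightarrow> \<omega> D = 0)}"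

definition form_scale :: "'k::complex_extension_field \<Rightarrow> 'k form \<Rightarrow> 'k form" where
  "form_scale a \<omega> = (\<lambda>D. a * \<omega> D)"

text \<open>\<open>df\<^sub>0 \<and> ... \<and> df\<^sub>n\<^sub>-\<^sub>1\<close>, whose value at \<open>D\<close> is the determinant of the matrix \<open>D\<^sub>i f\<^sub>j\<close>.\<close>

definition wedge_d :: "nat \<Rightarrow> (nat \<Rightarrow> 'k) \<Rightarrow> 'k::complex_extension_field form" where
  "wedge_d n f = (\<lambda>D. if D \<in> {..<n} \<rightarrow>\<^sub>E derivations
     then (\<Sum>\<pi> | \<pi> permutes {..<n}. of_int (sign \<pi>) * (\<Prod>i<n. D (\<pi> i) (f i))) else 0)"

text \<open>The image of the top exterior power of the module of differentials of the local ring \<open>S\<close>.\<close>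

definition regular_forms :: "nat \<Rightarrow> 'k::complex_extension_field set \<Rightarrow> 'k form set" where
  "regular_forms n S = {\<Sum>f\<in>F. form_scale (c f) (wedge_d n f) | F c.
     finite F \<and> (\<forall>f\<in>F. c f \<in> S \<and> (\<forall>i<n. f i \<in> S))}"

text \<open>Order of \<open>\<omega>\<close> along a prime divisor of a normal variety; there the regular top forms are free of
  rank one over \<open>S\<close>, generated by some \<open>\<eta>\<close>.\<close>

definition form_ord :: "nat \<Rightarrow> 'k::complex_extension_field set \<Rightarrow> 'k form \<Rightarrow> int" where
  "form_ord n S \<omega> = (THE d. \<exists>f \<eta>. f \<noteq> 0 \<and> regular_forms n S = {form_scale a \<eta> | a. a \<in> S} \<and>
     \<omega> = form_scale f \<eta> \<and> d = ord_along S f)"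

definition div_form ::
    "'k::complex_extension_field set set \<Rightarrow> 'k form \<Rightarrow> 'k set \<Rightarrow> int" where
  "div_form X \<omega> = (\<lambda>S. form_ord (variety_dim X) S \<omega>)"

definition canonical_divisor ::
    "'k::complex_extension_field set set \<Rightarrow> ('k set \<Rightarrow> int) \<Rightarrow> bool" where
  "canonical_divisor X D \<longleftrightarrow> (\<exists>\<omega>\<in>rational_forms (variety_dim X). \<omega> \<noteq> 0 \<and> D = div_form X \<omega>)"


section \<open>Singularities, minimality, general type\<close>

text \<open>For a normal Cohen-Macaulay variety the reflexive sheaf of the canonical divisor is the
  dualizing sheaf; Gorenstein means that it is invertible.\<close>

definition gorenstein :: "'k::complex_extension_field set set \<Rightarrow> bool" where
  "gorenstein X \<longleftrightarrow> normal_variety X \<and> (\<forall>P\<in>X. cohen_macaulay_local P) \<and>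
     (\<exists>D. canonical_divisor X D \<and> cartier X D)"

text \<open>The discrepancy of \<open>E\<close> is \<open>a(E) = ord\<^sub>E \<omega> - ord\<^sub>E g / r\<close>, where \<open>g\<close> is an equation of \<open>r K_X\<close> at
  the centre \<open>P\<close> of \<open>E\<close>. The divisor \<open>E\<close> is exceptional iff its centre has codimension at least 2.\<close>

definition terminal_singularities :: "'k::complex_extension_field set set \<Rightarrow> bool" where
  "terminal_singularities X \<longleftrightarrow> normal_variety X \<and>
     (\<exists>\<omega>\<in>rational_forms (variety_dim X). \<omega> \<noteq> 0 \<and> (\<exists>r::nat. r > 0 \<and>
        cartier X (\<lambda>S. int r * div_form X \<omega> S) \<and>
        (\<forall>Y. projective_variety Y \<and> normal_variety Y \<and> birational_morphism Y X \<longrightarrow>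
          (\<forall>E\<in>prime_divisors Y. \<forall>P\<in>X. \<forall>g.
             dominates E P \<and> krull_dim P \<ge> 2 \<and>
             local_equation X (\<lambda>S. int r * div_form X \<omega> S) P g \<longrightarrow>
             of_int (div_form Y \<omega> E) - of_int (ord_along E g) / of_nat r > (0::rat)))))"

definition minimal :: "'k::complex_extension_field set set \<Rightarrow> bool" where
  "minimal X \<longleftrightarrow> (\<exists>D. canonical_divisor X D \<and> nef X D)"

text \<open>The global sections of \<open>m D\<close> as rational functions.\<close>

definition multiple_sections :: "'k::field set set \<Rightarrow> ('k set \<Rightarrow> int) \<Rightarrow> nat \<Rightarrow> 'k set" where
  "multiple_sections X D m =
     {f. f \<noteq> 0 \<longrightarrow> (\<forall>S\<in>prime_divisors X. ord_along S f + int m * D S \<ge> 0)}"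

text \<open>The Kodaira dimension of a smooth projective model \<open>Y\<close> (birational to \<open>X\<close>, because it has the
  same function field) is the maximal possible one: some
  pluricanonical map has an image of dimension \<open>dim Y\<close>.\<close>

definition general_type :: "'k::complex_extension_field set set \<Rightarrow> bool" where
  "general_type (X :: 'k set set) \<longleftrightarrow> (\<exists>(Y :: 'k set set) D. projective_variety Y \<and> smooth_variety Y \<and> canonical_divisor Y D \<and>
     variety_dim Y = variety_dim X \<and>
     (\<exists>m N f. m > 0 \<and> (\<exists>i\<le>N. f i \<noteq> 0) \<and>
        module.span cplx_scale (f ` {..N}) = multiple_sections Y D m \<and>
        variety_dim (proj_closure N f) = variety_dim Y))"


section \<open>Morphisms to projective space\<close>

text \<open>Rational maps from \<open>X\<close> to projective \<open>n\<close>-space are given by points \<open>(s\<^sub>0 : ... : s\<^sub>n)\<close> with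
  coordinates in the function field; only \<open>s i\<close> with \<open>i \<le> n\<close> matter.\<close>

definition regular_map :: "nat \<Rightarrow> (nat \<Rightarrow> 'k::field) \<Rightarrow> 'k set set \<Rightarrow> bool" where
  "regular_map n s X \<longleftrightarrow> (\<forall>P\<in>X. \<exists>i\<le>n. s i \<noteq> 0 \<and> (\<forall>j\<le>n. s j / s i \<in> P))"

text \<open>The map sends the point \<open>P\<close> to \<open>(c\<^sub>0 : ... : c\<^sub>n)\<close>.\<close>

definition maps_to ::
    "nat \<Rightarrow> (nat \<Rightarrow> 'k::complex_extension_field) \<Rightarrow> 'k set \<Rightarrow> (nat \<Rightarrow> complex) \<Rightarrow> bool" where
  "maps_to n s P c \<longleftrightarrow> (\<exists>i\<le>n. s i \<noteq> 0 \<and> c i \<noteq> 0 \<and>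
     (\<forall>j\<le>n. s j / s i \<in> P \<and> s j / s i - of_cplx (c j / c i) \<in> max_ideal P))"

definition surjective_map ::
    "nat \<Rightarrow> (nat \<Rightarrow> 'k::complex_extension_field) \<Rightarrow> 'k set set \<Rightarrow> bool" where
  "surjective_map n s X \<longleftrightarrow>
     (\<forall>c. (\<exists>i\<le>n. c i \<noteq> 0) \<longrightarrow> (\<exists>P\<in>closed_points X. maps_to n s P c))"

text \<open>The preimage of each standard chart is the spectrum of an algebra \<open>B\<close> that is a finite module
  over the coordinate ring of the chart.\<close>

definition finite_map ::
    "nat \<Rightarrow> (nat \<Rightarrow> 'k::complex_extension_field) \<Rightarrow> 'k set set \<Rightarrow> bool" where
  "finite_map n s X \<longleftrightarrow> regular_map n s X \<and>
     (\<forall>i\<le>n. s i \<noteq> 0 \<longrightarrow> (\<exists>B. subring B whole_field \<and> chart_ring n s i \<subseteq> B \<and>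
        {P \<in> X. \<forall>j\<le>n. s j / s i \<in> P} = spec B \<and>
        (\<exists>M. finite M \<and> M \<subseteq> B \<and>
           B = {\<Sum>b\<in>M. c b * b | c. \<forall>b\<in>M. c b \<in> chart_ring n s i})))"

definition galois_group :: "'k::field set \<Rightarrow> ('k \<Rightarrow> 'k) monoid" where
  "galois_group L =
     \<lparr>carrier = {\<sigma> \<in> ring_iso whole_field whole_field. \<forall>x\<in>L. \<sigma> x = x},
      monoid.mult = (\<circ>), one = id\<rparr>"

text \<open>For a surjective map \<open>coordinate_field n s\<close> is the function field of projective space, embedded
  by pullback. For a finite surjective map the extension of function fields is finite, and then it is
  Galois iff the base is the fixed field of the automorphism group.\<close>

definition abelian_cover ::
    "('g, 'h) monoid_scheme \<Rightarrow> nat \<Rightarrow> (nat \<Rightarrow> 'k::complex_extension_field) \<Rightarrow> 'k set set \<Rightarrow> bool" where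
  "abelian_cover G n s X \<longleftrightarrow> comm_group G \<and> finite (carrier G) \<and>
     normal_variety X \<and> finite_map n s X \<and> surjective_map n s X \<and>
     {x. \<forall>\<sigma>\<in>carrier (galois_group (coordinate_field n s)). \<sigma> x = x} = coordinate_field n s \<and>
     G \<cong> galois_group (coordinate_field n s)"

text \<open>Degree of the extension of function fields; meaningful for generically finite maps.\<close>

definition map_degree :: "nat \<Rightarrow> (nat \<Rightarrow> 'k::complex_extension_field) \<Rightarrow> nat" where
  "map_degree n s = ring.dim whole_field (coordinate_field n s) UNIV"


section \<open>The canonical map\<close>

definition canonical_sections ::
    "'k::complex_extension_field set set \<Rightarrow> 'k form set" where
  "canonical_sections X = {\<omega> \<in> rational_forms (variety_dim X).
     \<omega> \<noteq> 0 \<longrightarrow> (\<forall>S\<in>prime_divisors X. div_form X \<omega> S \<ge> 0)}"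

definition geometric_genus :: "'k::complex_extension_field set set \<Rightarrow> nat" where
  "geometric_genus X =
     vector_space.dim (\<lambda>c. form_scale (of_cplx c)) (canonical_sections X)"

text \<open>The forms \<open>s\<^sub>i \<eta>\<close> are a basis of the canonical sections (\<open>n + 1 = p_g\<close> forms that span), and
  the complete canonical system has no base points: at each \<open>P\<close> one of them generates the canonical
  sheaf. So \<open>(s\<^sub>0 : ... : s\<^sub>n)\<close> is the canonical map, it is a morphism, and the canonical sheaf is the
  pullback of \<open>O(1)\<close>.\<close>

definition canonical_morphism ::
    "nat \<Rightarrow> (nat \<Rightarrow> 'k::complex_extension_field) \<Rightarrow> 'k set set \<Rightarrow> bool" where
  "canonical_morphism n s X \<longleftrightarrow> geometric_genus X = n + 1 \<and>
     (\<exists>\<eta>\<in>rational_forms (variety_dim X).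
        module.span (\<lambda>c. form_scale (of_cplx c)) ((\<lambda>i. form_scale (s i) \<eta>) ` {..n})
          = canonical_sections X \<and>
        (\<forall>P\<in>X. \<exists>i\<le>n. form_scale (s i) \<eta> \<noteq> 0 \<and>
           (\<forall>S\<in>prime_divisors X. P \<subseteq> S \<longrightarrow> div_form X (form_scale (s i) \<eta>) S = 0)))"

end

theory Submission
  imports Defs "HOL-Computational_Algebra.Polynomial_Factorial"
    "HOL-Computational_Algebra.Field_as_Ring"
    "HOL-Computational_Algebra.Fundamental_Theorem_Algebra"
begin

text \<open>
  Let \<open>L\<close> be the function field of projective space, \<open>K\<close> that of \<open>X\<close>, and \<open>E\<close> the group of common
  eigenvectors of the Galois group in \<open>K - {0}\<close>. As the group is abelian, \<open>K\<close> is the direct sum of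
  the lines \<open>L w\<close>, where \<open>w\<close> runs through representatives of \<open>E / (L - {0})\<close>; so the degree is the
  order of this quotient group.

  Because \<open>X\<close> is factorial, the reduced inverse image of a prime divisor \<open>D\<close> of projective space is
  locally given by an eigenvector. Hence the valuations over \<open>D\<close> agree on \<open>E\<close> and have the same
  ramification index \<open>r\<^sub>D\<close>, and as two distinct prime divisors \<open>D, D'\<close> meet, there is an eigenvector
  of valuation 1 over \<open>D\<close> and 0 over \<open>D'\<close>. So the residues \<open>v\<^sub>D(w) mod r\<^sub>D\<close> are uniformly
  distributed and pairwise independent on \<open>E / (L - {0})\<close>.

  Put \<open>l(w) = \<Sum>\<^sub>D deg D (v\<^sub>D(w) mod r\<^sub>D) / r\<^sub>D\<close>. This is an integer since a rational function has as many
  zeros as poles, and \<open>l(w) \<ge> 2\<close> for \<open>w\<close> outside of \<open>L\<close> since the pullback of \<open>O(1)\<close> has no sections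
  but those of \<open>O(1)\<close>. The ramification formula and \<open>K\<^sub>X = \<phi>\<^sup>*O(1)\<close> yield an eigenvector all of whose residues
  are \<open>r\<^sub>D - 1\<close> and where \<open>l = 5\<close>. By the symmetry that it induces, \<open>l\<close> takes the values 2 and 3
  apart from one 0 and one 5. The mean and the second moment of \<open>l\<close>, computed from these values and
  from pairwise independence, together with integrality conditions leave only the orders
  \<open>2, 4, 8, 16, 32\<close>.
\<close>

text \<open>The constant 5 is 1 + 4: the canonical sheaf of the cover comes from O(1), that of
  projective space is O(-4). In the numerical part the variance of a uniform residue turns the
  second moment into the identity \<open>\<Sum> d^2 (1 - 1/r^2) = 3 + 144 / n\<close>. Its left side
  exceeds \<open>\<Sum> d (1 - 1/r) = 5\<close>, whence \<open>n < 72\<close>. All residues of the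
  inverse of the distinguished element are 1, so \<open>l\<close> is explicit on its powers; since
  these values stay in {2, 3}, every k from 2 to the exponent minus 2 is a multiple of some index.
  This forces so many small primes into the exponent that only 2, 4 and 6 remain, and 6 fails by an
  equation in the squares of the degrees. The obstacle in the geometric part is that points, orders
  and forms are given by local rings, lengths, suprema and definite descriptions. Explicit
  polynomial algebra on the four standard charts replaces general theory: unique factorization and
  averaging over the Galois group give the lying-over facts, a count of monomials bounds the Krull
  dimension, and a regular sequence shows that two surfaces meet.\<close>

lemma sum_mod_shift:
  fixes F :: "int \<Rightarrow> real"
  assumes "r > 0"
  shows "(\<Sum>k<r. F ((z + int k) mod int r)) = (\<Sum>k<r. F (int k))"
proof (rule sum.reindex_bij_witness[where i = "\<lambda>j. nat ((int j - z) mod int r)" and j = "\<lambda>k. nat ((z + int k) mod int r)"])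
  fix k assume k: "k \<in> {..<r}"
  show "nat ((int (nat ((z + int k) mod int r)) - z) mod int r) = k"
    using k assms by (simp add: mod_diff_left_eq)
  show "nat ((z + int k) mod int r) \<in> {..<r}"
    using assms by (simp add: nat_less_iff)
  show "nat ((int k - z) mod int r) \<in> {..<r}"
    using assms by (simp add: nat_less_iff)
  show "nat ((z + int (nat ((int k - z) mod int r))) mod int r) = k"
    using k assms by (simp add: mod_add_right_eq)
  show "F (int (nat ((z + int k) mod int r))) = F ((z + int k) mod int r)"
    using assms by simp
qed

lemma sum_lessThan_nat_real: "(\<Sum>k<r. real k) = real r * (real r - 1) / 2"
  by (induction r) (auto simp: field_simps)

lemma sum_lessThan_centred:
  "(\<Sum>k<r. real k - (real r - 1) / 2) = 0"
  by (simp add: sum_subtractf sum_lessThan_nat_real)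

lemma sum_lessThan_sq: "(\<Sum>k<r. (real k)\<^sup>2) = real r * (real r - 1) * (2 * real r - 1) / 6"
  by (induction r) (auto simp: field_simps power2_eq_square)

text \<open>The variance of a uniform variable on \<open>{..<r}\<close> is (r^2 - 1) / 12; the
  remaining factor r is the number of values.\<close>

lemma sum_lessThan_centred_sq:
  "(\<Sum>k<r. (real k - (real r - 1) / 2)\<^sup>2) = real r * ((real r)\<^sup>2 - 1) / 12"
proof -
  have "(\<Sum>k<r. (real k - (real r - 1) / 2)\<^sup>2) =
      (\<Sum>k<r. (real k)\<^sup>2 - (real r - 1) * real k + ((real r - 1) / 2)\<^sup>2)"
    by (intro sum.cong refl) (simp add: power2_diff)
  also have "\<dots> = real r * ((real r)\<^sup>2 - 1) / 12"
    unfolding sum.distrib sum_subtractf sum_distrib_left[symmetric] sum_lessThan_nat_real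
        sum_lessThan_sq by (simp add: power2_eq_square field_simps)
  finally show ?thesis .
qed

text \<open>The numerical data of an abelian cover of projective space: \<open>G\<close> is the group of characters,
  \<open>I\<close> the set of components of the branch locus, of degrees \<open>d i\<close> and ramification indices \<open>r i\<close>;
  \<open>a i x / r i\<close> is the fractional part of the valuation along \<open>i\<close> of an eigenfunction for \<open>x\<close>.\<close>

locale cover_data = comm_group G for G (structure) +
  fixes I :: "'i set" and r d :: "'i \<Rightarrow> nat" and a :: "'i \<Rightarrow> 'a \<Rightarrow> int" and x0 :: 'a
  assumes fin_G: "finite (carrier G)" and fin_I: "finite I"
    and r_ge: "i \<in> I \<Longrightarrow> r i \<ge> 2" and d_ge: "i \<in> I \<Longrightarrow> d i \<ge> 1"
    and a_range: "i \<in> I \<Longrightarrow> x \<in> carrier G \<Longrightarrow> 0 \<le> a i x \<and> a i x < int (r i)"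
    and a_mult: "i \<in> I \<Longrightarrow> x \<in> carrier G \<Longrightarrow> y \<in> carrier G \<Longrightarrow>
       a i (x \<otimes> y) = (a i x + a i y) mod int (r i)"
    and single: "i \<in> I \<Longrightarrow> \<exists>x\<in>carrier G. a i x = 1"
    and pair: "i \<in> I \<Longrightarrow> j \<in> I \<Longrightarrow> i \<noteq> j \<Longrightarrow> \<exists>x\<in>carrier G. a i x = 1 \<and> a j x = 0"
    and l_int: "x \<in> carrier G \<Longrightarrow> (\<Sum>i\<in>I. real (d i) * real_of_int (a i x) / real (r i)) \<in> \<int>"
    and l_ge: "x \<in> carrier G \<Longrightarrow> x \<noteq> \<one> \<Longrightarrow>
       (\<Sum>i\<in>I. real (d i) * real_of_int (a i x) / real (r i)) \<ge> 2"
    and x0: "x0 \<in> carrier G" and a_x0: "i \<in> I \<Longrightarrow> a i x0 = int (r i) - 1"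
    and l_x0: "(\<Sum>i\<in>I. real (d i) * (real (r i) - 1) / real (r i)) = 5"
begin

definition l :: "'a \<Rightarrow> real" where
  "l x = (\<Sum>i\<in>I. real (d i) * real_of_int (a i x) / real (r i))"

text \<open>The fractional part \<open>a i x / r i\<close> minus its mean. Centring makes the cross
  terms of the second moment vanish.\<close>

definition c :: "'i \<Rightarrow> 'a \<Rightarrow> real" where
  "c i x = (real_of_int (a i x) - (real (r i) - 1) / 2) / real (r i)"

abbreviation n :: nat where "n \<equiv> card (carrier G)"

lemma r_pos: "i \<in> I \<Longrightarrow> r i > 0"
  using r_ge by force

lemma a_one: "i \<in> I \<Longrightarrow> a i \<one> = 0"
proof -
  assume i: "i \<in> I"
  have "a i \<one> = (a i \<one> + a i \<one>) mod int (r i)"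
    using a_mult[OF i one_closed one_closed] by simp
  moreover have "a i \<one> mod int (r i) = a i \<one>" using a_range[OF i one_closed] by simp
  ultimately have "(a i \<one> + a i \<one>) mod int (r i) = (a i \<one> + 0) mod int (r i)" by simp
  then have "int (r i) dvd a i \<one>" by (metis add_left_cancel mod_add_eq mod_eq_dvd_iff add_diff_cancel_left' diff_0_right)
  then show ?thesis using a_range[OF i one_closed] zdvd_not_zless[of "a i \<one>" "int (r i)"] by force
qed

lemma a_pow:
  assumes "i \<in> I" "x \<in> carrier G"
  shows "a i (x [^] (k::nat)) = (int k * a i x) mod int (r i)"
proof (induction k)
  case 0 show ?case by (simp add: a_one assms)
next
  case (Suc k)
  have "a i (x [^] Suc k) = ((int k * a i x) mod int (r i) + a i x) mod int (r i)"
    using assms Suc by (simp add: a_mult)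
  also have "\<dots> = (int (Suc k) * a i x) mod int (r i)"
    by (simp add: mod_simps algebra_simps)
  finally show ?case .
qed

lemma l_one: "l \<one> = 0"
  unfolding l_def by (simp add: a_one)

lemma l_x0': "l x0 = 5"
  unfolding l_def l_x0[symmetric] by (rule sum.cong) (auto simp: a_x0)

lemma x0_ne: "x0 \<noteq> \<one>"
  using l_one l_x0' by auto

lemma a_inv:
  assumes "i \<in> I" "x \<in> carrier G"
  shows "a i (inv x) = (- a i x) mod int (r i)"
proof -
  have "(a i x + a i (inv x)) mod int (r i) = 0"
    using a_mult[OF assms inv_closed[OF assms(2)]] a_one[OF assms(1)] assms by simp
  then have "int (r i) dvd (a i (inv x) - (- a i x))" by (simp add: add.commute mod_0_imp_dvd)
  then have "a i (inv x) mod int (r i) = (- a i x) mod int (r i)"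
    by (simp add: mod_eq_dvd_iff)
  moreover have "a i (inv x) mod int (r i) = a i (inv x)"
    using a_range[OF assms(1) inv_closed[OF assms(2)]] by simp
  ultimately show ?thesis by simp
qed

text \<open>As \<open>a i x0\<close> is the largest residue \<open>r i - 1\<close>, subtracting
  \<open>a i x\<close> from it never borrows. This is the numerical form of Serre duality on the
  cover.\<close>

lemma l_dual:
  assumes "x \<in> carrier G"
  shows "l x + l (x0 \<otimes> inv x) = 5"
proof -
  have "a i (x0 \<otimes> inv x) = int (r i) - 1 - a i x" if "i \<in> I" for i
  proof -
    have "a i (x0 \<otimes> inv x) = (int (r i) - 1 + (- a i x) mod int (r i)) mod int (r i)"
      using that assms by (simp add: a_mult a_inv x0 a_x0)
    also have "\<dots> = (int (r i) - 1 - a i x) mod int (r i)"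
      by (metis mod_add_right_eq uminus_add_conv_diff add.commute)
    also have "\<dots> = int (r i) - 1 - a i x"
      using a_range[OF that assms] by simp
    finally show ?thesis .
  qed
  then have "l x + l (x0 \<otimes> inv x) = (\<Sum>i\<in>I. real (d i) * (real (r i) - 1) / real (r i))"
    unfolding l_def sum.distrib[symmetric] add_divide_distrib[symmetric] distrib_left[symmetric]
    by (intro sum.cong refl) simp
  then show ?thesis using l_x0 by simp
qed

text \<open>Both \<open>l x\<close> and, by duality, \<open>5 - l x\<close> are integers that are at
  least 2.\<close>

lemma l_cases:
  assumes "x \<in> carrier G" "x \<noteq> \<one>" "x \<noteq> x0"
  shows "l x = 2 \<or> l x = 3"
proof -
  have "l x \<ge> 2" using l_ge assms unfolding l_def by auto
  moreover have "x0 \<otimes> inv x \<noteq> \<one>"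
    using assms x0 by (metis inv_closed inv_equality inv_inv)
  then have "l (x0 \<otimes> inv x) \<ge> 2" using l_ge[of "x0 \<otimes> inv x"] assms x0 unfolding l_def by auto
  moreover obtain k where "l x = real_of_int k" using l_int[OF assms(1)] unfolding l_def by (auto elim: Ints_cases)
  ultimately have "2 \<le> k \<and> k \<le> 3" using l_dual[OF assms(1)] by linarith
  then have "k = 2 \<or> k = 3" by linarith
  then show ?thesis using \<open>l x = real_of_int k\<close> by auto
qed

text \<open>Each translation permutes the group. Averaging along the powers of one element replaces
  a decomposition into cosets, and \<open>m\<close> may be taken as the period of a residue instead
  of the order of \<open>y\<close>.\<close>

lemma average:
  fixes g :: "'a \<Rightarrow> real"
  assumes "y \<in> carrier G"
  shows "(\<Sum>x\<in>carrier G. \<Sum>k<m. g (x \<otimes> y [^] k)) = real m * (\<Sum>x\<in>carrier G. g x)"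
proof -
  have "(\<Sum>x\<in>carrier G. g (x \<otimes> z)) = (\<Sum>x\<in>carrier G. g x)" if z: "z \<in> carrier G" for z
    by (rule sum.reindex_bij_witness[where i = "\<lambda>x. x \<otimes> inv z" and j = "\<lambda>x. x \<otimes> z"])
      (use z in \<open>auto simp: m_assoc\<close>)
  then show ?thesis
    by (subst sum.swap) (simp add: assms)
qed

text \<open>Equidistribution: along \<open>x \<otimes> y [^] k\<close> with \<open>a i y = 1\<close>
  the residue runs once through all classes modulo \<open>r i\<close>.\<close>

lemma sum_function_of_a:
  assumes i: "i \<in> I"
  shows "real (r i) * (\<Sum>x\<in>carrier G. F (a i x)) = real n * (\<Sum>k<r i. F (int k))"
proof -
  obtain y where y: "y \<in> carrier G" "a i y = 1" using single[OF i] by auto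
  have "F (a i (x \<otimes> y [^] k)) = F ((a i x + int k) mod int (r i))" if "x \<in> carrier G" for x k
    using that y i by (simp add: a_mult a_pow mod_add_right_eq)
  then show ?thesis
    using average[OF y(1), of "\<lambda>x. F (a i x)" "r i"] sum_mod_shift[OF r_pos[OF i], of F]
    by simp
qed

lemma sum_c_sq:
  assumes i: "i \<in> I"
  shows "(\<Sum>x\<in>carrier G. (c i x)\<^sup>2) = real n * ((real (r i))\<^sup>2 - 1) / (12 * (real (r i))\<^sup>2)"
proof -
  have "real (r i) * (\<Sum>x\<in>carrier G. (c i x)\<^sup>2) =
      real n * (\<Sum>k<r i. ((real k - (real (r i) - 1) / 2) / real (r i))\<^sup>2)"
    using sum_function_of_a[OF i, of "\<lambda>z. ((real_of_int z - (real (r i) - 1) / 2) / real (r i))\<^sup>2"]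
    unfolding c_def by simp
  also have "\<dots> = real n * (real (r i) * ((real (r i))\<^sup>2 - 1) / 12 / (real (r i))\<^sup>2)"
    by (simp add: power_divide sum_divide_distrib[symmetric] sum_lessThan_centred_sq)
  also have "\<dots> = real (r i) * (real n * ((real (r i))\<^sup>2 - 1) / (12 * (real (r i))\<^sup>2))"
    by simp
  finally show ?thesis using r_pos[OF i] by (subst (asm) mult_left_cancel) auto
qed

text \<open>Translation by powers of an element with residues 1 at \<open>i\<close> and 0 at
  \<open>j\<close> moves only \<open>c i\<close>, whose sum over a full period is zero.\<close>

lemma sum_c_prod:
  assumes ij: "i \<in> I" "j \<in> I" "i \<noteq> j"
  shows "(\<Sum>x\<in>carrier G. c i x * c j x) = 0"
proof -
  obtain y where y: "y \<in> carrier G" "a i y = 1" "a j y = 0" using pair[OF ij] by auto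
  have "(\<Sum>k<r i. c i (x \<otimes> y [^] k) * c j (x \<otimes> y [^] k)) = 0" if x: "x \<in> carrier G" for x
  proof -
    have 1: "c j (x \<otimes> y [^] k) = c j x" for k :: nat
      using x y ij a_range[OF ij(2) x] unfolding c_def by (simp add: a_mult a_pow)
    have 2: "c i (x \<otimes> y [^] k) =
      (real_of_int ((a i x + int k) mod int (r i)) - (real (r i) - 1) / 2) / real (r i)" for k :: nat
      using x y ij unfolding c_def by (simp add: a_mult a_pow mod_add_right_eq)
    have "(\<Sum>k<r i. c i (x \<otimes> y [^] k)) = 0"
      unfolding 2 sum_divide_distrib[symmetric]
      using sum_mod_shift[OF r_pos[OF ij(1)], of "\<lambda>z. real_of_int z - (real (r i) - 1) / 2" "a i x"]
      by (simp add: sum_lessThan_centred)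
    then show ?thesis unfolding 1 by (simp add: sum_distrib_right[symmetric])
  qed
  then have "real (r i) * (\<Sum>x\<in>carrier G. c i x * c j x) = 0"
    using average[OF y(1), of "\<lambda>x. c i x * c j x" "r i"] by simp
  then show ?thesis using r_pos[OF ij(1)] by simp
qed

text \<open>The means of the summands of \<open>l\<close> add up to half of the sum in
  \<open>l_x0\<close>, which is 5 / 2.\<close>

lemma l_centred: "x \<in> carrier G \<Longrightarrow> l x - 5 / 2 = (\<Sum>i\<in>I. real (d i) * c i x)"
proof -
  have "(\<Sum>i\<in>I. real (d i) * c i x) =
     (\<Sum>i\<in>I. real (d i) * real_of_int (a i x) / real (r i) - (real (d i) * (real (r i) - 1) / real (r i)) / 2)"
    unfolding c_def by (intro sum.cong) (auto simp: field_simps r_pos)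
  also have "\<dots> = l x - 5 / 2"
    unfolding l_def sum_subtractf sum_divide_distrib[symmetric] l_x0 ..
  finally show ?thesis by simp
qed

text \<open>The second moment of \<open>l\<close> in two ways: its values are known, and its summands are pairwise
  independent.\<close>

lemma second_moment:
  "(\<Sum>i\<in>I. (real (d i))\<^sup>2 * ((real (r i))\<^sup>2 - 1) / (real (r i))\<^sup>2) = 3 + 144 / real n"
proof -
  have n_pos: "n > 0" using fin_G one_closed by (metis card_gt_0_iff empty_iff)
  \<comment> \<open>The deviation from 5 / 2 is 5 / 2 at the values 0 and 5, and 1 / 2 at the values
    2 and 3.\<close>
  have "(\<Sum>x\<in>carrier G. (l x - 5 / 2)\<^sup>2) = (\<Sum>x\<in>carrier G. if x \<in> {\<one>, x0} then 25 / 4 else 1 / 4)"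
  proof (rule sum.cong)
    fix x assume "x \<in> carrier G"
    then show "(l x - 5 / 2)\<^sup>2 = (if x \<in> {\<one>, x0} then 25 / 4 else 1 / 4)"
      using l_cases[of x] l_one l_x0' by (auto simp: power2_eq_square)
  qed simp
  also have "\<dots> = (\<Sum>x\<in>carrier G. 1 / 4 + (if x \<in> {\<one>, x0} then 6 else 0))"
    by (rule sum.cong) auto
  also have "\<dots> = real n / 4 + 6 * real (card (carrier G \<inter> {\<one>, x0}))"
    unfolding sum.distrib sum.If_cases[OF fin_G] Collect_mem_eq by simp
  also have "carrier G \<inter> {\<one>, x0} = {\<one>, x0}" using x0 by auto
  finally have L: "(\<Sum>x\<in>carrier G. (l x - 5 / 2)\<^sup>2) = real n / 4 + 12"
    using x0_ne by simp
  have "(\<Sum>x\<in>carrier G. (l x - 5 / 2)\<^sup>2) =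
      (\<Sum>x\<in>carrier G. \<Sum>i\<in>I. \<Sum>j\<in>I. real (d i) * real (d j) * (c i x * c j x))"
    by (rule sum.cong) (auto simp: l_centred power2_eq_square sum_product algebra_simps)
  also have "\<dots> = (\<Sum>i\<in>I. \<Sum>j\<in>I. real (d i) * real (d j) * (\<Sum>x\<in>carrier G. c i x * c j x))"
    by (subst sum.swap, intro sum.cong refl, subst sum.swap) (simp add: sum_distrib_left)
  also have "\<dots> = (\<Sum>i\<in>I. \<Sum>j\<in>I. if j = i then (real (d i))\<^sup>2 * (real n * ((real (r i))\<^sup>2 - 1) / (12 * (real (r i))\<^sup>2)) else 0)"
  proof (intro sum.cong refl)
    fix i j assume "i \<in> I" "j \<in> I"
    then show "real (d i) * real (d j) * (\<Sum>x\<in>carrier G. c i x * c j x) =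
      (if j = i then (real (d i))\<^sup>2 * (real n * ((real (r i))\<^sup>2 - 1) / (12 * (real (r i))\<^sup>2)) else 0)"
      using sum_c_prod[of i j] sum_c_sq[of i]
      by (cases "j = i") (simp_all add: power2_eq_square[of "c i _"] power2_eq_square[of "real (d i)"])
  qed
  also have "\<dots> = (\<Sum>i\<in>I. (real (d i))\<^sup>2 * (real n * ((real (r i))\<^sup>2 - 1) / (12 * (real (r i))\<^sup>2)))"
    by (simp add: fin_I)
  also have "\<dots> = real n / 12 * (\<Sum>i\<in>I. (real (d i))\<^sup>2 * ((real (r i))\<^sup>2 - 1) / (real (r i))\<^sup>2)"
    unfolding sum_distrib_left by (rule sum.cong) simp_all
  finally have "real n / 12 * (\<Sum>i\<in>I. (real (d i))\<^sup>2 * ((real (r i))\<^sup>2 - 1) / (real (r i))\<^sup>2)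
      = real n / 12 * (3 + 144 / real n)" using L n_pos by (simp add: distrib_left)
  then show ?thesis using n_pos by (subst (asm) mult_left_cancel) auto
qed


lemma I_ne: "I \<noteq> {}"
proof
  assume "I = {}"
  then show False using l_x0 by simp
qed

text \<open>Termwise comparison with \<open>l_x0\<close>: (r^2 - 1) / r^2 is (r - 1) / r times 1 + 1
  / r, and the square of a degree is at least the degree.\<close>

lemma second_moment_gt: "(\<Sum>i\<in>I. (real (d i))\<^sup>2 * ((real (r i))\<^sup>2 - 1) / (real (r i))\<^sup>2) > 5"
proof -
  have "(\<Sum>i\<in>I. real (d i) * (real (r i) - 1) / real (r i)) <
    (\<Sum>i\<in>I. (real (d i))\<^sup>2 * ((real (r i))\<^sup>2 - 1) / (real (r i))\<^sup>2)"
  proof (intro sum_strict_mono fin_I I_ne)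
    fix i assume i: "i \<in> I"
    define x where "x = real (r i)"
    define e where "e = real (d i)"
    have x: "x \<ge> 2" and e: "e \<ge> 1" using r_ge[OF i] d_ge[OF i] by (auto simp: x_def e_def)
    have "e * 1 \<le> e * e" using e by (intro mult_left_mono) auto
    define q where "q = e * (x - 1) / x"
    have "q * 1 < q * (1 + 1 / x)"
    proof (rule mult_strict_left_mono)
      show "0 < q" unfolding q_def using x e by (intro divide_pos_pos mult_pos_pos) linarith+
    qed (use x in simp)
    moreover have "q * (1 + 1 / x) = e * ((x\<^sup>2 - 1) / x\<^sup>2)"
    proof -
      have "1 + 1 / x = (x + 1) / x" using x by (simp add: add_divide_distrib)
      moreover have "x\<^sup>2 - 1 = (x - 1) * (x + 1)" by (simp add: power2_eq_square algebra_simps)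
      ultimately show ?thesis unfolding q_def by (simp add: power2_eq_square)
    qed
    moreover have "1 \<le> x * x" using mult_mono[of 1 x 1 x] x by simp
    then have "e * ((x\<^sup>2 - 1) / x\<^sup>2) \<le> e\<^sup>2 * ((x\<^sup>2 - 1) / x\<^sup>2)"
      using \<open>e * 1 \<le> e * e\<close> unfolding power2_eq_square by (intro mult_right_mono divide_nonneg_nonneg) linarith+
    ultimately show "e * (x - 1) / x < e\<^sup>2 * (x\<^sup>2 - 1) / x\<^sup>2"
      unfolding q_def by simp
  qed
  then show ?thesis using l_x0 by simp
qed

lemma n_ge: "n \<ge> 2"
proof -
  have "card {\<one>, x0} \<le> n" using fin_G x0 by (intro card_mono) auto
  then show ?thesis using x0_ne by simp
qed

text \<open>The second moment gives \<open>3 + 144 / n > 5\<close>.\<close>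

lemma n_lt: "n < 72"
proof -
  have "144 / real n > 2" using second_moment_gt second_moment by linarith
  moreover have "real n > 0" using n_ge by linarith
  ultimately have "2 * real n < 144" by (subst (asm) pos_less_divide_eq)
  then show ?thesis by linarith
qed

text \<open>The pair of residues is a homomorphism onto the product of two cyclic groups; its fibres
  are translates of the kernel and so have equal size.\<close>

lemma fibre_dvd:
  assumes ij: "i \<in> I" "j \<in> I" "i \<noteq> j"
  shows "r i * r j dvd n"
proof -
  obtain y where y: "y \<in> carrier G" "a i y = 1" "a j y = 0" using pair[OF ij] by auto
  obtain z where z: "z \<in> carrier G" "a j z = 1" "a i z = 0" using pair[OF ij(2,1) ij(3)[symmetric]] by auto
  define F where "F p = {x \<in> carrier G. a i x = fst p \<and> a j x = snd p}" for p :: "int \<times> int"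
  have card_F: "card (F p) = card (F (0, 0))" if p: "p \<in> {0..<int (r i)} \<times> {0..<int (r j)}" for p
  proof -
    obtain u v :: nat where uv: "p = (int u, int v)" "u < r i" "v < r j"
      using p by (cases p) (auto elim!: nonneg_int_cases)
    define w where "w = y [^] u \<otimes> z [^] v"
    have w: "w \<in> carrier G" "a i w = fst p" "a j w = snd p"
      using y z uv ij unfolding w_def by (simp_all add: a_mult a_pow)
    have "bij_betw (\<lambda>x. x \<otimes> w) (F (0, 0)) (F p)"
    proof (rule bij_betwI[where g = "\<lambda>x. x \<otimes> inv w"])
      show "(\<lambda>x. x \<otimes> w) \<in> F (0, 0) \<rightarrow> F p"
        using w p ij by (simp add: F_def a_mult mem_Times_iff Pi_iff)
      show "(\<lambda>x. x \<otimes> inv w) \<in> F p \<rightarrow> F (0, 0)"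
        using w p ij by (simp add: F_def a_mult a_inv mod_add_right_eq Pi_iff)
    qed (use w in \<open>simp_all add: F_def m_assoc\<close>)
    then show ?thesis by (metis bij_betw_same_card)
  qed
  have "carrier G = (\<Union>p\<in>{0..<int (r i)} \<times> {0..<int (r j)}. F p)"
  proof (intro equalityI subsetI)
    fix x assume x: "x \<in> carrier G"
    then have "(a i x, a j x) \<in> {0..<int (r i)} \<times> {0..<int (r j)}" "x \<in> F (a i x, a j x)"
      using a_range[OF ij(1) x] a_range[OF ij(2) x] by (auto simp: F_def)
    then show "x \<in> (\<Union>p\<in>{0..<int (r i)} \<times> {0..<int (r j)}. F p)" by blast
  qed (auto simp: F_def)
  then have "n = card (\<Union>p\<in>{0..<int (r i)} \<times> {0..<int (r j)}. F p)" by simp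
  also have "\<dots> = (\<Sum>p\<in>{0..<int (r i)} \<times> {0..<int (r j)}. card (F p))"
    by (rule card_UN_disjoint) (use fin_G in \<open>auto simp: F_def\<close>)
  also have "\<dots> = r i * r j * card (F (0, 0))"
    using card_F by simp
  finally show ?thesis by simp
qed

text \<open>The exponent of the group, and the order of \<open>x0\<close>: residues detect the
  identity by \<open>eq_oneI\<close>, and those of \<open>inv x0\<close> are all 1.\<close>

definition expo :: nat where "expo = Lcm (r ` I)"

text \<open>The value of \<open>l\<close> at the k-th power of \<open>inv x0\<close>, see
  \<open>l_gen\<close>. It depends on the degrees and indices only, not on the group.\<close>

definition f :: "nat \<Rightarrow> real" where "f k = (\<Sum>i\<in>I. real (d i) * real (k mod r i) / real (r i))"

text \<open>The total degree of the components whose residue returns to 0 when the exponent of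
  \<open>inv x0\<close> reaches k.\<close>

definition D :: "nat \<Rightarrow> nat" where "D k = (\<Sum>i | i \<in> I \<and> r i dvd k. d i)"

lemma r_dvd_expo: "i \<in> I \<Longrightarrow> r i dvd expo"
  unfolding expo_def by simp

lemma expo_dvd_iff: "expo dvd k \<longleftrightarrow> (\<forall>i\<in>I. r i dvd k)"
  unfolding expo_def by auto

lemma expo_pos: "expo > 0"
  using fin_I r_pos unfolding expo_def by (metis (mono_tags, lifting) Lcm_0_iff_nat bot_nat_0.not_eq_extremum finite_imageI image_iff less_irrefl)

lemma a_gen: "i \<in> I \<Longrightarrow> a i (inv x0 [^] (k::nat)) = int (k mod r i)"
proof -
  assume i: "i \<in> I"
  have "a i (inv x0) = (1 - int (r i)) mod int (r i)" using i x0 by (simp add: a_inv a_x0)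
  also have "\<dots> = (1 - int (r i) + int (r i)) mod int (r i)" by simp
  also have "\<dots> = 1" using r_ge[OF i] by simp
  finally show ?thesis using i x0 by (simp add: a_pow zmod_int)
qed

lemma l_gen: "l (inv x0 [^] (k::nat)) = f k"
  unfolding l_def f_def by (rule sum.cong) (auto simp: a_gen)

text \<open>If all residues vanish, then \<open>l\<close> vanishes too, which is below the bound 2
  for non-trivial elements.\<close>

lemma eq_oneI:
  assumes "x \<in> carrier G" "\<And>i. i \<in> I \<Longrightarrow> a i x = 0"
  shows "x = \<one>"
  using l_ge[OF assms(1)] assms(2) by (cases "x = \<one>") auto

lemma expo_dvd_n: "expo dvd n"
  unfolding expo_dvd_iff
proof
  fix i assume i: "i \<in> I"
  have "inv x0 [^] n = \<one>" using x0 pow_order_eq_1[of "inv x0"] unfolding Coset.order_def by simp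
  then have "int (n mod r i) = 0" using a_gen[OF i, of n] a_one[OF i] by simp
  then show "r i dvd n" by (simp add: mod_eq_0_iff_dvd)
qed

lemma f_cases:
  assumes "\<not> expo dvd k" "\<not> expo dvd k + 1"
  shows "f k = 2 \<or> f k = 3"
proof -
  have "inv x0 [^] k \<noteq> \<one>"
    using assms(1) a_gen[of _ k] a_one unfolding expo_dvd_iff by (metis of_nat_eq_0_iff mod_eq_0_iff_dvd)
  moreover have "inv x0 [^] k \<noteq> x0"
  proof
    assume eq: "inv x0 [^] k = x0"
    have "r i dvd k + 1" if i: "i \<in> I" for i
    proof -
      have "k mod r i + 1 = r i" using a_gen[OF i, of k] eq a_x0[OF i] by simp
      then have "(k mod r i + 1) mod r i = 0" by simp
      then show ?thesis by (metis mod_add_left_eq mod_eq_0_iff_dvd)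
    qed
    then show False using assms(2) unfolding expo_dvd_iff by simp
  qed
  ultimately show ?thesis using l_cases[of "inv x0 [^] k"] x0 unfolding l_gen by simp
qed

text \<open>Each residue grows by one, except that those with \<open>r i dvd Suc k\<close> fall back
  to 0, which costs the full degree \<open>d i\<close>.\<close>

lemma f_Suc: "f (Suc k) = f k + f 1 - real (D (Suc k))"
proof -
  have D: "real (D (Suc k)) = (\<Sum>i\<in>I. if r i dvd Suc k then real (d i) else 0)"
    unfolding D_def by (simp add: sum.If_cases fin_I Int_def)
  have "real (d i) * real (Suc k mod r i) / real (r i) =
      real (d i) * real (k mod r i) / real (r i) + real (d i) * real (1 mod r i) / real (r i)
      - (if r i dvd Suc k then real (d i) else 0)" if i: "i \<in> I" for i
  proof (cases "r i dvd Suc k")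
    case True
    then have "Suc (k mod r i) = r i" by (metis Suc_leI mod_Suc mod_eq_0_iff_dvd nat.simps(3))
    then have "real (k mod r i) = real (r i) - 1" by linarith
    moreover have "Suc k mod r i = 0" using True by simp
    moreover have "1 mod r i = 1" using r_ge[OF i] by (intro mod_less) simp
    ultimately show ?thesis using True r_pos[OF i] by (simp only: if_True) (simp add: field_simps)
  next
    case False
    then have "Suc k mod r i = Suc (k mod r i)" by (metis mod_Suc mod_eq_0_iff_dvd)
    moreover have "1 mod r i = 1" using r_ge[OF i] by (intro mod_less) simp
    ultimately show ?thesis using False by (simp only: if_False) (simp add: distrib_left add_divide_distrib)
  qed
  then have "f (Suc k) = (\<Sum>i\<in>I. real (d i) * real (k mod r i) / real (r i)
    + real (d i) * real (1 mod r i) / real (r i) - (if r i dvd Suc k then real (d i) else 0))"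
    unfolding f_def by (rule sum.cong[OF refl])
  then show ?thesis unfolding D f_def sum.distrib sum_subtractf by simp
qed

text \<open>By \<open>f_Suc\<close>, \<open>D k = f (k - 1) + f 1 - f k\<close> is at least 2 + 2 -
  3. The bounds on \<open>k\<close> keep 1, \<open>k - 1\<close> and \<open>k\<close> away from the
  classes 0 and -1 modulo \<open>expo\<close>, where \<open>f\<close> is 0 or 5.\<close>

lemma ex_r_dvd:
  assumes "2 \<le> k" "k + 2 \<le> expo"
  shows "\<exists>i\<in>I. r i dvd k"
proof -
  obtain k' where k': "k = Suc k'" "k' \<ge> 1" using assms(1) by (cases k) auto
  have nd: "\<not> expo dvd m" if "1 \<le> m" "m < expo" for m using that by (auto dest: dvd_imp_le)
  have "f k = 2 \<or> f k = 3" "f k' = 2 \<or> f k' = 3" "f 1 = 2 \<or> f 1 = 3"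
    using assms k' by (intro f_cases nd; simp)+
  then have "real (D k) > 0" using f_Suc[of k'] k' by fastforce
  then have "D k \<noteq> 0" by simp
  then show ?thesis unfolding D_def by (metis (no_types, lifting) mem_Collect_eq sum.neutral)
qed

text \<open>An index that divides a prime is the prime itself. So all primes up to
  \<open>expo - 2\<close> divide \<open>expo\<close>, which cannot last as \<open>expo\<close>
  grows.\<close>

lemma prime_dvd_expo:
  assumes "Factorial_Ring.prime p" "p + 2 \<le> expo"
  shows "\<exists>i\<in>I. r i = p"
proof -
  obtain i where "i \<in> I" "r i dvd p" using ex_r_dvd[of p] assms prime_ge_2_nat by auto
  moreover have "r i \<noteq> 1" using r_ge[OF \<open>i \<in> I\<close>] by simp
  ultimately show ?thesis using assms(1) by (metis prime_nat_iff)
qed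

lemma expo_cases: "expo = 2 \<or> expo = 4 \<or> expo = 6"
proof -
  obtain i where "i \<in> I" using I_ne by auto
  then have ge2: "expo \<ge> 2" using r_ge[of i] r_dvd_expo[of i] expo_pos by (meson dvd_imp_le le_trans)
  have even: "2 dvd expo" if "expo \<ge> 4"
    using prime_dvd_expo[of 2] that r_dvd_expo two_is_prime_nat by fastforce
  \<comment> \<open>The primes 2, 3 and 5 divide \<open>expo\<close>, which is then at least 30; so
    7 divides it as well, and a multiple of 210 exceeds the bound 72.\<close>
  have "expo < 8"
  proof (rule ccontr)
    assume "\<not> expo < 8"
    then have "2 dvd expo" "3 dvd expo" "5 dvd expo"
      using even prime_dvd_expo[of 3] prime_dvd_expo[of 5] r_dvd_expo by fastforce+
    then have "2 * 3 * 5 dvd expo"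
      by (intro divides_mult) (simp_all add: coprime_iff_gcd_eq_1 gcd_non_0_nat)
    then have "30 dvd expo" by simp
    then have "expo \<ge> 30" using expo_pos by (auto dest: dvd_imp_le)
    then have "7 dvd expo" using prime_dvd_expo[of 7] r_dvd_expo by fastforce
    then have "2 * 3 * 5 * 7 dvd expo" using \<open>2 * 3 * 5 dvd expo\<close>
      by (intro divides_mult[of "2 * 3 * 5" _ 7]) (simp_all add: coprime_iff_gcd_eq_1 gcd_non_0_nat)
    then have "210 dvd expo" by simp
    then have "210 dvd n" using expo_dvd_n by (meson dvd_trans)
    then show False using n_lt n_ge by (auto dest: dvd_imp_le)
  qed
  moreover have "expo \<noteq> 3"
  proof
    \<comment> \<open>All indices are then 3, which makes \<open>f 1\<close> half of
      \<open>l x0\<close>, that is 5 / 2.\<close>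
    assume e: "expo = 3"
    have r3: "r i = 3" if "i \<in> I" for i
    proof -
      have "r i dvd 3" using r_dvd_expo[OF that] e by simp
      then have "r i \<le> 3" "r i \<noteq> 2" by (auto dest: dvd_imp_le)
      then show ?thesis using r_ge[OF that] by linarith
    qed
    have "f 1 = 2 \<or> f 1 = 3" by (rule f_cases; unfold e; presburger)
    moreover have "f 1 = (\<Sum>i\<in>I. real (d i)) / 3"
      unfolding f_def sum_divide_distrib by (rule sum.cong) (auto simp: r3)
    moreover have "5 = (\<Sum>i\<in>I. real (d i)) * 2 / 3"
      unfolding l_x0[symmetric] sum_divide_distrib sum_distrib_right by (rule sum.cong) (auto simp: r3)
    ultimately show False by auto
  qed
  moreover have "expo \<noteq> 5" "expo \<noteq> 7" using even by auto
  ultimately show ?thesis using ge2 by linarith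
qed

text \<open>For an odd prime factor p Sylow's theorem provides a subgroup of order p; its elements
  are killed by p and by 4, hence trivial.\<close>

lemma two_power_order:
  assumes "\<And>x. x \<in> carrier G \<Longrightarrow> x [^] (4::nat) = \<one>"
  shows "\<exists>m. n = 2 ^ m"
proof -
  have "p = 2" if p: "Factorial_Ring.prime p" "p dvd n" for p
  proof (rule ccontr)
    assume "p \<noteq> 2"
    have "Coset.order G = p ^ 1 * (n div p)" using p by (simp add: Coset.order_def)
    then obtain H where H: "subgroup H G" "card H = p ^ 1"
      using sylow_thm[OF p(1) group_axioms _ fin_G] by blast
    interpret H: subgroup H G by fact
    interpret GH: group "G\<lparr>carrier := H\<rparr>" by (rule H.subgroup_is_group[OF group_axioms])
    have "card H \<ge> 2" using H(2) p prime_ge_2_nat by simp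
    then obtain h where h: "h \<in> H" "h \<noteq> \<one>"
      by (metis H.one_closed card_le_Suc0_iff_eq not_numeral_le_zero numeral_2_eq_2 card.infinite not_less_eq_eq)
    have "h [^] p = \<one>"
      using GH.pow_order_eq_1[of h] h H(2) nat_pow_consistent[of h p H] by (simp add: Coset.order_def)
    moreover have "h [^] (4::nat) = \<one>" using assms h H.mem_carrier by auto
    moreover have "coprime p 4"
      using p(1) \<open>p \<noteq> 2\<close> primes_coprime[of p 2] two_is_prime_nat coprime_power_right_iff[of p 2 2] by auto
    ultimately show False using h(2) H.mem_carrier[OF h(1)]
      by (metis coprime_common_divisor_nat pow_eq_id ord_eq_1 nat_dvd_1_iff_1 coprime_def)
  qed
  note only_two = this
  define m where "m = multiplicity 2 n"
  obtain k where k: "n = 2 ^ m * k" "\<not> 2 dvd k"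
    using multiplicity_decompose'[of n 2] n_ge unfolding m_def by auto
  have "k = 1"
  proof (rule ccontr)
    assume "k \<noteq> 1"
    then obtain p where "Factorial_Ring.prime p" "p dvd k" using prime_factor_nat by blast
    then show False using only_two[of p] k by auto
  qed
  then show ?thesis using k by auto
qed

lemma split_sum_2:
  fixes h :: "'i \<Rightarrow> real"
  assumes "\<And>i. i \<in> I \<Longrightarrow> r i = p \<or> r i = q" "p \<noteq> q"
  shows "(\<Sum>i\<in>I. h i) = (\<Sum>i | i \<in> I \<and> r i = p. h i) + (\<Sum>i | i \<in> I \<and> r i = q. h i)"
proof -
  have "I = {i \<in> I. r i = p} \<union> {i \<in> I. r i = q}" using assms by auto
  then have "(\<Sum>i\<in>I. h i) = sum h ({i \<in> I. r i = p} \<union> {i \<in> I. r i = q})" by simp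
  then show ?thesis using assms fin_I by (subst (asm) sum.union_disjoint) auto
qed

lemma split_sum_3:
  fixes h :: "'i \<Rightarrow> real"
  assumes "\<And>i. i \<in> I \<Longrightarrow> r i = p \<or> r i = q \<or> r i = s" "p \<noteq> q" "p \<noteq> s" "q \<noteq> s"
  shows "(\<Sum>i\<in>I. h i) = (\<Sum>i | i \<in> I \<and> r i = p. h i) + (\<Sum>i | i \<in> I \<and> r i = q. h i) + (\<Sum>i | i \<in> I \<and> r i = s. h i)"
proof -
  have "I = {i \<in> I. r i = p} \<union> {i \<in> I. r i = q} \<union> {i \<in> I. r i = s}" using assms by auto
  then have "(\<Sum>i\<in>I. h i) = sum h ({i \<in> I. r i = p} \<union> {i \<in> I. r i = q} \<union> {i \<in> I. r i = s})" by simp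
  also have "\<dots> = sum h ({i \<in> I. r i = p} \<union> {i \<in> I. r i = q}) + sum h {i \<in> I. r i = s}"
    using assms fin_I by (intro sum.union_disjoint) auto
  also have "sum h ({i \<in> I. r i = p} \<union> {i \<in> I. r i = q}) = sum h {i \<in> I. r i = p} + sum h {i \<in> I. r i = q}"
    using assms fin_I by (intro sum.union_disjoint) auto
  finally show ?thesis .
qed

definition deg_of :: "nat \<Rightarrow> nat" where "deg_of s = (\<Sum>i | i \<in> I \<and> r i = s. d i)"
definition sq_of :: "nat \<Rightarrow> nat" where "sq_of s = (\<Sum>i | i \<in> I \<and> r i = s. (d i)\<^sup>2)"

lemma deg_le_sq: "deg_of s \<le> sq_of s"
  unfolding deg_of_def sq_of_def by (rule sum_mono) (metis power2_nat_le_imp_le le_square power2_eq_square)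

lemma sum_of_const:
  "(\<Sum>i | i \<in> I \<and> r i = s. real (d i) * y (r i) / z (r i)) = real (deg_of s) * y s / z s"
  unfolding deg_of_def of_nat_sum sum_distrib_right sum_divide_distrib by (rule sum.cong) auto

lemma sum_sq_of_const:
  "(\<Sum>i | i \<in> I \<and> r i = s. (real (d i))\<^sup>2 * y (r i) / z (r i)) = real (sq_of s) * y s / z s"
  unfolding sq_of_def of_nat_sum sum_distrib_right sum_divide_distrib by (rule sum.cong) auto

text \<open>The values \<open>f 1\<close>, \<open>f 2\<close>, \<open>f 3\<close> and
  \<open>l x0\<close> leave four triples of degrees. In each of them the indices 2, 3 and 6 all
  occur, so 12 and 18 divide the order, which must be 36. Then the second moment is 7, and this
  equation has no solution in integers.\<close>

lemma expo_6_False: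
  assumes e: "expo = 6"
  shows False
proof -
  have r: "r i = 2 \<or> r i = 3 \<or> r i = 6" if "i \<in> I" for i
  proof -
    have "r i dvd 6" using r_dvd_expo[OF that] e by simp
    moreover from this have "r i \<le> 6" by (auto dest: dvd_imp_le)
    moreover have "\<not> 4 dvd (6::nat)" "\<not> 5 dvd (6::nat)" by presburger+
    ultimately show ?thesis using r_ge[OF that]
      by (metis Suc_1 add_One_commute eval_nat_numeral(3) le_Suc_eq le_antisym numeral_eq_Suc one_plus_numeral pred_numeral_simps(2,3) semiring_norm(26,27,28) plus_1_eq_Suc)
  qed
  note split = split_sum_3[of 2 3 6, OF r, simplified]
  define \<alpha> \<beta> \<gamma> where "\<alpha> = deg_of 2" and "\<beta> = deg_of 3" and "\<gamma> = deg_of 6"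
  note defs = \<alpha>_def[symmetric] \<beta>_def[symmetric] \<gamma>_def[symmetric]
  have F: "f k = real \<alpha> * real (k mod 2) / 2 + real \<beta> * real (k mod 3) / 3 + real \<gamma> * real (k mod 6) / 6" for k
    unfolding f_def split[of "\<lambda>i. real (d i) * real (k mod r i) / real (r i)"]
      sum_of_const[of "\<lambda>s. real (k mod s)" real] defs by simp
  have L: "5 = real \<alpha> / 2 + real \<beta> * 2 / 3 + real \<gamma> * 5 / 6"
    using l_x0 unfolding split[of "\<lambda>i. real (d i) * (real (r i) - 1) / real (r i)"]
      sum_of_const[of "\<lambda>s. real s - 1" real] defs by simp
  have "f 1 = 2 \<or> f 1 = 3" "f 2 = 2 \<or> f 2 = 3" "f 3 = 2 \<or> f 3 = 3"
    by (rule f_cases; unfold e; presburger)+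
  then have eqs: "3 * \<alpha> + 2 * \<beta> + \<gamma> = 12 \<or> 3 * \<alpha> + 2 * \<beta> + \<gamma> = 18"
     "2 * \<beta> + \<gamma> = 6 \<or> 2 * \<beta> + \<gamma> = 9" "\<alpha> + \<gamma> = 4 \<or> \<alpha> + \<gamma> = 6"
    unfolding F by auto
  have L': "3 * \<alpha> + 4 * \<beta> + 5 * \<gamma> = 30" using L by simp
  have cases: "(\<alpha>, \<beta>, \<gamma>) \<in> {(1, 3, 3), (2, 1, 4), (3, 4, 1), (4, 2, 2)}"
  proof -
    have 1: "\<alpha> = 4 - \<gamma> \<and> \<gamma> \<le> 4 \<or> \<alpha> = 6 - \<gamma> \<and> \<gamma> \<le> 6" using eqs(3) by linarith
    have "\<gamma> = 0 \<or> \<gamma> = 1 \<or> \<gamma> = 2 \<or> \<gamma> = 3 \<or> \<gamma> = 4 \<or> \<gamma> = 5 \<or> \<gamma> = 6" using 1 by linarith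
    moreover have "\<beta> = 3 - \<gamma> div 2 \<and> even \<gamma> \<or> 2 * \<beta> = 9 - \<gamma>" using eqs(2) by presburger
    ultimately show ?thesis using 1 eqs(1) L' by (elim disjE conjE; simp)
  qed
  have mem: "\<exists>i\<in>I. r i = s" if "deg_of s \<noteq> 0" for s
    using that unfolding deg_of_def by (metis (mono_tags, lifting) mem_Collect_eq sum.neutral)
  obtain i j k where ijk: "i \<in> I" "r i = 2" "j \<in> I" "r j = 3" "k \<in> I" "r k = 6"
    using mem[of 2] mem[of 3] mem[of 6] cases unfolding defs by auto
  then have "i \<noteq> k" "j \<noteq> k" by force+
  then have "12 dvd n" "18 dvd n" using fibre_dvd[of i k] fibre_dvd[of j k] ijk by simp_all
  then have "n = 36" using n_lt n_ge by presburger
  then have "real (sq_of 2) * 3 / 4 + real (sq_of 3) * 8 / 9 + real (sq_of 6) * 35 / 36 = 7"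
    using second_moment unfolding split[of "\<lambda>i. (real (d i))\<^sup>2 * ((real (r i))\<^sup>2 - 1) / (real (r i))\<^sup>2"]
      sum_sq_of_const[of "\<lambda>s. (real s)\<^sup>2 - 1" "\<lambda>s. (real s)\<^sup>2"] by simp
  then have "27 * sq_of 2 + 32 * sq_of 3 + 35 * sq_of 6 = 252" by simp
  moreover have "\<alpha> \<le> sq_of 2" "\<beta> \<le> sq_of 3" "\<gamma> \<le> sq_of 6"
    unfolding \<alpha>_def \<beta>_def \<gamma>_def by (rule deg_le_sq)+
  \<comment> \<open>If each sum of squares equals the sum of degrees, the total stays below 252; a
    single excess by one adds at least 27 and overshoots it.\<close>
  moreover have "225 < 27 * \<alpha> + 32 * \<beta> + 35 * \<gamma>" "27 * \<alpha> + 32 * \<beta> + 35 * \<gamma> < 252"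
    using cases by auto
  moreover have "\<alpha> = sq_of 2 \<or> \<alpha> + 1 \<le> sq_of 2" "\<beta> = sq_of 3 \<or> \<beta> + 1 \<le> sq_of 3" "\<gamma> = sq_of 6 \<or> \<gamma> + 1 \<le> sq_of 6"
    using \<open>\<alpha> \<le> sq_of 2\<close> \<open>\<beta> \<le> sq_of 3\<close> \<open>\<gamma> \<le> sq_of 6\<close> by linarith+
  ultimately show False by (elim disjE) linarith+
qed

text \<open>With the exponent 2 or 4 the order is a power of two. The bound 72 still admits 64, so
  the second moment is estimated once more, now with the possible degrees.\<close>

theorem order_power_of_two: "\<exists>m. n = 2 ^ m \<and> 1 \<le> m \<and> m \<le> 5"
proof -
  have e: "expo = 2 \<or> expo = 4" using expo_cases expo_6_False by blast
  then have "expo dvd 4" by auto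
  then have dvd4: "r i dvd 4" if "i \<in> I" for i using r_dvd_expo[OF that] by (rule dvd_trans[rotated])
  have "x [^] (4::nat) = \<one>" if "x \<in> carrier G" for x
  proof (rule eq_oneI)
    fix i assume i: "i \<in> I"
    then have "int (r i) dvd 4" using dvd4[OF i] by (metis int_dvd_int_iff of_nat_numeral)
    then show "a i (x [^] (4::nat)) = 0" using i that by (simp add: a_pow)
  qed (use that in simp)
  then obtain m where m: "n = 2 ^ m" using two_power_order by blast
  have "n < 64"
  proof -
    have r: "r i = 2 \<or> r i = 4" if "i \<in> I" for i
    proof -
      have "r i \<le> 4" "r i \<noteq> 3" using dvd4[OF that] by (auto dest: dvd_imp_le)
      then show ?thesis using r_ge[OF that] by linarith
    qed
    note split = split_sum_2[of 2 4, OF r, simplified]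
    define \<alpha> \<beta> where "\<alpha> = deg_of 2" and "\<beta> = deg_of 4"
    note defs = \<alpha>_def[symmetric] \<beta>_def[symmetric]
    have L: "5 = real \<alpha> / 2 + real \<beta> * 3 / 4"
      using l_x0 unfolding split[of "\<lambda>i. real (d i) * (real (r i) - 1) / real (r i)"]
      sum_of_const[of "\<lambda>s. real s - 1" real] defs by simp
    have sq: "real (sq_of 2) * 3 / 4 + real (sq_of 4) * 15 / 16 = 3 + 144 / real n"
      unfolding second_moment[symmetric] split[of "\<lambda>i. (real (d i))\<^sup>2 * ((real (r i))\<^sup>2 - 1) / (real (r i))\<^sup>2"]
      sum_sq_of_const[of "\<lambda>s. (real s)\<^sup>2 - 1" "\<lambda>s. (real s)\<^sup>2"] by simp
    have le: "real \<alpha> \<le> real (sq_of 2)" "real \<beta> \<le> real (sq_of 4)"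
      unfolding \<alpha>_def \<beta>_def by (simp_all add: deg_le_sq)
    \<comment> \<open>For exponent 4 the value \<open>f 2 = \<beta> / 2\<close> is 2 or 3, and
      \<open>L\<close> then gives \<open>\<alpha>\<close>. In all three cases the second moment is
      at least 51 / 8, which exceeds 3 + 144 / 64.\<close>
    have "(\<alpha> = 10 \<and> \<beta> = 0) \<or> (\<alpha> = 4 \<and> \<beta> = 4) \<or> (\<alpha> = 1 \<and> \<beta> = 6)"
    proof (cases "expo = 2")
      case True
      have "r i \<noteq> 4" if "i \<in> I" for i using r_dvd_expo[OF that] True by (auto dest: dvd_imp_le)
      then have "\<beta> = 0" unfolding \<beta>_def deg_of_def by (auto intro: sum.neutral)
      then show ?thesis using L by simp
    next
      case False
      then have e4: "expo = 4" using e by simp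
      have "f 2 = real \<beta> / 2"
        unfolding f_def split[of "\<lambda>i. real (d i) * real (2 mod r i) / real (r i)"]
      sum_of_const[of "\<lambda>s. real (2 mod s)" real] defs by simp
      moreover have "f 2 = 2 \<or> f 2 = 3" by (rule f_cases; unfold e4; presburger)
      ultimately have "\<beta> = 4 \<or> \<beta> = 6" by auto
      then show ?thesis using L by auto
    qed
    then have "9 / 4 < 144 / real n" using sq le by auto
    moreover have "real n > 0" using n_ge by linarith
    ultimately have "9 / 4 * real n < 144" by (subst (asm) pos_less_divide_eq)
    then show ?thesis by linarith
  qed
  then have "(2::nat) ^ m < 2 ^ 6" using m by simp
  then have "m < 6" by (metis power_strict_increasing_iff one_less_numeral_iff semiring_norm(76))
  moreover have "m \<noteq> 0" using m n_ge by (cases m) auto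
  ultimately show ?thesis using m by (intro exI[of _ m]) auto
qed

end

hide_const (open) Divisibility.prime Divisibility.irreducible

section \<open>Subrings of a field\<close>

definition subr :: "'k::field set \<Rightarrow> bool" where
  "subr A \<longleftrightarrow> 0 \<in> A \<and> 1 \<in> A \<and> (\<forall>x\<in>A. \<forall>y\<in>A. x + y \<in> A \<and> x * y \<in> A) \<and> (\<forall>x\<in>A. - x \<in> A)"

definition pideal :: "'k::field set \<Rightarrow> 'k set \<Rightarrow> bool" where
  "pideal p A \<longleftrightarrow> p \<subseteq> A \<and> 0 \<in> p \<and> (\<forall>x\<in>p. \<forall>y\<in>p. x + y \<in> p) \<and> (\<forall>a\<in>A. \<forall>x\<in>p. a * x \<in> p) \<and> 1 \<notin> p
     \<and> (\<forall>a\<in>A. \<forall>b\<in>A. a * b \<in> p \<longrightarrow> a \<in> p \<or> b \<in> p)"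

text \<open>Since \<open>inverse 0 = 0\<close> belongs to \<open>A\<close>, being nonzero has to be
  required explicitly.\<close>

definition unit_in :: "'k::field set \<Rightarrow> 'k \<Rightarrow> bool" where
  "unit_in A u \<longleftrightarrow> u \<in> A \<and> u \<noteq> 0 \<and> inverse u \<in> A"

text \<open>Divisibility by \<open>x\<close> in \<open>A\<close> is expressed as membership in
  \<open>A\<close> of a quotient formed in the ambient field.\<close>

definition prime_in :: "'k::field set \<Rightarrow> 'k \<Rightarrow> bool" where
  "prime_in A x \<longleftrightarrow> x \<in> A \<and> x \<noteq> 0 \<and> inverse x \<notin> A \<and>
     (\<forall>a\<in>A. \<forall>b\<in>A. a * b / x \<in> A \<longrightarrow> a / x \<in> A \<or> b / x \<in> A)"

lemma whole_field_simps [simp]: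
  "carrier (whole_field :: 'k::field ring) = UNIV"
  "x \<otimes>\<^bsub>(whole_field :: 'k::field ring)\<^esub> y = x * y"
  "x \<oplus>\<^bsub>(whole_field :: 'k::field ring)\<^esub> y = x + y"
  "\<zero>\<^bsub>(whole_field :: 'k::field ring)\<^esub> = 0"
  "\<one>\<^bsub>(whole_field :: 'k::field ring)\<^esub> = 1"
  by (auto simp: ring_of_type_algebra_def)

lemma whole_field_field: "field (whole_field :: 'k::field ring)"
  by (rule field_from_type_algebra)

lemma whole_field_a_inv [simp]: "\<ominus>\<^bsub>(whole_field :: 'k::field ring)\<^esub> x = - x"
proof -
  interpret F: Ring.field "whole_field :: 'k ring" by (rule whole_field_field)
  show ?thesis
    using F.minus_equality[of "- x" x] by simp
qed

lemma sub_simps [simp]: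
  "carrier (sub A) = A"
  "x \<otimes>\<^bsub>sub A\<^esub> y = x * y"
  "x \<oplus>\<^bsub>sub A\<^esub> y = x + y"
  "\<zero>\<^bsub>sub A\<^esub> = 0"
  "\<one>\<^bsub>sub A\<^esub> = 1"
  by simp_all

context
  fixes A :: "'k::field set"
  assumes A: "subr A"
begin

lemma subr_0 [simp, intro]: "0 \<in> A" and subr_1 [simp, intro]: "1 \<in> A"
  using A by (auto simp: subr_def)

lemma subr_add [intro]: "x \<in> A \<Longrightarrow> y \<in> A \<Longrightarrow> x + y \<in> A"
  and subr_mult [intro]: "x \<in> A \<Longrightarrow> y \<in> A \<Longrightarrow> x * y \<in> A"
  and subr_uminus [intro]: "x \<in> A \<Longrightarrow> - x \<in> A"
  using A by (auto simp: subr_def)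

lemma subr_diff [intro]: "x \<in> A \<Longrightarrow> y \<in> A \<Longrightarrow> x - y \<in> A"
  using subr_add[of x "- y"] by auto

lemma subr_power [intro]: "x \<in> A \<Longrightarrow> x ^ n \<in> A"
  by (induction n) auto

lemma subr_of_nat [intro]: "of_nat n \<in> A"
  by (induction n) auto

lemma subr_sum [intro]: "(\<And>i. i \<in> I \<Longrightarrow> f i \<in> A) \<Longrightarrow> sum f I \<in> A"
  by (induction I rule: infinite_finite_induct) auto

lemma subr_prod [intro]: "(\<And>i. i \<in> I \<Longrightarrow> f i \<in> A) \<Longrightarrow> prod f I \<in> A"
  by (induction I rule: infinite_finite_induct) auto

lemma subr_prod_list [intro]: "set xs \<subseteq> A \<Longrightarrow> prod_list xs \<in> A"
  by (induction xs) auto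

lemma sub_domain: "domain (sub A)"
proof (intro domainI cringI abelian_groupI monoid.monoid_comm_monoidI monoidI)
  fix x assume "x \<in> carrier (sub A)"
  then show "\<exists>y\<in>carrier (sub A). y \<oplus>\<^bsub>sub A\<^esub> x = \<zero>\<^bsub>sub A\<^esub>"
    by (intro bexI[of _ "- x"]) auto
qed (auto simp: algebra_simps)

lemma sub_cring: "cring (sub A)"
  using sub_domain by (simp add: domain_def)

lemma sub_a_inv [simp]: "x \<in> A \<Longrightarrow> \<ominus>\<^bsub>sub A\<^esub> x = - x"
proof -
  assume x: "x \<in> A"
  interpret cring "sub A" by (rule sub_cring)
  show "\<ominus>\<^bsub>sub A\<^esub> x = - x" using minus_equality[of "- x" x] x by auto
qed

lemma ideal_iff:
  "ideal I (sub A) \<longleftrightarrow> I \<subseteq> A \<and> 0 \<in> I \<and> (\<forall>x\<in>I. \<forall>y\<in>I. x + y \<in> I) \<and> (\<forall>a\<in>A. \<forall>x\<in>I. a * x \<in> I)"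
proof
  interpret cring "sub A" by (rule sub_cring)
  assume "ideal I (sub A)"
  then interpret I: ideal I "sub A" .
  show "I \<subseteq> A \<and> 0 \<in> I \<and> (\<forall>x\<in>I. \<forall>y\<in>I. x + y \<in> I) \<and> (\<forall>a\<in>A. \<forall>x\<in>I. a * x \<in> I)"
    using I.Icarr I.zero_closed I.a_closed I.I_l_closed by auto
next
  interpret cring "sub A" by (rule sub_cring)
  assume I: "I \<subseteq> A \<and> 0 \<in> I \<and> (\<forall>x\<in>I. \<forall>y\<in>I. x + y \<in> I) \<and> (\<forall>a\<in>A. \<forall>x\<in>I. a * x \<in> I)"
  have "- x \<in> I" if "x \<in> I" for x
  proof -
    have "- 1 * x \<in> I" using I that by blast
    then show ?thesis by simp
  qed
  then show "ideal I (sub A)"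
  proof (intro idealI[OF ring_axioms])
    show "subgroup I (add_monoid (sub A))"
    proof (rule add.subgroupI)
      fix x assume x: "x \<in> I"
      then have "\<ominus>\<^bsub>sub A\<^esub> x = - x" using I by (intro sub_a_inv) auto
      then show "\<ominus>\<^bsub>sub A\<^esub> x \<in> I" using \<open>x \<in> I \<Longrightarrow> - x \<in> I\<close> x by simp
    qed (use I in auto)
  next
    fix a x assume "a \<in> I" "x \<in> carrier (sub A)"
    then have "x * a \<in> I" using I by simp
    then show "a \<otimes>\<^bsub>sub A\<^esub> x \<in> I" "x \<otimes>\<^bsub>sub A\<^esub> a \<in> I" by (simp_all add: mult.commute)
  qed
qed

lemma primeideal_iff: "primeideal p (sub A) \<longleftrightarrow> pideal p A"
proof
  assume "primeideal p (sub A)"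
  then interpret p: primeideal p "sub A" .
  have i: "ideal p (sub A)" by (rule p.is_ideal)
  moreover have "1 \<notin> p"
  proof
    assume "1 \<in> p"
    then have "A \<subseteq> p" using i unfolding ideal_iff by (metis mult.right_neutral subsetI)
    then show False using p.I_notcarr i unfolding ideal_iff by auto
  qed
  ultimately show "pideal p A"
    using p.I_prime unfolding pideal_def ideal_iff by auto
next
  assume "pideal p A"
  then show "primeideal p (sub A)"
    by (intro primeidealI sub_cring) (auto simp: ideal_iff pideal_def)
qed

lemma genideal_principal:
  assumes "a \<in> A"
  shows "genideal (sub A) (insert a {0}) = {a * x | x. x \<in> A}"
proof -
  interpret cring "sub A" by (rule sub_cring)
  have i: "ideal {a * x | x. x \<in> A} (sub A)"
    unfolding ideal_iff using assms
    by (auto intro: exI[of _ "0::'k"] simp: distrib_left[symmetric] mult.left_commute)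
  show ?thesis
  proof
    have "insert a {0} \<subseteq> {a * x | x. x \<in> A}"
    proof
      fix y assume "y \<in> insert a {0}"
      then have "y = a * 1 \<or> y = a * 0" by auto
      then show "y \<in> {a * x | x. x \<in> A}" by blast
    qed
    then show "genideal (sub A) (insert a {0}) \<subseteq> {a * x | x. x \<in> A}"
      by (rule genideal_minimal[OF i])
    have g: "ideal (genideal (sub A) (insert a {0})) (sub A)" using assms by (intro genideal_ideal) auto
    have "a \<in> genideal (sub A) (insert a {0})" using genideal_self[of "insert a {0}"] assms by auto
    then show "{a * x | x. x \<in> A} \<subseteq> genideal (sub A) (insert a {0})"
      using g unfolding ideal_iff by (auto simp: mult.commute)
  qed
qed

lemma unit_mult: "unit_in A u \<Longrightarrow> unit_in A v \<Longrightarrow> unit_in A (u * v)"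
  by (auto simp: unit_in_def)

lemma unit_1: "unit_in A 1"
  by (auto simp: unit_in_def)

text \<open>Carries factoriality over from the monoid of nonzero elements, where irreducible factors
  are prime.\<close>

lemma ufd_factorization:
  assumes "factorial_domain (sub A)" "a \<in> A" "a \<noteq> 0"
  shows "\<exists>u xs. unit_in A u \<and> (\<forall>x\<in>set xs. prime_in A x) \<and> a = u * prod_list xs"
proof -
  interpret M: factorial_monoid "Ring_Divisibility.mult_of (sub A)"
    using assms(1) by (simp add: factorial_domain_def)
  have U: "unit_in A u" if "u \<in> Units (Ring_Divisibility.mult_of (sub A))" for u
  proof -
    let ?M = "Ring_Divisibility.mult_of (sub A)"
    have "u \<in> carrier ?M" and "\<exists>v\<in>carrier ?M. v \<otimes>\<^bsub>?M\<^esub> u = \<one>\<^bsub>?M\<^esub>"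
      using that unfolding Units_def by blast+
    then have "u \<in> A" "u \<noteq> 0" "\<exists>v\<in>A. v * u = 1"
      by (simp_all add: Ring_Divisibility.mult_of_def) blast?
    then obtain v where v: "v \<in> A" "v * u = 1" "u \<in> A" "u \<noteq> 0" by blast
    then have "inverse u = v" by (metis inverse_unique mult.commute)
    then show ?thesis using v by (auto simp: unit_in_def)
  qed
  show ?thesis
  proof (cases "a \<in> Units (Ring_Divisibility.mult_of (sub A))")
    case True
    then show ?thesis using U by (intro exI[of _ a] exI[of _ "[]"]) auto
  next
    case False
    then obtain fs where fs: "set fs \<subseteq> carrier (Ring_Divisibility.mult_of (sub A))" "factors (Ring_Divisibility.mult_of (sub A)) fs a"
      using M.factors_exist[of a] assms by auto
    have "prime_in A x" if "x \<in> set fs" for x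
    proof -
      have x: "x \<in> A" "x \<noteq> 0" using that fs by auto
      have "Divisibility.irreducible (Ring_Divisibility.mult_of (sub A)) x" using fs(2) that by (auto simp: factors_def)
      then have pr: "Divisibility.prime (Ring_Divisibility.mult_of (sub A)) x" using M.irreducible_prime x by auto
      have "inverse x \<notin> A"
      proof
        assume "inverse x \<in> A"
        then have "x \<in> Units (Ring_Divisibility.mult_of (sub A))"
          using x by (auto simp: Units_def intro!: bexI[of _ "inverse x"])
        then show False using pr by (simp add: Divisibility.prime_def)
      qed
      moreover have "a / x \<in> A \<or> b / x \<in> A" if ab: "a \<in> A" "b \<in> A" "a * b / x \<in> A" for a b
      proof (cases "a = 0 \<or> b = 0")
        case True then show ?thesis by auto
      next
        case False
        then have "x divides\<^bsub>Ring_Divisibility.mult_of (sub A)\<^esub> (a \<otimes>\<^bsub>Ring_Divisibility.mult_of (sub A)\<^esub> b)"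
          using ab x by (auto simp: factor_def intro!: bexI[of _ "a * b / x"])
        then have "x divides\<^bsub>Ring_Divisibility.mult_of (sub A)\<^esub> a \<or> x divides\<^bsub>Ring_Divisibility.mult_of (sub A)\<^esub> b"
          using pr ab False by (auto simp: Divisibility.prime_def)
        then show ?thesis using x by (auto simp: factor_def)
      qed
      ultimately show ?thesis using x by (auto simp: prime_in_def)
    qed
    moreover have "monoid.mult (whole_field :: 'k ring) = (*)" by (simp add: fun_eq_iff)
    then have "foldr (*) fs 1 = a" using fs(2) by (simp add: factors_def Ring_Divisibility.mult_of_def)
    then have "a = prod_list fs" by (simp add: prod_list.eq_foldr)
    ultimately show ?thesis using unit_1 by (intro exI[of _ 1] exI[of _ fs]) auto
  qed
qed

text \<open>By Zorn's lemma there is an ideal maximal among those that contain \<open>I\<close> but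
  not 1, and maximal ideals are prime.\<close>

lemma ex_pideal:
  assumes I: "I \<subseteq> A" "0 \<in> I" "\<And>x y. x \<in> I \<Longrightarrow> y \<in> I \<Longrightarrow> x + y \<in> I" "\<And>a x. a \<in> A \<Longrightarrow> x \<in> I \<Longrightarrow> a * x \<in> I"
    and "1 \<notin> I"
  shows "\<exists>p. pideal p A \<and> I \<subseteq> p"
proof -
  define \<J> where "\<J> = {J. ideal J (sub A) \<and> I \<subseteq> J \<and> 1 \<notin> J}"
  have "\<exists>M\<in>\<J>. \<forall>J\<in>\<J>. M \<subseteq> J \<longrightarrow> J = M"
  proof (rule subset_Zorn_nonempty)
    show "\<J> \<noteq> {}" using assms by (auto simp: \<J>_def ideal_iff intro!: exI[of _ I])
    fix C assume C: "C \<noteq> {}" "subset.chain \<J> C"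
    then have sub: "C \<subseteq> \<J>" by (auto simp: subset.chain_def)
    have tot: "x \<in> Y \<or> y \<in> X" if "X \<in> C" "Y \<in> C" "x \<in> X" "y \<in> Y" for X Y x y
      using C(2) that unfolding subset.chain_def by blast
    show "\<Union>C \<in> \<J>"
      unfolding \<J>_def ideal_iff
    proof (intro CollectI conjI ballI)
      show "\<Union>C \<subseteq> A" "0 \<in> \<Union>C" "I \<subseteq> \<Union>C" "1 \<notin> \<Union>C"
        using C(1) sub by (auto simp: \<J>_def ideal_iff)
      show "x + y \<in> \<Union>C" if xy: "x \<in> \<Union>C" "y \<in> \<Union>C" for x y
      proof -
        obtain X Y where XY: "X \<in> C" "Y \<in> C" "x \<in> X" "y \<in> Y" using xy by auto
        then have "(x \<in> Y \<and> y \<in> Y) \<or> (x \<in> X \<and> y \<in> X)" using tot by blast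
        then show ?thesis using XY sub unfolding \<J>_def ideal_iff by blast
      qed
      show "a * x \<in> \<Union>C" if "a \<in> A" "x \<in> \<Union>C" for a x
        using that sub unfolding \<J>_def ideal_iff by blast
    qed
  qed
  then obtain M where M: "M \<in> \<J>" and max: "\<And>J. J \<in> \<J> \<Longrightarrow> M \<subseteq> J \<Longrightarrow> J = M" by blast
  have Mi: "M \<subseteq> A" "0 \<in> M" "1 \<notin> M" "I \<subseteq> M" "\<And>x y. x \<in> M \<Longrightarrow> y \<in> M \<Longrightarrow> x + y \<in> M"
     "\<And>a x. a \<in> A \<Longrightarrow> x \<in> M \<Longrightarrow> a * x \<in> M"
    using M by (auto simp: \<J>_def ideal_iff)
  have inv: "\<exists>c\<in>A. \<exists>m\<in>M. m + c * a = 1" if a: "a \<in> A" "a \<notin> M" for a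
  proof -
    define J where "J = {m + c * a | m c. m \<in> M \<and> c \<in> A}"
    have sub: "M \<subseteq> J" 
    proof
      fix m assume "m \<in> M"
      then have "m = m + 0 * a" "m \<in> M" by auto
      then show "m \<in> J" unfolding J_def by blast
    qed
    have "a \<in> J"
    proof -
      have "a = 0 + 1 * a" by simp
      then show ?thesis unfolding J_def using Mi(2) subr_1 by blast
    qed
    have ideal: "ideal J (sub A)"
      unfolding ideal_iff
    proof (intro conjI ballI)
      show "J \<subseteq> A" using Mi a by (auto simp: J_def)
      show "0 \<in> J" using sub Mi by auto
      show "x + y \<in> J" if xy: "x \<in> J" "y \<in> J" for x y
      proof -
        obtain m c m' c' where "x = m + c * a" "y = m' + c' * a" "m \<in> M" "m' \<in> M" "c \<in> A" "c' \<in> A"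
          using xy by (auto simp: J_def)
        then have "x + y = (m + m') + (c + c') * a" "m + m' \<in> M" "c + c' \<in> A" using Mi by (auto simp: algebra_simps)
        then show ?thesis unfolding J_def by blast
      qed
      show "b * x \<in> J" if b: "b \<in> A" and x: "x \<in> J" for b x
      proof -
        obtain m c where "x = m + c * a" "m \<in> M" "c \<in> A" using x by (auto simp: J_def)
        then have "b * x = b * m + (b * c) * a" "b * m \<in> M" "b * c \<in> A" using Mi b by (auto simp: algebra_simps)
        then show ?thesis unfolding J_def by blast
      qed
    qed
    have "J \<noteq> M" using \<open>a \<in> J\<close> a by auto
    then have "J \<notin> \<J>" using max[of J] sub by auto
    then have "1 \<in> J" using ideal sub Mi(4) by (auto simp: \<J>_def)
    then show ?thesis unfolding J_def by force
  qed
  have "a \<in> M \<or> b \<in> M" if ab: "a \<in> A" "b \<in> A" "a * b \<in> M" for a b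
  proof (rule ccontr)
    assume "\<not> (a \<in> M \<or> b \<in> M)"
    then obtain c m where cm: "c \<in> A" "m \<in> M" "m + c * a = 1" using inv[OF ab(1)] by blast
    have "b = b * m + c * (a * b)" using arg_cong[OF cm(3), of "\<lambda>x. b * x"] by (simp add: algebra_simps)
    also have "\<dots> \<in> M" using cm ab Mi by auto
    finally show False using \<open>\<not> (a \<in> M \<or> b \<in> M)\<close> by auto
  qed
  then have "pideal M A" using Mi by (auto simp: pideal_def)
  then show ?thesis using Mi(4) by blast
qed

lemma localization_subr:
  assumes p: "pideal p A"
  shows "subr (localization A p)" "A \<subseteq> localization A p"
    "\<And>x. x \<in> A - p \<Longrightarrow> unit_in (localization A p) x"
    "\<And>x. x \<in> p \<Longrightarrow> x \<noteq> 0 \<Longrightarrow> inverse x \<notin> localization A p"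
proof -
  have nz: "b \<noteq> 0" if "b \<in> A - p" for b using that p by (auto simp: pideal_def)
  have pm: "b * c \<in> A - p" if "b \<in> A - p" "c \<in> A - p" for b c using that p by (auto simp: pideal_def)
  have 1: "1 \<in> A - p" using p by (auto simp: pideal_def)
  show sub: "A \<subseteq> localization A p"
  proof
    fix a assume "a \<in> A"
    then have "a = a / 1" "a \<in> A" by auto
    then show "a \<in> localization A p" using 1 unfolding localization_def by blast
  qed
  show "subr (localization A p)"
    unfolding subr_def
  proof (intro conjI ballI)
    show "0 \<in> localization A p" "1 \<in> localization A p" using sub by auto
    fix x assume x: "x \<in> localization A p"
    then obtain a b where ab: "x = a / b" "a \<in> A" "b \<in> A - p" by (auto simp: localization_def)
    have "- x = (- a) / b" "- a \<in> A" using ab by auto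
    then show "- x \<in> localization A p" using ab unfolding localization_def by blast
    fix y assume y: "y \<in> localization A p"
    then obtain c d where cd: "y = c / d" "c \<in> A" "d \<in> A - p" by (auto simp: localization_def)
    have "x + y = (a * d + c * b) / (b * d)" using ab cd nz by (simp add: add_frac_eq)
    moreover have "a * d + c * b \<in> A" using ab cd by auto
    ultimately show "x + y \<in> localization A p" using pm[of b d] ab cd unfolding localization_def by blast
    have "x * y = (a * c) / (b * d)" "a * c \<in> A" using ab cd by auto
    then show "x * y \<in> localization A p" using pm[of b d] ab cd unfolding localization_def by blast
  qed
  show "unit_in (localization A p) x" if x: "x \<in> A - p" for x
  proof -
    have "inverse x = 1 / x" by (simp add: divide_inverse)
    then have "inverse x \<in> localization A p" using x unfolding localization_def by blast
    then show ?thesis using x sub nz by (auto simp: unit_in_def)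
  qed
  show "inverse x \<notin> localization A p" if x: "x \<in> p" "x \<noteq> 0" for x
  proof
    assume "inverse x \<in> localization A p"
    then obtain a b where ab: "inverse x = a / b" "a \<in> A" "b \<in> A - p" by (auto simp: localization_def)
    then have "b = a * x" using x nz[of b] by (simp add: field_simps)
    then show False using ab x p by (auto simp: pideal_def)
  qed
qed

end

lemma max_ideal_localization:
  assumes "subr A" "pideal p A"
  shows "max_ideal (localization A p) = {a / b | a b. a \<in> p \<and> b \<in> A - p}"
proof -
  note loc = localization_subr[OF assms]
  have nz: "b \<noteq> 0" if "b \<in> A - p" for b using that assms by (auto simp: pideal_def)
  have pA: "p \<subseteq> A" using assms by (auto simp: pideal_def)
  show ?thesis
  proof (intro equalityI subsetI)
    fix x assume "x \<in> max_ideal (localization A p)"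
    then have x: "x \<in> localization A p" "x = 0 \<or> inverse x \<notin> localization A p" by (auto simp: max_ideal_def)
    then obtain a b where ab: "x = a / b" "a \<in> A" "b \<in> A - p" by (auto simp: localization_def)
    have "a \<in> p"
    proof (rule ccontr)
      assume a: "a \<notin> p"
      then have "inverse x = b / a" "x \<noteq> 0" using ab nz[of a] nz[of b] by auto
      then show False using x(2) ab a unfolding localization_def by blast
    qed
    then show "x \<in> {a / b | a b. a \<in> p \<and> b \<in> A - p}" using ab by auto
  next
    fix x assume "x \<in> {a / b | a b. a \<in> p \<and> b \<in> A - p}"
    then obtain a b where ab: "x = a / b" "a \<in> p" "b \<in> A - p" by auto
    have "inverse x \<notin> localization A p" if "x \<noteq> 0"
    proof
      assume i: "inverse x \<in> localization A p"
      have "inverse a = inverse x * inverse b" using ab that nz[of b] by (simp add: field_simps)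
      moreover have "inverse b \<in> localization A p" using loc(3)[OF ab(3)] by (simp add: unit_in_def)
      ultimately have "inverse a \<in> localization A p" using i subr_mult[OF loc(1)] by auto
      then show False using loc(4)[of a] ab that by auto
    qed
    moreover have "x \<in> localization A p" using ab pA unfolding localization_def by auto
    ultimately show "x \<in> max_ideal (localization A p)" by (auto simp: max_ideal_def)
  qed
qed

text \<open>By definition \<open>max_ideal\<close> is the set of non-units. That it is closed under
  addition is special to local rings and is read off from the description by fractions.\<close>

lemma local_max_ideal:
  assumes "subr A" "pideal p A"
  defines "P \<equiv> localization A p"
  shows "pideal (max_ideal P) P" "max_ideal P \<inter> A = p" "\<And>x. x \<in> P \<Longrightarrow> x \<notin> max_ideal P \<longleftrightarrow> unit_in P x"
proof -
  note loc = localization_subr[OF assms(1,2), folded P_def]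
  note max = max_ideal_localization[OF assms(1,2), folded P_def]
  have nz: "b \<noteq> 0" if "b \<in> A - p" for b using that assms by (auto simp: pideal_def)
  have pm: "b * c \<in> A - p" if "b \<in> A - p" "c \<in> A - p" for b c
    using that assms subr_mult[OF assms(1)] by (auto simp: pideal_def)
  have p: "\<And>x y. x \<in> p \<Longrightarrow> y \<in> p \<Longrightarrow> x + y \<in> p" "\<And>a x. a \<in> A \<Longrightarrow> x \<in> p \<Longrightarrow> a * x \<in> p" "0 \<in> p" "p \<subseteq> A" "1 \<notin> p"
    using assms(2) by (auto simp: pideal_def)
  show unit: "x \<notin> max_ideal P \<longleftrightarrow> unit_in P x" if "x \<in> P" for x
    using that by (auto simp: max_ideal_def unit_in_def)
  show "max_ideal P \<inter> A = p"
  proof (intro equalityI subsetI)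
    fix x assume "x \<in> max_ideal P \<inter> A"
    then show "x \<in> p" using loc(3)[of x] unit[of x] loc(2) by auto
  next
    fix x assume x: "x \<in> p"
    then have "x = x / 1" "1 \<in> A - p" using p subr_1[OF assms(1)] by auto
    then show "x \<in> max_ideal P \<inter> A" using x p unfolding max by blast
  qed
  show "pideal (max_ideal P) P"
    unfolding pideal_def
  proof (intro conjI ballI impI)
    show "max_ideal P \<subseteq> P" "0 \<in> max_ideal P" "1 \<notin> max_ideal P"
      using subr_0[OF loc(1)] subr_1[OF loc(1)] by (auto simp: max_ideal_def)
    fix x assume "x \<in> max_ideal P"
    then obtain a b where ab: "x = a / b" "a \<in> p" "b \<in> A - p" unfolding max by auto
    {
      fix y assume "y \<in> max_ideal P"
      then obtain c d where cd: "y = c / d" "c \<in> p" "d \<in> A - p" unfolding max by auto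
      have "x + y = (a * d + c * b) / (b * d)" using ab cd nz by (simp add: add_frac_eq)
      moreover have "a * d + c * b \<in> p"
        using p(1)[OF p(2)[of d a] p(2)[of b c]] ab cd by (simp add: mult.commute)
      ultimately show "x + y \<in> max_ideal P" using pm[of b d] ab cd unfolding max by blast
    next
      fix y assume "y \<in> P"
      then obtain c d where cd: "y = c / d" "c \<in> A" "d \<in> A - p" unfolding P_def localization_def by auto
      have "y * x = (c * a) / (d * b)" using ab cd by simp
      then show "y * x \<in> max_ideal P" using pm[of d b] ab cd p unfolding max by blast
    }
  next
    fix x y assume "x \<in> P" "y \<in> P" "x * y \<in> max_ideal P"
    then show "x \<in> max_ideal P \<or> y \<in> max_ideal P"
      using unit unit_mult[OF loc(1)] subr_mult[OF loc(1)] by blast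
  qed
qed

section \<open>Discrete valuation rings and factorial local rings\<close>

definition dvr :: "'k::field set \<Rightarrow> 'k \<Rightarrow> bool" where
  "dvr S \<pi> \<longleftrightarrow> subr S \<and> \<pi> \<in> S \<and> \<pi> \<noteq> 0 \<and> inverse \<pi> \<notin> S \<and>
     (\<forall>x. x \<noteq> 0 \<longrightarrow> (\<exists>(n::int) u. unit_in S u \<and> x = u * \<pi> powi n))"

definition is_dvr :: "'k::field set \<Rightarrow> bool" where "is_dvr S \<longleftrightarrow> (\<exists>\<pi>. dvr S \<pi>)"

definition unif :: "'k::field set \<Rightarrow> 'k" where "unif S = (SOME \<pi>. dvr S \<pi>)"

text \<open>The choice made in \<open>unif\<close> does not matter: every uniformizer has value 1 by
  \<open>vl_dvr_unif\<close>.\<close>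

definition vl :: "'k::field set \<Rightarrow> 'k \<Rightarrow> int" where
  "vl S x = (THE n. \<exists>u. unit_in S u \<and> x = u * unif S powi n)"

lemma unit_in_inverse: "unit_in A u \<Longrightarrow> unit_in A (inverse u)"
  by (auto simp: unit_in_def)

context
  fixes S :: "'k::field set"
  assumes S: "is_dvr S"
begin

lemma dvr_unif: "dvr S (unif S)"
  using S unfolding is_dvr_def unif_def by (rule someI_ex)

lemma dvr_subr: "subr S"
  using dvr_unif by (simp add: dvr_def)

lemma unif_nz: "unif S \<noteq> 0"
  using dvr_unif by (simp add: dvr_def)

text \<open>Otherwise some positive power of the uniformizer, hence the uniformizer itself, would be
  invertible. This makes the exponent in \<open>vl\<close> unique.\<close>

lemma unit_powi:
  assumes "unit_in S (unif S powi n)" shows "n = 0"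
proof (rule ccontr)
  assume "n \<noteq> 0"
  have inv: "unif S powi (- n) \<in> S" "unif S powi n \<in> S"
    using assms by (auto simp: unit_in_def power_int_minus)
  define m where "m = nat \<bar>n\<bar>"
  have "m > 0" using \<open>n \<noteq> 0\<close> by (simp add: m_def)
  have "unif S powi (- int m) \<in> S" using inv by (cases "n > 0") (auto simp: m_def)
  then have "inverse (unif S ^ m) \<in> S" by (simp add: power_int_minus)
  moreover have "unif S ^ (m - 1) \<in> S" using dvr_unif subr_power[OF dvr_subr] by (simp add: dvr_def)
  ultimately have "inverse (unif S ^ m) * unif S ^ (m - 1) \<in> S" using subr_mult[OF dvr_subr] by blast
  moreover have "inverse (unif S ^ m) * unif S ^ (m - 1) = inverse (unif S)"
    using \<open>m > 0\<close> unif_nz by (cases m) (auto simp: field_simps)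
  ultimately show False using dvr_unif by (simp add: dvr_def)
qed

lemma vl_eq:
  assumes "unit_in S u" "x = u * unif S powi n"
  shows "vl S x = n"
  unfolding vl_def
proof (rule the_equality)
  show "\<exists>u. unit_in S u \<and> x = u * unif S powi n" using assms by blast
  fix m assume "\<exists>u. unit_in S u \<and> x = u * unif S powi m"
  then obtain w where w: "unit_in S w" "x = w * unif S powi m" by blast
  then have "unif S powi (m - n) = u * inverse w"
    using assms unif_nz by (auto simp: power_int_diff field_simps unit_in_def)
  moreover have "unit_in S (u * inverse w)"
    using assms w unit_in_inverse unit_mult[OF dvr_subr] by blast
  ultimately show "m = n" using unit_powi[of "m - n"] by simp
qed

lemma vl_decomp:
  assumes "x \<noteq> 0" shows "\<exists>u. unit_in S u \<and> x = u * unif S powi (vl S x)"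
proof -
  obtain n u where "unit_in S u" "x = u * unif S powi n" using dvr_unif assms unfolding dvr_def by blast
  then show ?thesis using vl_eq by auto
qed

lemma vl_mult: assumes "x \<noteq> 0" "y \<noteq> 0" shows "vl S (x * y) = vl S x + vl S y"
proof -
  obtain u v where uv: "unit_in S u" "x = u * unif S powi (vl S x)" "unit_in S v" "y = v * unif S powi (vl S y)"
    using vl_decomp assms by blast
  have "x * y = (u * unif S powi (vl S x)) * (v * unif S powi (vl S y))" using uv by simp
  also have "\<dots> = (u * v) * unif S powi (vl S x + vl S y)"
    using unif_nz by (simp add: power_int_add)
  finally show ?thesis by (rule vl_eq[OF unit_mult[OF dvr_subr uv(1,3)]])
qed

lemma vl_unit: "unit_in S u \<Longrightarrow> vl S u = 0"
  by (rule vl_eq[of u]) auto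

lemma vl_1 [simp]: "vl S 1 = 0"
  by (rule vl_unit[OF unit_1[OF dvr_subr]])

lemma vl_inverse: "x \<noteq> 0 \<Longrightarrow> vl S (inverse x) = - vl S x"
  using vl_mult[of x "inverse x"] by simp

lemma vl_divide: "x \<noteq> 0 \<Longrightarrow> y \<noteq> 0 \<Longrightarrow> vl S (x / y) = vl S x - vl S y"
  by (simp add: divide_inverse vl_mult vl_inverse)

lemma vl_power: "x \<noteq> 0 \<Longrightarrow> vl S (x ^ n) = int n * vl S x"
  by (induction n) (auto simp: vl_mult algebra_simps)

lemma vl_unif: "vl S (unif S) = 1"
  by (rule vl_eq[of 1]) (auto simp: unit_1 dvr_subr)

lemma vl_nonneg_iff: assumes "x \<noteq> 0" shows "x \<in> S \<longleftrightarrow> vl S x \<ge> 0"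
proof -
  obtain u where u: "unit_in S u" "x = u * unif S powi (vl S x)" using vl_decomp assms by blast
  have pow: "unif S ^ n \<in> S" for n using dvr_unif subr_power[OF dvr_subr] by (simp add: dvr_def)
  show ?thesis
  proof
    assume "vl S x \<ge> 0"
    then have "unif S powi (vl S x) \<in> S" using pow by (simp add: power_int_def)
    then show "x \<in> S" using u subr_mult[OF dvr_subr] by (metis unit_in_def)
  next
    assume x: "x \<in> S"
    show "vl S x \<ge> 0"
    proof (rule ccontr)
      assume neg: "\<not> vl S x \<ge> 0"
      have "inverse u * x = unif S powi (vl S x)" using u by (metis unit_in_def mult.assoc left_inverse mult_1)
      then have 1: "unif S powi (vl S x) \<in> S" using x u subr_mult[OF dvr_subr] by (metis unit_in_def)
      have "inverse (unif S powi (vl S x)) = unif S powi (- vl S x)" by (simp add: power_int_minus)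
      also have "\<dots> \<in> S" using pow neg by (simp add: power_int_def)
      finally have "unit_in S (unif S powi (vl S x))" using 1 unif_nz by (simp add: unit_in_def)
      then show False using unit_powi neg by fastforce
    qed
  qed
qed

lemma vl_unit_iff: "x \<noteq> 0 \<Longrightarrow> unit_in S x \<longleftrightarrow> vl S x = 0"
  unfolding unit_in_def using vl_nonneg_iff[of x] vl_nonneg_iff[of "inverse x"] vl_inverse[of x] by auto

lemma vl_max_ideal_iff: "x \<noteq> 0 \<Longrightarrow> x \<in> max_ideal S \<longleftrightarrow> vl S x > 0"
  using vl_unit_iff[of x] vl_nonneg_iff[of x] by (auto simp: max_ideal_def unit_in_def)

lemma vl_add_ge:
  assumes "x \<noteq> 0" "y \<noteq> 0" "x + y \<noteq> 0" "vl S x \<ge> n" "vl S y \<ge> n"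
  shows "vl S (x + y) \<ge> n"
proof -
  define p where "p = unif S powi n"
  have p: "p \<noteq> 0" "vl S p = n" using unif_nz vl_eq[of 1 p n] by (auto simp: p_def unit_1 dvr_subr)
  have "x / p \<in> S" "y / p \<in> S" using assms p by (auto simp: vl_nonneg_iff vl_divide)
  then have "(x + y) / p \<in> S" using subr_add[OF dvr_subr] by (simp add: add_divide_distrib)
  then show ?thesis using assms p by (auto simp: vl_nonneg_iff vl_divide)
qed

text \<open>An element of least value divides all others in the ideal.\<close>

lemma dvr_ideals:
  assumes "ideal J (sub S)" "J \<noteq> {0}"
  shows "\<exists>n. J = {x. x = 0 \<or> vl S x \<ge> int n}"
proof -
  have J: "J \<subseteq> S" "0 \<in> J" "\<And>a x. a \<in> S \<Longrightarrow> x \<in> J \<Longrightarrow> a * x \<in> J"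
    using assms(1) ideal_iff[OF dvr_subr] by auto
  define N where "N = {n. \<exists>x\<in>J. x \<noteq> 0 \<and> vl S x = int n}"
  obtain x where x: "x \<in> J" "x \<noteq> 0" using assms J by auto
  then have "vl S x \<ge> 0" using vl_nonneg_iff J by auto
  then have "nat (vl S x) \<in> N" using x by (auto simp: N_def)
  then have "(LEAST n. n \<in> N) \<in> N" by (rule LeastI)
  then obtain n y where y: "y \<in> J" "y \<noteq> 0" "vl S y = int n" "n = (LEAST n. n \<in> N)" by (auto simp: N_def)
  have "J = {x. x = 0 \<or> vl S x \<ge> int n}"
  proof (intro equalityI subsetI)
    fix z assume z: "z \<in> J"
    show "z \<in> {x. x = 0 \<or> vl S x \<ge> int n}"
    proof (cases "z = 0")
      case False
      then have "vl S z \<ge> 0" using vl_nonneg_iff z J by auto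
      then have "nat (vl S z) \<in> N" using z False by (auto simp: N_def)
      then have "n \<le> nat (vl S z)" unfolding y(4) by (rule Least_le)
      then have "int n \<le> vl S z" using \<open>vl S z \<ge> 0\<close> by linarith
      then show ?thesis by simp
    qed auto
  next
    fix z assume z: "z \<in> {x. x = 0 \<or> vl S x \<ge> int n}"
    show "z \<in> J"
    proof (cases "z = 0")
      case False
      then have "z / y \<in> S" using z y by (simp add: vl_nonneg_iff vl_divide)
      then have "z / y * y \<in> J" using J y by blast
      then show ?thesis using y by simp
    qed (use J in auto)
  qed
  then show ?thesis by blast
qed

lemma ideal_vl_ge: "ideal {x. x = 0 \<or> vl S x \<ge> int n} (sub S)"
  unfolding ideal_iff[OF dvr_subr]
proof (intro conjI ballI)
  show "{x. x = 0 \<or> vl S x \<ge> int n} \<subseteq> S"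
  proof
    fix x assume "x \<in> {x. x = 0 \<or> vl S x \<ge> int n}"
    then show "x \<in> S" using vl_nonneg_iff[of x] subr_0[OF dvr_subr] by (cases "x = 0") auto
  qed
  show "0 \<in> {x. x = 0 \<or> vl S x \<ge> int n}" by simp
  fix x assume x: "x \<in> {x. x = 0 \<or> vl S x \<ge> int n}"
  show "x + y \<in> {x. x = 0 \<or> vl S x \<ge> int n}" if "y \<in> {x. x = 0 \<or> vl S x \<ge> int n}" for y
    using x that vl_add_ge[of x y "int n"] by (cases "x = 0"; cases "y = 0"; cases "x + y = 0"; simp)
  show "a * x \<in> {x. x = 0 \<or> vl S x \<ge> int n}" if "a \<in> S" for a
    using x that vl_nonneg_iff[of a] vl_mult[of a x] by (cases "a = 0") auto
qed

text \<open>A nonzero ideal contains a power of the uniformizer, so a prime one contains the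
  uniformizer.\<close>

lemma pideal_dvr:
  assumes "pideal p S" "p \<noteq> {0}" shows "p = max_ideal S"
proof -
  have "primeideal p (sub S)" using primeideal_iff[OF dvr_subr] assms by simp
  then have "ideal p (sub S)" by (simp add: primeideal_def)
  then obtain n where n: "p = {x. x = 0 \<or> vl S x \<ge> int n}" using dvr_ideals assms by blast
  have p: "\<And>a b. a \<in> S \<Longrightarrow> b \<in> S \<Longrightarrow> a * b \<in> p \<Longrightarrow> a \<in> p \<or> b \<in> p" "1 \<notin> p" using assms by (auto simp: pideal_def)
  have "n \<noteq> 0" using p(2) n by auto
  have un: "unif S \<in> p"
  proof -
    have "unif S ^ k \<in> p \<Longrightarrow> unif S \<in> p" for k
    proof (induction k)
      case 0 then show ?case using p by simp
    next
      case (Suc k)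
      have "unif S \<in> S" "unif S ^ k \<in> S" using dvr_unif subr_power[OF dvr_subr] by (auto simp: dvr_def)
      then show ?case using Suc p(1)[of "unif S" "unif S ^ k"] by auto
    qed
    moreover have "unif S ^ n \<in> p" using n unif_nz by (simp add: vl_power vl_unif)
    ultimately show ?thesis by blast
  qed
  then have "n \<le> 1" using n unif_nz by (auto simp: vl_unif)
  then have "n = 1" using \<open>n \<noteq> 0\<close> by simp
  have "x \<in> max_ideal S \<longleftrightarrow> x \<in> p" for x
    using vl_max_ideal_iff[of x] n \<open>n = 1\<close> subr_0[OF dvr_subr] by (cases "x = 0") (auto simp: max_ideal_def)
  then show ?thesis by blast
qed

lemma pideal_max_dvr: "pideal (max_ideal S) S"
proof -
  have eq: "max_ideal S = {x. x = 0 \<or> vl S x \<ge> int 1}"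
  proof -
    have "x \<in> max_ideal S \<longleftrightarrow> x \<in> {x. x = 0 \<or> vl S x \<ge> int 1}" for x
      using vl_max_ideal_iff[of x] subr_0[OF dvr_subr] by (cases "x = 0") (auto simp: max_ideal_def)
    then show ?thesis by blast
  qed
  have 1: "a \<in> max_ideal S \<or> b \<in> max_ideal S" if ab: "a \<in> S" "b \<in> S" "a * b \<in> max_ideal S" for a b
  proof (cases "a = 0 \<or> b = 0")
    case True
    then show ?thesis by (auto simp: eq)
  next
    case False
    then have "vl S (a * b) = vl S a + vl S b" "vl S (a * b) > 0" "vl S a \<ge> 0" "vl S b \<ge> 0"
      using ab vl_mult vl_nonneg_iff vl_max_ideal_iff[of "a * b"] by simp_all
    then have "vl S a > 0 \<or> vl S b > 0" by linarith
    then show ?thesis using False vl_max_ideal_iff by blast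
  qed
  have 2: "ideal (max_ideal S) (sub S)" unfolding eq by (rule ideal_vl_ge)
  have 3: "1 \<notin> max_ideal S" using subr_1[OF dvr_subr] by (simp add: max_ideal_def)
  show ?thesis using 1 2 3 unfolding pideal_def ideal_iff[OF dvr_subr] by (intro conjI) simp_all
qed

lemma pideal_zero_dvr: "pideal {0} S"
  using subr_0[OF dvr_subr] by (auto simp: pideal_def)

text \<open>The only primes are zero and the maximal ideal. Thus a valuation ring that is a point of
  \<open>X\<close> belongs to \<open>prime_divisors X\<close>.\<close>

lemma krull_dim_dvr: "krull_dim S = 1"
proof -
  have pr: "pideal p S \<longleftrightarrow> p = {0} \<or> p = max_ideal S" for p
    using pideal_dvr pideal_zero_dvr pideal_max_dvr by auto
  have ne: "max_ideal S \<noteq> {0}"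
    using vl_max_ideal_iff[OF unif_nz] vl_unif unif_nz by auto
  let ?N = "{card C - 1 | C. finite C \<and> (\<forall>p\<in>C. primeideal p (sub S)) \<and> chain\<^sub>\<subseteq> C}"
  have "n \<le> 1" if "n \<in> ?N" for n
  proof -
    obtain C where C: "n = card C - 1" "\<forall>p\<in>C. pideal p S" using \<open>n \<in> ?N\<close> primeideal_iff[OF dvr_subr] by auto
    then have "C \<subseteq> {{0}, max_ideal S}" using pr by auto
    then have "card C \<le> card {{0}, max_ideal S}" by (intro card_mono) auto
    then show ?thesis using C(1) by (auto simp: card_insert_if split: if_splits)
  qed
  moreover have "1 \<in> ?N"
  proof -
    have "{0} \<subseteq> max_ideal S" using subr_0[OF dvr_subr] by (simp add: max_ideal_def)
    then have "chain\<^sub>\<subseteq> {{0}, max_ideal S}" unfolding chain_subset_def by blast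
    moreover have "card {{0}, max_ideal S} - 1 = 1" using ne by auto
    moreover have "\<forall>p\<in>{{0}, max_ideal S}. primeideal p (sub S)"
      unfolding primeideal_iff[OF dvr_subr] pr by blast
    ultimately show ?thesis
      by (intro CollectI exI[of _ "{{0}, max_ideal S}"] conjI) simp_all
  qed
  ultimately have "Sup ?N = 1" by (intro cSup_eq_maximum) auto
  then show ?thesis unfolding krull_dim_def .
qed

text \<open>The proper ideals above that of \<open>a\<close> are those of value at least 1, 2, and
  so on up to \<open>vl S a\<close>; they form a single chain.\<close>

lemma length_quotient_dvr:
  assumes "a \<in> S" "a \<noteq> 0"
  shows "int (length_quotient S (genideal (sub S) (insert a {0}))) = vl S a"
proof -
  define I where "I n = {x. x = 0 \<or> vl S x \<ge> int n}" for n :: nat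
  have gen: "genideal (sub S) (insert a {0}) = I (nat (vl S a))"
  proof -
    have "vl S a \<ge> 0" using assms vl_nonneg_iff by auto
    then have "x \<in> {a * y | y. y \<in> S} \<longleftrightarrow> x \<in> I (nat (vl S a))" for x
    proof (cases "x = 0")
      case True then show ?thesis using subr_0[OF dvr_subr] by (auto simp: I_def intro: exI[of _ 0])
    next
      case False
      have "x \<in> {a * y | y. y \<in> S} \<longleftrightarrow> x / a \<in> S"
        using assms by (auto intro!: exI[of _ "x / a"])
      then show ?thesis using False assms \<open>vl S a \<ge> 0\<close> by (auto simp: vl_nonneg_iff vl_divide I_def)
    qed
    then show ?thesis unfolding genideal_principal[OF dvr_subr assms(1)] by blast
  qed
  have mem: "unif S ^ k \<in> I n \<longleftrightarrow> n \<le> k" for k n using unif_nz by (simp add: I_def vl_power vl_unif)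
  have sub: "I n \<subseteq> I m \<longleftrightarrow> m \<le> n" for m n
  proof
    assume "I n \<subseteq> I m" then show "m \<le> n" using mem[of n n] mem[of n m] by auto
  qed (auto simp: I_def)
  have inj: "inj I" using sub by (intro injI) (metis antisym order_refl)
  have "x \<in> S \<longleftrightarrow> x \<in> I 0" for x
    using vl_nonneg_iff[of x] subr_0[OF dvr_subr] by (cases "x = 0") (auto simp: I_def)
  then have S0: "S = I 0" by blast
  have id: "ideal J (sub S) \<and> J \<noteq> {0} \<longleftrightarrow> (\<exists>n. J = I n)" for J
  proof
    assume "\<exists>n. J = I n"
    then obtain n where n: "J = I n" by blast
    then have "unif S ^ n \<in> J" "unif S ^ n \<noteq> 0" using mem[of n n] unif_nz by auto
    then have "J \<noteq> {0}" by auto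
    then show "ideal J (sub S) \<and> J \<noteq> {0}" using ideal_vl_ge[of n] n by (simp add: I_def)
  qed (use dvr_ideals[of J] in \<open>simp add: I_def\<close>)
  define m where "m = nat (vl S a)"
  have ok: "ideal J (sub S) \<and> I m \<subseteq> J \<and> J \<noteq> S \<longleftrightarrow> J \<in> I ` {1..m}" for J
  proof
    assume J: "ideal J (sub S) \<and> I m \<subseteq> J \<and> J \<noteq> S"
    moreover have "unif S ^ m \<in> I m" using mem by simp
    ultimately have "unif S ^ m \<in> J" "unif S ^ m \<noteq> 0" using unif_nz by auto
    then have "J \<noteq> {0}" by auto
    then obtain n where n: "J = I n" using J id[of J] by blast
    then have "n \<le> m" "n \<noteq> 0" using J sub S0 by auto
    then show "J \<in> I ` {1..m}" using n by auto
  next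
    assume "J \<in> I ` {1..m}"
    then obtain n where n: "J = I n" "1 \<le> n" "n \<le> m" by auto
    then have "J \<noteq> S" using S0 inj by (metis injD not_one_le_zero)
    then show "ideal J (sub S) \<and> I m \<subseteq> J \<and> J \<noteq> S" using n sub id by blast
  qed
  let ?N = "{card C | C. finite C \<and> (\<forall>J\<in>C. ideal J (sub S) \<and> I m \<subseteq> J \<and> J \<noteq> S) \<and> chain\<^sub>\<subseteq> C}"
  have "n \<le> m" if "n \<in> ?N" for n
  proof -
    obtain C where C: "n = card C" "\<forall>J\<in>C. J \<in> I ` {1..m}" using \<open>n \<in> ?N\<close> unfolding ok by blast
    then have "C \<subseteq> I ` {1..m}" by blast
    then have "card C \<le> card (I ` {1..m})" by (intro card_mono) auto
    also have "\<dots> \<le> m" using card_image_le[of "{1..m}" I] by simp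
    finally show ?thesis using C by simp
  qed
  moreover have "m \<in> ?N"
  proof -
    have "card (I ` {1..m}) = m" using card_image[of I "{1..m}"] inj by (simp add: inj_on_subset)
    moreover have "chain\<^sub>\<subseteq> (I ` {1..m})"
      using sub nat_le_linear unfolding chain_subset_def by blast
    ultimately show ?thesis using ok by (intro CollectI exI[of _ "I ` {1..m}"]) auto
  qed
  ultimately have "Sup ?N = m" by (intro cSup_eq_maximum) auto
  then have "length_quotient S (genideal (sub S) (insert a {0})) = m"
    unfolding gen length_quotient_def m_def .
  moreover have "vl S a \<ge> 0" using assms vl_nonneg_iff by auto
  ultimately show ?thesis by (simp add: m_def)
qed

text \<open>Additivity of the valuation makes the difference of lengths independent of the fraction
  that represents \<open>f\<close>, so the definite description denotes.\<close>

lemma ord_along_dvr: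
  assumes "f \<noteq> 0" shows "ord_along S f = vl S f"
  unfolding ord_along_def vanishing_order_def
proof (rule the_equality)
  have un: "unif S \<in> S" using dvr_unif by (simp add: dvr_def)
  have key: "int (length_quotient S (genideal (sub S) (insert a {0}))) -
        int (length_quotient S (genideal (sub S) (insert b {0}))) = vl S (a / b)"
    if "a \<in> S - {0}" "b \<in> S - {0}" for a b
    using that length_quotient_dvr[of a] length_quotient_dvr[of b] by (simp add: vl_divide)
  obtain a b where ab: "a \<in> S - {0}" "b \<in> S - {0}" "f = a / b"
  proof (cases "f \<in> S")
    case True then show ?thesis using that[of f 1] assms subr_1[OF dvr_subr] by auto
  next
    case False
    then have "inverse f \<in> S" using assms by (simp add: vl_nonneg_iff vl_inverse)
    then show ?thesis using that[of 1 "inverse f"] assms subr_1[OF dvr_subr] by (auto simp: divide_inverse)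
  qed
  then show "\<exists>a\<in>S - {0}. \<exists>b\<in>S - {0}. f = a / b \<and>
      vl S f = int (length_quotient S (genideal (sub S) (insert a {0}))) -
        int (length_quotient S (genideal (sub S) (insert b {0})))"
    by (intro bexI[of _ a] bexI[of _ b] conjI) (simp_all only: key)
  fix d assume "\<exists>a\<in>S - {0}. \<exists>b\<in>S - {0}. f = a / b \<and>
      d = int (length_quotient S (genideal (sub S) (insert a {0}))) -
        int (length_quotient S (genideal (sub S) (insert b {0})))"
  then show "d = vl S f" by (elim bexE conjE) (simp only: key)
qed

end

definition ufd :: "'k::field set \<Rightarrow> bool" where
  "ufd P \<longleftrightarrow> subr P \<and> (\<forall>a\<in>P. a \<noteq> 0 \<longrightarrow>
     (\<exists>u xs. unit_in P u \<and> (\<forall>x\<in>set xs. prime_in P x) \<and> a = u * prod_list xs))"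

text \<open>That is, the field of fractions of \<open>P\<close> is the whole type.\<close>

definition frac_full :: "'k::field set \<Rightarrow> bool" where
  "frac_full P \<longleftrightarrow> (\<forall>z. \<exists>a\<in>P. \<exists>b\<in>P. b \<noteq> 0 \<and> z = a / b)"

text \<open>The set in the body is the principal ideal of \<open>x\<close>; for prime
  \<open>x\<close> this is the local ring of the divisor of \<open>x\<close>.\<close>

definition loc_at :: "'k::field set \<Rightarrow> 'k \<Rightarrow> 'k set" where
  "loc_at P x = localization P {a \<in> P. a / x \<in> P}"

lemma prime_inD: "prime_in P x \<Longrightarrow> x \<in> P" "prime_in P x \<Longrightarrow> x \<noteq> 0" "prime_in P x \<Longrightarrow> inverse x \<notin> P"
  by (simp_all add: prime_in_def)

lemma ufdI: "subr P \<Longrightarrow> factorial_domain (sub P) \<Longrightarrow> ufd P"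
  using ufd_factorization[of P] by (auto simp: ufd_def)

text \<open>The chosen uniformizer is a unit times a power of \<open>\<pi>\<close>, so its value 1
  is a multiple of the positive value of \<open>\<pi>\<close>.\<close>

lemma vl_dvr_unif:
  assumes "dvr S \<pi>" shows "vl S \<pi> = 1"
proof -
  have S: "is_dvr S" using assms by (auto simp: is_dvr_def)
  have \<pi>: "\<pi> \<noteq> 0" "\<pi> \<in> S" "inverse \<pi> \<notin> S" using assms by (auto simp: dvr_def)
  then have "vl S \<pi> > 0"
    using vl_nonneg_iff[OF S, of \<pi>] vl_nonneg_iff[OF S, of "inverse \<pi>"] vl_inverse[OF S, of \<pi>] by auto
  obtain n u where u: "unit_in S u" "unif S = u * \<pi> powi n"
    using assms unif_nz[OF S] unfolding dvr_def by blast
  have "vl S (\<pi> powi n) = n * vl S \<pi>"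
    using \<pi> by (cases "n \<ge> 0") (auto simp: power_int_def vl_power[OF S] vl_inverse[OF S])
  moreover have "vl S (unif S) = vl S u + vl S (\<pi> powi n)"
    using u \<pi> vl_mult[OF S, of u "\<pi> powi n"] by (auto simp: unit_in_def)
  ultimately have "1 = n * vl S \<pi>" using u(1) by (simp add: vl_unif[OF S] vl_unit[OF S])
  then have "n * vl S \<pi> = 1" by simp
  then show ?thesis using \<open>vl S \<pi> > 0\<close> unfolding zmult_eq_1_iff by linarith
qed

context
  fixes P :: "'k::field set"
  assumes P: "ufd P"
begin

lemma ufd_subr: "subr P"
  using P by (simp add: ufd_def)

lemma prime_power_cancel:
  assumes "prime_in P x" "c \<in> P" "c / x \<notin> P" "b \<in> P" "c * b / x ^ k \<in> P"
  shows "b / x ^ k \<in> P"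
  using assms(5)
proof (induction k)
  case (Suc k)
  have x: "x \<in> P" "x \<noteq> 0" using assms(1) by (auto simp: prime_in_def)
  have "x * (c * b / x ^ Suc k) \<in> P" using Suc.prems x by (intro subr_mult[OF ufd_subr])
  then have "c * b / x ^ k \<in> P" using x by simp
  then have "b / x ^ k \<in> P" by (rule Suc.IH)
  moreover have "c * (b / x ^ k) / x \<in> P" using Suc.prems by (simp add: mult.commute)
  ultimately have "c / x \<in> P \<or> b / x ^ k / x \<in> P" using assms(1,2) unfolding prime_in_def by blast
  then show ?case using assms(3) by (simp add: mult.commute)
qed (use assms in simp)

lemma primes_associated:
  assumes "prime_in P x" "prime_in P y" "y / x \<in> P"
  shows "unit_in P (y / x)"
proof -
  have nz: "x \<noteq> 0" "y \<noteq> 0" "x \<in> P" using assms by (auto simp: prime_in_def)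
  have "(y / x) * x / y \<in> P" using nz subr_1[OF ufd_subr] by simp
  then have "y / x / y \<in> P \<or> x / y \<in> P" using assms nz unfolding prime_in_def by blast
  moreover have "y / x / y = inverse x" using nz by (simp add: field_simps)
  ultimately have "x / y \<in> P" using assms(1) by (auto simp: prime_in_def)
  then show ?thesis using assms nz by (auto simp: unit_in_def)
qed

lemma prime_power_not_dvd:
  assumes x: "prime_in P x"
  shows "unit_in P u \<Longrightarrow> \<forall>y\<in>set xs. prime_in P y \<Longrightarrow> u * prod_list xs / x ^ Suc (length xs) \<notin> P"
proof (induction xs arbitrary: u)
  case Nil
  show ?case
  proof
    assume "u * prod_list [] / x ^ Suc (length []) \<in> P"
    then have "inverse u * (u / x) \<in> P"
      using Nil by (intro subr_mult[OF ufd_subr]) (auto simp: unit_in_def)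
    moreover have "inverse u * (u / x) = inverse x" using Nil by (simp add: unit_in_def divide_inverse)
    ultimately have "inverse x \<in> P" by (simp only:)
    then show False using x by (simp add: prime_in_def)
  qed
next
  case (Cons y xs)
  have nz: "x \<noteq> 0" "x \<in> P" "y \<in> P" "y \<noteq> 0" using x Cons.prems by (auto simp: prime_in_def)
  have "set xs \<subseteq> P" using Cons.prems by (auto intro: prime_inD)
  then have b: "u * prod_list xs \<in> P"
    using Cons.prems by (intro subr_mult[OF ufd_subr] subr_prod_list[OF ufd_subr]) (auto simp: unit_in_def)
  show ?case
  proof
    assume a: "u * prod_list (y # xs) / x ^ Suc (length (y # xs)) \<in> P"
    show False
    proof (cases "y / x \<in> P")
      case True
      then have "unit_in P (y / x)" using primes_associated x Cons.prems by auto
      then have "unit_in P (u * (y / x))" using unit_mult[OF ufd_subr] Cons.prems by blast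
      then have "(u * (y / x)) * prod_list xs / x ^ Suc (length xs) \<notin> P"
        using Cons.prems by (intro Cons.IH) auto
      moreover have "(u * (y / x)) * prod_list xs / x ^ Suc (length xs) = u * prod_list (y # xs) / x ^ Suc (length (y # xs))"
        using nz by (simp add: mult_ac)
      ultimately show False using a by metis
    next
      case False
      have "y * (u * prod_list xs) / x ^ Suc (Suc (length xs)) \<in> P" using a by (simp add: mult_ac)
      then have "u * prod_list xs / x ^ Suc (Suc (length xs)) \<in> P"
        using prime_power_cancel[OF x nz(3) False b] by blast
      then have "x * (u * prod_list xs / x ^ Suc (Suc (length xs))) \<in> P" using nz subr_mult[OF ufd_subr] by blast
      then have "u * prod_list xs / x ^ Suc (length xs) \<in> P" using nz by simp
      then show False using Cons by auto
    qed
  qed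
qed

lemma max_prime_power:
  assumes x: "prime_in P x" and a: "a \<in> P" "a \<noteq> 0"
  shows "\<exists>n a'. a' \<in> P \<and> a' / x \<notin> P \<and> a = a' * x ^ n"
proof -
  have nz: "x \<noteq> 0" using x by (auto simp: prime_in_def)
  obtain u xs where u: "unit_in P u" "\<forall>y\<in>set xs. prime_in P y" "a = u * prod_list xs"
    using P a unfolding ufd_def by blast
  then have ex: "a / x ^ Suc (length xs) \<notin> P" using prime_power_not_dvd[OF x] by blast
  define m where "m = (LEAST n. a / x ^ n \<notin> P)"
  have m: "a / x ^ m \<notin> P" unfolding m_def using ex by (rule LeastI)
  then have "m \<noteq> 0" using a by (cases m) auto
  then obtain n where n: "m = Suc n" by (cases m) auto
  have "a / x ^ n \<in> P" using not_less_Least[of n "\<lambda>n. a / x ^ n \<notin> P"] n unfolding m_def by auto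
  then show ?thesis using m n nz by (intro exI[of _ n] exI[of _ "a / x ^ n"]) (auto simp: mult.commute)
qed

lemma prime_pideal:
  assumes x: "prime_in P x"
  shows "pideal {a \<in> P. a / x \<in> P} P"
  unfolding pideal_def
proof (intro conjI ballI impI)
  note sr = ufd_subr
  show "0 \<in> {a \<in> P. a / x \<in> P}" using subr_0[OF sr] by simp
  show "1 \<notin> {a \<in> P. a / x \<in> P}" using x by (simp add: prime_in_def divide_inverse)
  show "a + b \<in> {a \<in> P. a / x \<in> P}" if "a \<in> {a \<in> P. a / x \<in> P}" "b \<in> {a \<in> P. a / x \<in> P}" for a b
    using that subr_add[OF sr] by (simp add: add_divide_distrib)
  show "a * b \<in> {a \<in> P. a / x \<in> P}" if "a \<in> P" "b \<in> {a \<in> P. a / x \<in> P}" for a b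
    using that subr_mult[OF sr, of a "b / x"] subr_mult[OF sr, of a b] by simp
  show "a \<in> {a \<in> P. a / x \<in> P} \<or> b \<in> {a \<in> P. a / x \<in> P}" if "a \<in> P" "b \<in> P" "a * b \<in> {a \<in> P. a / x \<in> P}" for a b
    using that x by (auto simp: prime_in_def)
qed auto

context
  assumes K: "frac_full P"
begin

text \<open>Once the powers of \<open>x\<close> are split off from numerator and denominator, the
  remaining factors become units.\<close>

lemma dvr_loc_at:
  assumes x: "prime_in P x"
  shows "dvr (loc_at P x) x"
proof -
  note sr = ufd_subr
  have nz: "x \<noteq> 0" "x \<in> P" using x by (auto simp: prime_in_def)
  define q where "q = {a \<in> P. a / x \<in> P}"
  have q: "pideal q P" unfolding q_def by (rule prime_pideal[OF x])
  note loc = localization_subr[OF sr q]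
  have "x \<in> q" using nz subr_1[OF sr] by (simp add: q_def)
  have "\<exists>(n::int) u. unit_in (localization P q) u \<and> z = u * x powi n" if "z \<noteq> 0" for z
  proof -
    obtain a b where ab: "a \<in> P" "b \<in> P" "b \<noteq> 0" "z = a / b" using K unfolding frac_full_def by blast
    then have "a \<noteq> 0" using that by auto
    obtain n a' where a': "a' \<in> P" "a' / x \<notin> P" "a = a' * x ^ n" using max_prime_power[OF x ab(1) \<open>a \<noteq> 0\<close>] by blast
    obtain m b' where b': "b' \<in> P" "b' / x \<notin> P" "b = b' * x ^ m" using max_prime_power[OF x ab(2,3)] by blast
    have "a' \<in> P - q" "b' \<in> P - q" using a' b' by (auto simp: q_def)
    then have "unit_in (localization P q) (a' * inverse b')"
      using loc(3) unit_mult[OF loc(1)] unit_in_inverse by blast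
    moreover have "z = a' * inverse b' * x powi (int n - int m)"
      using ab a' b' nz by (simp add: power_int_diff divide_inverse)
    ultimately show ?thesis by blast
  qed
  then show ?thesis
    unfolding dvr_def loc_at_def q_def[symmetric] using loc(1,2) loc(4)[OF \<open>x \<in> q\<close> nz(1)] nz by auto
qed

lemma is_dvr_loc_at: "prime_in P x \<Longrightarrow> is_dvr (loc_at P x)"
  using dvr_loc_at by (auto simp: is_dvr_def)

lemma vl_loc_at_self: "prime_in P x \<Longrightarrow> vl (loc_at P x) x = 1"
  using vl_dvr_unif[OF dvr_loc_at] .

lemma subset_loc_at: "prime_in P x \<Longrightarrow> P \<subseteq> loc_at P x"
  unfolding loc_at_def using localization_subr(2)[OF ufd_subr prime_pideal] .

lemma loc_at_unit: "prime_in P x \<Longrightarrow> a \<in> P \<Longrightarrow> a / x \<notin> P \<Longrightarrow> unit_in (loc_at P x) a"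
  unfolding loc_at_def using localization_subr(3)[OF ufd_subr prime_pideal, of x a] by auto

lemma vl_loc_at_pos_iff:
  assumes "prime_in P x" "a \<in> P" "a \<noteq> 0"
  shows "vl (loc_at P x) a > 0 \<longleftrightarrow> a / x \<in> P"
proof
  note S = is_dvr_loc_at[OF assms(1)]
  show "a / x \<in> P" if "vl (loc_at P x) a > 0"
  proof (rule ccontr)
    assume "a / x \<notin> P"
    then have "vl (loc_at P x) a = 0" using loc_at_unit[OF assms(1,2)] vl_unit[OF S] by blast
    then show False using that by simp
  qed
  have nz: "x \<noteq> 0" using assms(1) by (simp add: prime_in_def)
  show "vl (loc_at P x) a > 0" if "a / x \<in> P"
  proof -
    have "a / x \<in> loc_at P x" using that subset_loc_at[OF assms(1)] by blast
    then have "vl (loc_at P x) (a / x) \<ge> 0" using vl_nonneg_iff[OF S, of "a / x"] assms nz by auto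
    then show ?thesis using vl_divide[OF S assms(3) nz] vl_loc_at_self[OF assms(1)] by simp
  qed
qed

text \<open>A factorial ring is the intersection of its valuation rings. The prime factors of the
  denominator are cancelled one at a time: the value at such a prime shows that it divides the
  numerator.\<close>

lemma mem_if_all_loc_at:
  assumes "\<And>x. prime_in P x \<Longrightarrow> z \<in> loc_at P x"
  shows "z \<in> P"
proof -
  have step: "a / prod_list ys \<in> P"
    if "\<forall>y\<in>set ys. prime_in P y" "a \<in> P" "\<forall>x. prime_in P x \<longrightarrow> a / prod_list ys \<in> loc_at P x" for ys a
    using that
  proof (induction ys arbitrary: a)
    case (Cons y ys)
    have y: "prime_in P y" "y \<noteq> 0" "y \<in> P" using Cons.prems by (auto simp: prime_in_def)
    have "set ys \<subseteq> P" using Cons.prems by (auto intro: prime_inD)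
    then have pl: "prod_list ys \<in> P" "prod_list ys \<noteq> 0"
      using Cons.prems by (auto intro: subr_prod_list[OF ufd_subr] dest: prime_inD simp: prod_list_zero_iff)
    have "a / y \<in> P"
    proof (cases "a = 0")
      case False
      note S = is_dvr_loc_at[OF y(1)]
      have "vl (loc_at P y) (a / (y * prod_list ys)) \<ge> 0"
        using vl_nonneg_iff[OF S, of "a / (y * prod_list ys)"] Cons.prems(3) y False pl by auto
      moreover have "vl (loc_at P y) (prod_list ys) \<ge> 0"
        using vl_nonneg_iff[OF S, of "prod_list ys"] subset_loc_at[OF y(1)] pl by auto
      ultimately have "vl (loc_at P y) a > 0"
        using False y pl by (simp add: vl_divide[OF S] vl_mult[OF S] vl_loc_at_self[OF y(1)])
      then show ?thesis using vl_loc_at_pos_iff[OF y(1) Cons.prems(2) False] by blast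
    qed (simp add: subr_0[OF ufd_subr])
    then have "a / y / prod_list ys \<in> P" using Cons by (intro Cons.IH) auto
    then show ?case by simp
  qed simp
  obtain a b where ab: "a \<in> P" "b \<in> P" "b \<noteq> 0" "z = a / b" using K unfolding frac_full_def by blast
  obtain u ys where u: "unit_in P u" "\<forall>y\<in>set ys. prime_in P y" "b = u * prod_list ys"
    using P ab unfolding ufd_def by blast
  have "z = (a * inverse u) / prod_list ys" using ab u by (simp add: field_simps)
  moreover have "a * inverse u \<in> P" using ab u subr_mult[OF ufd_subr] by (auto simp: unit_in_def)
  ultimately show ?thesis using step u assms by metis
qed

text \<open>If \<open>v d + k * v z\<close> is nonnegative for all k, then \<open>v z\<close> is
  nonnegative. So a common denominator for all powers already makes an element integral.\<close>

lemma ufd_almost_integral: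
  assumes "d \<in> P" "d \<noteq> 0" "\<And>k. d * z ^ k \<in> P"
  shows "z \<in> P"
proof (cases "z = 0")
  case True then show ?thesis using subr_0[OF ufd_subr] by simp
next
  case False
  show ?thesis
  proof (rule mem_if_all_loc_at)
    fix x assume x: "prime_in P x"
    note S = is_dvr_loc_at[OF x]
    define v where "v = vl (loc_at P x)"
    have "v d + int k * v z \<ge> 0" for k
    proof -
      have "d * z ^ k \<in> loc_at P x" using assms(3) subset_loc_at[OF x] by blast
      then have "v (d * z ^ k) \<ge> 0" using vl_nonneg_iff[OF S, of "d * z ^ k"] assms False by (auto simp: v_def)
      then show ?thesis using assms False by (simp add: v_def vl_mult[OF S] vl_power[OF S])
    qed
    note ge = this
    have "v z \<ge> 0"
    proof (rule ccontr)
      assume "\<not> v z \<ge> 0"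
      then have "v z \<le> -1" by simp
      define M where "M = nat (v d) + 1"
      have "int M * v z \<le> int M * (-1)" using \<open>v z \<le> -1\<close> by (rule mult_left_mono) simp
      moreover have "v d < int M" by (simp add: M_def)
      moreover have "v d + int M * v z \<ge> 0" by (rule ge)
      ultimately show False by linarith
    qed
    then show "z \<in> loc_at P x" using vl_nonneg_iff[OF S False] by (simp add: v_def)
  qed
qed

text \<open>The product of one prime from each class of associates that occurs in the list. A new
  prime is multiplied in unless it already divides the product; the clauses are those that survive
  this step.\<close>

lemma squarefree_of_list:
  assumes "\<forall>x\<in>set xs. prime_in P x"
  shows "\<exists>y\<in>P. y \<noteq> 0 \<and> y ^ length xs / prod_list xs \<in> P \<and>
    (\<forall>z\<in>P. (\<forall>x\<in>set xs. z / x \<in> P) \<longrightarrow> z / y \<in> P) \<and> (\<forall>x\<in>set xs. y / x \<in> P) \<and>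
    (\<forall>x. prime_in P x \<longrightarrow> y / x \<in> P \<longrightarrow> y / x / x \<notin> P \<and> (\<exists>x'\<in>set xs. x' / x \<in> P))"
  using assms
proof (induction xs)
  case Nil
  show ?case using subr_1[OF ufd_subr] by (intro bexI[of _ 1]) (auto simp: prime_in_def divide_inverse)
next
  case (Cons x xs)
  then obtain y where y: "y \<in> P" "y \<noteq> 0" "y ^ length xs / prod_list xs \<in> P"
    "\<forall>z\<in>P. (\<forall>x\<in>set xs. z / x \<in> P) \<longrightarrow> z / y \<in> P" "\<forall>x\<in>set xs. y / x \<in> P"
    "\<forall>x. prime_in P x \<longrightarrow> y / x \<in> P \<longrightarrow> y / x / x \<notin> P \<and> (\<exists>x'\<in>set xs. x' / x \<in> P)" by auto
  have x: "prime_in P x" "x \<noteq> 0" "x \<in> P" using Cons.prems by (auto simp: prime_in_def)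
  note m = subr_mult[OF ufd_subr]
  show ?case
  proof (cases "y / x \<in> P")
    case True
    have "y ^ length (x # xs) / prod_list (x # xs) = (y / x) * (y ^ length xs / prod_list xs)" by simp
    then have "y ^ length (x # xs) / prod_list (x # xs) \<in> P" using m True y by metis
    then show ?thesis using y True by (intro bexI[of _ y]) auto
  next
    case False
    define w where "w = x * y"
    have "w \<in> P" "w \<noteq> 0" using m x y by (auto simp: w_def)
    moreover have "w ^ length (x # xs) / prod_list (x # xs) \<in> P"
    proof -
      have "w ^ length (x # xs) / prod_list (x # xs) = (y * x ^ length xs) * (y ^ length xs / prod_list xs)"
        using x by (simp add: w_def power_mult_distrib)
      moreover have "y * x ^ length xs \<in> P" using m subr_power[OF ufd_subr] x y by auto
      ultimately show ?thesis using m y by metis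
    qed
    moreover have "z / w \<in> P" if z: "z \<in> P" "\<forall>x\<in>set (x # xs). z / x \<in> P" for z
    proof -
      define c where "c = z / y"
      have c: "c \<in> P" "y * c = z" using y(2,4) z by (auto simp: c_def)
      then have "y * c / x \<in> P" using z by simp
      then have "c / x \<in> P" using x False y(1) c unfolding prime_in_def by blast
      then show ?thesis by (simp add: c_def w_def mult.commute)
    qed
    moreover have "w / x' \<in> P" if "x' \<in> set (x # xs)" for x'
      using that y(1,5) x m[of x "y / x'"] by (auto simp: w_def)
    moreover have "w / x' / x' \<notin> P \<and> (\<exists>x''\<in>set (x # xs). x'' / x' \<in> P)" if x': "prime_in P x'" "w / x' \<in> P" for x'
    proof (cases "x / x' \<in> P")
      case True
      then have u: "unit_in P (x / x')" using primes_associated x x' by blast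
      have nz: "x' \<noteq> 0" using x' by (simp add: prime_in_def)
      have "w / x' / x' \<notin> P"
      proof
        assume "w / x' / x' \<in> P"
        then have "inverse (x / x') * (inverse (x / x') * (w / x' / x')) \<in> P"
          using u by (intro m) (simp_all only: unit_in_def)
        moreover have "inverse (x / x') * (inverse (x / x') * (w / x' / x')) = y / x"
          using x nz by (simp add: w_def)
        ultimately show False using False by metis
      qed
      then show ?thesis using True by auto
    next
      case F: False
      have nz: "x' \<noteq> 0" using x' by (simp add: prime_in_def)
      have yx: "y / x' \<in> P" using x' x y(1) F unfolding prime_in_def w_def by blast
      then have "y / x' / x' \<notin> P" "\<exists>x''\<in>set xs. x'' / x' \<in> P" using y x' by auto
      moreover have "w / x' / x' \<notin> P"
      proof
        assume "w / x' / x' \<in> P"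
        then have "x * (y / x') / x' \<in> P" by (simp add: w_def)
        then show False using x' x yx F \<open>y / x' / x' \<notin> P\<close> unfolding prime_in_def by blast
      qed
      ultimately show ?thesis by auto
    qed
    ultimately show ?thesis by (intro bexI[of _ w]) auto
  qed
qed

text \<open>\<open>y\<close> generates the radical of the ideal of \<open>p\<close>: some power is a
  multiple of \<open>p\<close>, everything divisible by all primes over \<open>p\<close> is
  divisible by \<open>y\<close>, and \<open>y\<close> vanishes simply there.\<close>

lemma squarefree_part:
  assumes "p \<in> P" "p \<noteq> 0"
  shows "\<exists>y\<in>P. y \<noteq> 0 \<and> (\<exists>n>0. y ^ n / p \<in> P) \<and>
    (\<forall>z\<in>P. (\<forall>x. prime_in P x \<longrightarrow> p / x \<in> P \<longrightarrow> z / x \<in> P) \<longrightarrow> z / y \<in> P) \<and>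
    (\<forall>x. prime_in P x \<longrightarrow> vl (loc_at P x) y = (if p / x \<in> P then 1 else 0))"
proof -
  note m = subr_mult[OF ufd_subr]
  obtain u xs where u: "unit_in P u" "\<forall>x\<in>set xs. prime_in P x" "p = u * prod_list xs"
    using P assms unfolding ufd_def by blast
  obtain y where y: "y \<in> P" "y \<noteq> 0" "y ^ length xs / prod_list xs \<in> P"
    "\<forall>z\<in>P. (\<forall>x\<in>set xs. z / x \<in> P) \<longrightarrow> z / y \<in> P" "\<forall>x\<in>set xs. y / x \<in> P"
    "\<forall>x. prime_in P x \<longrightarrow> y / x \<in> P \<longrightarrow> y / x / x \<notin> P \<and> (\<exists>x'\<in>set xs. x' / x \<in> P)"
    using squarefree_of_list[OF u(2)] by blast
  have dvd: "p / x \<in> P" if x: "x \<in> set xs" for x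
  proof -
    obtain as bs where as: "xs = as @ x # bs" using split_list[OF x] by blast
    have "set as \<subseteq> P" "set bs \<subseteq> P" using u(2) as by (auto intro: prime_inD)
    then have "u * prod_list as * prod_list bs \<in> P"
      using u(1) by (intro m subr_prod_list[OF ufd_subr]) (auto simp: unit_in_def)
    moreover have "p / x = u * prod_list as * prod_list bs" using u as by (auto dest: prime_inD)
    ultimately show ?thesis by simp
  qed
  have dvd': "\<exists>x'\<in>set xs. x' / x \<in> P" if x: "prime_in P x" "p / x \<in> P" for x
  proof -
    have nz: "x \<noteq> 0" using x by (simp add: prime_in_def)
    have "prod_list ys / x \<in> P \<Longrightarrow> set ys \<subseteq> P \<Longrightarrow> \<exists>x'\<in>set ys. x' / x \<in> P" for ys
    proof (induction ys)
      case Nil then show ?case using x by (auto simp: prime_in_def divide_inverse)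
    next
      case (Cons a ys)
      have "prod_list ys \<in> P" using Cons subr_prod_list[OF ufd_subr] by auto
      then have "a / x \<in> P \<or> prod_list ys / x \<in> P" using Cons x unfolding prime_in_def by auto
      then show ?case using Cons by auto
    qed
    moreover have "prod_list xs / x \<in> P"
    proof -
      have "inverse u * (p / x) \<in> P" using x u by (intro m) (auto simp: unit_in_def)
      moreover have "prod_list xs / x = inverse u * (p / x)" using u by (simp add: unit_in_def)
      ultimately show ?thesis by (simp only:)
    qed
    moreover have "set xs \<subseteq> P" using u by (auto intro: prime_inD)
    ultimately show ?thesis by blast
  qed
  have "y ^ Suc (length xs) / p \<in> P"
  proof -
    have "y ^ Suc (length xs) / p = y * inverse u * (y ^ length xs / prod_list xs)"
      using u by (simp add: divide_inverse)
    also have "\<dots> \<in> P" using y u by (intro m) (auto simp: unit_in_def)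
    finally show ?thesis .
  qed
  moreover have "vl (loc_at P x) y = (if p / x \<in> P then 1 else 0)" if x: "prime_in P x" for x
  proof -
    note S = is_dvr_loc_at[OF x]
    have nz: "x \<noteq> 0" using x by (simp add: prime_in_def)
    have iff: "p / x \<in> P \<longleftrightarrow> y / x \<in> P"
    proof
      assume "p / x \<in> P"
      then obtain x' where "x' \<in> set xs" "x' / x \<in> P" using dvd' x by blast
      then have "(y / x') * (x' / x) \<in> P" using y m by blast
      then show "y / x \<in> P" using \<open>x' \<in> set xs\<close> u(2) by (auto simp: prime_in_def)
    next
      assume "y / x \<in> P"
      then obtain x' where x': "x' \<in> set xs" "x' / x \<in> P" using y x by blast
      then have "(p / x') * (x' / x) \<in> P" using dvd m by blast
      then show "p / x \<in> P" using x' u(2) by (auto simp: prime_in_def)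
    qed
    show ?thesis
    proof (cases "y / x \<in> P")
      case True
      then have "vl (loc_at P x) (y / x) = 0"
        using y x vl_unit[OF S loc_at_unit[OF x]] by blast
      then show ?thesis using True iff y nz by (simp add: vl_divide[OF S] vl_loc_at_self[OF x])
    next
      case False
      then show ?thesis using iff y x vl_unit[OF S loc_at_unit[OF x]] by auto
    qed
  qed
  ultimately show ?thesis using y dvd u(2) by (intro bexI[of _ y]) auto
qed

end
end

section \<open>Polynomials in three variables\<close>

hide_const (open) UnivPoly.coeff UnivPoly.monom Polynomials.degree Polynomials.lead_coeff

type_synonym p3 = "complex poly poly poly"

definition rhom :: "('a::comm_ring_1 \<Rightarrow> 'b::comm_ring_1) \<Rightarrow> bool" where
  "rhom h \<longleftrightarrow> h 0 = 0 \<and> h 1 = 1 \<and> (\<forall>a b. h (a + b) = h a + h b) \<and> (\<forall>a b. h (a * b) = h a * h b)"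

definition evp :: "('a::comm_ring_1 \<Rightarrow> 'b::comm_ring_1) \<Rightarrow> 'b \<Rightarrow> 'a poly \<Rightarrow> 'b" where
  "evp h y p = poly (map_poly h p) y"

lemma rhomD:
  assumes "rhom h"
  shows "h 0 = 0" "h 1 = 1" "h (a + b) = h a + h b" "h (a * b) = h a * h b"
    "h (- a) = - h a" "h (a - b) = h a - h b" "h (a ^ n) = h a ^ n"
proof -
  show h: "h 0 = 0" "h 1 = 1" "\<And>a b. h (a + b) = h a + h b" "\<And>a b. h (a * b) = h a * h b"
    using assms by (auto simp: rhom_def)
  show u: "h (- a) = - h a" for a using h(3)[of a "- a"] h(1) by (simp add: eq_neg_iff_add_eq_0 add.commute)
  show "h (a - b) = h a - h b" using h(3)[of a "- b"] u by simp
  show "h (a ^ n) = h a ^ n" by (induction n) (auto simp: h)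
qed

lemma rhom_sum: "rhom h \<Longrightarrow> h (sum f I) = (\<Sum>i\<in>I. h (f i))"
  by (induction I rule: infinite_finite_induct) (auto simp: rhomD)

lemma evp_pCons: "rhom h \<Longrightarrow> evp h y (pCons a p) = h a + y * evp h y p"
  by (simp add: evp_def map_poly_pCons rhomD)

lemma evp_0 [simp]: "evp h y 0 = 0"
  by (simp add: evp_def)

lemma evp_add: "rhom h \<Longrightarrow> evp h y (p + q) = evp h y p + evp h y q"
proof (induction p q rule: poly_induct2)
  case (pCons a p b q)
  then show ?case by (simp add: evp_pCons rhomD algebra_simps)
qed simp

lemma evp_smult: "rhom h \<Longrightarrow> evp h y (smult a p) = h a * evp h y p"
  by (induction p) (auto simp: evp_pCons rhomD algebra_simps)

lemma evp_mult: "rhom h \<Longrightarrow> evp h y (p * q) = evp h y p * evp h y q"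
  by (induction p) (auto simp: evp_pCons evp_add evp_smult rhomD algebra_simps)

lemma rhom_evp: "rhom h \<Longrightarrow> rhom (evp h y)"
  unfolding rhom_def[of "evp h y"]
  by (auto simp: evp_add evp_mult evp_pCons rhomD one_pCons)

lemma evp_const: "rhom h \<Longrightarrow> evp h y [:c:] = h c"
  and evp_var: "rhom h \<Longrightarrow> evp h y [:0, 1:] = y"
  by (simp_all add: evp_pCons rhomD)

text \<open>\<open>T1\<close> is the outermost variable of the nested type: its coefficients,
  polynomials in \<open>T2\<close> and \<open>T3\<close>, are evaluated by the inner maps.\<close>

definition ev3 :: "(complex \<Rightarrow> 'b::comm_ring_1) \<Rightarrow> 'b \<Rightarrow> 'b \<Rightarrow> 'b \<Rightarrow> p3 \<Rightarrow> 'b" where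
  "ev3 g y1 y2 y3 = evp (evp (evp g y3) y2) y1"

definition T1 :: p3 where "T1 = [:0, 1:]"
definition T2 :: p3 where "T2 = [:[:0, 1:]:]"
definition T3 :: p3 where "T3 = [:[:[:0, 1:]:]:]"
definition C3 :: "complex \<Rightarrow> p3" where "C3 c = [:[:[:c:]:]:]"

lemma rhom_ev3: "rhom g \<Longrightarrow> rhom (ev3 g y1 y2 y3)"
  unfolding ev3_def by (intro rhom_evp)

lemma ev3_simps:
  assumes "rhom g"
  shows "ev3 g y1 y2 y3 T1 = y1" "ev3 g y1 y2 y3 T2 = y2" "ev3 g y1 y2 y3 T3 = y3" "ev3 g y1 y2 y3 (C3 c) = g c"
  unfolding ev3_def T1_def T2_def T3_def C3_def
  using assms by (simp_all add: evp_const evp_var rhom_evp)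

lemma rhom_C3: "rhom C3"
  by (simp add: rhom_def C3_def one_pCons)

lemma p3_induct [case_names C T1 T2 T3 add mult]:
  fixes P :: "p3 \<Rightarrow> bool"
  assumes C: "\<And>c. P (C3 c)" and T: "P T1" "P T2" "P T3"
    and add: "\<And>f g. P f \<Longrightarrow> P g \<Longrightarrow> P (f + g)" and mult: "\<And>f g. P f \<Longrightarrow> P g \<Longrightarrow> P (f * g)"
  shows "P f"
proof -
  have 3: "P [:[:r:]:]" for r
  proof (induction r)
    case 0 then show ?case using C[of 0] by (simp add: C3_def)
  next
    case (pCons a r)
    have "[:[:pCons a r:]:] = C3 a + T3 * [:[:r:]:]" by (simp add: C3_def T3_def)
    then show ?case using add mult C T pCons by metis
  qed
  have 2: "P [:q:]" for q
  proof (induction q)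
    case 0 then show ?case using 3[of 0] by simp
  next
    case (pCons a q)
    have "[:pCons a q:] = [:[:a:]:] + T2 * [:q:]" by (simp add: T2_def)
    then show ?case using add mult 3 T pCons by metis
  qed
  show ?thesis
  proof (induction f)
    case 0 then show ?case using 2[of 0] by simp
  next
    case (pCons a f)
    have "pCons a f = [:a:] + T1 * f" by (simp add: T1_def)
    then show ?case using add mult 2 T pCons by metis
  qed
qed

lemma rhom_p3_ext:
  fixes h h' :: "p3 \<Rightarrow> 'b::comm_ring_1"
  assumes "rhom h" "rhom h'" "\<And>c. h (C3 c) = h' (C3 c)" "h T1 = h' T1" "h T2 = h' T2" "h T3 = h' T3"
  shows "h f = h' f"
  by (induction f rule: p3_induct) (use assms in \<open>auto simp: rhomD\<close>)

subsection \<open>Total degree\<close>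

text \<open>The substitution that multiplies each variable by a new variable t. The coefficient of
  t^k is the homogeneous component of degree k, so the total degree is an ordinary degree and
  inherits its laws.\<close>

definition H :: "p3 \<Rightarrow> p3 poly" where
  "H = ev3 (\<lambda>c. [:C3 c:]) [:0, T1:] [:0, T2:] [:0, T3:]"

definition tdeg :: "p3 \<Rightarrow> nat" where "tdeg f = degree (H f)"

definition cmp :: "nat \<Rightarrow> p3 \<Rightarrow> p3" where "cmp k f = coeff (H f) k"

definition trunc :: "nat \<Rightarrow> p3 \<Rightarrow> p3" where "trunc d f = (\<Sum>k\<le>d. cmp k f)"

lemma rhom_const_C3: "rhom (\<lambda>c. [:C3 c:])"
  using rhom_C3 by (auto simp: rhom_def one_pCons)

lemma rhom_H: "rhom H"
  unfolding H_def by (rule rhom_ev3[OF rhom_const_C3])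

lemma H_simps: "H T1 = [:0, T1:]" "H T2 = [:0, T2:]" "H T3 = [:0, T3:]" "H (C3 c) = [:C3 c:]"
  unfolding H_def by (simp_all add: ev3_simps[OF rhom_const_C3])

text \<open>Both sides are homomorphisms in \<open>f\<close> with the same values at constants and
  variables. With \<open>s\<close> a ratio of homogeneous coordinates this is the change of affine
  chart; \<open>s = 1\<close> gives back \<open>f\<close>.\<close>

lemma ev3_scaled:
  assumes g: "rhom g"
  shows "ev3 g (s * y1) (s * y2) (s * y3) f = evp (ev3 g y1 y2 y3) s (H f)"
proof (rule rhom_p3_ext)
  note e = rhom_ev3[OF g]
  show "rhom (ev3 g (s * y1) (s * y2) (s * y3))" by (rule e)
  have "rhom (evp (ev3 g y1 y2 y3) s)" by (rule rhom_evp[OF e])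
  then show "rhom (\<lambda>a. evp (ev3 g y1 y2 y3) s (H a))" using rhom_H by (auto simp: rhom_def)
qed (simp_all add: ev3_simps[OF g] H_simps evp_pCons[OF rhom_ev3[OF g]] rhomD(1)[OF rhom_ev3[OF g]])

lemma ev3_id: "ev3 C3 T1 T2 T3 f = f"
  by (rule rhom_p3_ext[OF rhom_ev3[OF rhom_C3]]) (auto simp: rhom_def ev3_simps[OF rhom_C3])

lemma evp_H_one: "evp (\<lambda>x. x) 1 (H f) = f"
  using ev3_scaled[OF rhom_C3, of 1 T1 T2 T3 f] by (simp add: ev3_id[abs_def])

lemma H_eq_0_iff [simp]: "H f = 0 \<longleftrightarrow> f = 0"
  using evp_H_one[of f] rhomD(1)[OF rhom_H] by auto

lemma H_0 [simp]: "H 0 = 0" by simp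

lemma tdeg_mult: "f \<noteq> 0 \<Longrightarrow> g \<noteq> 0 \<Longrightarrow> tdeg (f * g) = tdeg f + tdeg g"
  unfolding tdeg_def rhomD(4)[OF rhom_H] by (rule degree_mult_eq) simp_all

lemma tdeg_mult_le: "tdeg (f * g) \<le> tdeg f + tdeg g"
  unfolding tdeg_def rhomD(4)[OF rhom_H] by (rule degree_mult_le)

lemma tdeg_add_le: "tdeg f \<le> d \<Longrightarrow> tdeg g \<le> d \<Longrightarrow> tdeg (f + g) \<le> d"
  unfolding tdeg_def rhomD(3)[OF rhom_H] by (rule degree_add_le)

lemma tdeg_diff_le: "tdeg f \<le> d \<Longrightarrow> tdeg g \<le> d \<Longrightarrow> tdeg (f - g) \<le> d"
  unfolding tdeg_def rhomD(6)[OF rhom_H] by (rule degree_diff_le)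

lemma tdeg_power: "f \<noteq> 0 \<Longrightarrow> tdeg (f ^ n) = n * tdeg f"
  unfolding tdeg_def rhomD(7)[OF rhom_H] by (rule degree_power_eq) simp

lemma T_nz [simp]: "T1 \<noteq> 0" "T2 \<noteq> 0" "T3 \<noteq> 0"
  by (auto simp: T1_def T2_def T3_def)

lemma tdeg_simps [simp]: "tdeg 0 = 0" "tdeg 1 = 0" "tdeg T1 = 1" "tdeg T2 = 1" "tdeg T3 = 1" "tdeg (C3 c) = 0"
  unfolding tdeg_def by (simp_all add: H_simps rhomD(2)[OF rhom_H])

lemma cmp_0_const: "\<exists>c. cmp 0 f = C3 c"
proof (induction f rule: p3_induct)
  case (add f g)
  then show ?case using rhomD(3)[OF rhom_C3] by (metis cmp_def coeff_add rhomD(3)[OF rhom_H])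
next
  case (mult f g)
  have "cmp 0 (f * g) = cmp 0 f * cmp 0 g" by (simp add: cmp_def rhomD(4)[OF rhom_H] coeff_mult)
  then show ?case using mult rhomD(4)[OF rhom_C3] by metis
qed (auto simp: cmp_def H_simps intro: exI[of _ 0] simp: rhomD(1)[OF rhom_C3])

lemma sum_cmp: "tdeg f \<le> d \<Longrightarrow> (\<Sum>k\<le>d. cmp k f) = f"
proof -
  assume d: "tdeg f \<le> d"
  have "f = poly (H f) 1" using evp_H_one[of f] by (simp add: evp_def)
  also have "\<dots> = (\<Sum>k\<le>degree (H f). coeff (H f) k)" by (simp add: poly_altdef)
  also have "\<dots> = (\<Sum>k\<le>d. coeff (H f) k)"
    using d unfolding tdeg_def by (intro sum.mono_neutral_left) (auto simp: coeff_eq_0)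
  finally show ?thesis by (simp add: cmp_def)
qed

lemma tdeg_0_const: "tdeg f = 0 \<Longrightarrow> \<exists>c. f = C3 c"
  using sum_cmp[of f 0] cmp_0_const[of f] by simp

lemma H_cmp: "H (cmp k f) = monom (cmp k f) k"
proof (induction f arbitrary: k rule: p3_induct)
  case (add f g)
  then show ?case by (simp add: cmp_def rhomD(3)[OF rhom_H] add_monom)
next
  case (mult f g)
  have c: "cmp k (f * g) = (\<Sum>i\<le>k. cmp i f * cmp (k - i) g)" for k
    by (simp add: cmp_def rhomD(4)[OF rhom_H] coeff_mult)
  have "H (cmp k (f * g)) = (\<Sum>i\<le>k. monom (cmp i f) i * monom (cmp (k - i) g) (k - i))"
    unfolding c by (simp add: rhom_sum[OF rhom_H] rhomD(4)[OF rhom_H] mult)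
  also have "\<dots> = (\<Sum>i\<le>k. monom (cmp i f * cmp (k - i) g) k)"
    by (intro sum.cong) (auto simp: mult_monom)
  also have "\<dots> = monom (cmp k (f * g)) k"
    unfolding c by (rule poly_eqI) (auto simp: coeff_sum)
  finally show ?case .
qed (auto simp: cmp_def H_simps coeff_pCons monom_0 monom_Suc split: nat.splits)

lemma tdeg_trunc: "tdeg (trunc d f) \<le> d"
  unfolding tdeg_def trunc_def rhom_sum[OF rhom_H] H_cmp
  by (intro degree_sum_le) (auto intro: order.trans[OF degree_monom_le])

lemma trunc_self: "tdeg f \<le> d \<Longrightarrow> trunc d f = f"
  unfolding trunc_def by (rule sum_cmp)

lemma trunc_add: "trunc d (f + g) = trunc d f + trunc d g"
  by (simp add: trunc_def cmp_def rhomD(3)[OF rhom_H] sum.distrib)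

text \<open>Multiplication by a form of degree \<open>m\<close> shifts all homogeneous components by
  \<open>m\<close>.\<close>

lemma trunc_homog_mult:
  assumes "H v = monom v m"
  shows "trunc (m + d) (v * f) = v * trunc d f"
proof -
  have c: "cmp k (v * f) = (if m \<le> k then v * cmp (k - m) f else 0)" for k
    by (simp add: cmp_def rhomD(4)[OF rhom_H] assms coeff_monom_mult)
  have "trunc (m + d) (v * f) = (\<Sum>k\<in>{m..m + d}. v * cmp (k - m) f)"
    unfolding trunc_def c by (intro sum.mono_neutral_cong_right) auto
  also have "\<dots> = (\<Sum>k\<in>{0..d}. v * cmp k f)"
    by (rule sum.reindex_bij_witness[of _ "\<lambda>k. k + m" "\<lambda>k. k - m"]) auto
  finally show ?thesis by (simp add: trunc_def sum_distrib_left atLeast0AtMost)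
qed

lemma H_T_power: "H (T1 ^ m) = monom (T1 ^ m) m" "H (T2 ^ m) = monom (T2 ^ m) m"
proof -
  have "[:0, T:] ^ m = monom (T ^ m) m" for T :: p3
    using monom_power[of T 1 m] by (simp add: monom_Suc monom_0)
  then show "H (T1 ^ m) = monom (T1 ^ m) m" "H (T2 ^ m) = monom (T2 ^ m) m"
    by (simp_all add: rhomD(7)[OF rhom_H] H_simps)
qed

lemma T1_power: "T1 ^ m = monom 1 m"
  by (simp add: T1_def monom_altdef)

lemma T2_power: "T2 ^ m = [:monom 1 m:]"
  by (simp add: T2_def poly_const_pow monom_altdef)

lemma T3_power: "T3 ^ m = [:[:monom 1 m:]:]"
  by (simp add: T3_def poly_const_pow monom_altdef)

text \<open>The powers of the variables form a regular sequence. Modulo \<open>T1 ^ m\<close> only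
  the coefficients below \<open>m\<close> count; for these \<open>T2 ^ m\<close> divides the product
  with \<open>T3 ^ m\<close>, hence the coefficient itself.\<close>

lemma T3_nonzerodivisor:
  assumes "T3 ^ m * \<Delta> = \<alpha> * T1 ^ m + \<beta> * T2 ^ m"
  shows "\<exists>\<alpha> \<beta>. \<Delta> = T1 ^ m * \<alpha> + T2 ^ m * \<beta>"
proof -
  have dvd: "monom 1 m dvd coeff \<Delta> k" if k: "k < m" for k
  proof -
    have "coeff (T3 ^ m * \<Delta>) k = [:monom 1 m:] * coeff \<Delta> k" by (simp add: T3_power)
    moreover have "\<alpha> * T1 ^ m + \<beta> * T2 ^ m = monom 1 m * \<alpha> + [:monom 1 m:] * \<beta>"
      unfolding T1_power T2_power by (simp only: mult.commute)
    then have "coeff (\<alpha> * T1 ^ m + \<beta> * T2 ^ m) k = monom 1 m * coeff \<beta> k"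
      using k by (simp add: coeff_monom_mult)
    ultimately have eq: "[:monom 1 m:] * coeff \<Delta> k = monom 1 m * coeff \<beta> k"
      using assms by metis
    have "coeff (coeff \<Delta> k) j = 0" if j: "j < m" for j
    proof -
      have "monom 1 m * coeff (coeff \<Delta> k) j = 0"
        using arg_cong[OF eq, of "\<lambda>q. coeff q j"] j by (simp add: coeff_monom_mult)
      then show ?thesis by (simp add: monom_eq_0_iff)
    qed
    then show ?thesis by (simp add: monom_1_dvd_iff')
  qed
  have "T2 ^ m dvd poly_cutoff m \<Delta>"
    unfolding T2_power const_poly_dvd_iff using dvd by (simp add: coeff_poly_cutoff)
  then obtain \<beta>' where \<beta>': "poly_cutoff m \<Delta> = T2 ^ m * \<beta>'" by blast
  have "\<Delta> = T1 ^ m * poly_shift m \<Delta> + poly_cutoff m \<Delta>"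
    by (rule poly_eqI) (simp add: T1_power coeff_monom_mult coeff_poly_shift coeff_poly_cutoff)
  then show ?thesis using \<beta>' by metis
qed

lemma T1_T2_coprime:
  assumes "T2 ^ m * x = T1 ^ m * y" shows "T1 ^ m dvd x"
proof -
  have "coeff x k = 0" if "k < m" for k
    using arg_cong[OF assms, of "\<lambda>q. coeff q k"] that
    by (simp add: T1_power T2_power coeff_monom_mult monom_eq_0_iff)
  then show ?thesis by (simp add: T1_power monom_1_dvd_iff')
qed

text \<open>By the Nullstellensatz two surfaces in projective space without common point, except possibly
  \<open>(1:0:0:0)\<close>, satisfy the hypothesis in every large degree \<open>m\<close>. The determinant of the
  coefficients is then killed by \<open>T3 ^ m\<close> modulo the regular sequence
  \<open>T1 ^ m, T2 ^ m\<close>, hence lies in the ideal of the latter, and comparing degrees one finds that the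
  second surface divides both \<open>T1 ^ m\<close> and \<open>T2 ^ m\<close>.\<close>

lemma no_common_point_dvd:
  assumes deg: "tdeg f1 \<le> a" "tdeg f2 \<le> b" "a + b \<le> m" "1 \<le> a"
    and eq: "T1 ^ m = U1 * f1 + W1 * f2" "T2 ^ m = U2 * f1 + W2 * f2" "T3 ^ m = U3 * f1 + W3 * f2"
    and dU: "tdeg U1 \<le> m - a" "tdeg U2 \<le> m - a" and dW: "tdeg W1 \<le> m - b" "tdeg W2 \<le> m - b"
  shows "f2 dvd T1 ^ m" "f2 dvd T2 ^ m"
proof -
  define \<Delta> where "\<Delta> = U1 * W2 - U2 * W1"
  \<comment> \<open>Cramer's rule for the first two equations: either surface times the determinant
    lies in the ideal of \<open>T1 ^ m\<close> and \<open>T2 ^ m\<close>.\<close>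
  have d2: "f2 * \<Delta> = U1 * T2 ^ m - U2 * T1 ^ m"
    unfolding eq \<Delta>_def by (simp add: algebra_simps)
  have d1: "f1 * \<Delta> = T1 ^ m * W2 - T2 ^ m * W1"
    unfolding eq \<Delta>_def by (simp add: algebra_simps)
  have "T3 ^ m * \<Delta> = U3 * (f1 * \<Delta>) + W3 * (f2 * \<Delta>)" unfolding eq(3) by (simp add: algebra_simps)
  also have "\<dots> = (U3 * W2 - W3 * U2) * T1 ^ m + (W3 * U1 - U3 * W1) * T2 ^ m"
    unfolding d1 d2 by (simp add: algebra_simps)
  finally obtain \<alpha> \<beta> where ab: "\<Delta> = T1 ^ m * \<alpha> + T2 ^ m * \<beta>" using T3_nonzerodivisor by blast
  \<comment> \<open>The determinant has degree at most 2 m - a - b, so its coefficients at forms of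
    degree m may be cut off in degree m - a - b.\<close>
  define \<alpha>' \<beta>' where "\<alpha>' = trunc (m - a - b) \<alpha>" and "\<beta>' = trunc (m - a - b) \<beta>"
  have "tdeg (U1 * W2) \<le> m + (m - a - b)" "tdeg (U2 * W1) \<le> m + (m - a - b)"
    using tdeg_mult_le[of U1 W2] tdeg_mult_le[of U2 W1] dU dW deg by linarith+
  then have "tdeg \<Delta> \<le> m + (m - a - b)" unfolding \<Delta>_def by (rule tdeg_diff_le)
  then have \<Delta>: "\<Delta> = T1 ^ m * \<alpha>' + T2 ^ m * \<beta>'"
    using trunc_self[of \<Delta> "m + (m - a - b)"] trunc_homog_mult[OF H_T_power(1), of m "m - a - b" \<alpha>]
      trunc_homog_mult[OF H_T_power(2), of m "m - a - b" \<beta>]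
    unfolding ab trunc_add \<alpha>'_def \<beta>'_def by simp
  have key: "T2 ^ m * (U1 - f2 * \<beta>') = T1 ^ m * (U2 + f2 * \<alpha>')"
    using d2 unfolding \<Delta> by (simp add: algebra_simps)
  \<comment> \<open>A multiple of \<open>T1 ^ m\<close> of degree at most \<open>m - a\<close>
    vanishes because \<open>a\<close> is positive.\<close>
  have "U1 - f2 * \<beta>' = 0"
  proof (rule ccontr)
    assume nz: "U1 - f2 * \<beta>' \<noteq> 0"
    obtain \<gamma> where \<gamma>: "U1 - f2 * \<beta>' = T1 ^ m * \<gamma>" using T1_T2_coprime[OF key] by blast
    then have "\<gamma> \<noteq> 0" using nz by auto
    then have "tdeg (U1 - f2 * \<beta>') = m + tdeg \<gamma>" unfolding \<gamma> by (simp add: tdeg_mult tdeg_power)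
    moreover have "tdeg (f2 * \<beta>') \<le> m - a"
      using tdeg_mult_le[of f2 \<beta>'] tdeg_trunc[of "m - a - b" \<beta>] deg unfolding \<beta>'_def by linarith
    then have "tdeg (U1 - f2 * \<beta>') \<le> m - a" using dU by (intro tdeg_diff_le)
    ultimately show False using deg by linarith
  qed
  then have "T1 ^ m = f2 * (\<beta>' * f1 + W1)" using eq(1) by (simp add: algebra_simps)
  then show "f2 dvd T1 ^ m" by (metis dvd_triv_left)
  have "T1 ^ m * (U2 + f2 * \<alpha>') = 0" using key \<open>U1 - f2 * \<beta>' = 0\<close> by simp
  then have "U2 = - (f2 * \<alpha>')" by (simp add: eq_neg_iff_add_eq_0)
  then have "T2 ^ m = f2 * (W2 - \<alpha>' * f1)" using eq(2) by (simp add: algebra_simps)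
  then show "f2 dvd T2 ^ m" by (metis dvd_triv_left)
qed

text \<open>A divisor of \<open>T2\<close> is constant in \<open>T1\<close>, and if it divides
  \<open>T1\<close> as well, its only coefficient is a unit.\<close>

lemma prime_dvd_T_powers_False:
  assumes "prime_elem (f :: p3)" "f dvd T1 ^ m" "f dvd T2 ^ m"
  shows False
proof -
  have "f dvd T1" "f dvd T2" using assms prime_elem_dvd_power by blast+
  then obtain g h where gh: "T1 = f * g" "T2 = f * h" by blast
  have nz: "f \<noteq> 0" "g \<noteq> 0" "h \<noteq> 0" using gh by (auto simp: T1_def T2_def)
  have "degree f + degree h = degree T2" unfolding gh(2) using nz by (simp add: degree_mult_eq)
  then have "degree f + degree h = 0" by (simp add: T2_def)
  then obtain c where c: "f = [:c:]" by (metis add_is_0 degree_eq_zeroE)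
  have "1 = c * coeff g 1" using arg_cong[OF gh(1), of "\<lambda>q. coeff q 1"] by (simp add: T1_def c)
  then have "is_unit f" unfolding c by (metis dvd_triv_left is_unit_const_poly_iff)
  then show False using assms(1) by (simp add: prime_elem_def)
qed

section \<open>Abelian extensions with roots of unity\<close>

lemma of_cplx_0 [simp]: "of_cplx 0 = 0"
  using of_cplx_add[of 0 0] by (metis add.right_neutral add_left_cancel)

declare of_cplx_one [simp]

lemma rhom_of_cplx: "rhom of_cplx"
  by (simp add: rhom_def of_cplx_add of_cplx_mult)

lemma of_cplx_uminus: "of_cplx (- a) = - of_cplx a"
  and of_cplx_diff: "of_cplx (a - b) = of_cplx a - of_cplx b"
  and of_cplx_power: "of_cplx (a ^ n) = of_cplx a ^ n"
  using rhomD(5-7)[OF rhom_of_cplx] by auto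

lemma of_cplx_of_nat: "of_cplx (of_nat n) = of_nat n"
  by (induction n) (auto simp: of_cplx_add)

lemma of_cplx_eq_0_iff [simp]: "of_cplx a = (0 :: 'k::complex_extension_field) \<longleftrightarrow> a = 0"
proof
  assume a: "of_cplx a = (0 :: 'k)"
  show "a = 0"
  proof (rule ccontr)
    assume "a \<noteq> 0"
    then have "of_cplx (a * inverse a) = (1 :: 'k)" by simp
    then show False using a by (simp add: of_cplx_mult)
  qed
qed simp

lemma of_cplx_eq_iff: "of_cplx a = of_cplx b \<longleftrightarrow> a = b"
  using of_cplx_eq_0_iff[of "a - b"] by (simp add: of_cplx_diff)

lemma of_cplx_inverse: "of_cplx (inverse a) = inverse (of_cplx a :: 'k::complex_extension_field)"
proof (cases "a = 0")
  case False
  then have "of_cplx a * of_cplx (inverse a) = (1::'k)" by (simp add: of_cplx_mult[symmetric])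
  then show ?thesis by (metis inverse_unique)
qed simp

lemma of_nat_nz: "n > 0 \<Longrightarrow> of_nat n \<noteq> (0 :: 'k::complex_extension_field)"
  by (metis (mono_tags) of_cplx_of_nat of_cplx_eq_0_iff of_nat_eq_0_iff less_irrefl)

lemma sum_list_concat_map: "sum_list (concat (map f xs)) = sum_list (map (\<lambda>x. sum_list (f x)) xs)"
  by (induction xs) auto

locale abelian_ext =
  fixes L :: "'k::complex_extension_field set" and Gal :: "('k \<Rightarrow> 'k) set"
  assumes auto_add: "\<sigma> \<in> Gal \<Longrightarrow> \<sigma> (x + y) = \<sigma> x + \<sigma> y"
    and auto_mult: "\<sigma> \<in> Gal \<Longrightarrow> \<sigma> (x * y) = \<sigma> x * \<sigma> y"
    and auto_one: "\<sigma> \<in> Gal \<Longrightarrow> \<sigma> 1 = 1"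
    and Gal_comp: "\<sigma> \<in> Gal \<Longrightarrow> \<tau> \<in> Gal \<Longrightarrow> \<sigma> \<circ> \<tau> \<in> Gal"
    and Gal_comm: "\<sigma> \<in> Gal \<Longrightarrow> \<tau> \<in> Gal \<Longrightarrow> \<sigma> \<circ> \<tau> = \<tau> \<circ> \<sigma>"
    and Gal_finite: "finite Gal" and Gal_id: "id \<in> Gal"
    and fixed: "{x. \<forall>\<sigma>\<in>Gal. \<sigma> x = x} = L"
    and const: "of_cplx c \<in> L"
begin

text \<open>The eigenvalues are asked to be complex constants. As the constants contain all roots of
  unity, Kummer theory applies.\<close>

definition E :: "'k set" where
  "E = {w. w \<noteq> 0 \<and> (\<forall>\<sigma>\<in>Gal. \<exists>c. \<sigma> w = of_cplx c * w)}"

lemma fixedD: "x \<in> L \<Longrightarrow> \<sigma> \<in> Gal \<Longrightarrow> \<sigma> x = x"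
  using fixed by auto

lemma fixedI: "(\<And>\<sigma>. \<sigma> \<in> Gal \<Longrightarrow> \<sigma> x = x) \<Longrightarrow> x \<in> L"
  using fixed by auto

lemma auto_rhom: "\<sigma> \<in> Gal \<Longrightarrow> rhom \<sigma>"
  unfolding rhom_def using auto_add auto_mult auto_one by (metis add_cancel_right_right)

lemmas auto_simps = rhomD[OF auto_rhom]

lemma auto_nz: "\<sigma> \<in> Gal \<Longrightarrow> x \<noteq> 0 \<Longrightarrow> \<sigma> x \<noteq> 0"
  using auto_mult[of \<sigma> x "inverse x"] auto_one[of \<sigma>] by auto

lemma auto_inverse: "\<sigma> \<in> Gal \<Longrightarrow> \<sigma> (inverse x) = inverse (\<sigma> x)"
proof (cases "x = 0")
  case False
  assume \<sigma>: "\<sigma> \<in> Gal"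
  then have "\<sigma> x * \<sigma> (inverse x) = 1" using False by (metis auto_mult auto_one right_inverse)
  then show ?thesis by (metis inverse_unique)
qed (simp add: auto_simps(1))

lemma auto_divide: "\<sigma> \<in> Gal \<Longrightarrow> \<sigma> (x / y) = \<sigma> x / \<sigma> y"
  by (simp add: divide_inverse auto_mult auto_inverse)

lemma auto_inj: "\<sigma> \<in> Gal \<Longrightarrow> \<sigma> x = \<sigma> y \<longleftrightarrow> x = y"
  using auto_nz[of \<sigma> "x - y"] by (auto simp: auto_simps(6))

lemma L_subr: "subr L"
  unfolding subr_def
  by (auto intro!: fixedI simp: auto_add auto_mult auto_one auto_simps(1,5) fixedD)

lemma L_inverse: "x \<in> L \<Longrightarrow> inverse x \<in> L"
  by (auto intro!: fixedI simp: auto_inverse fixedD)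

lemma L_divide: "x \<in> L \<Longrightarrow> y \<in> L \<Longrightarrow> x / y \<in> L"
  by (simp add: divide_inverse subr_mult[OF L_subr] L_inverse)

lemma funpow_Gal: "\<sigma> \<in> Gal \<Longrightarrow> (\<sigma> ^^ n) \<in> Gal"
  by (induction n) (auto simp: Gal_id[unfolded id_def] Gal_comp id_def[symmetric] Gal_id)

lemma finite_order:
  assumes "\<sigma> \<in> Gal" shows "\<exists>n>0. \<sigma> ^^ n = id"
proof -
  have "\<not> inj_on (\<lambda>n. \<sigma> ^^ n) (UNIV :: nat set)"
    using finite_subset[OF _ Gal_finite, of "range (\<lambda>n. \<sigma> ^^ n)"] funpow_Gal[OF assms]
    by (auto dest: finite_imageD)
  then obtain a b where ab: "\<sigma> ^^ a = \<sigma> ^^ b" "a < b"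
    unfolding inj_on_def by (metis linorder_neqE_nat)
  have "(\<sigma> ^^ (b - a)) x = x" for x
  proof -
    have "b = a + (b - a)" using ab by simp
    then have "(\<sigma> ^^ a) ((\<sigma> ^^ (b - a)) x) = (\<sigma> ^^ a) x" using ab(1) by (metis comp_apply funpow_add)
    then show ?thesis using auto_inj[OF funpow_Gal[OF assms]] by blast
  qed
  then show ?thesis using ab by (intro exI[of _ "b - a"]) (auto simp: fun_eq_iff)
qed

text \<open>Any common exponent of the Galois group serves; the product of chosen orders is
  one.\<close>

definition N :: nat where "N = (\<Prod>\<sigma>\<in>Gal. SOME n. n > 0 \<and> \<sigma> ^^ n = id)"

lemma N_pos: "N > 0"
  unfolding N_def by (rule prod_pos) (use finite_order in \<open>metis (mono_tags, lifting) someI_ex\<close>)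

lemma N_exponent: "\<sigma> \<in> Gal \<Longrightarrow> \<sigma> ^^ N = id"
proof -
  assume s: "\<sigma> \<in> Gal"
  define n where "n = (SOME n. n > 0 \<and> \<sigma> ^^ n = id)"
  have n: "\<sigma> ^^ n = id" using someI_ex[OF finite_order[OF s]] by (simp add: n_def)
  have "n dvd N" unfolding N_def n_def using s Gal_finite by (rule dvd_prodI[rotated])
  then obtain m where "N = n * m" by blast
  then show ?thesis using n by (simp add: funpow_mult[symmetric])
qed

text \<open>A discrete Fourier transform along \<open>\<tau>\<close>: \<open>f j\<close> is the
  component of \<open>w\<close> on which \<open>\<tau>\<close> acts by the root of unity
  \<open>z j\<close>. As the group is commutative, the transform preserves the eigenspaces of the
  other automorphisms.\<close>

lemma split_eigen:
  assumes \<tau>: "\<tau> \<in> Gal" and V: "\<And>x y. x \<in> V \<Longrightarrow> y \<in> V \<Longrightarrow> x + y \<in> V"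
     "\<And>c x. x \<in> V \<Longrightarrow> of_cplx c * x \<in> V" "\<And>\<sigma> x. \<sigma> \<in> Gal \<Longrightarrow> x \<in> V \<Longrightarrow> \<sigma> x \<in> V" "0 \<in> V"
    and w: "w \<in> V"
  shows "\<exists>ws. set ws \<subseteq> V \<and> sum_list ws = w \<and> (\<forall>v\<in>set ws. (\<exists>c. \<tau> v = of_cplx c * v) \<and>
     (\<forall>\<sigma>\<in>Gal. (\<exists>c. \<sigma> w = of_cplx c * w) \<longrightarrow> (\<exists>c. \<sigma> v = of_cplx c * v)))"
proof -
  define n where "n = N"
  have n: "n > 0" "\<tau> ^^ n = id" using N_pos N_exponent[OF \<tau>] by (auto simp: n_def)
  define z where "z j = cis (2 * pi * real j / real n)" for j :: nat
  have z: "z j ^ n = 1" "z j \<noteq> 0" for j using n by (auto simp: z_def DeMoivre)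
  have zj: "z j = 1 \<longleftrightarrow> j = 0" if "j < n" for j
  proof -
    have "inj_on z {..<n}" using bij_betw_imp_inj_on[OF bij_betw_roots_unity[OF n(1)]] by (simp add: z_def[abs_def])
    moreover have "z 0 = 1" by (simp add: z_def)
    ultimately show ?thesis using that n(1) by (metis inj_onD lessThan_iff)
  qed
  have zz: "z j ^ k = z k ^ j" for j k by (simp add: z_def DeMoivre mult_ac)
  define f where "f j = (\<Sum>k<n. of_cplx (inverse (z j) ^ k / of_nat n) * (\<tau> ^^ k) w)" for j
  have sumV: "sum g I \<in> V" if "\<And>i. i \<in> I \<Longrightarrow> g i \<in> V" for g :: "nat \<Rightarrow> 'k" and I
    using that by (induction I rule: infinite_finite_induct) (auto simp: V)
  have fV: "f j \<in> V" for j
    unfolding f_def by (intro sumV V(2) V(3)[OF funpow_Gal[OF \<tau>] w])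
  have \<tau>f: "\<tau> (f j) = of_cplx (z j) * f j" for j
  proof -
    define g where "g k = of_cplx (z j) * (of_cplx (inverse (z j) ^ k / of_nat n) * (\<tau> ^^ k) w)" for k
    have "\<tau> (f j) = (\<Sum>k<n. of_cplx (inverse (z j) ^ k / of_nat n) * (\<tau> ^^ Suc k) w)"
      unfolding f_def rhom_sum[OF auto_rhom[OF \<tau>]] by (simp add: auto_mult[OF \<tau>] fixedD[OF const \<tau>])
    also have "\<dots> = (\<Sum>k<n. g (Suc k))"
    proof (rule sum.cong)
      fix k
      have "inverse (z j) ^ k / of_nat n = z j * (inverse (z j) ^ Suc k / of_nat n)" using z by simp
      then show "of_cplx (inverse (z j) ^ k / of_nat n) * (\<tau> ^^ Suc k) w = g (Suc k)"
        unfolding g_def by (simp only: of_cplx_mult mult.assoc)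
    qed simp
    also have "\<dots> = (\<Sum>k<n. g k)"
    proof -
      have "g n = g 0" using n z(1)[of j] by (simp add: g_def power_inverse)
      then show ?thesis using sum.lessThan_Suc_shift[of g n] sum.lessThan_Suc[of g n] by simp
    qed
    finally show ?thesis by (simp add: f_def g_def sum_distrib_left)
  qed
  have sum: "(\<Sum>j<n. f j) = w"
  proof -
    have zs: "(\<Sum>j<n. inverse (z j) ^ k / of_nat n) = (if k = 0 then 1 else 0)" if "k < n" for k
    proof (cases "k = 0")
      case False
      define q where "q = inverse (z k)"
      have q: "q \<noteq> 1" "q ^ n = 1" using zj[OF that] False z(1)[of k] by (auto simp: q_def power_inverse)
      have "(\<Sum>j<n. inverse (z j) ^ k) = (\<Sum>j<n. q ^ j)"
        by (rule sum.cong) (auto simp: q_def power_inverse zz[of _ k])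
      also have "\<dots> = 0" using geometric_sum[OF q(1), of n] q(2) by simp
      finally show ?thesis using False by (simp add: sum_divide_distrib[symmetric])
    qed (use n in simp)
    have "(\<Sum>j<n. f j) = (\<Sum>k<n. of_cplx (\<Sum>j<n. inverse (z j) ^ k / of_nat n) * (\<tau> ^^ k) w)"
      unfolding f_def by (subst sum.swap) (simp add: rhom_sum[OF rhom_of_cplx] sum_distrib_right)
    also have "\<dots> = (\<Sum>k<n. if k = 0 then w else 0)"
      by (rule sum.cong) (auto simp: zs)
    finally show ?thesis using n by simp
  qed
  have eig: "\<exists>c. \<sigma> (f j) = of_cplx c * f j" if s: "\<sigma> \<in> Gal" "\<sigma> w = of_cplx c * w" for \<sigma> c j
  proof
    have "\<sigma> ((\<tau> ^^ k) w) = of_cplx c * (\<tau> ^^ k) w" for k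
    proof -
      have "\<sigma> ((\<tau> ^^ k) w) = (\<tau> ^^ k) (\<sigma> w)"
        using Gal_comm[OF s(1) funpow_Gal[OF \<tau>, of k]] by (metis comp_apply)
      then show ?thesis using s(2) by (simp add: auto_mult[OF funpow_Gal[OF \<tau>]] fixedD[OF const funpow_Gal[OF \<tau>]])
    qed
    then show "\<sigma> (f j) = of_cplx c * f j"
      unfolding f_def rhom_sum[OF auto_rhom[OF s(1)]] sum_distrib_left
      by (simp add: auto_mult[OF s(1)] fixedD[OF const s(1)] mult.left_commute)
  qed
  show ?thesis
    using fV \<tau>f eig sum by (intro exI[of _ "map f [0..<n]"]) (auto simp: sum_list_distinct_conv_sum_set atLeast0LessThan)
qed

text \<open>Commuting automorphisms of finite order are simultaneously diagonalizable.\<close>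

lemma eigen_decomposition:
  assumes V: "\<And>x y. x \<in> V \<Longrightarrow> y \<in> V \<Longrightarrow> x + y \<in> V"
     "\<And>c x. x \<in> V \<Longrightarrow> of_cplx c * x \<in> V" "\<And>\<sigma> x. \<sigma> \<in> Gal \<Longrightarrow> x \<in> V \<Longrightarrow> \<sigma> x \<in> V" "0 \<in> V"
    and f: "f \<in> V"
  shows "\<exists>ws. set ws \<subseteq> V \<inter> E \<and> f = sum_list ws"
proof -
  have "S \<subseteq> Gal \<Longrightarrow> \<exists>ws. set ws \<subseteq> {w \<in> V. \<forall>\<sigma>\<in>S. \<exists>c. \<sigma> w = of_cplx c * w} \<and> f = sum_list ws"
    if "finite S" for S
    using that
  proof (induction S rule: finite_induct)
    case empty
    show ?case using f by (intro exI[of _ "[f]"]) auto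
  next
    case (insert \<tau> S)
    then obtain ws where ws: "set ws \<subseteq> {w \<in> V. \<forall>\<sigma>\<in>S. \<exists>c. \<sigma> w = of_cplx c * w}" "f = sum_list ws" by auto
    have "\<forall>w\<in>set ws. \<exists>vs. set vs \<subseteq> V \<and> sum_list vs = w \<and> (\<forall>v\<in>set vs. (\<exists>c. \<tau> v = of_cplx c * v) \<and>
     (\<forall>\<sigma>\<in>Gal. (\<exists>c. \<sigma> w = of_cplx c * w) \<longrightarrow> (\<exists>c. \<sigma> v = of_cplx c * v)))"
    proof
      fix w assume "w \<in> set ws"
      then have w: "w \<in> V" "\<tau> \<in> Gal" using ws(1) insert.prems by auto
      show "\<exists>vs. set vs \<subseteq> V \<and> sum_list vs = w \<and> (\<forall>v\<in>set vs. (\<exists>c. \<tau> v = of_cplx c * v) \<and>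
     (\<forall>\<sigma>\<in>Gal. (\<exists>c. \<sigma> w = of_cplx c * w) \<longrightarrow> (\<exists>c. \<sigma> v = of_cplx c * v)))"
        by (rule split_eigen[where V = V, OF w(2) _ _ _ V(4) w(1)]) (fact V)+
    qed
    then obtain g where g: "\<forall>w\<in>set ws. set (g w) \<subseteq> V \<and> sum_list (g w) = w \<and> (\<forall>v\<in>set (g w). (\<exists>c. \<tau> v = of_cplx c * v) \<and>
     (\<forall>\<sigma>\<in>Gal. (\<exists>c. \<sigma> w = of_cplx c * w) \<longrightarrow> (\<exists>c. \<sigma> v = of_cplx c * v)))" by metis
    have "set (concat (map g ws)) \<subseteq> {w \<in> V. \<forall>\<sigma>\<in>insert \<tau> S. \<exists>c. \<sigma> w = of_cplx c * w}"
    proof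
      fix v assume "v \<in> set (concat (map g ws))"
      then obtain w where w: "w \<in> set ws" "v \<in> set (g w)" by auto
      then have "v \<in> V" "\<exists>c. \<tau> v = of_cplx c * v" using g by blast+
      moreover have "\<exists>c. \<sigma> v = of_cplx c * v" if "\<sigma> \<in> S" for \<sigma>
      proof -
        have "\<sigma> \<in> Gal" "\<exists>c. \<sigma> w = of_cplx c * w" using that insert.prems w ws(1) by auto
        then show ?thesis using g w by blast
      qed
      ultimately show "v \<in> {w \<in> V. \<forall>\<sigma>\<in>insert \<tau> S. \<exists>c. \<sigma> w = of_cplx c * w}" by auto
    qed
    moreover have "sum_list (concat (map g ws)) = f"
    proof -
      have "map (\<lambda>x. sum_list (g x)) ws = ws" using g by (intro map_idI) auto
      then show ?thesis using ws(2) by (simp add: sum_list_concat_map)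
    qed
    ultimately show ?case by (intro exI[of _ "concat (map g ws)"] conjI) (assumption, rule sym)
  qed
  from this[OF Gal_finite] obtain ws where ws:
    "set ws \<subseteq> {w \<in> V. \<forall>\<sigma>\<in>Gal. \<exists>c. \<sigma> w = of_cplx c * w}" "f = sum_list ws" by auto
  have "sum_list (filter (\<lambda>w. w \<noteq> 0) ws) = sum_list ws" by (induction ws) auto
  then show ?thesis using ws by (intro exI[of _ "filter (\<lambda>w. w \<noteq> 0) ws"]) (auto simp: E_def)
qed

lemma E_nz: "w \<in> E \<Longrightarrow> w \<noteq> 0"
  by (simp add: E_def)

lemma E_eigenvalue: "w \<in> E \<Longrightarrow> \<sigma> \<in> Gal \<Longrightarrow> \<exists>c. \<sigma> w = of_cplx c * w"
  by (simp add: E_def)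

lemma E_mult: "v \<in> E \<Longrightarrow> w \<in> E \<Longrightarrow> v * w \<in> E"
proof -
  assume vw: "v \<in> E" "w \<in> E"
  have "\<exists>c. \<sigma> (v * w) = of_cplx c * (v * w)" if s: "\<sigma> \<in> Gal" for \<sigma>
  proof -
    obtain c d where "\<sigma> v = of_cplx c * v" "\<sigma> w = of_cplx d * w" using E_eigenvalue[OF vw(1) s] E_eigenvalue[OF vw(2) s] by blast
    then have "\<sigma> (v * w) = of_cplx (c * d) * (v * w)" using s by (simp add: auto_mult of_cplx_mult)
    then show ?thesis ..
  qed
  then show ?thesis using vw by (auto simp: E_def)
qed

lemma E_inverse: "w \<in> E \<Longrightarrow> inverse w \<in> E"
proof -
  assume w: "w \<in> E"
  have "\<exists>c. \<sigma> (inverse w) = of_cplx c * inverse w" if s: "\<sigma> \<in> Gal" for \<sigma>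
  proof -
    obtain c where "\<sigma> w = of_cplx c * w" using E_eigenvalue[OF w s] by blast
    then have "\<sigma> (inverse w) = of_cplx (inverse c) * inverse w" using s by (simp add: auto_inverse of_cplx_inverse)
    then show ?thesis ..
  qed
  then show ?thesis using w by (auto simp: E_def)
qed

lemma L_in_E: "u \<in> L \<Longrightarrow> u \<noteq> 0 \<Longrightarrow> u \<in> E"
  by (auto simp: E_def fixedD intro!: exI[of _ 1])

lemma E_one: "1 \<in> E"
  using L_in_E subr_1[OF L_subr] by simp

lemma E_divide: "v \<in> E \<Longrightarrow> w \<in> E \<Longrightarrow> v / w \<in> E"
  by (simp add: divide_inverse E_mult E_inverse)

lemma E_power: "w \<in> E \<Longrightarrow> w ^ n \<in> E"
  by (induction n) (auto simp: E_one E_mult)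

text \<open>Eigenvalues are N-th roots of unity because every automorphism has order dividing
  \<open>N\<close>.\<close>

lemma E_power_N: "w \<in> E \<Longrightarrow> w ^ N \<in> L"
proof (rule fixedI)
  fix \<sigma> assume w: "w \<in> E" and s: "\<sigma> \<in> Gal"
  obtain c where c: "\<sigma> w = of_cplx c * w" using E_eigenvalue[OF w s] by blast
  have "(\<sigma> ^^ k) w = of_cplx (c ^ k) * w" for k
    by (induction k) (auto simp: c auto_mult[OF s] fixedD[OF const s] of_cplx_mult)
  then have "of_cplx (c ^ N) * w = w" using N_exponent[OF s] by (metis id_apply)
  then have "of_cplx (c ^ N) = (1::'k)" using E_nz[OF w] by simp
  then show "\<sigma> (w ^ N) = w ^ N" using c by (simp add: auto_simps(7)[OF s] power_mult_distrib of_cplx_power)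
qed

text \<open>The Reynolds operator, an \<open>L\<close>-linear projection onto
  \<open>L\<close>.\<close>

definition avg :: "'k \<Rightarrow> 'k" where "avg x = (\<Sum>\<sigma>\<in>Gal. \<sigma> x) / of_nat (card Gal)"

lemma card_Gal: "card Gal > 0"
  using Gal_finite Gal_id by (metis card_gt_0_iff empty_iff)

lemma avg_L: "avg x \<in> L"
proof (rule fixedI)
  fix \<tau> assume \<tau>: "\<tau> \<in> Gal"
  have inj: "inj_on ((\<circ>) \<tau>) Gal"
    using auto_inj[OF \<tau>] by (auto simp: inj_on_def fun_eq_iff)
  then have "(\<circ>) \<tau> ` Gal = Gal"
    using Gal_comp[OF \<tau>] Gal_finite by (intro card_subset_eq) (auto simp: card_image)
  then have "(\<Sum>\<sigma>\<in>Gal. \<tau> (\<sigma> x)) = (\<Sum>\<sigma>\<in>Gal. \<sigma> x)"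
    using sum.reindex[OF inj, of "\<lambda>\<sigma>. \<sigma> x"] by (simp add: comp_def)
  moreover have "\<tau> (of_nat (card Gal)) = of_nat (card Gal)"
    using fixedD[OF const \<tau>, of "of_nat (card Gal)"] by (simp add: of_cplx_of_nat)
  ultimately show "\<tau> (avg x) = avg x"
    by (simp add: avg_def auto_divide[OF \<tau>] rhom_sum[OF auto_rhom[OF \<tau>]])
qed

lemma avg_self: "x \<in> L \<Longrightarrow> avg x = x"
  using of_nat_nz[OF card_Gal, where 'k = 'k] by (simp add: avg_def fixedD)

lemma avg_add: "avg (x + y) = avg x + avg y"
  unfolding avg_def sum.distrib[symmetric] add_divide_distrib[symmetric]
  by (rule arg_cong2[of _ _ _ _ "(/)"]) (auto intro: sum.cong simp: auto_add)

lemma avg_mult: "u \<in> L \<Longrightarrow> avg (u * x) = u * avg x"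
  by (simp add: avg_def auto_mult fixedD sum_distrib_left[symmetric])

lemma avg_0: "avg 0 = 0"
  by (rule avg_self[OF subr_0[OF L_subr]])

lemma avg_sum: "avg (sum f I) = (\<Sum>i\<in>I. avg (f i))"
  by (induction I rule: infinite_finite_induct) (auto simp: avg_add avg_0)

end

section \<open>A chart of an abelian cover of affine space\<close>

text \<open>After division by the gcd, all powers of the coprime part of \<open>g\<close> divide
  \<open>d\<close>, which is possible for a unit only.\<close>

lemma dvd_if_power_dvd_bounded:
  fixes d f g :: "'a::factorial_ring_gcd"
  assumes "d \<noteq> 0" "g \<noteq> 0" "\<And>k. g ^ k dvd d * f ^ k"
  shows "g dvd f"
proof -
  define h where "h = gcd f g"
  have h: "h \<noteq> 0" using assms by (simp add: h_def)
  obtain f' g' where fg: "f = h * f'" "g = h * g'" "coprime f' g'"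
    using gcd_coprime_exists[of f g] h unfolding h_def by (metis mult.commute)
  have "g' ^ k dvd d" for k
  proof -
    have "h ^ k * g' ^ k dvd h ^ k * (d * f' ^ k)"
      using assms(3)[of k] unfolding fg power_mult_distrib by (simp only: mult_ac)
    then have "g' ^ k dvd d * f' ^ k" using h by simp
    moreover have "coprime (g' ^ k) (f' ^ k)" using fg(3) by (simp add: coprime_commute)
    ultimately show ?thesis by (simp add: coprime_dvd_mult_left_iff)
  qed
  then have "\<not> finite {n. g' ^ n dvd d}" by simp
  then have "is_unit g'" using finite_divisor_powers[of d g'] assms(1) by blast
  then show ?thesis unfolding fg using dvd_mult_unit_iff[of g' h h] by (simp add: mult_dvd_mono unit_imp_dvd)
qed

text \<open>\<open>B\<close> is the coordinate ring of the part of the cover over an affine chart with the coordinates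
  \<open>y1, y2, y3\<close>; as a module over the coordinate ring of the chart it is generated by \<open>M\<close>.\<close>

locale chart = abelian_ext L Gal for L :: "'k::complex_extension_field set" and Gal +
  fixes y1 y2 y3 :: 'k and B M :: "'k set"
  assumes y_L: "y1 \<in> L" "y2 \<in> L" "y3 \<in> L"
    and alg_indep: "ev3 of_cplx y1 y2 y3 f = 0 \<Longrightarrow> f = 0"
    and L_frac: "u \<in> L \<Longrightarrow> \<exists>f g. g \<noteq> 0 \<and> u = ev3 of_cplx y1 y2 y3 f / ev3 of_cplx y1 y2 y3 g"
    and B_subr: "subr B" and A_sub_B: "range (ev3 of_cplx y1 y2 y3) \<subseteq> B"
    and M: "finite M" "M \<subseteq> B" "B = {\<Sum>b\<in>M. c b * b | c. \<forall>b\<in>M. c b \<in> range (ev3 of_cplx y1 y2 y3)}"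
    and factorial: "pideal q B \<Longrightarrow> factorial_domain (sub (localization B q))"
    and normal: "pideal q B \<Longrightarrow> integrally_closed (localization B q)"
begin

definition ev :: "p3 \<Rightarrow> 'k" where "ev = ev3 of_cplx y1 y2 y3"
definition A :: "'k set" where "A = range ev"

lemma ev_rhom: "rhom ev"
  unfolding ev_def by (rule rhom_ev3[OF rhom_of_cplx])

lemmas ev_simps [simp] = rhomD[OF ev_rhom]

lemma ev_T [simp]: "ev T1 = y1" "ev T2 = y2" "ev T3 = y3" "ev (C3 c) = of_cplx c"
  unfolding ev_def by (simp_all add: ev3_simps[OF rhom_of_cplx])

lemma ev_eq_0_iff [simp]: "ev f = 0 \<longleftrightarrow> f = 0"
  using alg_indep ev_simps(1) unfolding ev_def by blast

lemma ev_eq_iff [simp]: "ev f = ev g \<longleftrightarrow> f = g"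
  using ev_eq_0_iff[of "f - g"] by simp

lemma A_subr: "subr A"
  unfolding subr_def A_def
  by (auto simp: ev_simps(3,4,5)[symmetric] intro: range_eqI[of _ _ 0] range_eqI[of _ _ 1] simp del: ev_simps(3,4,5))

lemma A_B: "A \<subseteq> B"
  using A_sub_B by (simp add: A_def ev_def)

lemma ev_A [simp]: "ev f \<in> A" and ev_B [simp]: "ev f \<in> B"
  using A_B by (auto simp: A_def)

lemma ev_L [simp]: "ev f \<in> L"
proof (induction f rule: p3_induct)
  case (add f g) then show ?case using subr_add[OF L_subr] by simp
next
  case (mult f g) then show ?case using subr_mult[OF L_subr] by simp
qed (use y_L const in simp_all)

lemma A_L: "A \<subseteq> L"
  by (auto simp: A_def)

lemma L_fracE:
  assumes "u \<in> L" obtains f g where "g \<noteq> 0" "u = ev f / ev g"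
  using L_frac[OF assms] unfolding ev_def by blast

lemma const_B: "of_cplx c \<in> B"
  using ev_B[of "C3 c"] by simp

lemma B_gen: "b \<in> B \<Longrightarrow> \<exists>c. (\<forall>m\<in>M. c m \<in> A) \<and> b = (\<Sum>m\<in>M. c m * m)"
  using M(3) unfolding A_def ev_def by blast

lemma loc_subr: "pideal q B \<Longrightarrow> subr (localization B q)" "pideal q B \<Longrightarrow> B \<subseteq> localization B q"
  using localization_subr[OF B_subr] by auto

text \<open>The \<open>b\<close> with \<open>b * x\<close> in \<open>B\<close> form an ideal. If it
  were proper, it would lie in a prime, and \<open>x\<close> would not be regular there.\<close>

lemma mem_B_if_all_local:
  assumes "\<And>q. pideal q B \<Longrightarrow> x \<in> localization B q"
  shows "x \<in> B"
proof (rule ccontr)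
  assume x: "x \<notin> B"
  define I where "I = {b \<in> B. b * x \<in> B}"
  note B = subr_add[OF B_subr] subr_mult[OF B_subr] subr_0[OF B_subr]
  have "\<exists>q. pideal q B \<and> I \<subseteq> q"
  proof (rule ex_pideal[OF B_subr])
    show "1 \<notin> I" "0 \<in> I" "I \<subseteq> B" using x B by (auto simp: I_def)
    show "\<And>a b. a \<in> I \<Longrightarrow> b \<in> I \<Longrightarrow> a + b \<in> I" using B by (simp add: I_def distrib_right)
    show "\<And>a b. a \<in> B \<Longrightarrow> b \<in> I \<Longrightarrow> a * b \<in> I" using B by (simp add: I_def mult.assoc)
  qed
  then obtain q where q: "pideal q B" "I \<subseteq> q" by blast
  obtain a s where as: "x = a / s" "a \<in> B" "s \<in> B - q" using assms[OF q(1)] by (auto simp: localization_def)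
  then have "s \<noteq> 0" using q(1) by (auto simp: pideal_def)
  then have "s \<in> I" using as by (simp add: I_def)
  then show False using q as by blast
qed

lemma root_in_B:
  assumes "z ^ n \<in> B" "n > 0" shows "z \<in> B"
proof (rule mem_B_if_all_local)
  fix q assume q: "pideal q B"
  define c where "c i = (if i = 0 then - (z ^ n) else 0)" for i :: nat
  have "(\<Sum>i<n. c i * z ^ i) = (\<Sum>i<n. if i = 0 then - (z ^ n) else 0)" by (rule sum.cong) (auto simp: c_def)
  then have "z ^ n + (\<Sum>i<n. c i * z ^ i) = 0" using assms(2) by simp
  moreover have "\<forall>i<n. c i \<in> localization B q"
    using loc_subr[OF q] assms(1) by (auto simp: c_def intro!: subr_uminus subr_0)
  ultimately show "z \<in> localization B q"
    using normal[OF q] assms(2) unfolding integrally_closed_def by blast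
qed

text \<open>If w^N = f / g, then (g w)^N = g^(N-1) f lies in \<open>B\<close>, and by normality
  \<open>B\<close> contains the root.\<close>

lemma E_denominator:
  assumes "w \<in> E" shows "\<exists>g. g \<noteq> 0 \<and> ev g * w \<in> B"
proof -
  obtain f g where fg: "g \<noteq> 0" "w ^ N = ev f / ev g" using L_fracE[OF E_power_N[OF assms]] by blast
  obtain n where n: "N = Suc n" using N_pos by (cases N) auto
  have "(ev g * w) ^ N = ev (g ^ n * f)" using fg by (simp add: power_mult_distrib n)
  then have "(ev g * w) ^ N \<in> B" by (simp only: ev_B)
  then have "ev g * w \<in> B" by (rule root_in_B[OF _ N_pos])
  then show ?thesis using fg by blast
qed

lemma denominator: "\<exists>g. g \<noteq> 0 \<and> ev g * z \<in> B"
proof -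
  obtain ws where ws: "set ws \<subseteq> UNIV \<inter> E" "z = sum_list ws"
    using eigen_decomposition[of UNIV z] by auto
  have "set ws \<subseteq> E \<Longrightarrow> \<exists>g. g \<noteq> 0 \<and> ev g * sum_list ws \<in> B" for ws
  proof (induction ws)
    case Nil show ?case using subr_0[OF B_subr] by (intro exI[of _ 1]) auto
  next
    case (Cons w ws)
    then obtain g where g: "g \<noteq> 0" "ev g * sum_list ws \<in> B" by auto
    obtain h where h: "h \<noteq> 0" "ev h * w \<in> B" using E_denominator Cons.prems by auto
    have "ev (g * h) * sum_list (w # ws) = ev g * (ev h * w) + ev h * (ev g * sum_list ws)" by (simp add: algebra_simps)
    then have "ev (g * h) * sum_list (w # ws) \<in> B"
      using g h subr_add[OF B_subr] subr_mult[OF B_subr] ev_B by metis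
    then show ?case using g h by (intro exI[of _ "g * h"]) auto
  qed
  then show ?thesis using ws by auto
qed

lemma common_denominator:
  assumes "finite I" shows "\<exists>g. g \<noteq> 0 \<and> (\<forall>i\<in>I. ev g * f i \<in> B)"
  using assms
proof (induction I rule: finite_induct)
  case empty show ?case by (intro exI[of _ 1]) auto
next
  case (insert i I)
  then obtain g where g: "g \<noteq> 0" "\<forall>i\<in>I. ev g * f i \<in> B" by auto
  obtain h where h: "h \<noteq> 0" "ev h * f i \<in> B" using denominator by blast
  have "ev (g * h) * f j \<in> B" if "j \<in> insert i I" for j
  proof (cases "j = i")
    case True
    then show ?thesis using h subr_mult[OF B_subr ev_B[of g]] by (simp add: mult.assoc)
  next
    case False
    then show ?thesis using g that subr_mult[OF B_subr ev_B[of h], of "ev g * f j"] by (simp add: mult_ac)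
  qed
  then show ?case using g h by (intro exI[of _ "g * h"]) auto
qed

lemma frac_full_B: "frac_full B"
  unfolding frac_full_def
proof
  fix z
  obtain g where "g \<noteq> 0" "ev g * z \<in> B" using denominator by blast
  then show "\<exists>a\<in>B. \<exists>b\<in>B. b \<noteq> 0 \<and> z = a / b"
    by (intro bexI[of _ "ev g * z"] bexI[of _ "ev g"]) auto
qed

lemma frac_full_loc: "pideal q B \<Longrightarrow> frac_full (localization B q)"
  using frac_full_B loc_subr(2)[of q] unfolding frac_full_def by blast

lemma ufd_loc: "pideal q B \<Longrightarrow> ufd (localization B q)"
  using factorial loc_subr(1) by (intro ufdI)

lemma almost_integral:
  assumes "d \<in> B" "d \<noteq> 0" "\<And>k. d * z ^ k \<in> B" shows "z \<in> B"
proof (rule mem_B_if_all_local)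
  fix q assume q: "pideal q B"
  show "z \<in> localization B q"
    by (rule ufd_almost_integral[OF ufd_loc[OF q] frac_full_loc[OF q], of d])
      (use assms loc_subr(2)[OF q] in blast)+
qed

text \<open>All powers of \<open>\<sigma> b\<close> are combinations of the images of the generators
  \<open>M\<close> with coefficients in \<open>A\<close>. So one denominator serves them all, and
  \<open>almost_integral\<close> applies.\<close>

lemma Gal_B:
  assumes s: "\<sigma> \<in> Gal" and b: "b \<in> B" shows "\<sigma> b \<in> B"
proof -
  obtain g where g: "g \<noteq> 0" "\<forall>m\<in>M. ev g * \<sigma> m \<in> B" using common_denominator[OF M(1)] by blast
  have "ev g * \<sigma> b' \<in> B" if b': "b' \<in> B" for b'
  proof -
    obtain c where c: "\<forall>m\<in>M. c m \<in> A" "b' = (\<Sum>m\<in>M. c m * m)" using B_gen[OF b'] by blast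
    have "ev g * \<sigma> b' = (\<Sum>m\<in>M. c m * (ev g * \<sigma> m))"
      unfolding c(2) rhom_sum[OF auto_rhom[OF s]] sum_distrib_left
    proof (rule sum.cong)
      fix m assume "m \<in> M"
      then have "c m \<in> L" using c(1) A_L by auto
      then show "ev g * \<sigma> (c m * m) = c m * (ev g * \<sigma> m)" using s by (simp add: auto_mult fixedD)
    qed simp
    also have "\<dots> \<in> B"
    proof (rule subr_sum[OF B_subr])
      fix m assume "m \<in> M"
      then show "c m * (ev g * \<sigma> m) \<in> B" using c(1) g(2) A_B subr_mult[OF B_subr] by blast
    qed
    finally show ?thesis .
  qed
  then have k: "ev g * \<sigma> b ^ k \<in> B" for k
    using subr_power[OF B_subr b, of k] by (metis auto_simps(7)[OF s])
  show ?thesis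
  proof (rule almost_integral)
    show "ev g \<in> B" "ev g \<noteq> 0" using g by simp_all
  qed (rule k)
qed

lemma avg_B: "b \<in> B \<Longrightarrow> avg b \<in> B"
proof -
  assume b: "b \<in> B"
  have "avg b = of_cplx (1 / of_nat (card Gal)) * (\<Sum>\<sigma>\<in>Gal. \<sigma> b)"
    by (simp add: avg_def divide_inverse of_cplx_inverse of_cplx_of_nat)
  then show ?thesis using Gal_B[OF _ b] by (auto intro!: subr_mult[OF B_subr] subr_sum[OF B_subr] const_B)
qed

text \<open>Averaging sends the generators \<open>M\<close> into \<open>L\<close>, so the powers of
  an element of \<open>B \<inter> L\<close> have a common denominator in the polynomial ring. By
  \<open>dvd_if_power_dvd_bounded\<close> the element is then a polynomial.\<close>

lemma B_Int_L: "B \<inter> L = A"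
proof
  show "A \<subseteq> B \<inter> L" using A_B A_L by auto
  show "B \<inter> L \<subseteq> A"
  proof
    fix u assume u: "u \<in> B \<inter> L"
    obtain f g where fg: "g \<noteq> 0" "u = ev f / ev g" using u L_fracE by blast
    have "\<exists>d. d \<noteq> 0 \<and> (\<forall>m\<in>I. ev d * avg m \<in> A)" if "finite I" for I
      using that
    proof (induction I rule: finite_induct)
      case empty show ?case by (intro exI[of _ 1]) auto
    next
      case (insert i I)
      then obtain d where d: "d \<noteq> 0" "\<forall>m\<in>I. ev d * avg m \<in> A" by auto
      obtain f' g' where "g' \<noteq> 0" "avg i = ev f' / ev g'" using L_fracE[OF avg_L] by blast
      then have i: "ev g' * avg i \<in> A" by simp
      have "ev (d * g') * avg j \<in> A" if "j \<in> insert i I" for j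
      proof (cases "j = i")
        case True
        then show ?thesis using i subr_mult[OF A_subr ev_A[of d]] by (simp add: mult.assoc)
      next
        case False
        then show ?thesis using d that subr_mult[OF A_subr ev_A[of g'], of "ev d * avg j"] by (simp add: mult_ac)
      qed
      then show ?case using d \<open>g' \<noteq> 0\<close> by (intro exI[of _ "d * g'"]) auto
    qed
    then obtain d where d: "d \<noteq> 0" "\<forall>m\<in>M. ev d * avg m \<in> A" using M(1) by blast
    have "g ^ k dvd d * f ^ k" for k
    proof -
      have uk: "u ^ k \<in> B" "u ^ k \<in> L" using u subr_power[OF B_subr] subr_power[OF L_subr] by auto
      obtain c where c: "\<forall>m\<in>M. c m \<in> A" "u ^ k = (\<Sum>m\<in>M. c m * m)" using B_gen[OF uk(1)] by blast
      have "u ^ k = avg (u ^ k)" using avg_self[OF uk(2)] by simp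
      also have "\<dots> = (\<Sum>m\<in>M. c m * avg m)"
        unfolding c(2) avg_sum using c(1) A_L by (intro sum.cong) (auto simp: avg_mult)
      finally have "ev d * u ^ k = (\<Sum>m\<in>M. c m * (ev d * avg m))" by (simp add: sum_distrib_left mult_ac)
      also have "\<dots> \<in> A"
      proof (rule subr_sum[OF A_subr])
        fix m assume "m \<in> M"
        then show "c m * (ev d * avg m) \<in> A" using c(1) d(2) subr_mult[OF A_subr] by blast
      qed
      finally obtain h where "ev d * u ^ k = ev h" by (auto simp: A_def)
      then have "ev (d * f ^ k) = ev (h * g ^ k)" using fg by (simp add: power_divide field_simps)
      then show ?thesis by (simp only: ev_eq_iff dvd_triv_right)
    qed
    then have "g dvd f" using d(1) fg(1) by (rule dvd_if_power_dvd_bounded[rotated 2])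
    then obtain h where "f = g * h" by blast
    then have "u = ev h" using fg by simp
    then show "u \<in> A" by simp
  qed
qed

lemma E_B_power: "w \<in> E \<Longrightarrow> w \<in> B \<Longrightarrow> \<exists>h. w ^ N = ev h \<and> h \<noteq> 0"
proof -
  assume w: "w \<in> E" "w \<in> B"
  then have "w ^ N \<in> A" using E_power_N subr_power[OF B_subr] B_Int_L by blast
  then obtain h where "w ^ N = ev h" by (auto simp: A_def)
  moreover have "w ^ N \<noteq> 0" using E_nz[OF w(1)] by simp
  ultimately show ?thesis by auto
qed

text \<open>In other words, \<open>p B\<close> has no embedded primes.\<close>

lemma nonzerodivisor_mod_prime:
  assumes p: "prime_elem p" and f: "\<not> p dvd f" and b: "b \<in> B" "ev f * b / ev p \<in> B"
  shows "b / ev p \<in> B"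
proof -
  have "p \<noteq> 0" using p by auto
  define V where "V = {b \<in> B. ev f * b / ev p \<in> B}"
  have "\<exists>ws. set ws \<subseteq> V \<inter> E \<and> b = sum_list ws"
  proof (rule eigen_decomposition)
    show "\<And>x y. x \<in> V \<Longrightarrow> y \<in> V \<Longrightarrow> x + y \<in> V"
      using subr_add[OF B_subr] by (simp add: V_def distrib_left add_divide_distrib)
    show "of_cplx c * x \<in> V" if "x \<in> V" for c x
      using that subr_mult[OF B_subr const_B[of c], of x] subr_mult[OF B_subr const_B[of c], of "ev f * x / ev p"]
      by (simp add: V_def mult_ac)
    show "\<sigma> x \<in> V" if s: "\<sigma> \<in> Gal" and x: "x \<in> V" for \<sigma> x
    proof -
      have "\<sigma> (ev f * x / ev p) = ev f * \<sigma> x / ev p"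
        using s by (simp add: auto_divide auto_mult fixedD)
      then show ?thesis using x Gal_B[OF s, of x] Gal_B[OF s, of "ev f * x / ev p"] by (simp add: V_def)
    qed
    show "0 \<in> V" using subr_0[OF B_subr] by (simp add: V_def)
    show "b \<in> V" using b by (simp add: V_def)
  qed
  then obtain ws where ws: "set ws \<subseteq> V \<inter> E" "b = sum_list ws" by blast
  have "w / ev p \<in> B" if w: "w \<in> V \<inter> E" for w
  proof -
    \<comment> \<open>For an eigenvector the N-th power is a polynomial, and unique factorization in
      three variables decides the question. The root is taken back by normality of
      \<open>B\<close>.\<close>
    obtain h where h: "w ^ N = ev h" using E_B_power w by (auto simp: V_def)
    have "(ev f * w / ev p) ^ N \<in> B" using w subr_power[OF B_subr] by (auto simp: V_def)
    moreover have eq: "(ev f * w / ev p) ^ N = ev (f ^ N * h) / ev (p ^ N)"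
      by (simp add: power_divide power_mult_distrib h)
    ultimately have "ev (f ^ N * h) / ev (p ^ N) \<in> B" by (simp only:)
    moreover have "ev (f ^ N * h) / ev (p ^ N) \<in> L" by (rule L_divide[OF ev_L ev_L])
    ultimately have "ev (f ^ N * h) / ev (p ^ N) \<in> A" using B_Int_L by blast
    then obtain k where "ev (f ^ N * h) / ev (p ^ N) = ev k" by (auto simp: A_def)
    then have "ev (f ^ N * h) = ev (p ^ N * k)" using \<open>p \<noteq> 0\<close> by (simp add: field_simps)
    then have "f ^ N * h = p ^ N * k" by (simp only: ev_eq_iff)
    then have "p ^ N dvd f ^ N * h" by simp
    moreover have "\<not> p dvd f ^ N" using f p prime_elem_dvd_power by blast
    ultimately have "p ^ N dvd h" using p prime_power_dvd_multD[of p N "f ^ N" h] N_pos by blast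
    then obtain k' where "h = p ^ N * k'" by blast
    then have "(w / ev p) ^ N = ev k'" using h \<open>p \<noteq> 0\<close> by (simp add: power_divide)
    then show ?thesis using root_in_B[of "w / ev p" N] N_pos by simp
  qed
  then have "\<forall>w\<in>set ws. w / ev p \<in> B" using ws by blast
  then have "sum_list ws / ev p \<in> B"
    by (induction ws) (auto simp: add_divide_distrib subr_0[OF B_subr] intro: subr_add[OF B_subr])
  then show ?thesis using ws by simp
qed

text \<open>The average of the identity over the Galois group has polynomial coefficients.\<close>

lemma unit_ideal_descends:
  assumes "b1 \<in> B" "b2 \<in> B" "ev g1 * b1 + ev g2 * b2 = 1"
  shows "\<exists>h1 h2. g1 * h1 + g2 * h2 = 1"
proof -
  have "avg b1 \<in> A" "avg b2 \<in> A" using B_Int_L avg_B avg_L assms by blast+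
  then obtain h1 h2 where h: "avg b1 = ev h1" "avg b2 = ev h2" by (auto simp: A_def)
  have "1 = avg (ev g1 * b1 + ev g2 * b2)" unfolding assms(3) using avg_self[OF subr_1[OF L_subr]] by simp
  also have "\<dots> = ev (g1 * h1 + g2 * h2)" by (simp add: avg_add avg_mult h)
  finally have "ev (g1 * h1 + g2 * h2) = ev 1" by simp
  then show ?thesis unfolding ev_eq_iff by blast
qed

text \<open>Lying over, in the form used later: a proper ideal of the polynomial ring with two
  generators stays proper in \<open>B\<close>, hence lies in a prime.\<close>

lemma ex_point:
  assumes "\<not> (\<exists>h1 h2. g1 * h1 + g2 * h2 = 1)"
  shows "\<exists>q. pideal q B \<and> ev g1 \<in> q \<and> ev g2 \<in> q"
proof -
  define I where "I = {ev g1 * b1 + ev g2 * b2 | b1 b2. b1 \<in> B \<and> b2 \<in> B}"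
  note B = subr_add[OF B_subr] subr_mult[OF B_subr] subr_0[OF B_subr] subr_1[OF B_subr]
  have I: "ev g1 * b1 + ev g2 * b2 \<in> I" if "b1 \<in> B" "b2 \<in> B" for b1 b2 using that by (auto simp: I_def)
  have "\<exists>q. pideal q B \<and> I \<subseteq> q"
  proof (rule ex_pideal[OF B_subr])
    show "1 \<notin> I" using unit_ideal_descends assms unfolding I_def by force
    show "I \<subseteq> B" using B by (auto simp: I_def)
    show "0 \<in> I" using I[OF B(3) B(3)] by simp
    show "x + y \<in> I" if xy: "x \<in> I" "y \<in> I" for x y
    proof -
      obtain a b c d where "x = ev g1 * a + ev g2 * b" "y = ev g1 * c + ev g2 * d" "a \<in> B" "b \<in> B" "c \<in> B" "d \<in> B"
        using xy unfolding I_def by blast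
      then show ?thesis using I[OF B(1)[of a c] B(1)[of b d]] by (simp add: algebra_simps)
    qed
    show "c * x \<in> I" if cx: "c \<in> B" "x \<in> I" for c x
    proof -
      obtain a b where "x = ev g1 * a + ev g2 * b" "a \<in> B" "b \<in> B" using cx unfolding I_def by blast
      then show ?thesis using I[OF B(2)[of c a] B(2)[of c b]] cx by (simp add: algebra_simps)
    qed
  qed
  then obtain q where q: "pideal q B" "I \<subseteq> q" by blast
  have "ev g1 \<in> I" "ev g2 \<in> I" using I[OF B(4) B(3)] I[OF B(3) B(4)] by simp_all
  then show ?thesis using q by blast
qed

end

lemma pidealD:
  assumes "pideal p A"
  shows "p \<subseteq> A" "0 \<in> p" "1 \<notin> p" "x \<in> p \<Longrightarrow> y \<in> p \<Longrightarrow> x + y \<in> p" "a \<in> A \<Longrightarrow> x \<in> p \<Longrightarrow> a * x \<in> p"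
    "a \<in> A \<Longrightarrow> b \<in> A \<Longrightarrow> a * b \<in> p \<Longrightarrow> a \<in> p \<or> b \<in> p"
  using assms by (auto simp: pideal_def)

lemma chain_least:
  assumes "finite C" "chain\<^sub>\<subseteq> C" "C \<noteq> {}"
  shows "\<exists>p\<in>C. \<forall>q\<in>C - {p}. p \<subset> q"
proof -
  obtain p where p: "p \<in> C" "\<forall>q\<in>C. q \<subseteq> p \<longrightarrow> p = q" using finite_has_minimal[OF assms(1,3)] by blast
  then show ?thesis using assms(2) unfolding chain_subset_def by blast
qed

lemma chain_five:
  assumes "finite C" "chain\<^sub>\<subseteq> C" "card C \<ge> 5"
  shows "\<exists>p0\<in>C. \<exists>p1\<in>C. \<exists>p2\<in>C. \<exists>p3\<in>C. \<exists>p4\<in>C. p0 \<subset> p1 \<and> p1 \<subset> p2 \<and> p2 \<subset> p3 \<and> p3 \<subset> p4"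
proof -
  have step: "\<exists>p\<in>D. \<exists>D'. finite D' \<and> chain\<^sub>\<subseteq> D' \<and> D' \<subseteq> D \<and> card D' \<ge> n \<and> (\<forall>q\<in>D'. p \<subset> q)"
    if D: "finite D" "chain\<^sub>\<subseteq> D" "card D \<ge> Suc n" for D :: "'a set set" and n
  proof -
    have "D \<noteq> {}" using D by auto
    then obtain p where p: "p \<in> D" "\<forall>q\<in>D - {p}. p \<subset> q" using chain_least D by blast
    have "card (D - {p}) \<ge> n" using p D by simp
    moreover have "chain\<^sub>\<subseteq> (D - {p})" using D(2) unfolding chain_subset_def by blast
    ultimately show ?thesis using p D(1) by (intro bexI[of _ p] exI[of _ "D - {p}"]) auto
  qed
  have c5: "card C \<ge> Suc 4" using assms(3) by simp
  obtain p0 D0 where p0: "p0 \<in> C" "finite D0" "chain\<^sub>\<subseteq> D0" "D0 \<subseteq> C" "card D0 \<ge> 4" "\<forall>q\<in>D0. p0 \<subset> q"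
    using step[OF assms(1,2) c5] by blast
  have c4: "card D0 \<ge> Suc 3" using p0(5) by simp
  obtain p1 D1 where p1: "p1 \<in> D0" "finite D1" "chain\<^sub>\<subseteq> D1" "D1 \<subseteq> D0" "card D1 \<ge> 3" "\<forall>q\<in>D1. p1 \<subset> q"
    using step[OF p0(2,3) c4] by blast
  have c3: "card D1 \<ge> Suc 2" using p1(5) by simp
  obtain p2 D2 where p2: "p2 \<in> D1" "finite D2" "chain\<^sub>\<subseteq> D2" "D2 \<subseteq> D1" "card D2 \<ge> 2" "\<forall>q\<in>D2. p2 \<subset> q"
    using step[OF p1(2,3) c3] by blast
  have c2: "card D2 \<ge> Suc 1" using p2(5) by simp
  obtain p3 D3 where p3: "p3 \<in> D2" "finite D3" "chain\<^sub>\<subseteq> D3" "D3 \<subseteq> D2" "card D3 \<ge> 1" "\<forall>q\<in>D3. p3 \<subset> q"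
    using step[OF p2(2,3) c2] by blast
  obtain p4 where p4: "p4 \<in> D3" using p3(5) by fastforce
  have mem: "p1 \<in> C" "p2 \<in> C" "p3 \<in> C" "p4 \<in> C" using p0(4) p1(1,4) p2(1,4) p3(1,4) p4 by blast+
  have "p0 \<subset> p1" "p1 \<subset> p2" "p2 \<subset> p3" "p3 \<subset> p4"
    using p0(6) p1(1,6) p2(1,6) p3(1,6) p4 by simp_all
  then show ?thesis
    by (intro bexI[OF _ p0(1)] bexI[OF _ mem(1)] bexI[OF _ mem(2)] bexI[OF _ mem(3)] bexI[OF _ mem(4)] conjI)
qed

text \<open>One variable of the argument of Coquand and Lombardi: an algebraic relation between the members
  of a chain of primes is peeled off lowest term by lowest term.\<close>

lemma lowest_coefficient_step:
  assumes S: "subr S" and p: "pideal p S" "pideal p' S" "p \<subseteq> p'" and x: "x \<in> p'" "x \<notin> p"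
    and g: "\<And>k. g k \<in> S" "k0 \<le> m" "\<And>k. k < k0 \<Longrightarrow> g k = 0" and sum: "(\<Sum>k\<le>m. g k * x ^ k) \<in> p"
  shows "g k0 \<in> p'"
proof -
  have xS: "x \<in> S" using x p by (auto simp: pideal_def)
  \<comment> \<open>The sum is \<open>x ^ k0 * (g k0 + x * r)\<close>; no power of \<open>x\<close>
    lies in \<open>p\<close>, so the second factor does.\<close>
  define r where "r = (\<Sum>k\<in>{Suc k0..m}. g k * x ^ (k - Suc k0))"
  have rS: "r \<in> S" unfolding r_def using g xS by (intro subr_sum[OF S] subr_mult[OF S] subr_power[OF S]) auto
  have "(\<Sum>k\<le>m. g k * x ^ k) = (\<Sum>k\<in>{k0..m}. g k * x ^ k)"
    using g(3) by (intro sum.mono_neutral_right) auto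
  also have "\<dots> = g k0 * x ^ k0 + (\<Sum>k\<in>{Suc k0..m}. g k * x ^ k)"
    using g(2) by (simp add: sum.atLeast_Suc_atMost)
  also have "(\<Sum>k\<in>{Suc k0..m}. g k * x ^ k) = (\<Sum>k\<in>{Suc k0..m}. x ^ Suc k0 * (g k * x ^ (k - Suc k0)))"
    by (intro sum.cong) (auto simp: power_add[symmetric] mult.left_commute simp del: power_Suc)
  also have "\<dots> = x ^ k0 * (x * r)" by (simp add: r_def sum_distrib_left mult_ac)
  finally have eq: "(\<Sum>k\<le>m. g k * x ^ k) = x ^ k0 * (g k0 + x * r)" by (simp add: algebra_simps)
  have "x ^ n \<notin> p" for n
  proof (induction n)
    case (Suc n)
    then show ?case using pidealD(6)[OF p(1) xS subr_power[OF S xS, of n]] x(2) by auto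
  qed (use p in \<open>simp add: pideal_def\<close>)
  moreover have "g k0 + x * r \<in> S" "x ^ k0 \<in> S" using g rS xS subr_add[OF S] subr_mult[OF S] subr_power[OF S] by blast+
  ultimately have "g k0 + x * r \<in> p" using sum pidealD(6)[OF p(1)] unfolding eq by blast
  then have 1: "g k0 + x * r \<in> p'" using p by blast
  have 2: "- r * x \<in> p'" by (rule pidealD(5)[OF p(2) subr_uminus[OF S rS] x(1)])
  have "(g k0 + x * r) + (- r * x) \<in> p'" by (rule pidealD(4)[OF p(2) 1 2])
  then show ?thesis by (simp add: mult.commute)
qed

section \<open>Krull dimension and codimension one points of a chart\<close>

context chart
begin

interpretation V: vector_space cplx_scale
  by unfold_locales (auto simp: cplx_scale_def algebra_simps of_cplx_add of_cplx_mult)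

text \<open>The degree is bounded in each coordinate separately, so that the size grows like the
  cube of \<open>D\<close>.\<close>

definition G :: "nat \<Rightarrow> 'k set" where
  "G D = (\<lambda>(a, b, c, m). y1 ^ a * y2 ^ b * y3 ^ c * m) ` ({..D} \<times> {..D} \<times> {..D} \<times> M)"

definition Z :: "nat \<Rightarrow> 'k set" where "Z D = V.span (G D)"

lemma G_fin: "finite (G D)" "card (G D) \<le> (D + 1) ^ 3 * card M"
proof -
  show "finite (G D)" unfolding G_def using M(1) by auto
  have "card (G D) \<le> card ({..D} \<times> {..D} \<times> {..D} \<times> M)" unfolding G_def using M(1) by (intro card_image_le) auto
  then show "card (G D) \<le> (D + 1) ^ 3 * card M" by (simp add: card_cartesian_product power3_eq_cube algebra_simps)
qed

lemma Z_mono: "D \<le> D' \<Longrightarrow> Z D \<subseteq> Z D'"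
  unfolding Z_def G_def by (intro V.span_mono image_mono Sigma_mono) auto

lemma Z_scale: "z \<in> Z D \<Longrightarrow> of_cplx c * z \<in> Z D"
  unfolding Z_def using V.span_scale[of z _ c] by (simp add: cplx_scale_def)

lemma Z_add: "z \<in> Z D \<Longrightarrow> w \<in> Z D \<Longrightarrow> z + w \<in> Z D"
  unfolding Z_def by (rule V.span_add)

lemma Z_sum: "(\<And>i. i \<in> I \<Longrightarrow> f i \<in> Z D) \<Longrightarrow> sum f I \<in> Z D"
  unfolding Z_def by (rule V.span_sum)

lemma Z_mult_gen:
  assumes "\<And>z. z \<in> G D \<Longrightarrow> x * z \<in> Z D'" "z \<in> Z D"
  shows "x * z \<in> Z D'"
  using assms(2) unfolding Z_def
proof (induction rule: V.span_induct_alt)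
  case base show ?case by (simp add: V.span_zero)
next
  case (step c g z)
  have "x * (cplx_scale c g + z) = of_cplx c * (x * g) + x * z" by (simp add: cplx_scale_def algebra_simps)
  then show ?case using Z_scale[OF assms(1)[OF step(1)], of c] step(2) Z_add unfolding Z_def by metis
qed

lemma Z_mult_y:
  assumes "a \<le> e" "b \<le> e" "c \<le> e" "z \<in> Z D"
  shows "y1 ^ a * y2 ^ b * y3 ^ c * z \<in> Z (D + e)"
proof (rule Z_mult_gen[OF _ assms(4)])
  fix g assume "g \<in> G D"
  then obtain a' b' c' m where g: "g = y1 ^ a' * y2 ^ b' * y3 ^ c' * m" "a' \<le> D" "b' \<le> D" "c' \<le> D" "m \<in> M"
    by (auto simp: G_def)
  have "y1 ^ a * y2 ^ b * y3 ^ c * g = y1 ^ (a' + a) * y2 ^ (b' + b) * y3 ^ (c' + c) * m"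
    by (simp add: g(1) power_add mult_ac)
  moreover have "\<dots> \<in> G (D + e)" using g assms unfolding G_def
    by (intro image_eqI[of _ _ "(a' + a, b' + b, c' + c, m)"]) auto
  ultimately show "y1 ^ a * y2 ^ b * y3 ^ c * g \<in> Z (D + e)" unfolding Z_def using V.span_base by metis
qed

text \<open>The shift \<open>E\<close> depends on \<open>f\<close> but not on \<open>D\<close>;
  therefore repeated multiplication raises the degree only linearly.\<close>

lemma Z_mult_ev: "\<exists>E. \<forall>D. \<forall>z\<in>Z D. ev f * z \<in> Z (D + E)"
proof (induction f rule: p3_induct)
  case (C c)
  show ?case using Z_scale by (intro exI[of _ 0]) auto
next
  case T1
  show ?case using Z_mult_y[of 1 1 0 0] by (intro exI[of _ 1]) auto
next
  case T2
  show ?case using Z_mult_y[of 0 1 1 0] by (intro exI[of _ 1]) auto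
next
  case T3
  show ?case using Z_mult_y[of 0 1 0 1] by (intro exI[of _ 1]) auto
next
  case (add f g)
  then obtain E F where EF: "\<forall>D. \<forall>z\<in>Z D. ev f * z \<in> Z (D + E)" "\<forall>D. \<forall>z\<in>Z D. ev g * z \<in> Z (D + F)" by blast
  have "ev (f + g) * z \<in> Z (D + (E + F))" if "z \<in> Z D" for D z
  proof -
    have "ev f * z \<in> Z (D + (E + F))" "ev g * z \<in> Z (D + (E + F))"
      using that EF Z_mono[of "D + E" "D + (E + F)"] Z_mono[of "D + F" "D + (E + F)"] by auto
    then show ?thesis using Z_add by (simp add: distrib_right)
  qed
  then show ?case by blast
next
  case (mult f g)
  then obtain E F where EF: "\<forall>D. \<forall>z\<in>Z D. ev f * z \<in> Z (D + E)" "\<forall>D. \<forall>z\<in>Z D. ev g * z \<in> Z (D + F)" by blast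
  have "ev (f * g) * z \<in> Z (D + (F + E))" if "z \<in> Z D" for D z
  proof -
    have "ev f * (ev g * z) \<in> Z (D + F + E)" using that EF by blast
    then show ?thesis by (simp add: mult.assoc add.assoc)
  qed
  then show ?case by blast
qed

lemma M_Z: "m \<in> M \<Longrightarrow> m \<in> Z 0"
  unfolding Z_def G_def by (rule V.span_base) (auto intro!: image_eqI[of _ _ "(0, 0, 0, m)"])

lemma B_Z: assumes "b \<in> B" shows "\<exists>E. b \<in> Z E"
proof -
  obtain c where c: "\<forall>m\<in>M. c m \<in> A" "b = (\<Sum>m\<in>M. c m * m)" using B_gen[OF assms] by blast
  have "\<forall>m\<in>M. \<exists>E. c m * m \<in> Z E"
  proof
    fix m assume m: "m \<in> M"
    then obtain f where "c m = ev f" using c(1) by (auto simp: A_def)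
    then show "\<exists>E. c m * m \<in> Z E" using Z_mult_ev[of f] M_Z[OF m] by (metis add_0)
  qed
  then obtain E where E: "\<forall>m\<in>M. c m * m \<in> Z (E m)" by metis
  have k: "c m * m \<in> Z (\<Sum>m\<in>M. E m)" if "m \<in> M" for m
    using E that Z_mono[of "E m" "\<Sum>m\<in>M. E m"] member_le_sum[OF that _ M(1), of E] by auto
  show ?thesis unfolding c(2) by (intro exI[of _ "\<Sum>m\<in>M. E m"] Z_sum k)
qed

lemma Z_mult_B: assumes "b \<in> B" shows "\<exists>E. \<forall>D. \<forall>z\<in>Z D. b * z \<in> Z (D + E)"
proof -
  have "\<forall>m\<in>M. \<exists>E. b * m \<in> Z E" using B_Z assms M(2) subr_mult[OF B_subr] by blast
  then obtain E where E: "\<forall>m\<in>M. b * m \<in> Z (E m)" by metis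
  define F where "F = (\<Sum>m\<in>M. E m)"
  have bm: "b * m \<in> Z F" if "m \<in> M" for m
    using E that Z_mono[of "E m" F] member_le_sum[OF that _ M(1), of E] by (auto simp: F_def)
  have "b * z \<in> Z (D + F)" if "z \<in> Z D" for D z
  proof (rule Z_mult_gen[OF _ that])
    fix g assume "g \<in> G D"
    then obtain a' b' c' m where g: "g = y1 ^ a' * y2 ^ b' * y3 ^ c' * m" "a' \<le> D" "b' \<le> D" "c' \<le> D" "m \<in> M"
      by (auto simp: G_def)
    have eq: "b * g = y1 ^ a' * y2 ^ b' * y3 ^ c' * (b * m)" by (simp add: g(1) mult_ac)
    show "b * g \<in> Z (D + F)" unfolding eq add.commute[of D F] by (rule Z_mult_y[OF g(2,3,4) bm[OF g(5)]])
  qed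
  then show ?thesis by blast
qed

lemma Z_mult_power:
  assumes "\<forall>D. \<forall>z\<in>Z D. b * z \<in> Z (D + e)" "z \<in> Z D"
  shows "b ^ n * z \<in> Z (D + n * e)"
proof (induction n)
  case (Suc n)
  have "b * (b ^ n * z) \<in> Z (D + n * e + e)" using assms(1) Suc by blast
  then show ?case by (simp add: mult.assoc add_ac)
qed (use assms in simp)

text \<open>There are more monomials of bounded degree in four elements than the dimension of a space
  containing these monomials.\<close>

lemma algebraic_dependence:
  assumes x: "x0 \<in> B" "x1 \<in> B" "x2 \<in> B" "x3 \<in> B"
  shows "\<exists>(c :: nat \<times> nat \<times> nat \<times> nat \<Rightarrow> complex) m. (\<exists>\<alpha>\<in>{..m} \<times> {..m} \<times> {..m} \<times> {..m}. c \<alpha> \<noteq> 0) \<and>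
     (\<Sum>(i, j, k, l)\<in>{..m} \<times> {..m} \<times> {..m} \<times> {..m}. of_cplx (c (i, j, k, l)) * (x0 ^ i * x1 ^ j * x2 ^ k * x3 ^ l)) = 0"
proof -
  obtain E0 E1 E2 E3 where E: "\<forall>D. \<forall>z\<in>Z D. x0 * z \<in> Z (D + E0)" "\<forall>D. \<forall>z\<in>Z D. x1 * z \<in> Z (D + E1)"
    "\<forall>D. \<forall>z\<in>Z D. x2 * z \<in> Z (D + E2)" "\<forall>D. \<forall>z\<in>Z D. x3 * z \<in> Z (D + E3)"
    using Z_mult_B[OF x(1)] Z_mult_B[OF x(2)] Z_mult_B[OF x(3)] Z_mult_B[OF x(4)] by blast
  obtain F where F: "1 \<in> Z F" using B_Z[OF subr_1[OF B_subr]] by blast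
  define e where "e = F + E0 + E1 + E2 + E3 + 1"
  \<comment> \<open>With this \<open>m\<close> the (m + 1)^4 monomials outnumber the at most m (m +
    1)^3 generators of a space that contains them.\<close>
  define m where "m = card M * (e + 1) ^ 3"
  define mono where "mono = (\<lambda>(i, j, k, l). x0 ^ i * x1 ^ j * x2 ^ k * x3 ^ l)"
  define Box where "Box = {..m} \<times> {..m} \<times> {..m} \<times> {..m}"
  have mono: "mono \<alpha> \<in> Z (e * (m + 1))" if \<alpha>: "\<alpha> \<in> Box" for \<alpha>
  proof -
    obtain i j k l where ijkl: "\<alpha> = (i, j, k, l)" "i \<le> m" "j \<le> m" "k \<le> m" "l \<le> m" using \<alpha> by (auto simp: Box_def)
    have "x0 ^ i * (x1 ^ j * (x2 ^ k * (x3 ^ l * 1))) \<in> Z (F + l * E3 + k * E2 + j * E1 + i * E0)"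
      by (intro Z_mult_power E F)
    moreover have "F + l * E3 + k * E2 + j * E1 + i * E0 \<le> e * (m + 1)"
    proof -
      have "l * E3 + k * E2 + j * E1 + i * E0 \<le> m * E3 + m * E2 + m * E1 + m * E0"
        by (intro add_mono mult_le_mono1 ijkl)
      moreover have "e * (m + 1) = F + (m * E3 + m * E2 + m * E1 + m * E0) + (m * F + E0 + E1 + E2 + E3 + 1 + m)"
        by (simp add: e_def algebra_simps)
      ultimately show ?thesis by linarith
    qed
    ultimately have "x0 ^ i * (x1 ^ j * (x2 ^ k * (x3 ^ l * 1))) \<in> Z (e * (m + 1))" using Z_mono by blast
    then show ?thesis by (simp add: mono_def ijkl mult.assoc)
  qed
  have "card (G (e * (m + 1))) \<le> (e * (m + 1) + 1) ^ 3 * card M" by (rule G_fin)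
  also have "\<dots> \<le> ((e + 1) * (m + 1)) ^ 3 * card M" by (intro mult_le_mono1 power_mono) auto
  also have "\<dots> = (card M * (e + 1) ^ 3) * (m + 1) ^ 3" by (simp only: power_mult_distrib mult_ac)
  also have "\<dots> = m * (m + 1) ^ 3" unfolding m_def[symmetric] ..
  also have "\<dots> < (m + 1) * (m + 1) ^ 3" by (rule mult_strict_right_mono) simp_all
  also have "\<dots> = card Box" by (simp add: Box_def card_cartesian_product power3_eq_cube)
  finally have card: "card (G (e * (m + 1))) < card Box" .
  have finBox: "finite Box" by (simp add: Box_def)
  have "\<exists>c. (\<exists>\<alpha>\<in>Box. c \<alpha> \<noteq> 0) \<and> (\<Sum>\<alpha>\<in>Box. of_cplx (c \<alpha>) * mono \<alpha>) = 0"
  proof (cases "inj_on mono Box")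
    case False
    then obtain \<alpha> \<beta> where ab: "\<alpha> \<in> Box" "\<beta> \<in> Box" "\<alpha> \<noteq> \<beta>" "mono \<alpha> = mono \<beta>" unfolding inj_on_def by blast
    define c where "c \<gamma> = (if \<gamma> = \<alpha> then 1 else 0) - (if \<gamma> = \<beta> then 1 else (0::complex))" for \<gamma>
    have "of_cplx (c \<gamma>) * mono \<gamma> = (if \<gamma> = \<alpha> then mono \<gamma> else 0) - (if \<gamma> = \<beta> then mono \<gamma> else 0)" for \<gamma>
      by (auto simp: c_def of_cplx_uminus)
    then have "(\<Sum>\<gamma>\<in>Box. of_cplx (c \<gamma>) * mono \<gamma>) = 0"
      using ab finBox by (simp add: sum_subtractf)
    moreover have "c \<alpha> \<noteq> 0" using ab by (simp add: c_def)
    ultimately show ?thesis using ab by blast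
  next
    case True
    have "mono ` Box \<subseteq> V.span (G (e * (m + 1)))" using mono unfolding Z_def by blast
    moreover have "card (mono ` Box) = card Box" using True by (rule card_image)
    ultimately have "\<not> V.independent (mono ` Box)"
      using V.independent_span_bound[OF G_fin(1), of "mono ` Box" "e * (m + 1)"] card by linarith
    then obtain u where u: "\<exists>v\<in>mono ` Box. u v \<noteq> 0" "(\<Sum>v\<in>mono ` Box. cplx_scale (u v) v) = 0"
      using V.dependent_finite[of "mono ` Box"] finBox by auto
    have "(\<Sum>\<alpha>\<in>Box. of_cplx (u (mono \<alpha>)) * mono \<alpha>) = 0"
      using u(2) sum.reindex[OF True, of "\<lambda>v. cplx_scale (u v) v"] by (simp add: cplx_scale_def)
    then show ?thesis using u(1) by (intro exI[of _ "\<lambda>\<alpha>. u (mono \<alpha>)"]) auto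
  qed
  then obtain c where c: "\<exists>\<alpha>\<in>Box. c \<alpha> \<noteq> 0" "(\<Sum>\<alpha>\<in>Box. of_cplx (c \<alpha>) * mono \<alpha>) = 0" by blast
  have "(\<Sum>\<alpha>\<in>Box. of_cplx (c \<alpha>) * mono \<alpha>) = (\<Sum>(i, j, k, l)\<in>Box. of_cplx (c (i, j, k, l)) * (x0 ^ i * x1 ^ j * x2 ^ k * x3 ^ l))"
    by (rule sum.cong) (auto simp: mono_def)
  then have "(\<Sum>(i, j, k, l)\<in>Box. of_cplx (c (i, j, k, l)) * (x0 ^ i * x1 ^ j * x2 ^ k * x3 ^ l)) = 0"
    using c(2) by (rule subst)
  with c(1) show ?thesis unfolding Box_def by (intro exI[of _ c] exI[of _ m] conjI)
qed

end

context chart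
begin

text \<open>Pick an element of \<open>B\<close> in each prime of the chain but not in the one
  before. Four such elements satisfy a polynomial relation; starting from its lexicographically
  least exponent, one variable is peeled off at each step of the chain, until a nonzero constant
  lies in the last prime.\<close>

lemma no_chain_of_five:
  assumes q: "pideal q B"
  defines "S \<equiv> localization B q"
  assumes p: "pideal p0 S" "pideal p1 S" "pideal p2 S" "pideal p3 S" "pideal p4 S"
    and sub: "p0 \<subset> p1" "p1 \<subset> p2" "p2 \<subset> p3" "p3 \<subset> p4"
  shows False
proof -
  note S = loc_subr(1)[OF q, folded S_def]
  have BS: "B \<subseteq> S" using loc_subr(2)[OF q] by (simp add: S_def)
  have pick: "\<exists>x\<in>B. x \<in> p' \<and> x \<notin> p" if pp: "pideal p S" "pideal p' S" "p \<subset> p'" for p p'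
  proof -
    obtain x where x: "x \<in> p'" "x \<notin> p" using pp by blast
    then have "x \<in> S" using pidealD(1)[OF pp(2)] by blast
    then obtain b s where bs: "x = b / s" "b \<in> B" "s \<in> B - q" by (auto simp: S_def localization_def)
    have "unit_in S s" unfolding S_def using localization_subr(3)[OF B_subr q bs(3)] .
    then have s: "s \<in> S" "s \<noteq> 0" "inverse s \<in> S" by (auto simp: unit_in_def)
    have b: "b = s * x" and b': "x = inverse s * b" using bs s by (auto simp: field_simps)
    have "b \<in> p'" unfolding b by (rule pidealD(5)[OF pp(2) s(1) x(1)])
    moreover have "b \<notin> p"
    proof
      assume "b \<in> p"
      then have "inverse s * b \<in> p" by (rule pidealD(5)[OF pp(1) s(3)])
      then show False using x(2) unfolding b' by blast
    qed
    ultimately show ?thesis using bs by blast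
  qed
  obtain x0 x1 x2 x3 where x: "x0 \<in> B" "x0 \<in> p1" "x0 \<notin> p0" "x1 \<in> B" "x1 \<in> p2" "x1 \<notin> p1"
      "x2 \<in> B" "x2 \<in> p3" "x2 \<notin> p2" "x3 \<in> B" "x3 \<in> p4" "x3 \<notin> p3"
    using pick[OF p(1,2) sub(1)] pick[OF p(2,3) sub(2)] pick[OF p(3,4) sub(3)] pick[OF p(4,5) sub(4)] by blast
  obtain c m where c: "\<exists>\<alpha>\<in>{..m} \<times> {..m} \<times> {..m} \<times> {..m}. c \<alpha> \<noteq> (0::complex)"
     "(\<Sum>(i, j, k, l)\<in>{..m} \<times> {..m} \<times> {..m} \<times> {..m}. of_cplx (c (i, j, k, l)) * (x0 ^ i * x1 ^ j * x2 ^ k * x3 ^ l)) = 0"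
    using algebraic_dependence[OF x(1,4,7,10)] by blast
  define g3 :: "nat \<Rightarrow> nat \<Rightarrow> nat \<Rightarrow> nat \<Rightarrow> 'k" where
    "g3 i j k l = of_cplx (if i \<le> m \<and> j \<le> m \<and> k \<le> m \<and> l \<le> m then c (i, j, k, l) else 0)" for i j k l
  define g2 where "g2 i j k = (\<Sum>l\<le>m. g3 i j k l * x3 ^ l)" for i j k
  define g1 where "g1 i j = (\<Sum>k\<le>m. g2 i j k * x2 ^ k)" for i j
  define g0 where "g0 i = (\<Sum>j\<le>m. g1 i j * x1 ^ j)" for i
  have xS: "x0 \<in> S" "x1 \<in> S" "x2 \<in> S" "x3 \<in> S" using x BS by auto
  have gS3: "g3 i j k l \<in> S" for i j k l unfolding g3_def using const_B BS by blast
  have gS2: "g2 i j k \<in> S" for i j k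
    unfolding g2_def by (intro subr_sum[OF S] subr_mult[OF S] subr_power[OF S] gS3 xS)
  have gS1: "g1 i j \<in> S" for i j
    unfolding g1_def by (intro subr_sum[OF S] subr_mult[OF S] subr_power[OF S] gS2 xS)
  have gS0: "g0 i \<in> S" for i
    unfolding g0_def by (intro subr_sum[OF S] subr_mult[OF S] subr_power[OF S] gS1 xS)
  have "(\<Sum>i\<le>m. g0 i * x0 ^ i) = (\<Sum>i\<le>m. \<Sum>j\<le>m. \<Sum>k\<le>m. \<Sum>l\<le>m. of_cplx (c (i, j, k, l)) * (x0 ^ i * x1 ^ j * x2 ^ k * x3 ^ l))"
    unfolding g0_def g1_def g2_def g3_def sum_distrib_right
    by (intro sum.cong refl) (simp add: mult_ac)
  also have "\<dots> = 0" using c(2) by (simp add: sum.cartesian_product)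
  finally have sum0: "(\<Sum>i\<le>m. g0 i * x0 ^ i) \<in> p0" using pidealD(2)[OF p(1)] by simp
  define i where "i = (LEAST i. \<exists>j k l. g3 i j k l \<noteq> 0)"
  define j where "j = (LEAST j. \<exists>k l. g3 i j k l \<noteq> 0)"
  define k where "k = (LEAST k. \<exists>l. g3 i j k l \<noteq> 0)"
  define l where "l = (LEAST l. g3 i j k l \<noteq> 0)"
  have "\<exists>i j k l. g3 i j k l \<noteq> 0" using c(1) by (auto simp: g3_def)
  then have i1: "\<exists>j k l. g3 i j k l \<noteq> 0" unfolding i_def by (rule LeastI_ex)
  then have j1: "\<exists>k l. g3 i j k l \<noteq> 0" unfolding j_def by (rule LeastI_ex)
  then have k1: "\<exists>l. g3 i j k l \<noteq> 0" unfolding k_def by (rule LeastI_ex)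
  then have l1: "g3 i j k l \<noteq> 0" unfolding l_def by (rule LeastI_ex)
  then have le: "i \<le> m" "j \<le> m" "k \<le> m" "l \<le> m" by (auto simp: g3_def split: if_splits)
  have i2: "g3 i' j' k' l' = 0" if "i' < i" for i' j' k' l' using not_less_Least[OF that[unfolded i_def]] by blast
  have j2: "g3 i j' k' l' = 0" if "j' < j" for j' k' l' using not_less_Least[OF that[unfolded j_def]] by blast
  have k2: "g3 i j k' l' = 0" if "k' < k" for k' l' using not_less_Least[OF that[unfolded k_def]] by blast
  have l2: "g3 i j k l' = 0" if "l' < l" for l' using not_less_Least[OF that[unfolded l_def]] by blast
  have "g0 i \<in> p1"
    by (rule lowest_coefficient_step[OF S p(1,2) _ x(2,3) gS0 le(1) _ sum0])
      (use sub(1) in \<open>auto simp: g0_def g1_def g2_def i2\<close>)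
  then have "g1 i j \<in> p2"
    unfolding g0_def by (intro lowest_coefficient_step[OF S p(2,3) _ x(5,6) gS1 le(2)])
      (use sub(2) in \<open>auto simp: g1_def g2_def j2\<close>)
  then have "g2 i j k \<in> p3"
    unfolding g1_def by (intro lowest_coefficient_step[OF S p(3,4) _ x(8,9) gS2 le(3)])
      (use sub(3) in \<open>auto simp: g2_def k2\<close>)
  then have "g3 i j k l \<in> p4"
    unfolding g2_def by (intro lowest_coefficient_step[OF S p(4,5) _ x(11,12) gS3 le(4)])
      (use sub(4) in \<open>auto simp: l2\<close>)
  moreover have "inverse (g3 i j k l) \<in> S"
    unfolding g3_def of_cplx_inverse[symmetric] using const_B BS by blast
  ultimately have "inverse (g3 i j k l) * g3 i j k l \<in> p4" using pidealD(5)[OF p(5)] by blast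
  then show False using l1 pidealD(3)[OF p(5)] by simp
qed

text \<open>A supremum of naturals bounds the members of the set only if the set is bounded, which
  \<open>no_chain_of_five\<close> ensures.\<close>

lemma krull_dim_ge:
  assumes q: "pideal q B"
  defines "S \<equiv> localization B q"
  assumes C: "finite C" "\<forall>p\<in>C. pideal p S" "chain\<^sub>\<subseteq> C"
  shows "card C - 1 \<le> krull_dim S"
proof -
  note S = loc_subr(1)[OF q, folded S_def]
  let ?N = "{card C - 1 | C. finite C \<and> (\<forall>p\<in>C. primeideal p (sub S)) \<and> chain\<^sub>\<subseteq> C}"
  have "card D - 1 \<le> 4" if D: "finite D" "\<forall>p\<in>D. pideal p S" "chain\<^sub>\<subseteq> D" for D
  proof (rule ccontr)
    assume "\<not> card D - 1 \<le> 4"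
    then have "card D \<ge> 5" by simp
    then obtain p0 p1 p2 p3 p4 where "p0 \<in> D" "p1 \<in> D" "p2 \<in> D" "p3 \<in> D" "p4 \<in> D" "p0 \<subset> p1" "p1 \<subset> p2" "p2 \<subset> p3" "p3 \<subset> p4"
      using chain_five[OF D(1,3)] by metis
    then show False using no_chain_of_five[OF q, folded S_def, of p0 p1 p2 p3 p4] D(2) by metis
  qed
  then have "bdd_above ?N" unfolding primeideal_iff[OF S] by (intro bdd_aboveI[of _ 4]) blast
  moreover have "card C - 1 \<in> ?N" using C unfolding primeideal_iff[OF S] by blast
  ultimately show ?thesis unfolding krull_dim_def by (rule cSup_upper[rotated])
qed

lemma krull_dim_field: "krull_dim (UNIV :: 'k set) = 0"
proof -
  have U: "subr (UNIV :: 'k set)" by (simp add: subr_def)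
  have pr: "p = {0}" if p: "pideal p (UNIV :: 'k set)" for p
  proof -
    have "x = 0" if "x \<in> p" for x
    proof (rule ccontr)
      assume "x \<noteq> 0"
      then show False using pidealD(5)[OF p _ that, of "inverse x"] pidealD(3)[OF p] by simp
    qed
    then show ?thesis using pidealD(2)[OF p] by blast
  qed
  have "{card C - 1 | C. finite C \<and> (\<forall>p\<in>C. primeideal p (sub (UNIV :: 'k set))) \<and> chain\<^sub>\<subseteq> C} = {0}"
  proof (intro equalityI subsetI)
    fix n assume "n \<in> {card C - 1 | C. finite C \<and> (\<forall>p\<in>C. primeideal p (sub (UNIV :: 'k set))) \<and> chain\<^sub>\<subseteq> C}"
    then obtain C where C: "n = card C - 1" "\<forall>p\<in>C. pideal p (UNIV :: 'k set)" unfolding primeideal_iff[OF U] by blast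
    then have "C \<subseteq> {{0}}" using pr by blast
    then have "card C \<le> card {{0::'k}}" by (intro card_mono) auto
    then show "n \<in> {0}" using C by simp
  next
    fix n :: nat assume "n \<in> {0}"
    then show "n \<in> {card C - 1 | C. finite C \<and> (\<forall>p\<in>C. primeideal p (sub (UNIV :: 'k set))) \<and> chain\<^sub>\<subseteq> C}"
      by (intro CollectI exI[of _ "{}"]) (auto simp: chain_subset_def)
  qed
  then show ?thesis unfolding krull_dim_def by simp
qed

text \<open>The prime ideal of \<open>x\<close> meets the polynomial ring exactly in the multiples
  of \<open>p\<close>. If \<open>x\<close> divided \<open>ev f\<close> with \<open>p\<close> prime
  to \<open>f\<close>, then after clearing denominators \<open>nonzerodivisor_mod_prime\<close>
  would make \<open>x\<close> a unit.\<close>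

lemma prime_dvd_ev_iff:
  assumes q: "pideal q B" and x: "prime_in (localization B q) x" and p: "prime_elem p" "ev p / x \<in> localization B q"
  shows "ev f / x \<in> localization B q \<longleftrightarrow> p dvd f"
proof
  define P where "P = localization B q"
  note P = loc_subr(1)[OF q, folded P_def]
  have BP: "B \<subseteq> P" using loc_subr(2)[OF q] by (simp add: P_def)
  have evP: "ev g \<in> P" for g using BP ev_B by blast
  note x = x[folded P_def] and p = p[folded P_def]
  have nz: "x \<noteq> 0" "p \<noteq> 0" using prime_inD(2)[OF x] p by auto
  {
    assume "p dvd f"
    then obtain h where "f = p * h" by blast
    then have "ev f / x = (ev p / x) * ev h" by simp
    also have "\<dots> \<in> P" using p BP by (intro subr_mult[OF P]) auto
    finally show "ev f / x \<in> localization B q" by (simp add: P_def)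
  next
    assume fx: "ev f / x \<in> localization B q"
    show "p dvd f"
    proof (rule ccontr)
      assume nd: "\<not> p dvd f"
      obtain b s where bs: "ev p / x = b / s" "b \<in> B" "s \<in> B - q" using p(2) by (auto simp: P_def localization_def)
      obtain c t where ct: "ev f / x = c / t" "c \<in> B" "t \<in> B - q" using fx by (auto simp: localization_def)
      have st: "s \<noteq> 0" "t \<noteq> 0" using bs ct pidealD(2)[OF q] by auto
      have b: "b = ev p * s / x" using bs(1) st nz by (simp add: field_simps)
      have c: "c = ev f * t / x" using ct(1) st nz by (simp add: field_simps)
      have sB: "s \<in> B" "t \<in> B" using bs(3) ct(3) by blast+
      have "ev f * (b * t) / ev p = c * s" using nz by (simp add: b c)
      also have "\<dots> \<in> B" by (rule subr_mult[OF B_subr ct(2) sB(1)])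
      finally have "b * t / ev p \<in> B"
        by (rule nonzerodivisor_mod_prime[OF p(1) nd subr_mult[OF B_subr bs(2) sB(2)]])
      moreover have "b * t / ev p = s * t * inverse x" using nz by (simp add: b divide_inverse mult_ac)
      ultimately have "s * t * inverse x \<in> P" using BP by (metis subsetD)
      moreover have "inverse s \<in> P" "inverse t \<in> P"
        using localization_subr(3)[OF B_subr q] bs ct unfolding P_def[symmetric] unit_in_def by blast+
      ultimately have "inverse s * (inverse t * (s * t * inverse x)) \<in> P" using subr_mult[OF P] by blast
      moreover have "inverse s * (inverse t * (s * t * inverse x)) = inverse x" using st nz by (simp add: field_simps)
      ultimately show False using prime_inD(3)[OF x] by metis
    qed
  }
qed

text \<open>Restricted to polynomials, the valuation at \<open>x\<close> is a multiple of the p-adic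
  one; the factor \<open>v (ev p)\<close> is the ramification index.\<close>

lemma vl_ev:
  assumes q: "pideal q B" and x: "prime_in (localization B q) x" and p: "prime_elem p" "ev p / x \<in> localization B q" and f: "f \<noteq> 0"
  defines "v \<equiv> vl (loc_at (localization B q) x)"
  shows "v (ev f) = int (multiplicity p f) * v (ev p)" "v (ev p) > 0"
proof -
  define P where "P = localization B q"
  note ufd = ufd_loc[OF q, folded P_def] and fr = frac_full_loc[OF q, folded P_def]
  note x = x[folded P_def] and p' = p[folded P_def]
  note S = is_dvr_loc_at[OF ufd fr x]
  have BP: "B \<subseteq> P" using loc_subr(2)[OF q] by (simp add: P_def)
  have evP: "ev g \<in> P" for g using BP ev_B by blast
  have nz: "p \<noteq> 0" using p by auto
  show "v (ev p) > 0"
    unfolding v_def P_def[symmetric] using vl_loc_at_pos_iff[OF ufd fr x evP] nz p' by simp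
  have "\<not> is_unit p" using p(1) by (simp add: prime_elem_def)
  then obtain h where h: "f = p ^ multiplicity p f * h" "\<not> p dvd h"
    using multiplicity_decompose'[of f p] f by metis
  have hx: "ev h / x \<notin> P" using prime_dvd_ev_iff[OF q x[unfolded P_def] p] h(2) by (simp add: P_def)
  have "h \<noteq> 0" using h f by auto
  have "v (ev h) = 0"
    unfolding v_def P_def[symmetric] using vl_unit[OF S loc_at_unit[OF ufd fr x evP hx]] by simp
  moreover have "ev f = ev p ^ multiplicity p f * ev h"
    by (subst h(1)) simp
  ultimately show "v (ev f) = int (multiplicity p f) * v (ev p)"
    unfolding v_def P_def[symmetric] using nz \<open>h \<noteq> 0\<close> by (simp add: vl_mult[OF S] vl_power[OF S])
qed

lemma prime_below:
  assumes q: "pideal q B" and x: "prime_in (localization B q) x" and f: "f \<noteq> 0" "ev f / x \<in> localization B q"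
  shows "\<exists>p. prime_elem p \<and> p dvd f \<and> ev p / x \<in> localization B q"
proof -
  define P where "P = localization B q"
  note P = loc_subr(1)[OF q, folded P_def]
  have BP: "B \<subseteq> P" using loc_subr(2)[OF q] by (simp add: P_def)
  have evP: "ev g \<in> P" for g using BP ev_B by blast
  note x = x[folded P_def]
  have "f \<noteq> 0 \<Longrightarrow> ev f / x \<in> P \<Longrightarrow> \<exists>p. prime_elem p \<and> p dvd f \<and> ev p / x \<in> P" for f
  proof (induction f rule: prime_divisors_induct)
    case (unit f)
    then obtain g where g: "f * g = 1" by (metis dvdE)
    have "ev g * (ev f / x) \<in> P" using unit.prems evP by (intro subr_mult[OF P]) simp_all
    moreover have "ev g * (ev f / x) = ev (f * g) * inverse x" by (simp add: divide_inverse mult_ac)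
    ultimately have "inverse x \<in> P" unfolding g by simp
    then show ?case using prime_inD(3)[OF x] by blast
  next
    case (factor p f)
    have "ev p * ev f / x \<in> P" using factor.prems by simp
    then have "ev p / x \<in> P \<or> ev f / x \<in> P" using x evP unfolding prime_in_def by blast
    then show ?case
    proof
      assume "ev p / x \<in> P" then show ?thesis using factor.hyps by (intro exI[of _ p]) auto
    next
      assume "ev f / x \<in> P"
      then show ?thesis using factor.IH factor.prems by (metis dvd_mult mult_zero_right)
    qed
  qed simp
  then show ?thesis using f by (simp add: P_def)
qed

text \<open>The norm of \<open>b\<close>, the product of its conjugates, is a multiple of
  \<open>b\<close> in \<open>B\<close> that lies in \<open>L\<close>.\<close>

lemma ev_in_ideal:
  assumes q: "pideal q B" and b: "b \<in> q" "b \<noteq> 0"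
  shows "\<exists>f. f \<noteq> 0 \<and> ev f \<in> q"
proof -
  have bB: "b \<in> B" using b pidealD(1)[OF q] by blast
  have fin: "finite (Gal - {id})" using Gal_finite by simp
  define n where "n = (\<Prod>\<sigma>\<in>Gal. \<sigma> b)"
  have nB: "(\<Prod>\<sigma>\<in>Gal - {id}. \<sigma> b) \<in> B" using Gal_B[OF _ bB] by (intro subr_prod[OF B_subr]) auto
  have n: "n = b * (\<Prod>\<sigma>\<in>Gal - {id}. \<sigma> b)"
    unfolding n_def using prod.remove[OF Gal_finite Gal_id, of "\<lambda>\<sigma>. \<sigma> b"] by simp
  have "n \<in> q" unfolding n using pidealD(5)[OF q nB b(1)] by (simp add: mult.commute)
  have "n \<in> L"
  proof (rule fixedI)
    fix \<tau> assume \<tau>: "\<tau> \<in> Gal"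
    have inj: "inj_on ((\<circ>) \<tau>) Gal"
      using auto_inj[OF \<tau>] by (auto simp: inj_on_def fun_eq_iff)
    then have "(\<circ>) \<tau> ` Gal = Gal"
      using Gal_comp[OF \<tau>] Gal_finite by (intro card_subset_eq) (auto simp: card_image)
    then have "(\<Prod>\<sigma>\<in>Gal. \<tau> (\<sigma> b)) = n"
      using prod.reindex[OF inj, of "\<lambda>\<sigma>. \<sigma> b"] by (simp add: comp_def n_def)
    moreover have "\<tau> (\<Prod>\<sigma>\<in>I. \<sigma> b) = (\<Prod>\<sigma>\<in>I. \<tau> (\<sigma> b))" for I
      by (induction I rule: infinite_finite_induct) (auto simp: auto_simps[OF \<tau>])
    ultimately show "\<tau> n = n" by (simp add: n_def)
  qed
  then obtain f where f: "n = ev f" using \<open>n \<in> q\<close> pidealD(1)[OF q] B_Int_L by (auto simp: A_def)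
  have "n \<noteq> 0" unfolding n_def using Gal_finite auto_nz[OF _ b(2)] by (simp add: prod_zero_iff)
  then show ?thesis using f \<open>n \<in> q\<close> by auto
qed

text \<open>Let \<open>x\<close> be a prime factor of a non-unit. The zero ideal, the ideal of
  \<open>x\<close> and the maximal ideal would be a chain of three, so in dimension one the last two
  coincide.\<close>

lemma codim_one_point:
  assumes q: "pideal q B" and kd: "krull_dim (localization B q) = 1"
  shows "\<exists>x. prime_in (localization B q) x \<and> loc_at (localization B q) x = localization B q"
proof -
  define S where "S = localization B q"
  note S = loc_subr(1)[OF q, folded S_def] and ufd = ufd_loc[OF q, folded S_def] and fr = frac_full_loc[OF q, folded S_def]
  note lm = local_max_ideal[OF B_subr q, folded S_def]
  have z: "pideal {0} S" using subr_0[OF S] by (auto simp: pideal_def)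
  have "S \<noteq> UNIV" using kd krull_dim_field by (auto simp: S_def)
  obtain z where z1: "z \<in> S" "z \<noteq> 0" "\<not> unit_in S z"
  proof -
    obtain w where w: "w \<notin> S" using \<open>S \<noteq> UNIV\<close> by blast
    obtain a b where ab: "a \<in> S" "b \<in> S" "b \<noteq> 0" "w = a / b" using fr unfolding frac_full_def by blast
    have "\<not> unit_in S b"
    proof
      assume "unit_in S b"
      then have "a * inverse b \<in> S" using ab subr_mult[OF S] by (auto simp: unit_in_def)
      then show False using w ab by (simp add: divide_inverse)
    qed
    then show ?thesis using ab that by blast
  qed
  obtain u xs where u: "unit_in S u" "\<forall>x\<in>set xs. prime_in S x" "z = u * prod_list xs"
    using ufd z1 unfolding ufd_def by blast
  have "xs \<noteq> []" using u z1 by auto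
  then obtain x where x: "prime_in S x" using u(2) by (cases xs) auto
  define qx where "qx = {a \<in> S. a / x \<in> S}"
  have qx: "pideal qx S" unfolding qx_def by (rule prime_pideal[OF ufd x])
  have "x \<in> qx" "x \<noteq> 0" using prime_inD[OF x] subr_1[OF S] by (auto simp: qx_def)
  have sub: "qx \<subseteq> max_ideal S"
  proof
    fix a assume a: "a \<in> qx"
    have "\<not> unit_in S a"
    proof
      assume "unit_in S a"
      then have "inverse a * a \<in> qx" using pidealD(5)[OF qx _ a, of "inverse a"] by (simp add: unit_in_def)
      then show False using \<open>unit_in S a\<close> pidealD(3)[OF qx] by (simp add: unit_in_def)
    qed
    then show "a \<in> max_ideal S" using lm(3) a pidealD(1)[OF qx] by blast
  qed
  have "qx = max_ideal S"
  proof (rule ccontr)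
    assume ne: "qx \<noteq> max_ideal S"
    have ne2: "{0} \<noteq> qx" "{0} \<noteq> max_ideal S" using \<open>x \<in> qx\<close> \<open>x \<noteq> 0\<close> sub by auto
    have "{0} \<subseteq> qx" using pidealD(2)[OF qx] by blast
    then have ch: "chain\<^sub>\<subseteq> {{0}, qx, max_ideal S}" using sub unfolding chain_subset_def by blast
    have "card {{0}, qx, max_ideal S} - 1 \<le> krull_dim S"
      unfolding S_def by (rule krull_dim_ge[OF q]) (use ch z qx lm(1) in \<open>auto simp: S_def\<close>)
    then show False using ne ne2 kd by (simp add: S_def)
  qed
  have "loc_at S x = S"
  proof
    show "S \<subseteq> loc_at S x" by (rule subset_loc_at[OF ufd fr x])
    show "loc_at S x \<subseteq> S"
    proof
      fix w assume "w \<in> loc_at S x"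
      then obtain a b where ab: "w = a / b" "a \<in> S" "b \<in> S - qx" by (auto simp: loc_at_def localization_def qx_def)
      then have "unit_in S b" using lm(3) \<open>qx = max_ideal S\<close> by blast
      then have "a * inverse b \<in> S" using ab subr_mult[OF S] by (auto simp: unit_in_def)
      then show "w \<in> S" using ab by (simp add: divide_inverse)
    qed
  qed
  then show ?thesis using x by (auto simp: S_def)
qed

text \<open>A localization of a localization of \<open>B\<close> is a localization of
  \<open>B\<close>, at the contracted prime.\<close>

lemma loc_at_is_point:
  assumes q: "pideal q B" and x: "prime_in (localization B q) x"
  shows "\<exists>q'. pideal q' B \<and> loc_at (localization B q) x = localization B q'"
proof -
  define P where "P = localization B q"
  note P = loc_subr(1)[OF q, folded P_def] and ufd = ufd_loc[OF q, folded P_def]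
  have BP: "B \<subseteq> P" using loc_subr(2)[OF q] by (simp add: P_def)
  have evP: "ev g \<in> P" for g using BP ev_B by blast
  note x = x[folded P_def]
  define qx where "qx = {a \<in> P. a / x \<in> P}"
  have qx: "pideal qx P" unfolding qx_def by (rule prime_pideal[OF ufd x])
  define q' where "q' = qx \<inter> B"
  have q': "pideal q' B"
    unfolding pideal_def
  proof (intro conjI ballI impI)
    show "q' \<subseteq> B" by (simp add: q'_def)
    show "0 \<in> q'" using pidealD(2)[OF qx] subr_0[OF B_subr] by (simp add: q'_def)
    show "1 \<notin> q'" using pidealD(3)[OF qx] by (simp add: q'_def)
    show "a + b \<in> q'" if "a \<in> q'" "b \<in> q'" for a b
      using that pidealD(4)[OF qx] subr_add[OF B_subr] by (simp add: q'_def)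
    show "a * b \<in> q'" if "a \<in> B" "b \<in> q'" for a b
      using that pidealD(5)[OF qx, of a b] BP subr_mult[OF B_subr] by (auto simp: q'_def)
    show "a \<in> q' \<or> b \<in> q'" if "a \<in> B" "b \<in> B" "a * b \<in> q'" for a b
      using that pidealD(6)[OF qx, of a b] BP by (auto simp: q'_def)
  qed
  have "loc_at P x = localization B q'"
  proof
    show "localization B q' \<subseteq> loc_at P x"
    proof
      fix w assume "w \<in> localization B q'"
      then obtain a b where "w = a / b" "a \<in> B" "b \<in> B - q'" by (auto simp: localization_def)
      moreover from this have "a \<in> P" "b \<in> P - qx" using BP by (auto simp: q'_def)
      ultimately show "w \<in> loc_at P x" unfolding loc_at_def qx_def[symmetric] localization_def by blast
    qed
    show "loc_at P x \<subseteq> localization B q'"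
    proof
      fix w assume "w \<in> loc_at P x"
      then obtain a b where ab: "w = a / b" "a \<in> P" "b \<in> P - qx"
        unfolding loc_at_def qx_def[symmetric] localization_def by blast
      obtain a1 s where a1: "a = a1 / s" "a1 \<in> B" "s \<in> B - q" using ab by (auto simp: P_def localization_def)
      obtain b1 t where b1: "b = b1 / t" "b1 \<in> B" "t \<in> B - q" using ab by (auto simp: P_def localization_def)
      have u: "unit_in P s" "unit_in P t" using localization_subr(3)[OF B_subr q] a1 b1 by (auto simp: P_def)
      have nz: "s \<noteq> 0" "t \<noteq> 0" using u by (auto simp: unit_in_def)
      have "b1 * s \<notin> qx"
      proof
        assume "b1 * s \<in> qx"
        then have "(inverse t * inverse s) * (b1 * s) \<in> qx"
          using u pidealD(5)[OF qx] subr_mult[OF P] by (simp add: unit_in_def)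
        moreover have "(inverse t * inverse s) * (b1 * s) = b" using b1 nz by (simp add: field_simps)
        ultimately show False using ab by simp
      qed
      then have "b1 * s \<in> B - q'" "a1 * t \<in> B" using a1 b1 subr_mult[OF B_subr] by (auto simp: q'_def)
      moreover have "w = (a1 * t) / (b1 * s)" using ab a1 b1 nz by simp
      ultimately show "w \<in> localization B q'" unfolding localization_def by blast
    qed
  qed
  then show ?thesis using q' by (auto simp: P_def)
qed

text \<open>The key consequence of factoriality: at a point of the cover over \<open>p\<close> the radical of \<open>p\<close> is
  principal, and since it is spanned by eigenvectors it is generated by an eigenvector.\<close>

lemma ex_eigen_radical:
  assumes q: "pideal q B" and p: "prime_elem p" "ev p \<in> q"
  shows "\<exists>w\<in>E. \<forall>x. prime_in (localization B q) x \<longrightarrow>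
    vl (loc_at (localization B q) x) w = (if ev p / x \<in> localization B q then 1 else 0)"
proof -
  define P where "P = localization B q"
  note P = loc_subr(1)[OF q, folded P_def] and ufd = ufd_loc[OF q, folded P_def] and fr = frac_full_loc[OF q, folded P_def]
  note lm = local_max_ideal[OF B_subr q, folded P_def]
  have BP: "B \<subseteq> P" using loc_subr(2)[OF q] by (simp add: P_def)
  have evP: "ev g \<in> P" for g using BP ev_B by blast
  have pnz: "ev p \<noteq> 0" using p by auto
  obtain y n where y: "y \<in> P" "y \<noteq> 0" "y ^ n / ev p \<in> P" "n > 0"
    "\<And>z. z \<in> P \<Longrightarrow> (\<forall>x. prime_in P x \<longrightarrow> ev p / x \<in> P \<longrightarrow> z / x \<in> P) \<Longrightarrow> z / y \<in> P"
    "\<And>x. prime_in P x \<Longrightarrow> vl (loc_at P x) y = (if ev p / x \<in> P then 1 else 0)"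
    using squarefree_part[OF ufd fr evP pnz] by blast
  obtain a b where ab: "y = a / b" "a \<in> B" "b \<in> B - q" using y(1) by (auto simp: P_def localization_def)
  obtain c d where cd: "y ^ n / ev p = c / d" "c \<in> B" "d \<in> B - q" using y(3) by (auto simp: P_def localization_def)
  have nz: "b \<noteq> 0" "d \<noteq> 0" using ab cd pidealD(2)[OF q] by auto
  \<comment> \<open>The radical of \<open>p B\<close>, as the intersection of the primes over
    \<open>p\<close>; in this form it is visibly stable under the Galois group.\<close>
  define V where "V = {z \<in> B. \<forall>q'. pideal q' B \<longrightarrow> ev p \<in> q' \<longrightarrow> z \<in> q'}"
  have pow: "z \<in> q'" if "pideal q' B" "z ^ m \<in> q'" "z \<in> B" for z m q'
    using that(2)
  proof (induction m)
    case 0 then show ?case using pidealD(3)[OF that(1)] by simp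
  next
    case (Suc m) then show ?case using pidealD(6)[OF that(1,3) subr_power[OF B_subr that(3), of m]] by auto
  qed
  \<comment> \<open>\<open>a * d\<close> differs from \<open>y\<close> by the factor
    \<open>b * d\<close>, a unit at \<open>q\<close>, and its n-th power is a multiple of
    \<open>ev p\<close> in \<open>B\<close>. So the local generator is replaced by a global
    element.\<close>
  have adV: "a * d \<in> V"
    unfolding V_def
  proof (intro CollectI conjI allI impI)
    show ad: "a * d \<in> B" using ab cd subr_mult[OF B_subr] by blast
    fix q' assume q': "pideal q' B" "ev p \<in> q'"
    have yn: "y ^ n = ev p * c / d" using cd(1) pnz nz by (simp add: field_simps)
    have "a = y * b" using ab nz by simp
    then have "a ^ n * d = ev p * (c * b ^ n)" using yn nz by (simp add: power_mult_distrib field_simps)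
    then have "(a * d) ^ n = (c * b ^ n * d ^ (n - 1)) * ev p"
      using y(4) by (cases n) (simp_all add: power_mult_distrib mult_ac)
    moreover have "c * b ^ n * d ^ (n - 1) \<in> B" using ab cd by (intro subr_mult[OF B_subr] subr_power[OF B_subr]) auto
    ultimately have "(a * d) ^ n \<in> q'" using pidealD(5)[OF q'(1) _ q'(2)] by metis
    then show "a * d \<in> q'" using pow[OF q'(1)] ad by blast
  qed
  have "\<exists>ws. set ws \<subseteq> V \<inter> E \<and> a * d = sum_list ws"
  proof (rule eigen_decomposition[OF _ _ _ _ adV])
    show "z + z' \<in> V" if "z \<in> V" "z' \<in> V" for z z'
      using that subr_add[OF B_subr] pidealD(4) unfolding V_def by blast
    show "of_cplx c * z \<in> V" if "z \<in> V" for c z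
      using that subr_mult[OF B_subr const_B] pidealD(5)[OF _ const_B] unfolding V_def by blast
    show "0 \<in> V" using subr_0[OF B_subr] pidealD(2) unfolding V_def by blast
    show "\<sigma> z \<in> V" if s: "\<sigma> \<in> Gal" and z: "z \<in> V" for \<sigma> z
      unfolding V_def
    proof (intro CollectI conjI allI impI)
      show "\<sigma> z \<in> B" using z Gal_B[OF s] by (simp add: V_def)
      fix q' assume q': "pideal q' B" "ev p \<in> q'"
      define q'' where "q'' = {b \<in> B. \<sigma> b \<in> q'}"
      have "pideal q'' B"
        unfolding pideal_def
      proof (intro conjI ballI impI)
        show "q'' \<subseteq> B" by (auto simp: q''_def)
        show "0 \<in> q''" using pidealD(2)[OF q'(1)] subr_0[OF B_subr] s by (simp add: q''_def auto_simps)
        show "1 \<notin> q''" using pidealD(3)[OF q'(1)] s by (simp add: q''_def auto_simps)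
        show "u + v \<in> q''" if "u \<in> q''" "v \<in> q''" for u v
          using that pidealD(4)[OF q'(1)] subr_add[OF B_subr] s by (simp add: q''_def auto_simps)
        show "u * v \<in> q''" if "u \<in> B" "v \<in> q''" for u v
          using that pidealD(5)[OF q'(1) Gal_B[OF s that(1)], of "\<sigma> v"] subr_mult[OF B_subr] s by (simp add: q''_def auto_simps)
        show "u \<in> q'' \<or> v \<in> q''" if "u \<in> B" "v \<in> B" "u * v \<in> q''" for u v
          using that pidealD(6)[OF q'(1) Gal_B[OF s that(1)] Gal_B[OF s that(2)]] s by (simp add: q''_def auto_simps)
      qed
      moreover have "ev p \<in> q''" using q' s by (simp add: q''_def fixedD)
      ultimately have "z \<in> q''" using z unfolding V_def by blast
      then show "\<sigma> z \<in> q'" by (simp add: q''_def)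
    qed
  qed
  then obtain ws where ws: "set ws \<subseteq> V \<inter> E" "a * d = sum_list ws" by blast
  have wy: "w / y \<in> P" if w: "w \<in> set ws" for w
  proof (rule y(5))
    have wV: "w \<in> V" using ws w by blast
    then show "w \<in> P" using BP by (auto simp: V_def)
    show "\<forall>x. prime_in P x \<longrightarrow> ev p / x \<in> P \<longrightarrow> w / x \<in> P"
    proof (intro allI impI)
      fix x assume x: "prime_in P x" "ev p / x \<in> P"
      have px: "pideal {a \<in> P. a / x \<in> P} P" by (rule prime_pideal[OF ufd x(1)])
      have "pideal ({a \<in> P. a / x \<in> P} \<inter> B) B"
        unfolding pideal_def
      proof (intro conjI ballI impI)
        show "0 \<in> {a \<in> P. a / x \<in> P} \<inter> B" using pidealD(2)[OF px] subr_0[OF B_subr] by simp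
        show "1 \<notin> {a \<in> P. a / x \<in> P} \<inter> B" using pidealD(3)[OF px] by blast
        show "u + v \<in> {a \<in> P. a / x \<in> P} \<inter> B" if "u \<in> {a \<in> P. a / x \<in> P} \<inter> B" "v \<in> {a \<in> P. a / x \<in> P} \<inter> B" for u v
          using that pidealD(4)[OF px] subr_add[OF B_subr] by blast
        show "u * v \<in> {a \<in> P. a / x \<in> P} \<inter> B" if "u \<in> B" "v \<in> {a \<in> P. a / x \<in> P} \<inter> B" for u v
          using that pidealD(5)[OF px] subr_mult[OF B_subr] BP by blast
        show "u \<in> {a \<in> P. a / x \<in> P} \<inter> B \<or> v \<in> {a \<in> P. a / x \<in> P} \<inter> B"
          if "u \<in> B" "v \<in> B" "u * v \<in> {a \<in> P. a / x \<in> P} \<inter> B" for u v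
          using that pidealD(6)[OF px] BP by blast
      qed simp
      moreover have "ev p \<in> {a \<in> P. a / x \<in> P} \<inter> B" using x BP by auto
      ultimately have "w \<in> {a \<in> P. a / x \<in> P} \<inter> B" using wV unfolding V_def by blast
      then show "w / x \<in> P" by blast
    qed
  qed
  \<comment> \<open>The quotients \<open>w / y\<close> add up to the unit \<open>b * d\<close>, so
    they cannot all lie in the maximal ideal.\<close>
  have "\<exists>w\<in>set ws. unit_in P (w / y)"
  proof (rule ccontr)
    assume no: "\<not> (\<exists>w\<in>set ws. unit_in P (w / y))"
    then have "\<forall>w\<in>set ws. w / y \<in> max_ideal P" using wy lm(3) by blast
    then have "sum_list ws / y \<in> max_ideal P"
      by (induction ws) (auto simp: add_divide_distrib pidealD(2)[OF lm(1)] intro: pidealD(4)[OF lm(1)])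
    moreover have "sum_list ws / y = b * d" unfolding ws(2)[symmetric] using ab(1) nz y(2) by auto
    ultimately have "b * d \<in> q" using lm(2) ab cd subr_mult[OF B_subr] by auto
    then show False using pidealD(6)[OF q, of b d] ab cd by auto
  qed
  then obtain w where w: "w \<in> set ws" "unit_in P (w / y)" by blast
  have "vl (loc_at P x) w = (if ev p / x \<in> P then 1 else 0)" if x: "prime_in P x" for x
  proof -
    note S = is_dvr_loc_at[OF ufd fr x]
    have "unit_in (loc_at P x) (w / y)"
      using w(2) subset_loc_at[OF ufd fr x] by (auto simp: unit_in_def)
    then have "vl (loc_at P x) (w / y) = 0" by (rule vl_unit[OF S])
    moreover have "w \<noteq> 0" using w(2) by (auto simp: unit_in_def)
    ultimately show ?thesis using y(2) y(6)[OF x] by (simp add: vl_divide[OF S])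
  qed
  then show ?thesis using ws(1) w(1) unfolding P_def by blast
qed

end

section \<open>Differential forms of degree three\<close>

definition det3 :: "(nat \<Rightarrow> nat \<Rightarrow> 'a::comm_ring_1) \<Rightarrow> 'a" where
  "det3 a = a 0 0 * a 1 1 * a 2 2 + a 0 1 * a 1 2 * a 2 0 + a 0 2 * a 1 0 * a 2 1
     - a 0 0 * a 1 2 * a 2 1 - a 0 1 * a 1 0 * a 2 2 - a 0 2 * a 1 1 * a 2 0"

lemma lessThan_3: "{..<3::nat} = {0, 1, 2}"
  by auto

lemma sum_permutes_3:
  fixes g :: "(nat \<Rightarrow> nat) \<Rightarrow> 'a::comm_ring_1"
  shows "(\<Sum>\<pi> | \<pi> permutes {..<3}. of_int (sign \<pi>) * (\<Prod>i<3. a (\<pi> i) i)) = det3 a"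
proof -
  have f: "finite {1, 2::nat}" "0 \<notin> {1, 2::nat}" "finite {2::nat}" "1 \<notin> {2::nat}" by auto
  show ?thesis
    unfolding lessThan_3 sum_over_permutations_insert[OF f(1,2)] sum_over_permutations_insert[OF f(3,4)] permutes_sing
    by (simp add: det3_def sign_swap_id sign_compose sign_id permutation_swap_id transpose_def algebra_simps)
qed

text \<open>The value \<open>undefined\<close> beyond index 2 places the triple in the extensional
  function space on which forms are defined.\<close>

definition tup :: "'a \<Rightarrow> 'a \<Rightarrow> 'a \<Rightarrow> nat \<Rightarrow> 'a" where
  "tup a b c = (\<lambda>i. if i = 0 then a else if i = 1 then b else if i = 2 then c else undefined)"

lemma tup_simps [simp]: "tup a b c 0 = a" "tup a b c (Suc 0) = b" "tup a b c 1 = b" "tup a b c 2 = c"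
  by (auto simp: tup_def)

lemma tup_upd: "(tup a b c)(0 := x) = tup x b c" "(tup a b c)(1 := x) = tup a x c" "(tup a b c)(2 := x) = tup a b x"
    "(tup a b c)(Suc 0 := x) = tup a x c"
  by (auto simp: tup_def fun_eq_iff)

lemma tup_mem: "tup a b c \<in> {..<3} \<rightarrow>\<^sub>E S \<longleftrightarrow> a \<in> S \<and> b \<in> S \<and> c \<in> S"
  by (auto simp: tup_def PiE_iff extensional_def lessThan_3)

lemma tup_eta: "D \<in> {..<3} \<rightarrow>\<^sub>E S \<Longrightarrow> D = tup (D 0) (D 1) (D 2)"
proof
  fix i assume D: "D \<in> {..<3} \<rightarrow>\<^sub>E S"
  show "D i = tup (D 0) (D 1) (D 2) i"
  proof (cases "i < 3")
    case True then have "i = 0 \<or> i = 1 \<or> i = 2" by auto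
    then show ?thesis by auto
  next
    case False then show ?thesis using PiE_arb[OF D, of i] by (auto simp: tup_def)
  qed
qed

lemma wedge_d_3: "wedge_d 3 f D = (if D \<in> {..<3} \<rightarrow>\<^sub>E derivations then det3 (\<lambda>i j. D i (f j)) else 0)"
  unfolding wedge_d_def using sum_permutes_3[of "\<lambda>i j. D i (f j)"] by simp

lemma derivationD:
  assumes "D \<in> derivations"
  shows "D (x + y) = D x + D y" "D (x * y) = x * D y + D x * y" "D (of_cplx c) = 0"
    "D 0 = 0" "D 1 = 0" "D (- x) = - D x" "D (x - y) = D x - D y"
proof -
  show 1: "\<And>x y. D (x + y) = D x + D y" "D (x * y) = x * D y + D x * y" "\<And>c. D (of_cplx c) = 0"
    using assms by (auto simp: derivations_def)
  show 0: "D 0 = 0" "D 1 = 0" using 1(3)[of 0] 1(3)[of 1] by auto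
  show u: "D (- x) = - D x" for x using 1(1)[of x "- x"] 0 by (simp add: eq_neg_iff_add_eq_0 add.commute)
  show "D (x - y) = D x - D y" using 1(1)[of x "- y"] u by simp
qed

lemma derivation_power: "D \<in> derivations \<Longrightarrow> D (x ^ n) = of_nat n * x ^ (n - 1) * D x"
proof (induction n)
  case (Suc n)
  then show ?case by (cases n) (auto simp: derivationD(2) algebra_simps)
qed (simp add: derivationD)

lemma derivation_divide:
  assumes "D \<in> derivations" "t \<noteq> 0" shows "D (a / t) = (D a * t - a * D t) / t\<^sup>2"
proof -
  have "D a = D ((a / t) * t)" using assms by simp
  also have "\<dots> = (a / t) * D t + D (a / t) * t" by (rule derivationD(2)[OF assms(1)])
  finally show ?thesis using assms(2) by (simp add: field_simps power2_eq_square)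
qed

lemma derivation_sum_list: "D \<in> derivations \<Longrightarrow> D (sum_list ws) = sum_list (map D ws)"
  by (induction ws) (auto simp: derivationD)

lemma derivation_comb:
  assumes "E \<in> derivations" "F \<in> derivations"
  shows "(\<lambda>x. a * E x + F x) \<in> derivations"
  using assms by (auto simp: derivations_def algebra_simps)

lemma derivation_zero: "(\<lambda>x. 0) \<in> derivations"
  by (simp add: derivations_def)

lemma derivation_scale: "E \<in> derivations \<Longrightarrow> (\<lambda>x. a * E x) \<in> derivations"
  using derivation_comb[OF _ derivation_zero, of E a] by simp

definition lc3 :: "'k \<Rightarrow> 'k \<Rightarrow> 'k \<Rightarrow> ('k \<Rightarrow> 'k) \<Rightarrow> ('k \<Rightarrow> 'k) \<Rightarrow> ('k \<Rightarrow> 'k::field) \<Rightarrow> 'k \<Rightarrow> 'k" where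
  "lc3 a b c D E F = (\<lambda>x. a * D x + (b * E x + c * F x))"

lemma derivation_lc3:
  "D \<in> derivations \<Longrightarrow> E \<in> derivations \<Longrightarrow> F \<in> derivations \<Longrightarrow> lc3 a b c D E F \<in> derivations"
  unfolding lc3_def by (intro derivation_comb derivation_scale)

context
  fixes \<omega> :: "'k::complex_extension_field form"
  assumes \<omega>: "\<omega> \<in> rational_forms 3"
begin

lemma form_linear:
  assumes "D \<in> derivations" "E \<in> derivations" "F \<in> derivations" "Y \<in> derivations"
  shows "\<omega> (tup (\<lambda>x. a * E x + F x) D Y) = a * \<omega> (tup E D Y) + \<omega> (tup F D Y)"
    "\<omega> (tup D (\<lambda>x. a * E x + F x) Y) = a * \<omega> (tup D E Y) + \<omega> (tup D F Y)"
    "\<omega> (tup D Y (\<lambda>x. a * E x + F x)) = a * \<omega> (tup D Y E) + \<omega> (tup D Y F)"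
proof -
  have L: "\<forall>D \<in> {..<3} \<rightarrow>\<^sub>E derivations. \<forall>i<3. \<forall>E\<in>derivations. \<forall>F\<in>derivations. \<forall>a.
        \<omega> (D(i := (\<lambda>x. a * E x + F x))) = a * \<omega> (D(i := E)) + \<omega> (D(i := F))"
    using \<omega> by (simp add: rational_forms_def)
  have m: "tup D D Y \<in> {..<3} \<rightarrow>\<^sub>E derivations" "tup D Y Y \<in> {..<3} \<rightarrow>\<^sub>E derivations"
    using assms by (simp_all add: tup_mem)
  show "\<omega> (tup (\<lambda>x. a * E x + F x) D Y) = a * \<omega> (tup E D Y) + \<omega> (tup F D Y)"
    using L[rule_format, OF m(1) _ assms(2,3), of 0 a] by (simp add: tup_upd)
  show "\<omega> (tup D (\<lambda>x. a * E x + F x) Y) = a * \<omega> (tup D E Y) + \<omega> (tup D F Y)"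
    using L[rule_format, OF m(1) _ assms(2,3), of 1 a] by (simp add: tup_upd)
  show "\<omega> (tup D Y (\<lambda>x. a * E x + F x)) = a * \<omega> (tup D Y E) + \<omega> (tup D Y F)"
    using L[rule_format, OF m(2) _ assms(2,3), of 2 a] by (simp add: tup_upd)
qed

lemma form_alt:
  assumes "D \<in> derivations" "E \<in> derivations"
  shows "\<omega> (tup D D E) = 0" "\<omega> (tup D E D) = 0" "\<omega> (tup E D D) = 0"
proof -
  have L: "\<forall>D \<in> {..<3} \<rightarrow>\<^sub>E derivations. \<forall>i<3. \<forall>j<3. i \<noteq> j \<and> D i = D j \<longrightarrow> \<omega> D = 0"
    using \<omega> by (simp add: rational_forms_def)
  have m: "tup D D E \<in> {..<3} \<rightarrow>\<^sub>E derivations" "tup D E D \<in> {..<3} \<rightarrow>\<^sub>E derivations" "tup E D D \<in> {..<3} \<rightarrow>\<^sub>E derivations"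
    using assms by (simp_all add: tup_mem)
  show "\<omega> (tup D D E) = 0" using L[rule_format, OF m(1), of 0 1] by simp
  show "\<omega> (tup D E D) = 0" using L[rule_format, OF m(2), of 0 2] by simp
  show "\<omega> (tup E D D) = 0" using L[rule_format, OF m(3), of 1 2] by simp
qed

lemma form_scale_slot:
  assumes "D \<in> derivations" "E \<in> derivations" "Y \<in> derivations"
  shows "\<omega> (tup (\<lambda>x. a * E x) D Y) = a * \<omega> (tup E D Y)" "\<omega> (tup D (\<lambda>x. a * E x) Y) = a * \<omega> (tup D E Y)"
    "\<omega> (tup D Y (\<lambda>x. a * E x)) = a * \<omega> (tup D Y E)"
proof -
  have "\<omega> (tup (\<lambda>x. 0) D Y) = 0"
    using form_linear(1)[OF assms(1) derivation_zero derivation_zero assms(3), of "- 1"] by simp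
  then show "\<omega> (tup (\<lambda>x. a * E x) D Y) = a * \<omega> (tup E D Y)"
    using form_linear(1)[OF assms(1,2) derivation_zero assms(3), of a] by simp
  have "\<omega> (tup D (\<lambda>x. 0) Y) = 0"
    using form_linear(2)[OF assms(1) derivation_zero derivation_zero assms(3), of "- 1"] by simp
  then show "\<omega> (tup D (\<lambda>x. a * E x) Y) = a * \<omega> (tup D E Y)"
    using form_linear(2)[OF assms(1,2) derivation_zero assms(3), of a] by simp
  have "\<omega> (tup D Y (\<lambda>x. 0)) = 0"
    using form_linear(3)[OF assms(1) derivation_zero derivation_zero assms(3), of "- 1"] by simp
  then show "\<omega> (tup D Y (\<lambda>x. a * E x)) = a * \<omega> (tup D Y E)"
    using form_linear(3)[OF assms(1,2) derivation_zero assms(3), of a] by simp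
qed

lemma form_lc3:
  assumes "D \<in> derivations" "Y \<in> derivations" "E1 \<in> derivations" "E2 \<in> derivations" "E3 \<in> derivations"
  shows "\<omega> (tup (lc3 a b c E1 E2 E3) D Y) = a * \<omega> (tup E1 D Y) + b * \<omega> (tup E2 D Y) + c * \<omega> (tup E3 D Y)"
    "\<omega> (tup D (lc3 a b c E1 E2 E3) Y) = a * \<omega> (tup D E1 Y) + b * \<omega> (tup D E2 Y) + c * \<omega> (tup D E3 Y)"
    "\<omega> (tup D Y (lc3 a b c E1 E2 E3)) = a * \<omega> (tup D Y E1) + b * \<omega> (tup D Y E2) + c * \<omega> (tup D Y E3)"
proof -
  have d: "(\<lambda>x. c * E3 x) \<in> derivations" "(\<lambda>x. b * E2 x + c * E3 x) \<in> derivations"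
    using assms by (auto intro: derivation_comb derivation_scale)
  note l = form_linear[OF assms(1,3) d(2) assms(2)] form_linear[OF assms(1,4) d(1) assms(2)] form_scale_slot[OF assms(1,5,2)]
  show "\<omega> (tup (lc3 a b c E1 E2 E3) D Y) = a * \<omega> (tup E1 D Y) + b * \<omega> (tup E2 D Y) + c * \<omega> (tup E3 D Y)"
    "\<omega> (tup D (lc3 a b c E1 E2 E3) Y) = a * \<omega> (tup D E1 Y) + b * \<omega> (tup D E2 Y) + c * \<omega> (tup D E3 Y)"
    "\<omega> (tup D Y (lc3 a b c E1 E2 E3)) = a * \<omega> (tup D Y E1) + b * \<omega> (tup D Y E2) + c * \<omega> (tup D Y E3)"
    unfolding lc3_def l by (simp_all add: add.assoc)
qed

lemma form_antisym:
  assumes "D \<in> derivations" "E \<in> derivations" "F \<in> derivations"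
  shows "\<omega> (tup E D F) = - \<omega> (tup D E F)" "\<omega> (tup D F E) = - \<omega> (tup D E F)"
proof -
  have s: "(\<lambda>x. 1 * D x + E x) \<in> derivations" "(\<lambda>x. 1 * E x + F x) \<in> derivations"
    using assms by (auto intro: derivation_comb simp del: mult_1)
  have "\<omega> (tup (\<lambda>x. 1 * D x + E x) (\<lambda>x. 1 * D x + E x) F) = 0"
    by (rule form_alt(1)[OF s(1) assms(3)])
  then have "1 * (1 * \<omega> (tup D D F) + \<omega> (tup D E F)) + (1 * \<omega> (tup E D F) + \<omega> (tup E E F)) = 0"
    unfolding form_linear(1)[OF s(1) assms(1,2,3)] form_linear(2)[OF assms(1) assms(1,2,3)] form_linear(2)[OF assms(2) assms(1,2,3)] .
  then show "\<omega> (tup E D F) = - \<omega> (tup D E F)"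
    using assms by (simp add: form_alt eq_neg_iff_add_eq_0 add.commute)
  have "\<omega> (tup D (\<lambda>x. 1 * E x + F x) (\<lambda>x. 1 * E x + F x)) = 0"
    by (rule form_alt(3)[OF s(2) assms(1)])
  then have "1 * (1 * \<omega> (tup D E E) + \<omega> (tup D E F)) + (1 * \<omega> (tup D F E) + \<omega> (tup D F F)) = 0"
    unfolding form_linear(2)[OF assms(1,2,3) s(2)] form_linear(3)[OF assms(1,2,3) assms(2)] form_linear(3)[OF assms(1,2,3) assms(3)] .
  then show "\<omega> (tup D F E) = - \<omega> (tup D E F)"
    using assms by (simp add: form_alt eq_neg_iff_add_eq_0 add.commute)
qed

lemma form_det:
  assumes d: "E0 \<in> derivations" "E1 \<in> derivations" "E2 \<in> derivations"
  shows "\<omega> (tup (lc3 (a 0 0) (a 0 1) (a 0 2) E0 E1 E2) (lc3 (a 1 0) (a 1 1) (a 1 2) E0 E1 E2) (lc3 (a 2 0) (a 2 1) (a 2 2) E0 E1 E2))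
    = det3 a * \<omega> (tup E0 E1 E2)"
proof -
  note D = derivation_lc3[OF d]
  have p: "\<omega> (tup E1 E0 E2) = - \<omega> (tup E0 E1 E2)" "\<omega> (tup E0 E2 E1) = - \<omega> (tup E0 E1 E2)"
    "\<omega> (tup E1 E2 E0) = \<omega> (tup E0 E1 E2)" "\<omega> (tup E2 E0 E1) = \<omega> (tup E0 E1 E2)" "\<omega> (tup E2 E1 E0) = - \<omega> (tup E0 E1 E2)"
    using form_antisym(1)[OF d(1,2,3)] form_antisym(2)[OF d(1,2,3)] form_antisym(2)[OF d(2,1,3)]
      form_antisym(1)[OF d(1,3,2)] form_antisym(2)[OF d(3,1,2)] by auto
  show ?thesis
    unfolding form_lc3(1)[OF D D d] form_lc3(2)[OF d(1) D d] form_lc3(2)[OF d(2) D d] form_lc3(2)[OF d(3) D d]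
    by (simp add: form_lc3(3) d form_alt p det3_def algebra_simps)
qed

lemma form_dependent:
  assumes d: "D0 \<in> derivations" "D1 \<in> derivations" "D2 \<in> derivations"
    and dep: "\<And>x. c0 * D0 x + c1 * D1 x + c2 * D2 x = 0" and nz: "c0 \<noteq> 0 \<or> c1 \<noteq> 0 \<or> c2 \<noteq> 0"
  shows "\<omega> (tup D0 D1 D2) = 0"
proof -
  consider "c0 \<noteq> 0" | "c1 \<noteq> 0" | "c2 \<noteq> 0" using nz by blast
  then show ?thesis
  proof cases
    case 1
    have "D0 = lc3 0 (- c1 / c0) (- c2 / c0) D0 D1 D2"
      using dep 1 by (auto simp: lc3_def fun_eq_iff field_simps eq_neg_iff_add_eq_0)
    then have "\<omega> (tup D0 D1 D2) = \<omega> (tup (lc3 0 (- c1 / c0) (- c2 / c0) D0 D1 D2) D1 D2)" by metis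
    then show ?thesis using form_alt d by (simp add: form_lc3(1)[OF d(2,3) d])
  next
    case 2
    have "D1 = lc3 (- c0 / c1) 0 (- c2 / c1) D0 D1 D2"
      using dep 2 by (auto simp: lc3_def fun_eq_iff field_simps eq_neg_iff_add_eq_0)
    then have "\<omega> (tup D0 D1 D2) = \<omega> (tup D0 (lc3 (- c0 / c1) 0 (- c2 / c1) D0 D1 D2) D2)" by metis
    then show ?thesis using form_alt d by (simp add: form_lc3(2)[OF d(1,3) d])
  next
    case 3
    have "D2 = lc3 (- c0 / c2) (- c1 / c2) 0 D0 D1 D2"
      using dep 3 by (auto simp: lc3_def fun_eq_iff field_simps eq_neg_iff_add_eq_0)
    then have "\<omega> (tup D0 D1 D2) = \<omega> (tup D0 D1 (lc3 (- c0 / c2) (- c1 / c2) 0 D0 D1 D2))" by metis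
    then show ?thesis using form_alt d by (simp add: form_lc3(3)[OF d(1,2) d])
  qed
qed

end

lemma det3_mult:
  "det3 (\<lambda>i j. a i 0 * b 0 j + a i 1 * b 1 j + a i 2 * b 2 j) = det3 a * det3 b"
  by (simp add: det3_def algebra_simps)

lemma det3_cong:
  "(\<And>i j. i \<in> {0, 1, 2} \<Longrightarrow> a i j = b i j) \<Longrightarrow> det3 a = det3 b"
  by (simp add: det3_def)

text \<open>\<open>n j k\<close> is the cross product of two columns and hence orthogonal to all
  columns when the determinant is zero. If all three cross products vanish, the first row is zero or
  proportional to the second.\<close>

lemma det3_singular:
  fixes m :: "nat \<Rightarrow> nat \<Rightarrow> 'a::field"
  assumes "det3 m = 0"
  shows "\<exists>c0 c1 c2. (c0 \<noteq> 0 \<or> c1 \<noteq> 0 \<or> c2 \<noteq> 0) \<and> (\<forall>j\<in>{0, 1, 2}. c0 * m 0 j + c1 * m 1 j + c2 * m 2 j = 0)"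
proof -
  define n where "n j k = (m 1 j * m 2 k - m 1 k * m 2 j, m 2 j * m 0 k - m 2 k * m 0 j, m 0 j * m 1 k - m 0 k * m 1 j)" for j k
  have key: "fst (n j k) * m 0 l + fst (snd (n j k)) * m 1 l + snd (snd (n j k)) * m 2 l = 0"
    if jk: "(j, k) \<in> {(1, 2), (2, 0), (0, 1)}" and l: "l \<in> {0, 1, 2}" for j k l
  proof -
    have "fst (n j k) * m 0 l + fst (snd (n j k)) * m 1 l + snd (snd (n j k)) * m 2 l = (if l \<noteq> j \<and> l \<noteq> k then det3 m else 0)"
      using jk l by (elim insertE emptyE; simp add: n_def det3_def algebra_simps)
    then show ?thesis using assms by simp
  qed
  show ?thesis
  proof (cases "\<exists>(j, k)\<in>{(1, 2), (2, 0), (0, 1)}. n j k \<noteq> (0, 0, 0)")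
    case True
    then obtain j k where jk: "(j, k) \<in> {(1, 2), (2, 0), (0, 1)}" "n j k \<noteq> (0, 0, 0)" by blast
    then have "fst (n j k) \<noteq> 0 \<or> fst (snd (n j k)) \<noteq> 0 \<or> snd (snd (n j k)) \<noteq> 0" by (simp add: prod_eq_iff)
    then show ?thesis using key[OF jk(1)] by blast
  next
    case False
    then have "n 1 2 = (0, 0, 0)" "n 2 0 = (0, 0, 0)" "n 0 1 = (0, 0, 0)" by auto
    then have z: "m 0 1 * m 1 2 - m 0 2 * m 1 1 = 0" "m 0 2 * m 1 0 - m 0 0 * m 1 2 = 0" "m 0 0 * m 1 1 - m 0 1 * m 1 0 = 0"
      unfolding n_def by (simp_all only: prod.inject)
    have minors: "m 0 j * m 1 k - m 0 k * m 1 j = 0" if "j \<in> {0, 1, 2}" "k \<in> {0, 1, 2}" for j k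
      using that z by (elim insertE emptyE; simp)
  show ?thesis
  proof (cases "\<exists>k\<in>{0, 1, 2}. m 0 k \<noteq> 0")
    case True
    then obtain k where k: "k \<in> {0, 1, 2}" "m 0 k \<noteq> 0" by blast
    have "- m 1 k * m 0 j + m 0 k * m 1 j + 0 * m 2 j = 0" if "j \<in> {0, 1, 2}" for j
      using minors[OF k(1) that] by (simp add: mult.commute)
    then show ?thesis using k(2) by blast
  next
    case False
    then have "1 * m 0 j + 0 * m 1 j + 0 * m 2 j = 0" if "j \<in> {0, 1, 2}" for j using that by auto
    then show ?thesis by (intro exI[of _ 1] exI[of _ 0]) auto
  qed
  qed
qed

lemma derivation_evp:
  assumes D: "D \<in> derivations" and h: "rhom h" "\<And>r. D (h r) = 0"
  shows "D (evp h y f) = evp h y (pderiv f) * D y"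
proof (induction f)
  case (pCons a f)
  have "D (evp h y (pCons a f)) = y * D (evp h y f) + D y * evp h y f"
    by (simp add: evp_pCons[OF h(1)] derivationD[OF D] h(2))
  also have "\<dots> = evp h y (pderiv (pCons a f)) * D y"
    by (simp add: pderiv_pCons evp_add[OF h(1)] evp_pCons[OF h(1)] rhomD(1)[OF h(1)] pCons algebra_simps)
  finally show ?case .
qed (simp add: derivationD[OF D])

lemma form_scale_simps:
  "form_scale a (form_scale b \<omega>) = form_scale (a * b) \<omega>" "form_scale 1 \<omega> = \<omega>"
  "form_scale a \<omega> + form_scale b \<omega> = form_scale (a + b) \<omega>" "form_scale 0 \<omega> = 0"
  by (auto simp: form_scale_def fun_eq_iff algebra_simps)

lemma sum_form_scale: "(\<Sum>i\<in>I. form_scale (a i) \<omega>) = form_scale (\<Sum>i\<in>I. a i) \<omega>"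
  by (induction I rule: infinite_finite_induct) (auto simp: form_scale_simps)

lemma form_scale_inj: "\<omega> \<noteq> 0 \<Longrightarrow> form_scale a \<omega> = form_scale b \<omega> \<longleftrightarrow> a = b"
  by (auto simp: form_scale_def fun_eq_iff)

context chart
begin

definition yf :: "nat \<Rightarrow> 'k" where "yf = tup y1 y2 y3"

lemma yf_simps [simp]: "yf 0 = y1" "yf (Suc 0) = y2" "yf 1 = y2" "yf 2 = y3"
  by (simp_all add: yf_def)

text \<open>The quotient rule extends the vanishing from polynomials to \<open>L\<close>; for an
  eigenvector, \<open>of_nat N * w ^ (N - 1) * D w = D (w ^ N) = 0\<close> extends it further, as
  the characteristic is zero.\<close>

lemma derivation_zero_if:
  assumes D: "D \<in> derivations" and y: "D y1 = 0" "D y2 = 0" "D y3 = 0"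
  shows "D z = 0"
proof -
  have ev: "D (ev f) = 0" for f
    by (induction f rule: p3_induct) (auto simp: y derivationD[OF D])
  have L: "D u = 0" if u: "u \<in> L" for u
  proof -
    obtain f g where "g \<noteq> 0" "u = ev f / ev g" using L_fracE[OF u] by blast
    then show ?thesis using derivation_divide[OF D, of "ev g" "ev f"] ev by simp
  qed
  have E: "D w = 0" if w: "w \<in> E" for w
  proof -
    have "of_nat N * w ^ (N - 1) * D w = 0" using L[OF E_power_N[OF w]] derivation_power[OF D, of w N] by simp
    then show ?thesis using of_nat_nz[OF N_pos, where 'k = 'k] E_nz[OF w] by simp
  qed
  obtain ws where ws: "set ws \<subseteq> UNIV \<inter> E" "z = sum_list ws"
    using eigen_decomposition[of UNIV z] by auto
  then have "\<forall>w\<in>set ws. D w = 0" using E by auto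
  then have "sum_list (map D ws) = 0" by (induction ws) auto
  then show ?thesis unfolding ws(2) derivation_sum_list[OF D] .
qed

lemma derivation_ext:
  assumes D: "D \<in> derivations" "D' \<in> derivations" and y: "D y1 = D' y1" "D y2 = D' y2" "D y3 = D' y3"
  shows "D = D'"
proof
  fix z
  have "(\<lambda>x. (-1) * D' x + D x) \<in> derivations" using derivation_comb[OF D(2,1)] .
  then have "(-1) * D' z + D z = 0" using derivation_zero_if[of "\<lambda>x. (-1) * D' x + D x"] y by simp
  then show "D z = D' z" by simp
qed

text \<open>The partial derivatives with respect to the chart coordinates, extended to the whole
  function field.\<close>

definition dual :: "(nat \<Rightarrow> 'k \<Rightarrow> 'k) \<Rightarrow> bool" where
  "dual d \<longleftrightarrow> (\<forall>i\<in>{0, 1, 2}. d i \<in> derivations \<and> (\<forall>j\<in>{0, 1, 2}. d i (yf j) = (if i = j then 1 else 0)))"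

text \<open>A nonzero form takes a nonzero value at some triple of derivations. By
  \<open>derivation_zero_if\<close> their matrix on the coordinates is invertible, and its inverse
  turns the triple into the dual basis.\<close>

lemma ex_dual:
  fixes \<omega> :: "'k form"
  assumes \<omega>: "\<omega> \<in> rational_forms 3" "\<omega> \<noteq> 0"
  shows "\<exists>d. dual d"
proof -
  obtain D where D: "\<omega> D \<noteq> 0" using \<omega>(2) by (auto simp: fun_eq_iff)
  then have "D \<in> {..<3} \<rightarrow>\<^sub>E derivations" using \<omega>(1) by (auto simp: rational_forms_def)
  then have "D = tup (D 0) (D 1) (D 2)" and d: "D 0 \<in> derivations" "D 1 \<in> derivations" "D 2 \<in> derivations"
    using tup_eta[of D] by auto
  then have nz: "\<omega> (tup (D 0) (D 1) (D 2)) \<noteq> 0" using D by simp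
  define m where "m i j = D i (yf j)" for i j
  have det: "det3 m \<noteq> 0"
  proof
    assume "det3 m = 0"
    then obtain c0 c1 c2 where c: "c0 \<noteq> 0 \<or> c1 \<noteq> 0 \<or> c2 \<noteq> 0" "\<forall>j\<in>{0, 1, 2}. c0 * m 0 j + c1 * m 1 j + c2 * m 2 j = 0"
      using det3_singular by blast
    have "lc3 c0 c1 c2 (D 0) (D 1) (D 2) \<in> derivations" by (rule derivation_lc3[OF d])
    moreover have "lc3 c0 c1 c2 (D 0) (D 1) (D 2) y1 = 0" "lc3 c0 c1 c2 (D 0) (D 1) (D 2) y2 = 0"
      "lc3 c0 c1 c2 (D 0) (D 1) (D 2) y3 = 0"
      using c(2) by (simp_all add: lc3_def m_def add.assoc)
    ultimately have "lc3 c0 c1 c2 (D 0) (D 1) (D 2) x = 0" for x by (rule derivation_zero_if)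
    then show False using form_dependent[OF \<omega>(1) d _ c(1)] nz by (simp add: lc3_def add.assoc)
  qed
  \<comment> \<open>The adjugate matrix of \<open>m\<close>.\<close>
  define cof where "cof k i = (if k = 0 then (if i = 0 then m 1 1 * m 2 2 - m 1 2 * m 2 1 else if i = 1 then m 0 2 * m 2 1 - m 0 1 * m 2 2 else m 0 1 * m 1 2 - m 0 2 * m 1 1)
    else if k = 1 then (if i = 0 then m 1 2 * m 2 0 - m 1 0 * m 2 2 else if i = 1 then m 0 0 * m 2 2 - m 0 2 * m 2 0 else m 0 2 * m 1 0 - m 0 0 * m 1 2)
    else (if i = 0 then m 1 0 * m 2 1 - m 1 1 * m 2 0 else if i = 1 then m 0 1 * m 2 0 - m 0 0 * m 2 1 else m 0 0 * m 1 1 - m 0 1 * m 1 0))" for k i :: nat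
  define d' where "d' k = lc3 (cof k 0 / det3 m) (cof k 1 / det3 m) (cof k 2 / det3 m) (D 0) (D 1) (D 2)" for k
  have "d' k (yf j) = (if k = j then 1 else 0)" if "k \<in> {0, 1, 2}" "j \<in> {0, 1, 2}" for k j
  proof -
    have "d' k (yf j) = (cof k 0 * m 0 j + cof k 1 * m 1 j + cof k 2 * m 2 j) / det3 m"
      by (simp add: d'_def lc3_def m_def add_divide_distrib add.assoc)
    moreover have "cof k 0 * m 0 j + cof k 1 * m 1 j + cof k 2 * m 2 j = (if k = j then det3 m else 0)"
      using that by (elim insertE emptyE) (simp_all add: cof_def det3_def algebra_simps)
    ultimately show ?thesis using det by simp
  qed
  moreover have "d' k \<in> derivations" for k unfolding d'_def by (rule derivation_lc3[OF d])
  ultimately show ?thesis unfolding dual_def by blast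
qed

definition \<omega>0 :: "'k form" where "\<omega>0 = wedge_d 3 yf"

context
  fixes d :: "nat \<Rightarrow> 'k \<Rightarrow> 'k"
  assumes dual: "dual d"
begin

lemma d_der: "d 0 \<in> derivations" "d 1 \<in> derivations" "d 2 \<in> derivations" "d (Suc 0) \<in> derivations"
  using dual by (auto simp: dual_def)

lemma d_y: "d 0 y1 = 1" "d 0 y2 = 0" "d 0 y3 = 0" "d 1 y1 = 0" "d 1 y2 = 1" "d 1 y3 = 0"
   "d 2 y1 = 0" "d 2 y2 = 0" "d 2 y3 = 1"
  using dual unfolding dual_def by force+

lemma derivation_expand:
  assumes "D \<in> derivations" shows "D = lc3 (D y1) (D y2) (D y3) (d 0) (d 1) (d 2)"
  by (rule derivation_ext[OF assms derivation_lc3[OF d_der(1-3)]]) (simp_all add: lc3_def d_y[simplified])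

lemma form_eq_\<omega>0:
  assumes \<omega>: "\<omega> \<in> rational_forms 3"
  shows "\<omega> = form_scale (\<omega> (tup (d 0) (d 1) (d 2))) \<omega>0"
proof
  fix D
  show "\<omega> D = form_scale (\<omega> (tup (d 0) (d 1) (d 2))) \<omega>0 D"
  proof (cases "D \<in> {..<3} \<rightarrow>\<^sub>E derivations")
    case True
    have D: "D 0 \<in> derivations" "D 1 \<in> derivations" "D 2 \<in> derivations"
      using PiE_mem[OF True] by simp_all
    have "\<omega> D = \<omega> (tup (D 0) (D 1) (D 2))" by (rule arg_cong[OF tup_eta[OF True]])
    also have "\<dots> = \<omega> (tup (lc3 (D 0 y1) (D 0 y2) (D 0 y3) (d 0) (d 1) (d 2))
       (lc3 (D 1 y1) (D 1 y2) (D 1 y3) (d 0) (d 1) (d 2)) (lc3 (D 2 y1) (D 2 y2) (D 2 y3) (d 0) (d 1) (d 2)))"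
      unfolding derivation_expand[OF D(1), symmetric] derivation_expand[OF D(2), symmetric]
        derivation_expand[OF D(3), symmetric] ..
    also have "\<dots> = det3 (\<lambda>i j. D i (yf j)) * \<omega> (tup (d 0) (d 1) (d 2))"
      using form_det[OF \<omega> d_der(1-3), of "\<lambda>i j. D i (yf j)"] by simp
    finally show ?thesis using True by (simp add: form_scale_def \<omega>0_def wedge_d_3)
  next
    case False
    then show ?thesis using \<omega> by (auto simp: form_scale_def \<omega>0_def wedge_d_3 rational_forms_def)
  qed
qed

lemma wedge_eq_\<omega>0: "wedge_d 3 f = form_scale (det3 (\<lambda>i j. d i (f j))) \<omega>0"
proof
  fix D
  show "wedge_d 3 f D = form_scale (det3 (\<lambda>i j. d i (f j))) \<omega>0 D"
  proof (cases "D \<in> {..<3} \<rightarrow>\<^sub>E derivations")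
    case True
    have D: "D i \<in> derivations" if "i \<in> {0, 1, 2}" for i using PiE_mem[OF True, of i] that by auto
    have e: "D i z = D i (yf 0) * d 0 z + D i (yf 1) * d 1 z + D i (yf 2) * d 2 z" if "i \<in> {0, 1, 2}" for i z
      using fun_cong[OF derivation_expand[OF D[OF that]], of z] by (simp add: lc3_def add.assoc)
    have "det3 (\<lambda>i j. D i (f j)) = det3 (\<lambda>i j. D i (yf 0) * d 0 (f j) + D i (yf 1) * d 1 (f j) + D i (yf 2) * d 2 (f j))"
      by (rule det3_cong) (rule e)
    also have "\<dots> = det3 (\<lambda>i j. D i (yf j)) * det3 (\<lambda>i j. d i (f j))"
      by (rule det3_mult)
    finally show ?thesis using True by (simp add: form_scale_def \<omega>0_def wedge_d_3)
  qed (simp add: form_scale_def \<omega>0_def wedge_d_3)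
qed

lemma \<omega>0_nz: "\<omega>0 \<noteq> 0"
proof
  assume "\<omega>0 = 0"
  then have "\<omega>0 (tup (d 0) (d 1) (d 2)) = 0" by simp
  moreover have "\<omega>0 (tup (d 0) (d 1) (d 2)) = 1"
    using d_der d_y[simplified] by (simp add: \<omega>0_def wedge_d_3 tup_mem det3_def)
  ultimately show False by simp
qed

lemma d_ev: assumes "i \<in> {0, 1, 2}" shows "\<exists>g. d i (ev f) = ev g"
proof -
  have D: "d i \<in> derivations" using assms dual unfolding dual_def by blast
  have y: "\<exists>g. d i y = ev g" if "y \<in> {y1, y2, y3}" for y
  proof -
    have "y \<in> yf ` {0, 1, 2}" using that by auto
    then have "d i y = ev 1 \<or> d i y = ev 0" using dual assms unfolding dual_def by auto
    then show ?thesis by blast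
  qed
  show ?thesis
  proof (induction f rule: p3_induct)
    case (add f g)
    then obtain f' g' where "d i (ev f) = ev f'" "d i (ev g) = ev g'" by blast
    then have "d i (ev (f + g)) = ev (f' + g')" by (simp add: derivationD[OF D])
    then show ?case by blast
  next
    case (mult f g)
    then obtain f' g' where "d i (ev f) = ev f'" "d i (ev g) = ev g'" by blast
    then have "d i (ev (f * g)) = ev (f * g' + f' * g)" by (simp add: derivationD[OF D])
    then show ?case by blast
  next
    case (C c)
    have "d i (ev (C3 c)) = ev 0" by (simp add: derivationD[OF D])
    then show ?case by blast
  qed (use y in simp_all)
qed

text \<open>Differentiate with respect to the outermost variable that occurs in \<open>p\<close>: in
  characteristic zero the derivative is nonzero and of smaller degree in that variable.\<close>

lemma nonvanishing_partial:
  assumes p: "prime_elem p"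
  shows "\<exists>k\<in>{0, 1, 2}. \<exists>g. d k (ev p) = ev g \<and> \<not> p dvd g"
proof -
  define h3 where "h3 = evp (of_cplx :: complex \<Rightarrow> 'k) y3"
  define h2 where "h2 = evp h3 y2"
  have r3: "rhom h3" unfolding h3_def by (rule rhom_evp[OF rhom_of_cplx])
  have r2: "rhom h2" unfolding h2_def by (rule rhom_evp[OF r3])
  have ev: "ev f = evp h2 y1 f" for f by (simp add: ev_def ev3_def h2_def h3_def)
  have k3: "D (h3 r) = evp of_cplx y3 (pderiv r) * D y3" if "D \<in> derivations" for D r
    unfolding h3_def by (rule derivation_evp[OF that rhom_of_cplx derivationD(3)[OF that]])
  have k2: "D (h2 r) = evp h3 y2 (pderiv r) * D y2" if "D \<in> derivations" "D y3 = 0" for D r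
    unfolding h2_def by (rule derivation_evp[OF that(1) r3]) (simp add: k3[OF that(1)] that(2))
  have nd: "\<not> q dvd pderiv q" if "degree q \<noteq> 0" for q :: "'c::{idom,ring_char_0} poly"
  proof
    assume "q dvd pderiv q"
    moreover have "pderiv q \<noteq> 0" using that by (simp add: pderiv_eq_0_iff)
    ultimately have "degree q \<le> degree (pderiv q)" by (rule dvd_imp_degree_le)
    then show False using that by (simp add: degree_pderiv)
  qed
  show ?thesis
  proof (cases "degree p = 0")
    case False
    have "d 0 (ev p) = evp h2 y1 (pderiv p) * d 0 y1"
      unfolding ev by (rule derivation_evp[OF d_der(1) r2]) (simp add: k2[OF d_der(1)] d_y)
    then have "d 0 (ev p) = ev (pderiv p)" by (simp add: ev d_y)
    then show ?thesis using nd[OF False] by blast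
  next
    case True
    then obtain q where q: "p = [:q:]" by (rule degree_eq_zeroE)
    show ?thesis
    proof (cases "degree q = 0")
      case False
      have "d 1 (ev p) = d 1 (h2 q)" by (simp only: ev q evp_const[OF r2])
      also have "\<dots> = h2 (pderiv q)" using k2[OF d_der(2), of q] d_y by (simp add: h2_def)
      also have "\<dots> = ev [:pderiv q:]" by (simp only: ev evp_const[OF r2])
      finally have e: "d 1 (ev p) = ev [:pderiv q:]" .
      have "\<not> p dvd [:pderiv q:]" unfolding q using nd[OF False] by (simp add: const_poly_dvd_const_poly_iff)
      then show ?thesis using e by blast
    next
      case True
      then obtain r where r: "q = [:r:]" by (rule degree_eq_zeroE)
      show ?thesis
      proof (cases "degree r = 0")
        case False
        have "d 2 (ev p) = d 2 (h3 r)" by (simp only: ev q r evp_const[OF r2]) (simp only: h2_def evp_const[OF r3])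
        also have "\<dots> = h3 (pderiv r)" using k3[OF d_der(3), of r] d_y by (simp add: h3_def)
        also have "\<dots> = ev [:[:pderiv r:]:]" by (simp only: ev evp_const[OF r2]) (simp only: h2_def evp_const[OF r3])
        finally have e: "d 2 (ev p) = ev [:[:pderiv r:]:]" .
        have "\<not> p dvd [:[:pderiv r:]:]" unfolding q r using nd[OF False] by (simp add: const_poly_dvd_const_poly_iff)
        then show ?thesis using e by blast
      next
        case True
        then obtain c where "r = [:c:]" by (rule degree_eq_zeroE)
        then have "p = [:[:[:c:]:]:]" using q r by simp
        then have "p = 0 \<or> is_unit p" by (cases "c = 0") (auto simp: is_unit_const_poly_iff dvd_field_iff)
        then show ?thesis using p by (auto simp: prime_elem_def)
      qed
    qed
  qed
qed

end
end

section \<open>The ramification formula\<close>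

context chart
begin

text \<open>A derivation that is logarithmic along a prime divisor of the base lifts to one that is
  logarithmic along the prime divisors above: the logarithmic derivative of an eigenvector
  \<open>w\<close> is a rational multiple of that of \<open>w ^ N\<close>, an element of the base. Here \<open>J\<close> is the local ring itself or its maximal ideal.\<close>

lemma log_derivation:
  assumes q: "pideal q B" and x: "prime_in (localization B q) x" and p: "prime_elem p" "ev p / x \<in> localization B q"
  defines "S \<equiv> loc_at (localization B q) x"
  assumes D: "D \<in> derivations" and J: "0 \<in> J" "\<And>a b. a \<in> J \<Longrightarrow> b \<in> J \<Longrightarrow> a + b \<in> J" "\<And>a b. a \<in> S \<Longrightarrow> b \<in> J \<Longrightarrow> a * b \<in> J"
      "max_ideal S \<subseteq> J" "J \<subseteq> S"
    and DA: "\<And>f. D (ev f) \<in> J" and Dp: "D (ev p) / ev p \<in> S"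
    and z: "z \<in> S"
  shows "D z \<in> J"
proof -
  define P where "P = localization B q"
  note ufd = ufd_loc[OF q, folded P_def] and fr = frac_full_loc[OF q, folded P_def]
  note x' = x[folded P_def] and p' = p[folded P_def]
  note Sd = is_dvr_loc_at[OF ufd fr x', unfolded P_def, folded S_def]
  note S = dvr_subr[OF Sd]
  have PS: "P \<subseteq> S" using subset_loc_at[OF ufd fr x'] by (simp add: S_def P_def)
  have BS: "B \<subseteq> S" using PS loc_subr(2)[OF q] by (simp add: P_def)
  have evS: "ev f \<in> S" for f using BS ev_B by blast
  have evP: "ev f \<in> P" for f using loc_subr(2)[OF q] ev_B unfolding P_def by blast
  have pnz: "p \<noteq> 0" using p by auto
  have unit: "unit_in S (ev h)" if "\<not> p dvd h" for h
  proof -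
    have "ev h / x \<notin> P" using that prime_dvd_ev_iff[OF q x p] by (simp add: P_def)
    moreover have "ev h \<in> P" using loc_subr(2)[OF q] ev_B by (auto simp: P_def)
    ultimately show ?thesis using loc_at_unit[OF ufd fr x'] by (simp add: S_def P_def)
  qed
  \<comment> \<open>Write f = p^n h with h prime to p: the logarithmic derivative of p is regular by
    hypothesis, and h is a unit at S.\<close>
  have log: "D (ev f) / ev f \<in> S" if f: "f \<noteq> 0" for f
  proof -
    have "\<not> is_unit p" using p(1) by (simp add: prime_elem_def)
    then obtain h where h: "f = p ^ multiplicity p f * h" "\<not> p dvd h"
      using multiplicity_decompose'[of f p] f by metis
    define n where "n = multiplicity p f"
    have "h \<noteq> 0" using h f by auto
    have f': "ev f = ev p ^ n * ev h" using h(1) unfolding n_def[symmetric] by simp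
    have "D (ev f) / ev f = of_nat n * (D (ev p) / ev p) + inverse (ev h) * D (ev h)"
    proof -
      have 1: "D (ev f) = ev p ^ n * D (ev h) + of_nat n * ev p ^ (n - 1) * D (ev p) * ev h"
        unfolding f' by (simp add: derivationD(2)[OF D] derivation_power[OF D])
      have 2: "of_nat n * ev p ^ (n - 1) * ev p = of_nat n * ev p ^ n" by (cases n) auto
      have "D (ev f) * ev p = ev p ^ n * ev p * D (ev h) + (of_nat n * ev p ^ (n - 1) * ev p) * (D (ev p) * ev h)"
        unfolding 1 by (simp add: algebra_simps)
      then have "D (ev f) * ev p = ev p ^ n * ev p * D (ev h) + of_nat n * ev p ^ n * (D (ev p) * ev h)"
        unfolding 2 .
      then show ?thesis unfolding f' using pnz \<open>h \<noteq> 0\<close> by (simp add: field_simps)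
    qed
    also have "\<dots> \<in> S"
    proof (intro subr_add[OF S] subr_mult[OF S])
      show "of_nat n \<in> S" by (rule subr_of_nat[OF S])
      show "D (ev p) / ev p \<in> S" by (rule Dp)
      show "inverse (ev h) \<in> S" using unit[OF h(2)] by (simp add: unit_in_def)
      show "D (ev h) \<in> S" using DA J(5) by blast
    qed
    finally show ?thesis .
  qed
  \<comment> \<open>With w^N = f, the derivative of w is w times that of f divided by N f. If p
    divides f, then w lies in the maximal ideal and absorbs the logarithmic term; otherwise f is a
    unit.\<close>
  have w: "D w \<in> J" if w: "w \<in> B \<inter> E" for w
  proof -
    obtain f where f: "w ^ N = ev f" "f \<noteq> 0" using E_B_power w by blast
    have wnz: "w \<noteq> 0" using w E_nz by blast
    have 1: "D (ev f) = of_nat N * w ^ (N - 1) * D w" using derivation_power[OF D, of w N] f(1) by simp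
    have 2: "w ^ (N - 1) * w = ev f" using f(1) N_pos by (cases N) (simp_all add: mult.commute)
    have "of_nat N * (w ^ (N - 1) * w) * D w = w * D (ev f)" unfolding 1 by (simp add: mult_ac)
    then have eq: "of_nat N * ev f * D w = w * D (ev f)" unfolding 2 .
    have Nnz: "of_nat N \<noteq> (0::'k)" by (rule of_nat_nz[OF N_pos])
    have Dw: "D w = of_cplx (inverse (of_nat N)) * (w * (D (ev f) / ev f))"
      unfolding of_cplx_inverse of_cplx_of_nat using eq f(2) Nnz by (simp add: field_simps)
    have cS: "of_cplx (inverse (of_nat N)) \<in> S" using const_B BS by blast
    have wS: "w \<in> S" using w BS by blast
    have "w * (D (ev f) / ev f) \<in> J"
    proof (cases "p dvd f")
      case True
      have "ev f / x \<in> P" using True prime_dvd_ev_iff[OF q x p] by (simp add: P_def)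
      then have "vl S (ev f) > 0"
        using vl_loc_at_pos_iff[OF ufd fr x' evP, of f] f(2) by (simp add: S_def P_def)
      then have "int N * vl S w > 0" unfolding f(1)[symmetric] by (simp add: vl_power[OF Sd wnz])
      then have "vl S w > 0" by (simp add: zero_less_mult_iff)
      then have "w \<in> max_ideal S" using vl_max_ideal_iff[OF Sd wnz] by simp
      then have "(D (ev f) / ev f) * w \<in> J" using J(3,4) log[OF f(2)] by blast
      then show ?thesis by (simp add: mult.commute)
    next
      case False
      have "(w * inverse (ev f)) * D (ev f) \<in> J"
        using unit[OF False] wS DA by (intro J(3) subr_mult[OF S]) (auto simp: unit_in_def)
      then show ?thesis by (simp add: divide_inverse mult_ac)
    qed
    then show ?thesis unfolding Dw by (rule J(3)[OF cS])
  qed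
  have b: "D b \<in> J" if b: "b \<in> B" for b
  proof -
    have "\<exists>ws. set ws \<subseteq> B \<inter> E \<and> b = sum_list ws"
      by (rule eigen_decomposition)
        (use subr_add[OF B_subr] subr_mult[OF B_subr const_B] Gal_B subr_0[OF B_subr] b in blast)+
    then obtain ws where ws: "set ws \<subseteq> B \<inter> E" "b = sum_list ws" by blast
    then have "\<forall>w\<in>set ws. D w \<in> J" using w by blast
    then show ?thesis unfolding ws(2) derivation_sum_list[OF D]
      by (induction ws) (auto simp: J(1) J(2))
  qed
  obtain q' where q': "pideal q' B" "S = localization B q'" using loc_at_is_point[OF q x] by (auto simp: S_def)
  obtain a t where at: "z = a / t" "a \<in> B" "t \<in> B - q'" using z unfolding q'(2) localization_def by blast
  have t: "unit_in S t" unfolding q'(2) by (rule localization_subr(3)[OF B_subr q'(1) at(3)])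
  then have tnz: "t \<noteq> 0" "inverse t \<in> S" by (auto simp: unit_in_def)
  have "D z = (inverse t) * D a + (- (z * inverse t)) * D t"
    unfolding at(1) derivation_divide[OF D tnz(1)] using tnz(1) by (simp add: field_simps power2_eq_square)
  also have "\<dots> \<in> J"
    using b[OF at(2)] b[of t] at(3) tnz z
    by (intro J(2) J(3) subr_uminus[OF S] subr_mult[OF S]) auto
  finally show ?thesis .
qed

lemma vl_of_nat:
  fixes S :: "'k set"
  assumes "is_dvr S" "\<And>c. of_cplx c \<in> S" "n > 0"
  shows "vl S (of_nat n) = 0"
proof -
  have "of_nat n = (of_cplx (of_nat n) :: 'k)" "inverse (of_nat n) = (of_cplx (inverse (of_nat n)) :: 'k)"
    by (simp_all add: of_cplx_of_nat of_cplx_inverse)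
  then have "unit_in S (of_nat n)" using assms of_nat_nz[OF assms(3), where 'k = 'k] unfolding unit_in_def by metis
  then show ?thesis by (rule vl_unit[OF assms(1)])
qed

text \<open>The ramification formula: if \<open>e\<close> is the ramification index, the pulled back volume form
  \<open>\<omega>0\<close> vanishes to the order \<open>e - 1\<close>.\<close>

lemma regular_forms_loc_at:
  assumes q: "pideal q B" and x: "prime_in (localization B q) x" and p: "prime_elem p" "ev p / x \<in> localization B q"
  defines "S \<equiv> loc_at (localization B q) x"
  assumes d: "dual d" and e: "vl S (ev p) = int e"
  shows "regular_forms 3 S = {form_scale a (form_scale (inverse x ^ (e - 1)) \<omega>0) | a. a \<in> S}"
proof -
  define P where "P = localization B q"
  note ufd = ufd_loc[OF q, folded P_def] and fr = frac_full_loc[OF q, folded P_def]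
  note x' = x[folded P_def] and p' = p[folded P_def]
  note Sd = is_dvr_loc_at[OF ufd fr x', unfolded P_def, folded S_def]
  note S = dvr_subr[OF Sd]
  have PS: "P \<subseteq> S" using subset_loc_at[OF ufd fr x'] by (simp add: S_def P_def)
  have BS: "B \<subseteq> S" using PS loc_subr(2)[OF q] by (simp add: P_def)
  have evS: "ev f \<in> S" for f using BS ev_B by blast
  have evP: "ev f \<in> P" for f using loc_subr(2)[OF q] ev_B unfolding P_def by blast
  have pnz: "p \<noteq> 0" and xnz: "x \<noteq> 0" using p prime_inD(2)[OF x] by auto
  have vx: "vl S x = 1" using vl_loc_at_self[OF ufd fr x'] by (simp add: S_def P_def)
  have e_pos: "e > 0" using vl_ev(2)[OF q x p pnz, folded S_def] e by simp
  have xS: "x \<in> S" using vl_nonneg_iff[OF Sd xnz] vx by simp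
  note der = d_der[OF d] and dy = d_y[OF d]
  note m = pideal_max_dvr[OF Sd]
  obtain k g where k: "k \<in> {0, 1, 2}" and g: "d k (ev p) = ev g" "\<not> p dvd g"
    using nonvanishing_partial[OF d p(1)] by blast
  have gnz: "g \<noteq> 0" using g(2) by auto
  have g_unit: "unit_in S (ev g)"
  proof -
    have "ev g / x \<notin> P" using g(2) prime_dvd_ev_iff[OF q x p] by (simp add: P_def)
    moreover have "ev g \<in> P" using loc_subr(2)[OF q] ev_B by (auto simp: P_def)
    ultimately show ?thesis using loc_at_unit[OF ufd fr x'] by (simp add: S_def P_def)
  qed
  then have gi: "inverse (ev g) \<in> S" by (simp add: unit_in_def)
  have dk: "d i \<in> derivations" if "i \<in> {0, 1, 2}" for i using d that unfolding dual_def by blast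
  have dA: "d i (ev f) \<in> S" if "i \<in> {0, 1, 2}" for i f using d_ev[OF d that, of f] evS by metis
  \<comment> \<open>A frame adapted to \<open>p\<close>: \<open>\<delta>\<close> maps
    \<open>ev p\<close> to itself and every \<open>\<eta> i\<close> kills it, so
    \<open>log_derivation\<close> applies to both, with the maximal ideal and with
    \<open>S\<close>.\<close>
  define \<delta> where "\<delta> = (\<lambda>z. (ev p / ev g) * d k z)"
  define \<eta> where "\<eta> i = (\<lambda>z. (- (d i (ev p) / ev g)) * d k z + d i z)" for i
  have \<delta>_der: "\<delta> \<in> derivations" unfolding \<delta>_def by (rule derivation_scale[OF dk[OF k]])
  have \<eta>_der: "\<eta> i \<in> derivations" if "i \<in> {0, 1, 2}" for i
    unfolding \<eta>_def by (rule derivation_comb[OF dk[OF k] dk[OF that]])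
  have p_max: "ev p \<in> max_ideal S" using vl_max_ideal_iff[OF Sd] vl_ev(2)[OF q x p pnz, folded S_def] pnz by auto
  have \<delta>S: "\<delta> z \<in> max_ideal S" if "z \<in> S" for z
  proof (rule log_derivation[OF q x p \<delta>_der, folded S_def, where J = "max_ideal S"])
    show "\<delta> (ev f) \<in> max_ideal S" for f
    proof -
      have "(inverse (ev g) * d k (ev f)) * ev p \<in> max_ideal S"
        using gi dA[OF k] by (intro pidealD(5)[OF m _ p_max] subr_mult[OF S])
      then show ?thesis by (simp add: \<delta>_def divide_inverse mult_ac)
    qed
    show "\<delta> (ev p) / ev p \<in> S" using g gnz pnz subr_1[OF S] by (simp add: \<delta>_def)
  qed (use that pidealD(1,2,4,5)[OF m] in auto)
  have \<eta>S: "\<eta> i z \<in> S" if i: "i \<in> {0, 1, 2}" and z: "z \<in> S" for i z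
  proof (rule log_derivation[OF q x p \<eta>_der[OF i], folded S_def, where J = S])
    show "\<eta> i (ev f) \<in> S" for f
      unfolding \<eta>_def divide_inverse using dA[OF i] dA[OF k] gi
      by (intro subr_add[OF S] subr_mult[OF S] subr_uminus[OF S])
    show "\<eta> i (ev p) / ev p \<in> S" using g gnz subr_0[OF S] by (simp add: \<eta>_def)
  qed (use z subr_0[OF S] subr_add[OF S] subr_mult[OF S] in \<open>auto simp: max_ideal_def\<close>)
  define \<rho> where "\<rho> = ev p / ev g"
  have \<rho>nz: "\<rho> \<noteq> 0" using pnz gnz by (simp add: \<rho>_def)
  have v\<rho>: "vl S \<rho> = int e" unfolding \<rho>_def using pnz gnz e vl_unit[OF Sd g_unit] by (simp add: vl_divide[OF Sd])
  \<comment> \<open>Row operations on the Jacobian: row \<open>k\<close> is scaled by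
    \<open>\<rho>\<close>, and multiples of the old row \<open>k\<close> are added to the other
    rows.\<close>
  have det: "\<rho> * det3 (\<lambda>i j. d i (f j)) = det3 (\<lambda>i j. if i = k then \<delta> (f j) else \<eta> i (f j))" for f
  proof -
    define c where "c i = d i (ev p) / ev g" for i
    have "det3 (\<lambda>i j. if i = k then \<rho> * d k (f j) else - c i * d k (f j) + d i (f j)) = \<rho> * det3 (\<lambda>i j. d i (f j))"
      using k by (elim insertE emptyE; simp add: det3_def algebra_simps)
    moreover have "(\<lambda>i j. if i = k then \<delta> (f j) else \<eta> i (f j))
        = (\<lambda>i j. if i = k then \<rho> * d k (f j) else - c i * d k (f j) + d i (f j))"
      unfolding \<delta>_def \<eta>_def \<rho>_def c_def ..
    ultimately show ?thesis by (simp only:)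
  qed
  \<comment> \<open>The row of \<open>\<delta>\<close> has entries in the maximal ideal, so a factor
    \<open>x\<close> can be taken out of it.\<close>
  have bound: "inverse x * (\<rho> * det3 (\<lambda>i j. d i (f j))) \<in> S" if f: "f 0 \<in> S" "f 1 \<in> S" "f 2 \<in> S" for f
  proof -
    define a where "a i j = (if i = k then \<delta> (f j) else \<eta> i (f j))" for i j
    have fj: "f j \<in> S" if "j \<in> {0, 1, 2}" for j using that f by auto
    define b where "b i j = (if i = k then inverse x * a i j else a i j)" for i j
    have bS: "b i j \<in> S" if ij: "i \<in> {0, 1, 2}" "j \<in> {0, 1, 2}" for i j
    proof (cases "i = k")
      case True
      have "\<delta> (f j) \<in> max_ideal S" using \<delta>S fj ij by blast
      then have "inverse x * \<delta> (f j) \<in> S"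
      proof (cases "\<delta> (f j) = 0")
        case False
        then have "vl S (\<delta> (f j)) > 0" using \<open>\<delta> (f j) \<in> max_ideal S\<close> vl_max_ideal_iff[OF Sd False] by simp
        then show ?thesis using False xnz vx
          by (subst vl_nonneg_iff[OF Sd]) (auto simp: vl_mult[OF Sd] vl_inverse[OF Sd])
      qed (simp add: subr_0[OF S])
      then show ?thesis using True by (simp add: a_def b_def)
    next
      case False
      then show ?thesis using \<eta>S[OF ij(1) fj[OF ij(2)]] by (simp add: a_def b_def)
    qed
    have "inverse x * det3 a = det3 b"
      using k by (elim insertE emptyE; simp add: b_def det3_def algebra_simps)
    also have "\<dots> \<in> S" unfolding det3_def
      by (intro subr_add[OF S] subr_diff[OF S] subr_mult[OF S] bS) simp_all
    finally show ?thesis unfolding det a_def .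
  qed
  \<comment> \<open>The bound is sharp: in the coordinate system, replace the k-th coordinate by the
    local parameter \<open>x\<close>.\<close>
  have special: "\<exists>f. (\<forall>i<3. f i \<in> S) \<and> det3 (\<lambda>i j. d i (f j)) \<noteq> 0 \<and> vl S (det3 (\<lambda>i j. d i (f j))) = 1 - int e"
  proof -
    define f where "f = yf(k := x)"
    have yS: "yf i \<in> S" if "i \<in> {0, 1, 2}" for i
    proof -
      have "yf i = ev T1 \<or> yf i = ev T2 \<or> yf i = ev T3" using that by auto
      then show ?thesis using evS by metis
    qed
    have "\<forall>i<3. f i \<in> S"
    proof (intro allI impI)
      fix i :: nat assume "i < 3"
      then have "i \<in> {0, 1, 2}" by auto
      then show "f i \<in> S" using yS xS by (auto simp: f_def)
    qed
    moreover have det_f: "det3 (\<lambda>i j. d i (f j)) = d k x"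
      using k dy by (elim insertE emptyE; simp add: f_def det3_def)
    moreover have "\<delta> x \<noteq> 0 \<and> vl S (\<delta> x) = 1"
    proof -
      define u where "u = ev p / x ^ e"
      have u: "unit_in S u" "u \<noteq> 0"
        using vl_unit_iff[OF Sd, of u] e vx xnz pnz by (simp_all add: u_def vl_divide[OF Sd] vl_power[OF Sd])
      have pu: "ev p = u * x ^ e" using xnz by (simp add: u_def)
      \<comment> \<open>Applying \<open>\<delta>\<close> to p = u x^e shows that u e times
        \<open>\<delta> x\<close> is the unit u - \<open>\<delta> u\<close> times x. In
        characteristic zero e is a unit, hence \<open>\<delta> x\<close> has value 1.\<close>
      have "\<delta> (ev p) = ev p" using g gnz by (simp add: \<delta>_def)
      then have "u * x ^ e = u * (of_nat e * x ^ (e - 1) * \<delta> x) + \<delta> u * x ^ e"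
        unfolding pu derivationD(2)[OF \<delta>_der] derivation_power[OF \<delta>_der] by simp
      moreover have "x ^ e = x ^ (e - 1) * x" using e_pos by (cases e) (simp_all add: mult.commute)
      ultimately have "x ^ (e - 1) * (u * x) = x ^ (e - 1) * (u * of_nat e * \<delta> x + \<delta> u * x)"
        by (simp add: algebra_simps)
      then have "u * x = u * of_nat e * \<delta> x + \<delta> u * x"
        by (subst (asm) mult_left_cancel) (simp_all add: xnz)
      then have eq: "u * of_nat e * \<delta> x = (u - \<delta> u) * x" by (simp add: algebra_simps)
      have "\<delta> u \<in> max_ideal S" using \<delta>S u(1) by (simp add: unit_in_def)
      have "\<not> (u - \<delta> u) \<in> max_ideal S"
      proof
        assume "u - \<delta> u \<in> max_ideal S"
        then have "u - \<delta> u + \<delta> u \<in> max_ideal S" using \<open>\<delta> u \<in> max_ideal S\<close> by (rule pidealD(4)[OF m])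
        then show False using u by (simp add: unit_in_def max_ideal_def)
      qed
      moreover have "u - \<delta> u \<in> S" using u(1) \<open>\<delta> u \<in> max_ideal S\<close> pidealD(1)[OF m]
        by (intro subr_diff[OF S]) (auto simp: unit_in_def)
      ultimately have w: "unit_in S (u - \<delta> u)" by (auto simp: max_ideal_def unit_in_def)
      have enz: "of_nat e \<noteq> (0::'k)" by (rule of_nat_nz[OF e_pos])
      have cS: "of_cplx c \<in> S" for c using const_B BS by blast
      have nz: "\<delta> x \<noteq> 0"
      proof
        assume "\<delta> x = 0"
        then have "(u - \<delta> u) * x = 0" using eq by simp
        then show False using w xnz by (auto simp: unit_in_def)
      qed
      have "vl S u + vl S (of_nat e) + vl S (\<delta> x) = vl S (u - \<delta> u) + vl S x"
        using arg_cong[OF eq, of "vl S"] nz u(2) enz w xnz by (simp add: vl_mult[OF Sd] unit_in_def)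
      then show ?thesis using nz vl_unit[OF Sd u(1)] vl_unit[OF Sd w] vl_of_nat[OF Sd cS e_pos] vx by simp
    qed
    moreover have "\<delta> x = \<rho> * d k x" by (simp add: \<delta>_def \<rho>_def)
    ultimately have "d k x \<noteq> 0" "vl S (d k x) = 1 - int e"
      using \<rho>nz v\<rho> by (auto simp: vl_mult[OF Sd])
    then show ?thesis using \<open>\<forall>i<3. f i \<in> S\<close> det_f by (intro exI[of _ f]) simp
  qed
  define \<gamma> where "\<gamma> = inverse x ^ (e - 1)"
  have \<gamma>: "\<gamma> \<noteq> 0" "vl S \<gamma> = 1 - int e"
    using xnz e_pos vx by (simp_all add: \<gamma>_def vl_power[OF Sd] vl_inverse[OF Sd])
  show ?thesis
    unfolding \<gamma>_def[symmetric]
  proof (intro equalityI subsetI)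
    fix \<omega> assume "\<omega> \<in> regular_forms 3 S"
    then obtain F c where F: "finite F" "\<forall>f\<in>F. c f \<in> S \<and> (\<forall>i<3. f i \<in> S)" "\<omega> = (\<Sum>f\<in>F. form_scale (c f) (wedge_d 3 f))"
      unfolding regular_forms_def by blast
    define a where "a f = c f * (det3 (\<lambda>i j. d i (f j)) / \<gamma>)" for f
    have "\<omega> = (\<Sum>f\<in>F. form_scale (a f) (form_scale \<gamma> \<omega>0))"
      unfolding F(3) wedge_eq_\<omega>0[OF d] form_scale_simps a_def using \<gamma>(1) by (intro sum.cong refl) simp
    then have "\<omega> = form_scale (\<Sum>f\<in>F. a f) (form_scale \<gamma> \<omega>0)" by (simp add: sum_form_scale)
    moreover have "(\<Sum>f\<in>F. a f) \<in> S"
    proof (rule subr_sum[OF S])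
      fix f assume f: "f \<in> F"
      have fi: "f 0 \<in> S" "f 1 \<in> S" "f 2 \<in> S" using F(2) f by auto
      have "det3 (\<lambda>i j. d i (f j)) / \<gamma> = (inverse x * (\<rho> * det3 (\<lambda>i j. d i (f j)))) * (x / (\<rho> * \<gamma>))"
        using xnz \<rho>nz by simp
      moreover have "x / (\<rho> * \<gamma>) \<in> S"
        using xnz \<rho>nz \<gamma> v\<rho> vx by (subst vl_nonneg_iff[OF Sd]) (simp_all add: vl_divide[OF Sd] vl_mult[OF Sd])
      ultimately have "det3 (\<lambda>i j. d i (f j)) / \<gamma> \<in> S" using bound[OF fi] subr_mult[OF S] by metis
      then show "a f \<in> S" unfolding a_def using F(2) f subr_mult[OF S] by blast
    qed
    ultimately show "\<omega> \<in> {form_scale a (form_scale \<gamma> \<omega>0) | a. a \<in> S}" by blast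
  next
    fix \<omega> assume "\<omega> \<in> {form_scale a (form_scale \<gamma> \<omega>0) | a. a \<in> S}"
    then obtain a where a: "a \<in> S" "\<omega> = form_scale a (form_scale \<gamma> \<omega>0)" by blast
    obtain f where f: "\<forall>i<3. f i \<in> S" "det3 (\<lambda>i j. d i (f j)) \<noteq> 0" "vl S (det3 (\<lambda>i j. d i (f j))) = 1 - int e"
      using special by blast
    define c where "c = a * (\<gamma> / det3 (\<lambda>i j. d i (f j)))"
    have "\<gamma> / det3 (\<lambda>i j. d i (f j)) \<in> S"
      using f \<gamma> by (subst vl_nonneg_iff[OF Sd]) (simp_all add: vl_divide[OF Sd])
    then have cS: "c \<in> S" unfolding c_def using a(1) subr_mult[OF S] by blast
    have "\<omega> = (\<Sum>f\<in>{f}. form_scale c (wedge_d 3 f))"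
      unfolding a(2) using f(2) by (simp add: wedge_eq_\<omega>0[OF d] form_scale_simps c_def)
    moreover have "finite {f} \<and> (\<forall>f'\<in>{f}. c \<in> S \<and> (\<forall>i<3. f' i \<in> S))" using cS f(1) by simp
    ultimately show "\<omega> \<in> regular_forms 3 S" unfolding regular_forms_def
      by (intro CollectI exI[of _ "{f}"] exI[of _ "\<lambda>_. c"]) simp_all
  qed
qed

text \<open>Two generators of the regular forms differ by a unit, so the definite description in
  \<open>form_ord\<close> denotes; ramification contributes the index minus one.\<close>

lemma form_ord_loc_at:
  assumes q: "pideal q B" and x: "prime_in (localization B q) x" and p: "prime_elem p" "ev p / x \<in> localization B q"
  defines "S \<equiv> loc_at (localization B q) x"
  assumes d: "dual d" and f: "f \<noteq> 0"
  shows "form_ord 3 S (form_scale f \<omega>0) = vl S f + vl S (ev p) - 1"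
proof -
  define P where "P = localization B q"
  note ufd = ufd_loc[OF q, folded P_def] and fr = frac_full_loc[OF q, folded P_def]
  note x' = x[folded P_def]
  note Sd = is_dvr_loc_at[OF ufd fr x', unfolded P_def, folded S_def]
  note S = dvr_subr[OF Sd]
  have pnz: "p \<noteq> 0" and xnz: "x \<noteq> 0" using p prime_inD(2)[OF x] by auto
  have vx: "vl S x = 1" using vl_loc_at_self[OF ufd fr x'] by (simp add: S_def P_def)
  define e where "e = nat (vl S (ev p))"
  have e: "vl S (ev p) = int e" "e > 0" using vl_ev(2)[OF q x p pnz, folded S_def] by (simp_all add: e_def)
  define \<gamma> where "\<gamma> = inverse x ^ (e - 1)"
  have \<gamma>: "\<gamma> \<noteq> 0" "vl S \<gamma> = 1 - int e"
    using xnz e vx by (simp_all add: \<gamma>_def vl_power[OF Sd] vl_inverse[OF Sd])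
  note R = regular_forms_loc_at[OF q x p d e(1)[unfolded S_def], folded S_def \<gamma>_def]
  note nz = \<omega>0_nz[OF d]
  show ?thesis
    unfolding form_ord_def
  proof (rule the_equality)
    have fg: "f / \<gamma> \<noteq> 0" "form_scale f \<omega>0 = form_scale (f / \<gamma>) (form_scale \<gamma> \<omega>0)"
      using f \<gamma> by (simp_all add: form_scale_simps)
    have "vl S f + vl S (ev p) - 1 = ord_along S (f / \<gamma>)"
      using f \<gamma> e by (simp add: ord_along_dvr[OF Sd] vl_divide[OF Sd])
    then show "\<exists>f' \<eta>. f' \<noteq> 0 \<and> regular_forms 3 S = {form_scale a \<eta> |a. a \<in> S} \<and>
       form_scale f \<omega>0 = form_scale f' \<eta> \<and> vl S f + vl S (ev p) - 1 = ord_along S f'"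
      using R fg by blast
    fix n assume "\<exists>f' \<eta>. f' \<noteq> 0 \<and> regular_forms 3 S = {form_scale a \<eta> |a. a \<in> S} \<and>
       form_scale f \<omega>0 = form_scale f' \<eta> \<and> n = ord_along S f'"
    then obtain f' \<eta> where f': "f' \<noteq> 0" "regular_forms 3 S = {form_scale a \<eta> |a. a \<in> S}"
       "form_scale f \<omega>0 = form_scale f' \<eta>" "n = ord_along S f'" by blast
    have "\<eta> = form_scale 1 \<eta>" by (simp add: form_scale_simps)
    then have "\<eta> \<in> regular_forms 3 S" unfolding f'(2) using subr_1[OF S] by blast
    then obtain a where a: "a \<in> S" "\<eta> = form_scale a (form_scale \<gamma> \<omega>0)" unfolding R by blast
    have "form_scale \<gamma> \<omega>0 = form_scale 1 (form_scale \<gamma> \<omega>0)" by (simp add: form_scale_simps)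
    then have "form_scale \<gamma> \<omega>0 \<in> regular_forms 3 S" unfolding R using subr_1[OF S] by blast
    then obtain b where b: "b \<in> S" "form_scale \<gamma> \<omega>0 = form_scale b \<eta>" unfolding f'(2) by blast
    have "form_scale \<gamma> \<omega>0 = form_scale b (form_scale a (form_scale \<gamma> \<omega>0))" using b(2) unfolding a(2) .
    then have "form_scale \<gamma> \<omega>0 = form_scale (b * a * \<gamma>) \<omega>0" by (simp only: form_scale_simps mult.assoc)
    then have "b * a = 1" using form_scale_inj[OF nz] \<gamma> by simp
    then have "a \<noteq> 0" "inverse a = b" by (auto simp: inverse_unique mult.commute)
    then have "vl S a = 0" using a b by (intro vl_unit[OF Sd]) (auto simp: unit_in_def)
    have "form_scale f \<omega>0 = form_scale (f' * a * \<gamma>) \<omega>0" unfolding f'(3) a(2) by (simp add: form_scale_simps mult.assoc)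
    then have "f = f' * a * \<gamma>" using form_scale_inj[OF nz] by simp
    then have "vl S f = vl S f' + (1 - int e)"
      using f' \<open>a \<noteq> 0\<close> \<gamma> \<open>vl S a = 0\<close> by (simp add: vl_mult[OF Sd])
    then show "n = vl S f + vl S (ev p) - 1" unfolding f'(4) ord_along_dvr[OF Sd f'(1)] using e by simp
  qed
qed

end

section \<open>Abelian covers of projective space\<close>

definition yc :: "(nat \<Rightarrow> 'k::field) \<Rightarrow> nat \<Rightarrow> nat \<Rightarrow> 'k" where
  "yc s i k = s (if k < i then k else Suc k) / s i"

text \<open>A prime divisor of projective space is given by a normalized irreducible polynomial, or is the
  hyperplane at infinity (\<open>None\<close>).\<close>

fun val :: "p3 option \<Rightarrow> p3 \<Rightarrow> int" where
  "val (Some p) f = int (multiplicity p f)"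
| "val None f = - int (tdeg f)"

fun dg :: "p3 option \<Rightarrow> nat" where
  "dg (Some p) = tdeg p"
| "dg None = 1"

definition divisors :: "p3 option set" where
  "divisors = insert None (Some ` {p. Factorial_Ring.prime p})"

text \<open>The ratio \<open>s i / s 0\<close> as a polynomial in the coordinates of the chart 0,
  see \<open>ec_Sv\<close>.\<close>

definition Sv :: "nat \<Rightarrow> p3" where
  "Sv i = (if i = 0 then 1 else if i = 1 then T1 else if i = 2 then T2 else T3)"

lemma Sv_nz [simp]: "Sv i \<noteq> 0"
  by (simp add: Sv_def)

lemma tdeg_Sv: "tdeg (Sv i) = (if i = 0 then 0 else 1)"
  by (simp add: Sv_def)

lemma T1_dvd_iff: "T1 dvd f \<longleftrightarrow> poly f 0 = 0"
  by (simp add: T1_def poly_eq_0_iff_dvd)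

lemma prime_elem_T1: "prime_elem T1"
proof (rule prime_elemI)
  show "\<not> is_unit T1" by (simp add: T1_dvd_iff)
qed (auto simp: T1_dvd_iff)

lemma tdeg_unit:
  assumes "is_unit u" shows "tdeg u = 0"
proof -
  obtain v where v: "u * v = 1" using assms by (metis dvdE)
  then have "u \<noteq> 0" "v \<noteq> 0" by auto
  then show ?thesis using v tdeg_mult[of u v] by simp
qed

lemma tdeg_normalize: "tdeg (normalize f) = tdeg f"
proof (cases "f = 0")
  case False
  have "tdeg (unit_factor f * normalize f) = tdeg (unit_factor f) + tdeg (normalize f)"
    using False by (intro tdeg_mult) auto
  then show ?thesis using tdeg_unit[of "unit_factor f"] False by simp
qed simp

lemma tdeg_prime: "prime_elem p \<Longrightarrow> tdeg p \<ge> 1"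
proof (rule ccontr)
  assume p: "prime_elem p" and "\<not> tdeg p \<ge> 1"
  then obtain c where c: "p = C3 c" using tdeg_0_const[of p] by auto
  then have "c \<noteq> 0" using p by (auto simp: C3_def)
  then have "p * C3 (inverse c) = 1" unfolding c using rhomD(4)[OF rhom_C3, of c "inverse c"] rhomD(2)[OF rhom_C3] by simp
  then have "is_unit p" by (metis dvd_triv_left)
  then show False using p by (simp add: prime_elem_def)
qed

text \<open>Test on defining polynomials: a prime polynomial has value 1 on its own divisor, value 0
  on the divisor of another prime, and negative value at infinity.\<close>

lemma divisors_separated:
  assumes D: "D \<in> divisors" "D' \<in> divisors" and e: "e > 0" "e' > 0"
    and eq: "\<And>f. f \<noteq> 0 \<Longrightarrow> e * val D f = e' * val D' f"
  shows "D = D'"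
proof (cases D)
  case None
  show ?thesis
  proof (cases D')
    case (Some p)
    then have p: "Factorial_Ring.prime p" using D by (auto simp: divisors_def)
    have "e * val None p = e' * val (Some p) p" using eq[of p] None Some p by auto
    moreover have "multiplicity p p = 1" using p by (intro multiplicity_self) auto
    ultimately have "- (e * int (tdeg p)) = e'" by simp
    moreover have "e * int (tdeg p) \<ge> 0" using e by simp
    ultimately show ?thesis using e by linarith
  qed (use None in simp)
next
  case (Some p)
  then have p: "Factorial_Ring.prime p" using D by (auto simp: divisors_def)
  have self: "multiplicity p p = 1" using p by (intro multiplicity_self) auto
  show ?thesis
  proof (cases D')
    case None
    have "e = e' * val None p" using eq[of p] None Some p self by auto
    moreover have "e' * int (tdeg p) \<ge> 0" using e by simp
    ultimately show ?thesis using e by simp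
  next
    case Some': (Some p')
    then have p': "Factorial_Ring.prime p'" using D by (auto simp: divisors_def)
    have "e = e' * int (multiplicity p' p)" using eq[of p] Some Some' p self by auto
    then have "multiplicity p' p \<noteq> 0" using e by (intro notI) simp
    then have "p' dvd p" using not_dvd_imp_multiplicity_0[of p' p] by argo
    then have "p' = p" using primes_dvd_imp_eq[OF p' p] by simp
    then show ?thesis using Some Some' by simp
  qed
qed

lemma tdeg_eq_sum:
  assumes "f \<noteq> 0" "finite F" "prime_factors f \<subseteq> F" "\<And>p. p \<in> F \<Longrightarrow> Factorial_Ring.prime p"
  shows "(\<Sum>p\<in>F. tdeg p * multiplicity p f) = tdeg f"
proof -
  have "(\<Sum>p\<in>F. tdeg p * multiplicity p f) = (\<Sum>p\<in>prime_factors f. tdeg p * multiplicity p f)"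
    using assms by (intro sum.mono_neutral_right) (auto simp: prime_factors_multiplicity)
  also have "\<dots> = (\<Sum>p\<in>prime_factors f. tdeg (p ^ multiplicity p f))"
  proof (intro sum.cong refl)
    fix p assume "p \<in> prime_factors f"
    then have "p \<noteq> 0" using in_prime_factors_imp_prime by fastforce
    then show "tdeg p * multiplicity p f = tdeg (p ^ multiplicity p f)" by (simp add: tdeg_power)
  qed
  also have "\<dots> = tdeg (\<Prod>p\<in>prime_factors f. p ^ multiplicity p f)"
  proof -
    have "finite I \<Longrightarrow> (\<forall>i\<in>I. g i \<noteq> 0) \<Longrightarrow> (\<Sum>i\<in>I. tdeg (g i)) = tdeg (\<Prod>i\<in>I. g i)" for I and g :: "p3 \<Rightarrow> p3"
      by (induction I rule: finite_induct) (auto simp: tdeg_mult prod_zero_iff)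
    then show ?thesis by auto
  qed
  also have "(\<Prod>p\<in>prime_factors f. p ^ multiplicity p f) = prod_mset (prime_factorization f)"
    unfolding prod_mset_multiplicity
    by (intro prod.cong refl) (simp add: count_prime_factorization_prime in_prime_factors_imp_prime)
  also have "tdeg \<dots> = tdeg f"
    using prod_mset_prime_factorization_weak[OF assms(1)] by (metis tdeg_normalize)
  finally show ?thesis .
qed

abbreviation evc :: "(nat \<Rightarrow> 'k::complex_extension_field) \<Rightarrow> nat \<Rightarrow> p3 \<Rightarrow> 'k" where
  "evc s i \<equiv> ev3 of_cplx (yc s i 0) (yc s i 1) (yc s i 2)"

lemmas evc_simps = rhomD[OF rhom_ev3[OF rhom_of_cplx]] ev3_simps[OF rhom_of_cplx]

lemma s_ratio_range:
  assumes i: "i \<le> 3" and j: "j \<le> 3" and nz: "s i \<noteq> 0"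
  shows "s j / s i \<in> range (evc s i)"
proof -
  have "s i / s i = evc s i 1" using nz by (simp add: evc_simps)
  moreover have y: "yc s i 0 = evc s i T1" "yc s i 1 = evc s i T2" "yc s i 2 = evc s i T3" by (simp_all add: evc_simps)
  moreover have "i = 0 \<or> i = 1 \<or> i = 2 \<or> i = 3" "j = 0 \<or> j = 1 \<or> j = 2 \<or> j = 3" using i j by linarith+
  then have "j = i \<or> s j / s i = yc s i 0 \<or> s j / s i = yc s i 1 \<or> s j / s i = yc s i 2"
    by (elim disjE) (simp_all add: yc_def numeral_eq_Suc)
  ultimately show ?thesis by (metis rangeI)
qed

lemma ufd_nonunit:
  assumes P: "ufd P" and a: "a \<in> P" "a \<noteq> 0" "inverse a \<notin> P"
  shows "\<exists>x. prime_in P x \<and> a / x \<in> P"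
proof -
  obtain u xs where u: "unit_in P u" and xs: "\<forall>x\<in>set xs. prime_in P x" and eq: "a = u * prod_list xs"
    using P a unfolding ufd_def by blast
  show ?thesis
  proof (cases xs)
    case Nil
    then show ?thesis using u eq a by (simp add: unit_in_def)
  next
    case (Cons x ys)
    have x: "prime_in P x" "x \<noteq> 0" "set ys \<subseteq> P" using xs Cons prime_inD(1,2)[of P] by auto
    have "a / x = u * prod_list ys" using eq Cons x by simp
    moreover have "u * prod_list ys \<in> P"
      using subr_mult[OF ufd_subr[OF P]] subr_prod_list[OF ufd_subr[OF P]] u x by (simp add: unit_in_def)
    ultimately show ?thesis using x by metis
  qed
qed

lemma range_ev3:
  assumes "rhom h" "\<And>c. of_cplx c \<in> range h" "y1 \<in> range h" "y2 \<in> range h" "y3 \<in> range h"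
  shows "ev3 of_cplx y1 y2 y3 f \<in> range (h :: p3 \<Rightarrow> 'k::complex_extension_field)"
proof (induction f rule: p3_induct)
  case (add f g)
  then obtain a b where "ev3 of_cplx y1 y2 y3 f = h a" "ev3 of_cplx y1 y2 y3 g = h b" by blast
  then have "ev3 of_cplx y1 y2 y3 (f + g) = h (a + b)"
    by (simp add: rhomD[OF rhom_ev3[OF rhom_of_cplx]] rhomD[OF assms(1)])
  then show ?case by simp
next
  case (mult f g)
  then obtain a b where "ev3 of_cplx y1 y2 y3 f = h a" "ev3 of_cplx y1 y2 y3 g = h b" by blast
  then have "ev3 of_cplx y1 y2 y3 (f * g) = h (a * b)"
    by (simp add: rhomD[OF rhom_ev3[OF rhom_of_cplx]] rhomD[OF assms(1)])
  then show ?case by simp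
qed (simp_all add: ev3_simps[OF rhom_of_cplx] assms)

text \<open>The prime ideal of \<open>x\<close> meets \<open>B\<close> in a nonzero prime, which
  contains a nonzero polynomial by \<open>ev_in_ideal\<close>; some prime factor of it is divisible
  by \<open>x\<close>.\<close>

lemma (in chart) ex_prime_over:
  assumes q: "pideal q B" and x: "prime_in (localization B q) x"
  shows "\<exists>p. prime_elem p \<and> ev p / x \<in> localization B q"
proof -
  define P where "P = localization B q"
  have uP: "ufd P" unfolding P_def by (rule ufd_loc[OF q])
  have BP: "B \<subseteq> P" unfolding P_def by (rule loc_subr(2)[OF q])
  have x': "prime_in P x" using x unfolding P_def .
  note J = prime_pideal[OF uP x']
  define q' where "q' = {b \<in> B. b / x \<in> P}"
  have q': "pideal q' B" unfolding pideal_def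
  proof (intro conjI ballI impI)
    show "0 \<in> q'" using pidealD(2)[OF J] subr_0[OF B_subr] by (simp add: q'_def)
    show "1 \<notin> q'" using pidealD(3)[OF J] BP subr_1[OF B_subr] by (auto simp: q'_def)
    show "q' \<subseteq> B" by (auto simp: q'_def)
  next
    fix a b assume "a \<in> q'" "b \<in> q'"
    then show "a + b \<in> q'" using pidealD(4)[OF J, of a b] subr_add[OF B_subr, of a b] BP by (auto simp: q'_def)
  next
    fix a b assume "a \<in> B" "b \<in> q'"
    then show "a * b \<in> q'" using pidealD(5)[OF J, of a b] subr_mult[OF B_subr, of a b] BP by (auto simp: q'_def)
  next
    fix a b assume "a \<in> B" "b \<in> B" "a * b \<in> q'"
    then show "a \<in> q' \<or> b \<in> q'" using pidealD(6)[OF J, of a b] BP by (auto simp: q'_def)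
  qed
  obtain a b where ab: "a \<in> B" "b \<in> B - q" "x = a / b"
    using prime_inD(1)[OF x] unfolding localization_def by blast
  have nz: "x \<noteq> 0" by (rule prime_inD(2)[OF x])
  have b: "b \<noteq> 0" using ab pidealD(2)[OF q] by auto
  have "a / x = b" "a \<noteq> 0" using ab nz b by auto
  then have "a \<in> q'" using ab BP unfolding q'_def by auto
  then obtain f where f: "f \<noteq> 0" "ev f \<in> q'" using ev_in_ideal[OF q' _ \<open>a \<noteq> 0\<close>] by blast
  have "ev f / x \<in> localization B q" using f(2) unfolding q'_def P_def by simp
  then show ?thesis using prime_below[OF q x f(1)] by blast
qed

text \<open>\<open>Bc i\<close> is the coordinate ring of the inverse image of the chart \<open>s i \<noteq> 0\<close>.\<close>

locale cover = abelian_ext L Gal for L :: "'k::complex_extension_field set" and Gal +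
  fixes X :: "'k set set" and s :: "nat \<Rightarrow> 'k" and Bc Mc :: "nat \<Rightarrow> 'k set"
  assumes s_nz: "i \<le> 3 \<Longrightarrow> s i \<noteq> 0"
    and charts: "i \<le> 3 \<Longrightarrow> chart L Gal (yc s i 0) (yc s i 1) (yc s i 2) (Bc i) (Mc i)"
    and pts: "i \<le> 3 \<Longrightarrow> {P \<in> X. \<forall>j\<le>3. s j / s i \<in> P} = {localization (Bc i) q | q. pideal q (Bc i)}"
    and cov: "P \<in> X \<Longrightarrow> \<exists>i\<le>3. \<forall>j\<le>3. s j / s i \<in> P"
begin

definition ec :: "nat \<Rightarrow> p3 \<Rightarrow> 'k" where
  "ec i = chart.ev (yc s i 0) (yc s i 1) (yc s i 2)"

lemma le_3_cases: "i \<le> 3 \<Longrightarrow> i = 0 \<or> i = 1 \<or> i = 2 \<or> i = (3::nat)" by linarith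

lemma ec_rhom: "i \<le> 3 \<Longrightarrow> rhom (ec i)"
  unfolding ec_def by (rule chart.ev_rhom[OF charts])

lemma ec_Sv: "i \<le> 3 \<Longrightarrow> ec 0 (Sv i) = s i / s 0"
proof -
  interpret C: chart L Gal "yc s 0 0" "yc s 0 1" "yc s 0 2" "Bc 0" "Mc 0"
    rewrites "chart.ev (yc s 0 0) (yc s 0 1) (yc s 0 2) = ec 0" by (rule charts, simp, rule ec_def[symmetric])
  assume "i \<le> 3"
  moreover have "yc s 0 0 = s 1 / s 0" "yc s 0 (Suc 0) = s 2 / s 0" "yc s 0 2 = s 3 / s 0"
    by (simp_all add: yc_def numeral_eq_Suc)
  ultimately show ?thesis using le_3_cases[of i] s_nz[of 0] by (auto simp: Sv_def)
qed

lemma ec_T1: "1 \<le> i \<Longrightarrow> i \<le> 3 \<Longrightarrow> ec i T1 = s 0 / s i"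
proof -
  assume i: "1 \<le> i" "i \<le> 3"
  interpret C: chart L Gal "yc s i 0" "yc s i 1" "yc s i 2" "Bc i" "Mc i"
    rewrites "chart.ev (yc s i 0) (yc s i 1) (yc s i 2) = ec i" by (rule charts, fact, rule ec_def[symmetric])
  have "yc s i 0 = s 0 / s i" using i by (simp add: yc_def)
  then show ?thesis by simp
qed

lemma s_ratio_ec: "i \<le> 3 \<Longrightarrow> j \<le> 3 \<Longrightarrow> s j / s i \<in> range (ec i)"
  unfolding ec_def using s_ratio_range[where s = s, of i j] s_nz chart.ev_def[OF charts] by metis

text \<open>Make \<open>f\<close> homogeneous of degree \<open>d\<close> and set the i-th coordinate
  to 1: the component of degree k is multiplied by \<open>(s 0 / s i) ^ (d - k)\<close>.\<close>

lemma ec_to_chart: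
  assumes i: "i \<le> 3" and d: "tdeg f \<le> d"
  shows "\<exists>g. ec i g = ec 0 f / (s i / s 0) ^ d"
proof -
  interpret C: chart L Gal "yc s i 0" "yc s i 1" "yc s i 2" "Bc i" "Mc i"
    rewrites "chart.ev (yc s i 0) (yc s i 1) (yc s i 2) = ec i" by (rule charts, fact, rule ec_def[symmetric])
  define t where "t = s i / s 0"
  have t: "t \<noteq> 0" using s_nz[OF i] s_nz[of 0] by (simp add: t_def)
  define e where "e = ev3 of_cplx (s 1 / s i) (s 2 / s i) (s 3 / s i)"
  have e: "e g \<in> range (ec i)" for g unfolding e_def
  proof (rule range_ev3[OF ec_rhom[OF i]])
    fix c show "of_cplx c \<in> range (ec i)" by (metis C.ev_T(4) rangeI)
  qed (rule s_ratio_ec[OF i]; simp)+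
  have y: "s j / s 0 = t * (s j / s i)" for j using s_nz[OF i] s_nz[of 0] by (simp add: t_def)
  have "ec 0 f = ev3 of_cplx (s 1 / s 0) (s 2 / s 0) (s 3 / s 0) f"
    unfolding ec_def chart.ev_def[OF charts[of 0, OF le0]] unfolding yc_def by (simp add: numeral_eq_Suc)
  also have "\<dots> = ev3 of_cplx (t * (s 1 / s i)) (t * (s 2 / s i)) (t * (s 3 / s i)) f" using y by metis
  also have "\<dots> = evp e t (H f)" unfolding e_def by (rule ev3_scaled[OF rhom_of_cplx])
  also have "\<dots> = (\<Sum>k\<le>d. e (cmp k f) * t ^ k)"
  proof -
    have e0: "e 0 = 0" unfolding e_def by (rule rhomD(1)[OF rhom_ev3[OF rhom_of_cplx]])
    have "degree (map_poly e (H f)) \<le> d" using d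
      by (intro degree_le) (simp add: coeff_map_poly e0 coeff_eq_0 tdeg_def)
    then have "evp e t (H f) = (\<Sum>k\<le>d. coeff (map_poly e (H f)) k * t ^ k)"
      unfolding evp_def poly_altdef by (intro sum.mono_neutral_left) (auto simp: coeff_eq_0)
    then show ?thesis by (simp add: coeff_map_poly e0 cmp_def)
  qed
  finally have "ec 0 f / t ^ d = (\<Sum>k\<le>d. e (cmp k f) * (s 0 / s i) ^ (d - k))"
  proof -
    assume "ec 0 f = (\<Sum>k\<le>d. e (cmp k f) * t ^ k)"
    moreover have "t ^ k / t ^ d = (s 0 / s i) ^ (d - k)" if "k \<le> d" for k
    proof -
      have "t ^ d = t ^ k * t ^ (d - k)" using that by (simp flip: power_add)
      then have "t ^ k / t ^ d = inverse t ^ (d - k)" using t by (simp add: field_simps)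
      then show ?thesis by (simp add: t_def)
    qed
    ultimately show ?thesis by (simp add: sum_divide_distrib flip: times_divide_eq_right)
  qed
  moreover have "(\<Sum>k\<le>d. e (cmp k f) * (s 0 / s i) ^ (d - k)) \<in> C.A"
    unfolding C.A_def by (intro subr_sum subr_mult subr_power C.A_subr[unfolded C.A_def] e s_ratio_ec i) simp
  ultimately show ?thesis unfolding C.A_def t_def by (metis imageE)
qed

text \<open>The converse passage. The bound \<open>tdeg f \<le> k\<close> says that there is no pole
  along the hyperplane at infinity beyond the one that the denominator compensates.\<close>

lemma ec_from_chart:
  assumes i: "i \<le> 3"
  shows "\<exists>f k. tdeg f \<le> k \<and> ec i g = ec 0 f / (s i / s 0) ^ k"
proof -
  interpret C: chart L Gal "yc s i 0" "yc s i 1" "yc s i 2" "Bc i" "Mc i"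
    rewrites "chart.ev (yc s i 0) (yc s i 1) (yc s i 2) = ec i" by (rule charts, fact, rule ec_def[symmetric])
  interpret C0: chart L Gal "yc s 0 0" "yc s 0 1" "yc s 0 2" "Bc 0" "Mc 0"
    rewrites "chart.ev (yc s 0 0) (yc s 0 1) (yc s 0 2) = ec 0" by (rule charts, simp, rule ec_def[symmetric])
  define t where "t = s i / s 0"
  have t: "t \<noteq> 0" using s_nz[OF i] s_nz[of 0] by (simp add: t_def)
  have St: "ec 0 (Sv i) = t" "tdeg (Sv i) \<le> 1" using ec_Sv[OF i] by (simp_all add: t_def tdeg_Sv)
  have St': "ec 0 (Sv i ^ k) = t ^ k" "tdeg (Sv i ^ k) \<le> k" for k
    using St by (simp_all add: tdeg_power)
  have y: "\<exists>f k. tdeg f \<le> k \<and> s j / s i = ec 0 f / t ^ k" if j: "j \<le> 3" for j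
  proof (intro exI[of _ "Sv j"] exI[of _ 1] conjI)
    show "s j / s i = ec 0 (Sv j) / t ^ 1" using ec_Sv[OF j] s_nz[of 0] by (simp add: t_def)
  qed (simp add: tdeg_Sv)
  have yj: "\<exists>j\<le>3. yc s i k = s j / s i" if "k \<le> 2" for k
    unfolding yc_def using that by (intro exI[of _ "if k < i then k else Suc k"]) auto
  show ?thesis unfolding t_def[symmetric]
  proof (induction g rule: p3_induct)
    case (C c)
    show ?case by (intro exI[of _ "C3 c"] exI[of _ 0]) simp
  next
    case T1 show ?case using y yj[of 0] unfolding C.ev_T by fastforce
  next
    case T2 show ?case using y yj[of 1] unfolding C.ev_T by fastforce
  next
    case T3 show ?case using y yj[of 2] unfolding C.ev_T by fastforce
  next
    case (add g1 g2)
    then obtain f1 k1 f2 k2 where f: "tdeg f1 \<le> k1" "ec i g1 = ec 0 f1 / t ^ k1" "tdeg f2 \<le> k2" "ec i g2 = ec 0 f2 / t ^ k2"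
      by blast
    have "tdeg (f1 * Sv i ^ k2 + f2 * Sv i ^ k1) \<le> k1 + k2"
      using f St'(2)[of k1] St'(2)[of k2] tdeg_mult_le[of f1 "Sv i ^ k2"] tdeg_mult_le[of f2 "Sv i ^ k1"]
      by (intro tdeg_add_le) linarith+
    moreover have "ec i (g1 + g2) = ec 0 (f1 * Sv i ^ k2 + f2 * Sv i ^ k1) / t ^ (k1 + k2)"
      using t f by (simp add: St power_add add_frac_eq)
    ultimately show ?case by blast
  next
    case (mult g1 g2)
    then obtain f1 k1 f2 k2 where f: "tdeg f1 \<le> k1" "ec i g1 = ec 0 f1 / t ^ k1" "tdeg f2 \<le> k2" "ec i g2 = ec 0 f2 / t ^ k2"
      by blast
    have "tdeg (f1 * f2) \<le> k1 + k2" using f tdeg_mult_le[of f1 f2] by linarith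
    moreover have "ec i (g1 * g2) = ec 0 (f1 * f2) / t ^ (k1 + k2)" using f by (simp add: power_add)
    ultimately show ?case by blast
  qed
qed

lemma PD_intro:
  assumes i: "i \<le> 3" and q: "pideal q (Bc i)" and x: "prime_in (localization (Bc i) q) x"
  shows "loc_at (localization (Bc i) q) x \<in> prime_divisors X"
proof -
  interpret C: chart L Gal "yc s i 0" "yc s i 1" "yc s i 2" "Bc i" "Mc i"
    rewrites "chart.ev (yc s i 0) (yc s i 1) (yc s i 2) = ec i" by (rule charts, fact, rule ec_def[symmetric])
  have "krull_dim (loc_at (localization (Bc i) q) x) = 1"
    by (intro krull_dim_dvr is_dvr_loc_at C.ufd_loc C.frac_full_loc q x)
  then show ?thesis using C.loc_at_is_point[OF q x] pts[OF i] unfolding prime_divisors_def by blast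
qed

lemma PD_chart:
  assumes S: "S \<in> prime_divisors X" and i: "i \<le> 3" "\<And>j. j \<le> 3 \<Longrightarrow> s j / s i \<in> S"
  obtains q x p where "pideal q (Bc i)" "prime_in (localization (Bc i) q) x" "S = loc_at (localization (Bc i) q) x"
    "prime_elem p" "ec i p / x \<in> localization (Bc i) q"
proof -
  interpret C: chart L Gal "yc s i 0" "yc s i 1" "yc s i 2" "Bc i" "Mc i"
    rewrites "chart.ev (yc s i 0) (yc s i 1) (yc s i 2) = ec i" by (rule charts, fact, rule ec_def[symmetric])
  have SX: "S \<in> X" and kd: "krull_dim S = 1" using S by (simp_all add: prime_divisors_def)
  then have "S \<in> {P \<in> X. \<forall>j\<le>3. s j / s i \<in> P}" using i(2) by simp
  then have "S \<in> {localization (Bc i) q | q. pideal q (Bc i)}" unfolding pts[OF i(1)] .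
  then obtain q where q: "pideal q (Bc i)" "S = localization (Bc i) q" by (elim CollectE exE conjE)
  moreover note kd
  ultimately obtain x where x: "prime_in S x" "loc_at S x = S" using C.codim_one_point[OF q(1)] by blast
  obtain p where "prime_elem p" "ec i p / x \<in> localization (Bc i) q"
    using C.ex_prime_over[OF q(1)] x q by blast
  then show thesis using that[OF q(1), of x] x q by simp
qed

lemma PD_dvr: assumes S: "S \<in> prime_divisors X" shows "is_dvr S"
proof -
  obtain i where i: "i \<le> 3" "\<And>j. j \<le> 3 \<Longrightarrow> s j / s i \<in> S" using cov[of S] S by (auto simp: prime_divisors_def)
  interpret C: chart L Gal "yc s i 0" "yc s i 1" "yc s i 2" "Bc i" "Mc i"
    rewrites "chart.ev (yc s i 0) (yc s i 1) (yc s i 2) = ec i" by (rule charts, fact, rule ec_def[symmetric])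
  obtain q x where "pideal q (Bc i)" "prime_in (localization (Bc i) q) x" "S = loc_at (localization (Bc i) q) x"
    using PD_chart[OF S i] by blast
  then show ?thesis using is_dvr_loc_at[OF C.ufd_loc[of q] C.frac_full_loc[of q]] by metis
qed

end

section \<open>Prime divisors of the cover over those of projective space\<close>

context cover
begin

text \<open>Stated by values of polynomials of the chart 0, so that the hyperplane at infinity needs
  no separate treatment; \<open>e\<close> is the ramification index.\<close>

definition lies_over :: "'k set \<Rightarrow> p3 option \<Rightarrow> int \<Rightarrow> bool" where
  "lies_over S D e \<longleftrightarrow> S \<in> prime_divisors X \<and> D \<in> divisors \<and> e > 0 \<and> (\<forall>f. f \<noteq> 0 \<longrightarrow> vl S (ec 0 f) = e * val D f)"

text \<open>The hyperplane at infinity is visible in the charts \<open>i \<ge> 1\<close>, as \<open>T1 = 0\<close>; all other prime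
  divisors meet the chart 0.\<close>

definition rep :: "nat \<Rightarrow> 'k set \<Rightarrow> 'k \<Rightarrow> p3 \<Rightarrow> 'k set \<Rightarrow> p3 option \<Rightarrow> bool" where
  "rep i q x p S D \<longleftrightarrow> i \<le> 3 \<and> pideal q (Bc i) \<and> prime_in (localization (Bc i) q) x \<and>
     S = loc_at (localization (Bc i) q) x \<and> prime_elem p \<and> ec i p / x \<in> localization (Bc i) q \<and>
     (i = 0 \<and> D = Some p \<and> Factorial_Ring.prime p \<or> 1 \<le> i \<and> p = T1 \<and> D = None)"

lemma ec0_eq_0_iff [simp]: "ec 0 f = 0 \<longleftrightarrow> f = 0"
  and ec0_eq_iff: "ec 0 f = ec 0 g \<longleftrightarrow> f = g"
  unfolding ec_def using chart.ev_eq_0_iff[OF charts[of 0]] chart.ev_eq_iff[OF charts[of 0]] by auto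

lemmas ec0_simps = rhomD[OF ec_rhom[OF le0]]

text \<open>In the chart \<open>i\<close>, \<open>T1\<close> is the equation
  \<open>s 0 / s i\<close> of the hyperplane at infinity. If it divided the form of exact degree
  \<open>tdeg f\<close>, total degrees would disagree after clearing powers of
  \<open>Sv i\<close>.\<close>

lemma T1_not_dvd_top:
  assumes i: "1 \<le> i" "i \<le> 3" and f: "f \<noteq> 0" and g: "ec i g = ec 0 f / (s i / s 0) ^ tdeg f"
  shows "\<not> T1 dvd g"
proof
  assume "T1 dvd g"
  then obtain g' where g': "g = T1 * g'" by (elim dvdE)
  obtain f' k where f': "tdeg f' \<le> k" "ec i g' = ec 0 f' / (s i / s 0) ^ k" using ec_from_chart[OF i(2)] by blast
  define t where "t = s i / s 0"
  have t: "t \<noteq> 0" using s_nz[OF i(2)] s_nz[of 0] by (simp add: t_def)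
  have "ec i T1 = inverse t" using ec_T1[OF i] by (simp add: t_def)
  then have "ec 0 f / t ^ tdeg f = inverse t * (ec 0 f' / t ^ k)"
    using g f' unfolding g' t_def[symmetric] by (simp add: rhomD[OF ec_rhom[OF i(2)]])
  then have "ec 0 f * t ^ Suc k = ec 0 f' * t ^ tdeg f" using t by (simp add: field_simps)
  then have "ec 0 (f * Sv i ^ Suc k) = ec 0 (f' * Sv i ^ tdeg f)"
    using ec_Sv[OF i(2)] unfolding t_def by (simp only: ec0_simps)
  then have eq: "f * Sv i ^ Suc k = f' * Sv i ^ tdeg f" by (simp only: ec0_eq_iff)
  then have "f' \<noteq> 0" using f by auto
  have "tdeg (f * Sv i ^ Suc k) = tdeg f + Suc k" "tdeg (f' * Sv i ^ tdeg f) = tdeg f' + tdeg f"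
    using f i \<open>f' \<noteq> 0\<close> by (simp_all add: tdeg_mult tdeg_power tdeg_Sv del: power_Suc)
  then show False using eq f' by simp
qed

lemma rep_vl:
  assumes "i \<le> 3" "pideal q (Bc i)" "prime_in (localization (Bc i) q) x" "S = loc_at (localization (Bc i) q) x"
    "prime_elem p" "ec i p / x \<in> localization (Bc i) q" "f \<noteq> 0"
  shows "vl S (ec i f) = int (multiplicity p f) * vl S (ec i p)" "vl S (ec i p) > 0"
proof -
  interpret C: chart L Gal "yc s i 0" "yc s i 1" "yc s i 2" "Bc i" "Mc i"
    rewrites "chart.ev (yc s i 0) (yc s i 1) (yc s i 2) = ec i" by (rule charts, fact, rule ec_def[symmetric])
  show "vl S (ec i f) = int (multiplicity p f) * vl S (ec i p)" "vl S (ec i p) > 0"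
    using C.vl_ev[OF assms(2,3,5,6,7)] assms(4) by simp_all
qed

text \<open>At infinity \<open>f\<close> is a power of \<open>s i / s 0\<close>, with exponent
  \<open>tdeg f\<close>, times a factor that is prime to \<open>T1\<close>. Its value is therefore
  \<open>- tdeg f\<close> times that of \<open>T1\<close>.\<close>

lemma rep_over:
  assumes rep: "rep i q x p S D"
  shows "lies_over S D (vl S (ec i p))"
proof -
  note r = rep[unfolded rep_def]
  have PD: "S \<in> prime_divisors X" using PD_intro[of i q x] r by simp
  note vl = rep_vl[of i q x S p, OF r[THEN conjunct1] r[THEN conjunct2, THEN conjunct1]
     r[THEN conjunct2, THEN conjunct2, THEN conjunct1] r[THEN conjunct2, THEN conjunct2, THEN conjunct2, THEN conjunct1]
     r[THEN conjunct2, THEN conjunct2, THEN conjunct2, THEN conjunct2, THEN conjunct1]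
     r[THEN conjunct2, THEN conjunct2, THEN conjunct2, THEN conjunct2, THEN conjunct2, THEN conjunct1]]
  note dvr = PD_dvr[OF PD]
  have D: "D \<in> divisors" using r by (auto simp: divisors_def)
  have "vl S (ec 0 f) = vl S (ec i p) * val D f" if f: "f \<noteq> 0" for f
  proof (cases "i = 0")
    case True
    then show ?thesis using vl(1)[OF f] r by simp
  next
    case False
    then have i: "1 \<le> i" "i \<le> 3" and p: "p = T1" "D = None" using r by auto
    obtain g where g: "ec i g = ec 0 f / (s i / s 0) ^ tdeg f" using ec_to_chart[OF i(2) order_refl] by blast
    have t: "s i / s 0 \<noteq> 0" using s_nz[OF i(2)] s_nz[of 0] by simp
    have g0: "ec i g \<noteq> 0" using f t by (simp add: g)
    then have "g \<noteq> 0" using rhomD(1)[OF ec_rhom[OF i(2)]] by auto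
    then have "vl S (ec i g) = 0" using vl(1)[of g] T1_not_dvd_top[OF i f g] p
      by (simp add: not_dvd_imp_multiplicity_0)
    moreover have "vl S (s i / s 0) = - vl S (ec i T1)"
      using vl_inverse[OF dvr, of "ec i T1"] ec_T1[OF i] t by simp
    moreover have "ec 0 f = ec i g * (s i / s 0) ^ tdeg f" using g t by simp
    ultimately show ?thesis using vl_mult[OF dvr g0, of "(s i / s 0) ^ tdeg f"] vl_power[OF dvr t] t p by simp
  qed
  then show ?thesis unfolding lies_over_def using PD D vl(2)[of 1] by simp
qed

text \<open>If \<open>S\<close> is not a point over the chart 0, then \<open>s 0 / s i\<close> is
  not a unit at \<open>S\<close> for a chart \<open>i\<close> that contains \<open>S\<close>; so
  \<open>x\<close> divides \<open>T1\<close>.\<close>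

lemma PD_rep:
  assumes S: "S \<in> prime_divisors X"
  shows "\<exists>i q x p D. rep i q x p S D"
proof (cases "\<forall>j\<le>3. s j / s 0 \<in> S")
  case True
  obtain q x p where r: "pideal q (Bc 0)" "prime_in (localization (Bc 0) q) x" "S = loc_at (localization (Bc 0) q) x"
    "prime_elem p" "ec 0 p / x \<in> localization (Bc 0) q" by (rule PD_chart[OF S, of 0]) (use True in auto)
  interpret C: chart L Gal "yc s 0 0" "yc s 0 1" "yc s 0 2" "Bc 0" "Mc 0"
    rewrites "chart.ev (yc s 0 0) (yc s 0 1) (yc s 0 2) = ec 0" by (rule charts, simp, rule ec_def[symmetric])
  have "ec 0 (normalize p) / x \<in> localization (Bc 0) q"
    using C.prime_dvd_ev_iff[OF r(1,2,4,5), of "normalize p"] by simp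
  moreover have "Factorial_Ring.prime (normalize p)" using r(4) by simp
  ultimately have "rep 0 q x (normalize p) S (Some (normalize p))" unfolding rep_def using r by auto
  then show ?thesis by blast
next
  case False
  obtain i where i: "i \<le> 3" "\<And>j. j \<le> 3 \<Longrightarrow> s j / s i \<in> S" using cov[of S] S by (auto simp: prime_divisors_def)
  then have i1: "1 \<le> i" using False by (cases i) auto
  obtain q x p where r: "pideal q (Bc i)" "prime_in (localization (Bc i) q) x" "S = loc_at (localization (Bc i) q) x"
    by (rule PD_chart[OF S i])
  interpret C: chart L Gal "yc s i 0" "yc s i 1" "yc s i 2" "Bc i" "Mc i"
    rewrites "chart.ev (yc s i 0) (yc s i 1) (yc s i 2) = ec i" by (rule charts, fact, rule ec_def[symmetric])
  define P where "P = localization (Bc i) q"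
  have P: "ufd P" "frac_full P" "prime_in P x" using r C.ufd_loc C.frac_full_loc by (auto simp: P_def)
  have T1P: "ec i T1 \<in> P" unfolding P_def by (rule subsetD[OF C.loc_subr(2)[OF r(1)] C.ev_B])
  have "ec i T1 / x \<in> P"
  proof (rule ccontr)
    assume "ec i T1 / x \<notin> P"
    then have u: "unit_in S (ec i T1)" using loc_at_unit[OF P T1P] r by (simp add: P_def)
    have "s j / s 0 \<in> S" if j: "j \<le> 3" for j
    proof -
      have "s j / s 0 = (s j / s i) * inverse (ec i T1)"
        using s_nz[OF i(1)] s_nz[of 0] ec_T1[OF i1 i(1)] by simp
      then show ?thesis using subr_mult[OF dvr_subr[OF PD_dvr[OF S]] i(2)[OF j]] u by (simp add: unit_in_def)
    qed
    then show False using False by blast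
  qed
  then have "rep i q x T1 S None" unfolding rep_def using r i(1) i1 prime_elem_T1 by (simp add: P_def)
  then show ?thesis by blast
qed

lemma point_of_dvd:
  assumes i: "i \<le> 3" and q: "pideal q (Bc i)" and x: "prime_in (localization (Bc i) q) x"
    and px: "ec i p / x \<in> localization (Bc i) q"
  shows "ec i p \<in> q"
proof (rule ccontr)
  assume np: "ec i p \<notin> q"
  interpret C: chart L Gal "yc s i 0" "yc s i 1" "yc s i 2" "Bc i" "Mc i"
    rewrites "chart.ev (yc s i 0) (yc s i 1) (yc s i 2) = ec i" by (rule charts, fact, rule ec_def[symmetric])
  have u: "unit_in (localization (Bc i) q) (ec i p)" using localization_subr(3)[OF C.B_subr q, of "ec i p"] np by simp
  have "inverse x = inverse (ec i p) * (ec i p / x)" using u by (simp add: unit_in_def divide_inverse)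
  then have "inverse x \<in> localization (Bc i) q"
    using subr_mult[OF C.loc_subr(1)[OF q] _ px, of "inverse (ec i p)"] u by (simp add: unit_in_def)
  then show False using prime_inD(3)[OF x] by simp
qed

lemma rep_point:
  assumes rep: "rep i q x p S D" shows "ec i p \<in> q"
  using point_of_dvd[of i q x p] rep unfolding rep_def by simp

lemma point_rep:
  assumes i: "i \<le> 3" and q: "pideal q (Bc i)" and p: "prime_elem p" "ec i p \<in> q"
  shows "\<exists>x. prime_in (localization (Bc i) q) x \<and> ec i p / x \<in> localization (Bc i) q"
proof -
  interpret C: chart L Gal "yc s i 0" "yc s i 1" "yc s i 2" "Bc i" "Mc i"
    rewrites "chart.ev (yc s i 0) (yc s i 1) (yc s i 2) = ec i" by (rule charts, fact, rule ec_def[symmetric])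
  have nz: "ec i p \<noteq> 0" using p by auto
  have "ec i p \<in> localization (Bc i) q" by (rule subsetD[OF C.loc_subr(2)[OF q] C.ev_B])
  then show ?thesis by (rule ufd_nonunit[OF C.ufd_loc[OF q] _ nz localization_subr(4)[OF C.B_subr q p(2) nz]])
qed

lemma ex_rep:
  assumes D: "D \<in> divisors" shows "\<exists>i q x p S. rep i q x p S D"
proof -
  define i :: nat and p where "i = (if D = None then 1 else 0)" and "p = (case D of None \<Rightarrow> T1 | Some p \<Rightarrow> p)"
  have i: "i \<le> 3" by (simp add: i_def)
  have p: "prime_elem p" using D prime_elem_T1 by (auto simp: p_def divisors_def)
  interpret C: chart L Gal "yc s i 0" "yc s i 1" "yc s i 2" "Bc i" "Mc i"
    rewrites "chart.ev (yc s i 0) (yc s i 1) (yc s i 2) = ec i" by (rule charts, fact, rule ec_def[symmetric])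
  have "\<not> (\<exists>h1 h2. p * h1 + 0 * h2 = 1)" using p by (metis add.right_neutral mult_zero_left dvd_triv_left prime_elem_def)
  then obtain q where q: "pideal q (Bc i)" "ec i p \<in> q" using C.ex_point by blast
  obtain x where "prime_in (localization (Bc i) q) x" "ec i p / x \<in> localization (Bc i) q"
    using point_rep[OF i q(1) p q(2)] by blast
  then have "rep i q x p (loc_at (localization (Bc i) q) x) D" unfolding rep_def
    using i q p D by (auto simp: i_def p_def divisors_def)
  then show ?thesis by blast
qed

lemma over_unique:
  assumes "lies_over S D e" "lies_over S D' e'" shows "D' = D"
proof (rule divisors_separated[of D' D e' e])
  fix f :: p3 assume "f \<noteq> 0"
  then have "vl S (ec 0 f) = e * val D f" "vl S (ec 0 f) = e' * val D' f" using assms by (auto simp: lies_over_def)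
  then show "e' * val D' f = e * val D f" by linarith
qed (use assms in \<open>auto simp: lies_over_def\<close>)

lemma L_ec0E:
  assumes "u \<in> L" obtains f g where "g \<noteq> 0" "u = ec 0 f / ec 0 g"
proof -
  interpret C: chart L Gal "yc s 0 0" "yc s 0 1" "yc s 0 2" "Bc 0" "Mc 0"
    rewrites "chart.ev (yc s 0 0) (yc s 0 1) (yc s 0 2) = ec 0" by (rule charts, simp, rule ec_def[symmetric])
  obtain f g where "g \<noteq> 0" "u = ec 0 f / ec 0 g" by (rule C.L_fracE[OF assms])
  then show thesis by (rule that)
qed

lemma over_vl_L:
  assumes S: "lies_over S D e" and S': "lies_over S' D e'" and u: "u \<in> L" "u \<noteq> 0"
  shows "e' * vl S u = e * vl S' u"
proof -
  obtain f g where fg: "g \<noteq> 0" "u = ec 0 f / ec 0 g" using L_ec0E[OF u(1)] .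
  then have f: "f \<noteq> 0" using u(2) by auto
  have v: "vl S u = e * val D f - e * val D g" "vl S' u = e' * val D f - e' * val D g"
    using S S' f fg vl_divide[OF PD_dvr, of S "ec 0 f" "ec 0 g"] vl_divide[OF PD_dvr, of S' "ec 0 f" "ec 0 g"]
    unfolding lies_over_def by simp_all
  show ?thesis unfolding v by (simp add: algebra_simps)
qed

text \<open>Values over the same divisor are proportional on \<open>L\<close>, and the N-th powers
  of eigenvectors lie in \<open>L\<close>.\<close>

lemma over_vl_E:
  assumes S: "lies_over S D e" and S': "lies_over S' D e'" and w: "w \<in> E"
  shows "e' * vl S w = e * vl S' w"
proof -
  have "int N * (e' * vl S w) = e' * vl S (w ^ N)" using vl_power[OF PD_dvr E_nz[OF w], of S] S by (simp add: lies_over_def)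
  also have "\<dots> = e * vl S' (w ^ N)" using over_vl_L[OF S S' E_power_N[OF w]] E_nz[OF w] by simp
  also have "\<dots> = int N * (e * vl S' w)" using vl_power[OF PD_dvr E_nz[OF w], of S'] S' by (simp add: lies_over_def)
  finally show ?thesis using N_pos by simp
qed

lemma point_eigen:
  assumes i: "i \<le> 3" and q: "pideal q (Bc i)" and p: "prime_elem p" "ec i p \<in> q"
  shows "\<exists>w\<in>E. \<forall>x. prime_in (localization (Bc i) q) x \<longrightarrow>
    vl (loc_at (localization (Bc i) q) x) w = (if ec i p / x \<in> localization (Bc i) q then 1 else 0)"
proof -
  interpret C: chart L Gal "yc s i 0" "yc s i 1" "yc s i 2" "Bc i" "Mc i"
    rewrites "chart.ev (yc s i 0) (yc s i 1) (yc s i 2) = ec i" by (rule charts, fact, rule ec_def[symmetric])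
  show ?thesis by (rule C.ex_eigen_radical[OF q p])
qed

lemma PD_over: "S \<in> prime_divisors X \<Longrightarrow> \<exists>D e. lies_over S D e"
  using PD_rep rep_over by blast

lemma ex_over: "D \<in> divisors \<Longrightarrow> \<exists>S e. lies_over S D e"
  using ex_rep rep_over by blast

text \<open>The eigenvector that generates the radical at a point of \<open>S\<close> vanishes
  simply along \<open>S\<close>.\<close>

lemma over_uniformizer:
  assumes S: "lies_over S D e" shows "\<exists>w\<in>E. vl S w = 1"
proof -
  have "S \<in> prime_divisors X" using S by (simp add: lies_over_def)
  then obtain i q x p D where rep: "rep i q x p S D" using PD_rep by blast
  then have r: "i \<le> 3" "pideal q (Bc i)" "prime_elem p" "prime_in (localization (Bc i) q) x"
    "ec i p / x \<in> localization (Bc i) q" "S = loc_at (localization (Bc i) q) x" unfolding rep_def by auto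
  obtain w where "w \<in> E" "vl (loc_at (localization (Bc i) q) x) w = 1"
    using point_eigen[OF r(1-3) rep_point[OF rep]] r(4,5) by metis
  then show ?thesis using r(6) by blast
qed

text \<open>With uniformizers in \<open>E\<close> on both sides the two indices divide each other.
  This takes the place of transitivity of the Galois group on the divisors over
  \<open>D\<close>.\<close>

lemma over_same:
  assumes S: "lies_over S D e" and S': "lies_over S' D e'"
  shows "e = e'" "w \<in> E \<Longrightarrow> vl S w = vl S' w"
proof -
  have e: "e > 0" "e' > 0" using S S' by (auto simp: lies_over_def)
  obtain w where w: "w \<in> E" "vl S w = 1" using over_uniformizer[OF S] by blast
  obtain w' where w': "w' \<in> E" "vl S' w' = 1" using over_uniformizer[OF S'] by blast
  have m: "e' = e * vl S' w" "e = e' * vl S w'" using over_vl_E[OF S S' w(1)] over_vl_E[OF S S' w'(1)] w w' by auto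
  have "e dvd e'" "e' dvd e" by (rule dvdI, rule m)+
  then show eq: "e = e'" by (intro zdvd_antisym_nonneg) (use e in linarith)+
  show "vl S w = vl S' w" if "w \<in> E" for w using over_vl_E[OF S S' that] e unfolding eq by simp
qed

text \<open>By \<open>over_same\<close> the choice affects neither the index nor the values on
  \<open>E\<close>.\<close>

definition pick :: "p3 option \<Rightarrow> 'k set" where "pick D = (SOME S. \<exists>e. lies_over S D e)"
definition V :: "p3 option \<Rightarrow> 'k \<Rightarrow> int" where "V D w = vl (pick D) w"
definition ram :: "p3 option \<Rightarrow> nat" where "ram D = nat (SOME e. lies_over (pick D) D e)"

lemma over_pick: assumes "D \<in> divisors" shows "lies_over (pick D) D (int (ram D))"
proof -
  have "\<exists>e. lies_over (pick D) D e" unfolding pick_def by (rule someI_ex) (rule ex_over[OF assms])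
  then have o: "lies_over (pick D) D (SOME e. lies_over (pick D) D e)" by (rule someI_ex)
  have "e > 0 \<Longrightarrow> int (nat e) = e" for e by simp
  then show ?thesis using o unfolding ram_def by (metis lies_over_def)
qed

lemma overD:
  assumes S: "lies_over S D e"
  shows "S \<in> prime_divisors X" "D \<in> divisors" "e = int (ram D)" "w \<in> E \<Longrightarrow> vl S w = V D w"
proof -
  show D: "S \<in> prime_divisors X" "D \<in> divisors" using S by (auto simp: lies_over_def)
  note o = over_same[OF S over_pick[OF D(2)]]
  show "e = int (ram D)" by (rule o(1))
  show "w \<in> E \<Longrightarrow> vl S w = V D w" unfolding V_def by (rule o(2))
qed

context
  fixes D :: "p3 option" assumes D: "D \<in> divisors"
begin

lemma ram_pos: "ram D > 0" using over_pick[OF D] by (simp add: lies_over_def)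

lemma V_dvr: "is_dvr (pick D)" using over_pick[OF D] PD_dvr by (simp add: lies_over_def)

lemma V_mult: "w \<in> E \<Longrightarrow> w' \<in> E \<Longrightarrow> V D (w * w') = V D w + V D w'"
  unfolding V_def by (intro vl_mult V_dvr E_nz)

lemma V_inverse: "w \<in> E \<Longrightarrow> V D (inverse w) = - V D w"
  unfolding V_def by (intro vl_inverse V_dvr E_nz)

lemma V_1 [simp]: "V D 1 = 0"
  unfolding V_def by (rule vl_1[OF V_dvr])

lemma V_ec: "f \<noteq> 0 \<Longrightarrow> V D (ec 0 f) = int (ram D) * val D f"
  using over_pick[OF D] by (simp add: lies_over_def V_def)

lemma V_L_dvd: assumes "u \<in> L" "u \<noteq> 0" shows "int (ram D) dvd V D u"
proof -
  obtain f g where fg: "g \<noteq> 0" "u = ec 0 f / ec 0 g" using L_ec0E[OF assms(1)] .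
  then have f: "f \<noteq> 0" using assms(2) by auto
  have "V D u = V D (ec 0 f) - V D (ec 0 g)"
    unfolding V_def fg using fg f by (intro vl_divide V_dvr) auto
  then show ?thesis using V_ec f fg by simp
qed

lemma V_surj: "\<exists>w\<in>E. V D w = 1"
  unfolding V_def by (rule over_uniformizer[OF over_pick[OF D]])

end

end

section \<open>Common points and independence of two divisors\<close>

context cover
begin

lemma prime_factor_point:
  assumes i: "i \<le> 3" and q: "pideal q (Bc i)" and g: "g \<noteq> 0" "ec i g \<in> q"
  obtains p x where "prime_elem p" "p dvd g" "prime_in (localization (Bc i) q) x" "ec i p / x \<in> localization (Bc i) q" "ec i p \<in> q"
proof -
  interpret C: chart L Gal "yc s i 0" "yc s i 1" "yc s i 2" "Bc i" "Mc i"
    rewrites "chart.ev (yc s i 0) (yc s i 1) (yc s i 2) = ec i" by (rule charts, fact, rule ec_def[symmetric])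
  have nz: "ec i g \<noteq> 0" using g by simp
  have "ec i g \<in> localization (Bc i) q" by (rule subsetD[OF C.loc_subr(2)[OF q] C.ev_B])
  then have "\<exists>x. prime_in (localization (Bc i) q) x \<and> ec i g / x \<in> localization (Bc i) q"
    by (rule ufd_nonunit[OF C.ufd_loc[OF q] _ nz localization_subr(4)[OF C.B_subr q g(2) nz]])
  then obtain x where x: "prime_in (localization (Bc i) q) x" "ec i g / x \<in> localization (Bc i) q" by blast
  obtain p where p: "prime_elem p" "p dvd g" "ec i p / x \<in> localization (Bc i) q"
    using C.prime_below[OF q x(1) g(1) x(2)] by blast
  show thesis by (rule that[OF p(1,2) x(1) p(3) point_of_dvd[OF i q x(1) p(3)]])
qed

text \<open>Equations in the chart 0, which does not meet the hyperplane at infinity. Read as a form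
  of degree \<open>dg None = 1\<close>, the polynomial 1 still becomes \<open>s 0 / s i\<close> in
  the other charts.\<close>

fun fm :: "p3 option \<Rightarrow> p3" where "fm (Some p) = p" | "fm None = 1"

lemma fm: "D \<in> divisors \<Longrightarrow> fm D \<noteq> 0 \<and> tdeg (fm D) \<le> dg D \<and> dg D \<ge> 1"
  using tdeg_prime by (cases D) (auto simp: divisors_def)

text \<open>The value is a positive multiple of \<open>val D' (fm D) - dg D * val D' (Sv i)\<close>.
  At infinity this is \<open>dg D - tdeg (fm D)\<close>, positive for \<open>D = None\<close> only;
  along a prime it is positive only if the prime divides \<open>fm D\<close>.\<close>

lemma positive_on_divisor:
  assumes i: "1 \<le> i" "i \<le> 3" and D: "D \<in> divisors" and g: "ec i g = ec 0 (fm D) / (s i / s 0) ^ dg D"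
    and S: "lies_over S D' e" and pos: "vl S (ec i g) > 0"
  shows "D' = D"
proof -
  have dvr: "is_dvr S" and e: "e > 0" and D': "D' \<in> divisors" and ov: "\<And>f. f \<noteq> 0 \<Longrightarrow> vl S (ec 0 f) = e * val D' f"
    using S PD_dvr by (auto simp: lies_over_def)
  have f: "fm D \<noteq> 0" using fm[OF D] by simp
  have t: "s i / s 0 \<noteq> 0" using s_nz[OF i(2)] s_nz[of 0] by simp
  have "vl S (s i / s 0) = e * val D' (Sv i)" using ov[of "Sv i"] ec_Sv[OF i(2)] by simp
  then have "vl S (ec i g) = e * val D' (fm D) - int (dg D) * (e * val D' (Sv i))"
    unfolding g using vl_divide[OF dvr, of "ec 0 (fm D)" "(s i / s 0) ^ dg D"] vl_power[OF dvr t] t f ov[OF f] by simp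
  also have "\<dots> = e * (val D' (fm D) - int (dg D) * val D' (Sv i))" by (simp add: algebra_simps)
  finally have *: "val D' (fm D) - int (dg D) * val D' (Sv i) > 0" using pos e by (simp add: zero_less_mult_iff)
  show ?thesis
  proof (cases D')
    case None
    then have "int (dg D) > int (tdeg (fm D))" using * i by (simp add: tdeg_Sv)
    then show ?thesis using None by (cases D) auto
  next
    case (Some p)
    have pos0: "0 \<le> int (dg D) * val D' (Sv i)" using Some by (simp del: of_nat_mult)
    have "multiplicity p (fm D) \<noteq> 0" 
    proof
      assume "multiplicity p (fm D) = 0"
      then have "val D' (fm D) = 0" using Some by simp
      then show False using * pos0 by linarith
    qed
    then have "p dvd fm D" using not_dvd_imp_multiplicity_0[of p "fm D"] by argo
    moreover have p: "Factorial_Ring.prime p" using Some D' by (auto simp: divisors_def)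
    ultimately obtain p' where p': "D = Some p'" "p dvd p'" by (cases D) auto
    then have "Factorial_Ring.prime p'" using D by (auto simp: divisors_def)
    then show ?thesis using primes_dvd_imp_eq[OF p _ p'(2)] Some p'(1) by simp
  qed
qed

text \<open>At a common point both equations have a prime factor there. The eigenvector for the
  factor of the first equation has value 1 along a divisor over \<open>D\<close>, and value 0 along
  one over \<open>D'\<close>, where that factor does not vanish.\<close>

lemma pair_at_point:
  assumes i: "1 \<le> i" "i \<le> 3" and D: "D \<in> divisors" "D' \<in> divisors" "D \<noteq> D'"
    and g: "ec i g = ec 0 (fm D) / (s i / s 0) ^ dg D" and g': "ec i g' = ec 0 (fm D') / (s i / s 0) ^ dg D'"
    and q: "pideal q (Bc i)" "ec i g \<in> q" "ec i g' \<in> q"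
  shows "\<exists>w\<in>E. V D w = 1 \<and> V D' w = 0"
proof -
  have t: "s i / s 0 \<noteq> 0" using s_nz[OF i(2)] s_nz[of 0] by simp
  have nz: "h \<noteq> 0" if "ec i h = ec 0 (fm C) / (s i / s 0) ^ dg C" "C \<in> divisors" for h C
  proof
    assume "h = 0"
    then show False using that fm[OF that(2)] t rhomD(1)[OF ec_rhom[OF i(2)]] by simp
  qed
  have over: "lies_over (loc_at (localization (Bc i) q) x) C (int (ram C))"
    if h: "ec i h = ec 0 (fm C) / (s i / s 0) ^ dg C" "C \<in> divisors" "prime_elem p" "p dvd h"
      "prime_in (localization (Bc i) q) x" "ec i p / x \<in> localization (Bc i) q" for h C p x
  proof -
    define S where "S = loc_at (localization (Bc i) q) x"
    obtain C' e where C': "lies_over S C' e" using PD_over PD_intro[OF i(2) q(1) h(5)] unfolding S_def by blast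
    have "h \<noteq> 0" by (rule nz[OF h(1,2)])
    then have "multiplicity p h > 0" using h(3,4) by (simp add: prime_multiplicity_gt_zero_iff)
    then have "vl S (ec i h) > 0"
      using rep_vl[OF i(2) q(1) h(5) S_def h(3,6) \<open>h \<noteq> 0\<close>] by simp
    then have "C' = C" by (rule positive_on_divisor[OF i h(2,1) C'])
    then show ?thesis using C' overD(3)[OF C'] unfolding S_def by simp
  qed
  obtain p x where p: "prime_elem p" "p dvd g" "prime_in (localization (Bc i) q) x" "ec i p / x \<in> localization (Bc i) q" "ec i p \<in> q"
    by (rule prime_factor_point[OF i(2) q(1) nz[OF g D(1)] q(2)])
  obtain p' x' where p': "prime_elem p'" "p' dvd g'" "prime_in (localization (Bc i) q) x'" "ec i p' / x' \<in> localization (Bc i) q" "ec i p' \<in> q"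
    by (rule prime_factor_point[OF i(2) q(1) nz[OF g' D(2)] q(3)])
  obtain w where w: "w \<in> E" "\<And>x. prime_in (localization (Bc i) q) x \<Longrightarrow>
    vl (loc_at (localization (Bc i) q) x) w = (if ec i p / x \<in> localization (Bc i) q then 1 else 0)"
    using point_eigen[OF i(2) q(1) p(1,5)] by blast
  note o = over[OF g D(1) p(1-4)] and o' = over[OF g' D(2) p'(1-4)]
  have "ec i p / x' \<notin> localization (Bc i) q"
  proof
    assume "ec i p / x' \<in> localization (Bc i) q"
    then have "lies_over (loc_at (localization (Bc i) q) x') D (int (ram D))" by (rule over[OF g D(1) p(1,2) p'(3)])
    then show False using over_unique[OF _ o'] D(3) by blast
  qed
  then have "V D' w = 0" using overD(4)[OF o' w(1)] w(2)[OF p'(3)] by simp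
  moreover have "V D w = 1" using overD(4)[OF o w(1)] w(2)[OF p(3)] p(4) by simp
  ultimately show ?thesis using w(1) by blast
qed

text \<open>Multiply the identity of the chart \<open>i\<close> by a large power of
  \<open>s i / s 0\<close>, which also pads both cofactors; \<open>Sv i ^ m\<close> is what becomes
  of 1.\<close>

lemma homogenize_identity:
  assumes i: "i \<le> 3" and t: "t = s i / s 0"
    and eq: "g * h + g' * h' = 1" and g: "ec i g = ec 0 f / t ^ a" "ec i g' = ec 0 f' / t ^ b"
  shows "\<exists>m0. \<forall>m\<ge>m0. \<exists>U W. tdeg U \<le> m - a \<and> tdeg W \<le> m - b \<and> Sv i ^ m = U * f + W * f'"
proof -
  have t0: "t \<noteq> 0" using s_nz[OF i] s_nz[of 0] by (simp add: t)
  obtain U k where U: "tdeg U \<le> k" "ec i h = ec 0 U / t ^ k" using ec_from_chart[OF i] unfolding t by blast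
  obtain W l where W: "tdeg W \<le> l" "ec i h' = ec 0 W / t ^ l" using ec_from_chart[OF i] unfolding t by blast
  have dS: "tdeg (Sv i ^ n) \<le> n" for n by (simp add: tdeg_power tdeg_Sv)
  have "\<exists>U W. tdeg U \<le> m - a \<and> tdeg W \<le> m - b \<and> Sv i ^ m = U * f + W * f'" if m: "m \<ge> a + b + k + l" for m
  proof (intro exI conjI)
    show "tdeg (U * Sv i ^ (m - a - k)) \<le> m - a"
      using tdeg_mult_le[of U "Sv i ^ (m - a - k)"] dS[of "m - a - k"] U(1) m by linarith
    show "tdeg (W * Sv i ^ (m - b - l)) \<le> m - b"
      using tdeg_mult_le[of W "Sv i ^ (m - b - l)"] dS[of "m - b - l"] W(1) m by linarith
    have "ec i (g * h + g' * h') = 1" unfolding eq by (rule rhomD(2)[OF ec_rhom[OF i]])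
    then have "ec 0 f / t ^ a * (ec 0 U / t ^ k) + ec 0 f' / t ^ b * (ec 0 W / t ^ l) = 1"
      using g U(2) W(2) by (simp add: rhomD[OF ec_rhom[OF i]])
    then have "t ^ m * (ec 0 f / t ^ a * (ec 0 U / t ^ k) + ec 0 f' / t ^ b * (ec 0 W / t ^ l)) = t ^ m" by simp
    moreover have "t ^ m = t ^ a * t ^ k * t ^ (m - a - k)" "t ^ m = t ^ b * t ^ l * t ^ (m - b - l)"
      using m by (simp_all flip: power_add)
    ultimately have "t ^ m = ec 0 f * ec 0 U * t ^ (m - a - k) + ec 0 f' * ec 0 W * t ^ (m - b - l)"
    proof -
      assume 1: "t ^ m * (ec 0 f / t ^ a * (ec 0 U / t ^ k) + ec 0 f' / t ^ b * (ec 0 W / t ^ l)) = t ^ m"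
        and 2: "t ^ m = t ^ a * t ^ k * t ^ (m - a - k)" and 3: "t ^ m = t ^ b * t ^ l * t ^ (m - b - l)"
      have "t ^ m * (ec 0 f / t ^ a * (ec 0 U / t ^ k)) = ec 0 f * ec 0 U * t ^ (m - a - k)"
        unfolding 2 using t0 by simp
      moreover have "t ^ m * (ec 0 f' / t ^ b * (ec 0 W / t ^ l)) = ec 0 f' * ec 0 W * t ^ (m - b - l)"
        unfolding 3 using t0 by simp
      ultimately show ?thesis using 1 by (simp only: distrib_left)
    qed
    then have "ec 0 (Sv i ^ m) = ec 0 (U * Sv i ^ (m - a - k) * f + W * Sv i ^ (m - b - l) * f')"
      using ec_Sv[OF i] by (simp add: ec0_simps t mult_ac)
    then show "Sv i ^ m = U * Sv i ^ (m - a - k) * f + W * Sv i ^ (m - b - l) * f'" by (simp only: ec0_eq_iff)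
  qed
  then show ?thesis by blast
qed

text \<open>Two surfaces in projective space meet, even outside of the point \<open>(1:0:0:0)\<close> that belongs only
  to the chart 0.\<close>

lemma common_point:
  assumes D: "D \<in> divisors" "D' \<in> divisors" "D \<noteq> D'"
  obtains i g g' q where "1 \<le> i" "i \<le> 3" "ec i g = ec 0 (fm D) / (s i / s 0) ^ dg D"
    "ec i g' = ec 0 (fm D') / (s i / s 0) ^ dg D'" "pideal q (Bc i)" "ec i g \<in> q" "ec i g' \<in> q"
proof -
  have "\<exists>i g g' q. 1 \<le> i \<and> i \<le> 3 \<and> ec i g = ec 0 (fm D) / (s i / s 0) ^ dg D \<and>
    ec i g' = ec 0 (fm D') / (s i / s 0) ^ dg D' \<and> pideal q (Bc i) \<and> ec i g \<in> q \<and> ec i g' \<in> q"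
  proof (rule ccontr)
    assume none: "\<not> ?thesis"
    define P where "P i m = (\<exists>U W. tdeg U \<le> m - dg D \<and> tdeg W \<le> m - dg D' \<and> Sv i ^ m = U * fm D + W * fm D')" for i m
    have "\<exists>m0. \<forall>m\<ge>m0. P i m" if i: "1 \<le> i" "i \<le> 3" for i
    proof -
      obtain g where g: "ec i g = ec 0 (fm D) / (s i / s 0) ^ dg D" using ec_to_chart[OF i(2)] fm[OF D(1)] by blast
      obtain g' where g': "ec i g' = ec 0 (fm D') / (s i / s 0) ^ dg D'" using ec_to_chart[OF i(2)] fm[OF D(2)] by blast
      interpret C: chart L Gal "yc s i 0" "yc s i 1" "yc s i 2" "Bc i" "Mc i"
        rewrites "chart.ev (yc s i 0) (yc s i 1) (yc s i 2) = ec i" by (rule charts, fact, rule ec_def[symmetric])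
      have "\<not> (\<exists>q. pideal q (Bc i) \<and> ec i g \<in> q \<and> ec i g' \<in> q)" using none i g g' by blast
      then obtain h h' where "g * h + g' * h' = 1" using C.ex_point[of g g'] by blast
      then show ?thesis unfolding P_def by (rule homogenize_identity[OF i(2) refl _ g g'])
    qed
    note ev = this
    obtain m1 m2 m3 where mm: "\<And>m. m \<ge> m1 \<Longrightarrow> P 1 m" "\<And>m. m \<ge> m2 \<Longrightarrow> P 2 m" "\<And>m. m \<ge> m3 \<Longrightarrow> P 3 m"
      using ev[of 1] ev[of 2] ev[of 3] by auto
    define m where "m = m1 + m2 + m3 + dg D + dg D'"
    have P: "P 1 m" "P 2 m" "P 3 m" using mm by (simp_all add: m_def)
    obtain U1 W1 where 1: "tdeg U1 \<le> m - dg D" "tdeg W1 \<le> m - dg D'" "T1 ^ m = U1 * fm D + W1 * fm D'"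
      using P(1) unfolding P_def by (auto simp: Sv_def)
    obtain U2 W2 where 2: "tdeg U2 \<le> m - dg D" "tdeg W2 \<le> m - dg D'" "T2 ^ m = U2 * fm D + W2 * fm D'"
      using P(2) unfolding P_def by (auto simp: Sv_def)
    obtain U3 W3 where 3: "T3 ^ m = U3 * fm D + W3 * fm D'"
      using P(3) unfolding P_def by (auto simp: Sv_def)
    have a: "tdeg (fm D) \<le> dg D" "1 \<le> dg D" and b: "tdeg (fm D') \<le> dg D'" "1 \<le> dg D'" and
      ab: "dg D + dg D' \<le> m" "dg D' + dg D \<le> m"
      using fm[OF D(1)] fm[OF D(2)] by (auto simp: m_def)
    show False
    \<comment> \<open>The second polynomial in \<open>no_common_point_dvd\<close> has to be a prime.
      If \<open>D'\<close> is the hyperplane at infinity, whose polynomial is 1, the two divisors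
      change places.\<close>
    proof (cases D')
      case (Some p)
      then have "prime_elem p" using D by (auto simp: divisors_def)
      moreover have "fm D' dvd T1 ^ m" "fm D' dvd T2 ^ m"
        using no_common_point_dvd[OF a(1) b(1) ab(1) a(2) 1(3) 2(3) 3 1(1) 2(1) 1(2) 2(2)] by auto
      ultimately show False using prime_dvd_T_powers_False Some by simp
    next
      case None
      then obtain p where p: "D = Some p" using D(3) by (cases D) auto
      then have "prime_elem p" using D by (auto simp: divisors_def)
      moreover have "fm D dvd T1 ^ m" "fm D dvd T2 ^ m"
        using no_common_point_dvd[OF b(1) a(1) ab(2) b(2) 1(3)[unfolded add.commute[of "U1 * fm D"]]
          2(3)[unfolded add.commute[of "U2 * fm D"]] 3[unfolded add.commute[of "U3 * fm D"]] 1(2) 2(2) 1(1) 2(1)] by auto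
      ultimately show False using prime_dvd_T_powers_False p by simp
    qed
  qed
  then show thesis using that by (elim exE conjE)
qed

lemma ex_pair:
  assumes D: "D \<in> divisors" "D' \<in> divisors" "D \<noteq> D'"
  shows "\<exists>w\<in>E. V D w = 1 \<and> V D' w = 0"
proof -
  obtain i g g' q where *: "1 \<le> i" "i \<le> 3" "ec i g = ec 0 (fm D) / (s i / s 0) ^ dg D"
    "ec i g' = ec 0 (fm D') / (s i / s 0) ^ dg D'" "pideal q (Bc i)" "ec i g \<in> q" "ec i g' \<in> q"
    by (rule common_point[OF D])
  show ?thesis by (rule pair_at_point[OF *(1,2) D *(3-7)])
qed

end

section \<open>Volume forms of the charts\<close>

context cover
begin

definition Om :: "nat \<Rightarrow> 'k form" where
  "Om i = wedge_d 3 (tup (yc s i 0) (yc s i 1) (yc s i 2))"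

lemma Om_eq: "i \<le> 3 \<Longrightarrow> chart.\<omega>0 (yc s i 0) (yc s i 1) (yc s i 2) = Om i"
  unfolding chart.\<omega>0_def[OF charts] chart.yf_def[OF charts] Om_def ..

context
  fixes \<eta> :: "'k form"
  assumes \<eta>: "\<eta> \<in> rational_forms 3" "\<eta> \<noteq> 0"
begin

text \<open>The volume form of the chart 0 has a pole of order 4 along the hyperplane at infinity.\<close>

lemma Om_change:
  assumes i: "1 \<le> i" "i \<le> 3"
  shows "\<exists>c. Om 0 = form_scale c (Om i) \<and> (c = inverse (ec i T1) ^ 4 \<or> c = - (inverse (ec i T1) ^ 4))"
proof -
  interpret C: chart L Gal "yc s i 0" "yc s i 1" "yc s i 2" "Bc i" "Mc i"
    rewrites "chart.ev (yc s i 0) (yc s i 1) (yc s i 2) = ec i" by (rule charts, fact, rule ec_def[symmetric])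
  obtain d where d: "C.dual d" using C.ex_dual[OF \<eta>] by blast
  define y1 where "y1 = yc s i 0"
  define y2 where "y2 = yc s i 1"
  define y3 where "y3 = yc s i 2"
  have u: "y1 = ec i T1" "y1 = s 0 / s i" using ec_T1[OF i] by (simp_all add: y1_def)
  have u0: "y1 \<noteq> 0" using s_nz[OF i(2)] s_nz[of 0] by (simp add: u(2))
  note dd = C.d_der[OF d] and dy = C.d_y[OF d, folded y1_def y2_def y3_def]
  have q: "d a (x / y1) = (d a x * y1 - x * d a y1) / y1\<^sup>2" if "a \<in> {0, 1, 2}" for a x
    using that dd by (auto intro!: derivation_divide u0)
  have one: "d a 1 = 0" if "a \<in> {0, 1, 2}" for a using that dd by (auto simp: derivationD(5))
  have "Om 0 = form_scale (det3 (\<lambda>a b. d a (tup (yc s 0 0) (yc s 0 1) (yc s 0 2) b))) (Om i)"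
    unfolding Om_def[of 0] C.wedge_eq_\<omega>0[OF d] Om_eq[OF i(2)] ..
  \<comment> \<open>The Jacobian of (1, y2, y3) / y1 up to the position of the entry 1 / y1, which
    causes the sign.\<close>
  moreover have "det3 (\<lambda>a b. d a (tup (yc s 0 0) (yc s 0 1) (yc s 0 2) b)) = (if i = 2 then 1 else -1) * inverse y1 ^ 4"
  proof -
    have nz: "s i \<noteq> 0" "s 0 \<noteq> 0" using s_nz i by auto
    consider "i = 1" | "i = 2" | "i = 3" using i by linarith
    then show ?thesis
    proof cases
      case 1
      have yy: "yc s 0 0 = 1 / y1" "yc s 0 1 = y2 / y1" "yc s 0 2 = y3 / y1"
        using nz unfolding y1_def y2_def y3_def yc_def 1 by (simp_all add: numeral_eq_Suc)
      have "det3 (\<lambda>a b. d a (tup (yc s 0 0) (yc s 0 1) (yc s 0 2) b)) = - 1 / (y1 * y1 * y1 * y1)"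
        unfolding det3_def tup_simps yy using u0 by (simp add: q one dy dy[unfolded One_nat_def] power2_eq_square)
      then show ?thesis using 1 by (simp add: power4_eq_xxxx divide_inverse mult_ac)
    next
      case 2
      have yy: "yc s 0 0 = y2 / y1" "yc s 0 1 = 1 / y1" "yc s 0 2 = y3 / y1"
        using nz unfolding y1_def y2_def y3_def yc_def 2 by (simp_all add: numeral_eq_Suc)
      have "det3 (\<lambda>a b. d a (tup (yc s 0 0) (yc s 0 1) (yc s 0 2) b)) =  1 / (y1 * y1 * y1 * y1)"
        unfolding det3_def tup_simps yy using u0 by (simp add: q one dy dy[unfolded One_nat_def] power2_eq_square)
      then show ?thesis using 2 by (simp add: power4_eq_xxxx divide_inverse mult_ac)
    next
      case 3
      have yy: "yc s 0 0 = y2 / y1" "yc s 0 1 = y3 / y1" "yc s 0 2 = 1 / y1"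
        using nz unfolding y1_def y2_def y3_def yc_def 3 by (simp_all add: numeral_eq_Suc)
      have "det3 (\<lambda>a b. d a (tup (yc s 0 0) (yc s 0 1) (yc s 0 2) b)) = - 1 / (y1 * y1 * y1 * y1)"
        unfolding det3_def tup_simps yy using u0 by (simp add: q one dy dy[unfolded One_nat_def] power2_eq_square)
      then show ?thesis using 3 by (simp add: power4_eq_xxxx divide_inverse mult_ac)
    qed
  qed
  ultimately show ?thesis unfolding u(1) by (cases "i = 2") auto
qed

text \<open>The ramification formula in a chart that contains \<open>S\<close>; at infinity the
  change of chart adds the pole of order 4, multiplied by the index.\<close>

lemma form_ord_over:
  assumes S: "lies_over S D e" and g: "g \<noteq> 0"
  shows "form_ord 3 S (form_scale g (Om 0)) = vl S g + e - 1 - (if D = None then 4 * e else 0)"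
proof -
  have SX: "S \<in> prime_divisors X" using S by (simp add: lies_over_def)
  then obtain i q x p D' where rep: "rep i q x p S D'" using PD_rep by blast
  note o = rep_over[OF rep]
  have D': "D' = D" by (rule over_unique[OF S o])
  have e: "e = vl S (ec i p)" using over_same(1)[OF S] o unfolding D' by simp
  have r: "i \<le> 3" "pideal q (Bc i)" "prime_in (localization (Bc i) q) x" "prime_elem p"
    "ec i p / x \<in> localization (Bc i) q" "S = loc_at (localization (Bc i) q) x"
    "i = 0 \<and> D \<noteq> None \<or> 1 \<le> i \<and> p = T1 \<and> D = None" using rep unfolding rep_def D' by auto
  interpret C: chart L Gal "yc s i 0" "yc s i 1" "yc s i 2" "Bc i" "Mc i"
    rewrites "chart.ev (yc s i 0) (yc s i 1) (yc s i 2) = ec i" by (rule charts, fact, rule ec_def[symmetric])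
  obtain d where d: "C.dual d" using C.ex_dual[OF \<eta>] by blast
  have ord: "form_ord 3 S (form_scale f (Om i)) = vl S f + e - 1" if "f \<noteq> 0" for f
    using C.form_ord_loc_at[OF r(2,3,4,5) d that] unfolding Om_eq[OF r(1)] r(6)[symmetric] e .
  show ?thesis
  proof (cases "i = 0")
    case True
    then obtain p' where "D = Some p'" using r(7) by auto
    then show ?thesis using ord[OF g] True by simp
  next
    case False
    then have i: "1 \<le> i" "p = T1" "D = None" using r(7) by auto
    obtain c where c: "Om 0 = form_scale c (Om i)" "c = inverse (ec i T1) ^ 4 \<or> c = - (inverse (ec i T1) ^ 4)"
      using Om_change[OF i(1) r(1)] by blast
    have u0: "ec i T1 \<noteq> 0" using ec_T1[OF i(1) r(1)] s_nz[OF r(1)] s_nz[of 0] by simp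
    then have c0: "c \<noteq> 0" using c(2) by auto
    have dvr: "is_dvr S" by (rule PD_dvr[OF SX])
    \<comment> \<open>Squaring disposes of the undetermined sign of \<open>c\<close>.\<close>
    have "c ^ 2 = inverse (ec i T1) ^ 8" using c(2) by (auto simp: power_mult[symmetric])
    then have "2 * vl S c = 8 * - e"
      using vl_power[OF dvr c0, of 2] vl_power[OF dvr, of "inverse (ec i T1)" 8] vl_inverse[OF dvr u0] u0 e i(2) by simp
    then have vc: "vl S c = - 4 * e" by simp
    have "form_scale g (Om 0) = form_scale (g * c) (Om i)" unfolding c(1) form_scale_simps ..
    then show ?thesis using ord[of "g * c"] g c0 vl_mult[OF dvr g c0] vc i(3) by simp
  qed
qed

lemma form_eq_Om:
  assumes "\<omega> \<in> rational_forms 3" shows "\<exists>c. \<omega> = form_scale c (Om 0)"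
proof -
  interpret C: chart L Gal "yc s 0 0" "yc s 0 1" "yc s 0 2" "Bc 0" "Mc 0"
    rewrites "chart.ev (yc s 0 0) (yc s 0 1) (yc s 0 2) = ec 0" by (rule charts, simp, rule ec_def[symmetric])
  obtain d where d: "C.dual d" using C.ex_dual[OF \<eta>] by blast
  show ?thesis using C.form_eq_\<omega>0[OF d assms] unfolding Om_eq[OF le0] by blast
qed

end

end

lemma rational_forms_scale:
  assumes w: "\<omega> \<in> rational_forms 3" shows "form_scale a \<omega> \<in> rational_forms 3"
  using w unfolding rational_forms_def form_scale_def by (simp add: algebra_simps)

lemma module_forms: "Modules.module (\<lambda>c. form_scale (of_cplx c) :: 'k::complex_extension_field form \<Rightarrow> 'k form)"
  by unfold_locales (simp_all add: form_scale_def fun_eq_iff of_cplx_add of_cplx_mult algebra_simps)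

text \<open>Transport of structure: \<open>\<tau>\<close> carries the uniformizer of
  \<open>S\<close> to one of \<open>S'\<close>, and the value does not depend on the
  uniformizer.\<close>

lemma vl_automorphism:
  fixes S :: "'k::field set" and \<sigma> \<tau> :: "'k \<Rightarrow> 'k"
  assumes S: "is_dvr S" and \<sigma>: "rhom \<sigma>" and \<tau>: "rhom \<tau>" "\<And>x. \<sigma> (\<tau> x) = x" "\<And>x. \<tau> (\<sigma> x) = x"
  defines "S' \<equiv> {x. \<sigma> x \<in> S}"
  shows "is_dvr S'" "g \<noteq> 0 \<Longrightarrow> vl S' g = vl S (\<sigma> g)"
proof -
  have nz: "\<sigma> x \<noteq> 0" "\<tau> x \<noteq> 0" if "x \<noteq> 0" for x
    using that \<tau>(2)[of x] \<tau>(3)[of x] rhomD(1)[OF \<sigma>] rhomD(1)[OF \<tau>(1)] by metis+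
  have inv: "\<sigma> (inverse x) = inverse (\<sigma> x)" "\<tau> (inverse x) = inverse (\<tau> x)" for x
  proof -
    show "\<sigma> (inverse x) = inverse (\<sigma> x)"
      using rhomD(4)[OF \<sigma>, of x "inverse x"] rhomD(1,2)[OF \<sigma>] nz(1)[of x] by (cases "x = 0") (auto simp: field_simps)
    show "\<tau> (inverse x) = inverse (\<tau> x)"
      using rhomD(4)[OF \<tau>(1), of x "inverse x"] rhomD(1,2)[OF \<tau>(1)] nz(2)[of x] by (cases "x = 0") (auto simp: field_simps)
  qed
  have powi: "\<tau> (x powi n) = \<tau> x powi n" for x n
    by (cases "n \<ge> 0") (simp_all add: power_int_def inv rhomD(7)[OF \<tau>(1)] flip: power_inverse)
  note d = dvr_unif[OF S]
  have unit: "unit_in S' (\<tau> u)" if "unit_in S u" for u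
    using that nz(2) by (auto simp: unit_in_def S'_def \<tau>(2) inv)
  have decomp: "x = \<tau> u * \<tau> (unif S) powi n" if "\<sigma> x = u * unif S powi n" for x u n
    using arg_cong[OF that, of \<tau>] by (simp add: \<tau>(3) rhomD(4)[OF \<tau>(1)] powi)
  have dvr': "dvr S' (\<tau> (unif S))" unfolding dvr_def
  proof (intro conjI allI impI)
    show "subr S'" using dvr_subr[OF S] unfolding subr_def S'_def by (simp add: rhomD[OF \<sigma>])
    show "\<tau> (unif S) \<in> S'" "\<tau> (unif S) \<noteq> 0" "inverse (\<tau> (unif S)) \<notin> S'"
      using d nz(2) unfolding dvr_def by (auto simp: S'_def \<tau>(2) inv(1))
    fix x :: 'k assume "x \<noteq> 0"
    then obtain u n where "unit_in S u" "\<sigma> x = u * unif S powi n" using d nz(1) unfolding dvr_def by blast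
    then show "\<exists>n u. unit_in S' u \<and> x = u * \<tau> (unif S) powi n" using unit decomp by blast
  qed
  then show S': "is_dvr S'" unfolding is_dvr_def by blast
  assume g: "g \<noteq> 0"
  obtain u where u: "unit_in S u" "\<sigma> g = u * unif S powi (vl S (\<sigma> g))" using vl_decomp[OF S nz(1)[OF g]] by blast
  note g' = decomp[OF u(2)]
  have u0: "\<tau> u \<noteq> 0" and p0: "\<tau> (unif S) \<noteq> 0" using u(1) nz(2) unif_nz[OF S] by (auto simp: unit_in_def)
  have pow: "vl S' (\<tau> (unif S) powi n) = n" for n
    using vl_power[OF S' p0, of "nat n"] vl_power[OF S' p0, of "nat (- n)"] vl_dvr_unif[OF dvr']
      vl_inverse[OF S', of "\<tau> (unif S) ^ nat (- n)"] p0
    by (cases "n \<ge> 0") (simp_all add: power_int_def power_inverse)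
  have "vl S' (\<tau> u * \<tau> (unif S) powi (vl S (\<sigma> g))) = vl S (\<sigma> g)"
    using vl_mult[OF S' u0, of "\<tau> (unif S) powi (vl S (\<sigma> g))"] p0 pow vl_unit[OF S' unit[OF u(1)]] by simp
  then show "vl S' g = vl S (\<sigma> g)" by (simp only: flip: g')
qed

context cover
begin

text \<open>\<open>\<sigma>\<close> preserves the coordinate rings of the charts and fixes the
  polynomials, so it permutes the prime divisors over \<open>D\<close> without changing the
  index.\<close>

lemma PD_conjugate:
  assumes S: "lies_over S D e" and \<sigma>: "\<sigma> \<in> Gal"
  shows "lies_over {x. \<sigma> x \<in> S} D e" "g \<noteq> 0 \<Longrightarrow> vl {x. \<sigma> x \<in> S} g = vl S (\<sigma> g)"
proof -
  define S' where "S' = {x. \<sigma> x \<in> S}"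
  have PD: "S \<in> prime_divisors X" using S by (simp add: lies_over_def)
  obtain n where n: "n > 0" "\<sigma> ^^ n = id" using finite_order[OF \<sigma>] by blast
  then obtain m where m: "n = Suc m" by (cases n) auto
  define \<tau> where "\<tau> = \<sigma> ^^ m"
  have \<tau>: "\<tau> \<in> Gal" unfolding \<tau>_def by (rule funpow_Gal[OF \<sigma>])
  have st: "\<sigma> (\<tau> x) = x" for x using fun_cong[OF n(2), of x] by (simp add: m \<tau>_def)
  have ts: "\<tau> (\<sigma> x) = x" for x using fun_cong[OF n(2), of x] by (simp add: m \<tau>_def funpow_swap1)
  note v = vl_automorphism[OF PD_dvr[OF PD] auto_rhom[OF \<sigma>] auto_rhom[OF \<tau>] st ts, folded S'_def]
  obtain i where i: "i \<le> 3" "\<forall>j\<le>3. s j / s i \<in> S" using cov[of S] PD by (auto simp: prime_divisors_def)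
  interpret C: chart L Gal "yc s i 0" "yc s i 1" "yc s i 2" "Bc i" "Mc i"
    rewrites "chart.ev (yc s i 0) (yc s i 1) (yc s i 2) = ec i" by (rule charts, fact, rule ec_def[symmetric])
  have "S \<in> X" using PD by (simp add: prime_divisors_def)
  then have "S \<in> {localization (Bc i) q | q. pideal q (Bc i)}" using i(2) unfolding pts[OF i(1), symmetric] by simp
  then obtain q where q: "pideal q (Bc i)" "S = localization (Bc i) q" by (elim CollectE exE conjE)
  define q' where "q' = {b \<in> Bc i. \<sigma> b \<in> q}"
  note sB = C.Gal_B[OF \<sigma>] and tB = C.Gal_B[OF \<tau>] and \<sigma>s = auto_simps[OF \<sigma>]
  have q': "pideal q' (Bc i)" unfolding pideal_def
  proof (intro conjI ballI impI)
    show "q' \<subseteq> Bc i" "0 \<in> q'" "1 \<notin> q'"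
      using pidealD(2,3)[OF q(1)] subr_0[OF C.B_subr] by (auto simp: q'_def \<sigma>s)
  next
    fix a b assume "a \<in> q'" "b \<in> q'"
    then show "a + b \<in> q'" using pidealD(4)[OF q(1), of "\<sigma> a" "\<sigma> b"] subr_add[OF C.B_subr, of a b] by (auto simp: q'_def \<sigma>s)
  next
    fix a b assume "a \<in> Bc i" "b \<in> q'"
    then show "a * b \<in> q'" using pidealD(5)[OF q(1) sB, of a "\<sigma> b"] subr_mult[OF C.B_subr, of a b] by (auto simp: q'_def \<sigma>s)
  next
    fix a b assume "a \<in> Bc i" "b \<in> Bc i" "a * b \<in> q'"
    then show "a \<in> q' \<or> b \<in> q'" using pidealD(6)[OF q(1) sB sB, of a b] by (auto simp: q'_def \<sigma>s)
  qed
  have "S' = localization (Bc i) q'"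
  proof (intro equalityI subsetI)
    fix x assume "x \<in> S'"
    then obtain a b where ab: "a \<in> Bc i" "b \<in> Bc i" "b \<notin> q" "\<sigma> x = a / b"
      unfolding S'_def q(2) localization_def by auto
    then have "x = \<tau> a / \<tau> b" using ts[of x] auto_divide[OF \<tau>] by metis
    moreover have "\<tau> a \<in> Bc i" "\<tau> b \<in> Bc i - q'" using ab tB by (auto simp: q'_def st)
    ultimately show "x \<in> localization (Bc i) q'" unfolding localization_def by blast
  next
    fix x assume "x \<in> localization (Bc i) q'"
    then obtain a b where ab: "a \<in> Bc i" "b \<in> Bc i - q'" "x = a / b" unfolding localization_def by blast
    then have "\<sigma> x = \<sigma> a / \<sigma> b" "\<sigma> a \<in> Bc i" "\<sigma> b \<in> Bc i - q" using sB by (auto simp: auto_divide[OF \<sigma>] q'_def)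
    then show "x \<in> S'" unfolding S'_def q(2) localization_def by blast
  qed
  then have "S' \<in> {P \<in> X. \<forall>j\<le>3. s j / s i \<in> P}" unfolding pts[OF i(1)] using q' by blast
  then have "S' \<in> prime_divisors X" using krull_dim_dvr[OF v(1)] by (simp add: prime_divisors_def)
  moreover have "vl S' (ec 0 f) = e * val D f" if f: "f \<noteq> 0" for f
  proof -
    have "ec 0 f \<in> L" unfolding ec_def by (rule chart.ev_L[OF charts[OF le0]])
    then show ?thesis using v(2)[of "ec 0 f"] f fixedD[OF _ \<sigma>] S by (simp add: lies_over_def)
  qed
  ultimately show "lies_over {x. \<sigma> x \<in> S} D e" using S unfolding lies_over_def S'_def by blast
  show "g \<noteq> 0 \<Longrightarrow> vl {x. \<sigma> x \<in> S} g = vl S (\<sigma> g)" using v(2) unfolding S'_def .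
qed

lemma vl_const:
  assumes S: "lies_over S D e" and c: "c \<noteq> 0" shows "vl S (of_cplx c) = 0"
proof -
  have "val D (C3 c) = 0"
  proof (cases D)
    case (Some p)
    have "C3 c * C3 (inverse c) = 1" using rhomD(4)[OF rhom_C3, of c "inverse c"] rhomD(2)[OF rhom_C3] c by simp
    then have "is_unit (C3 c)" by (metis dvd_triv_left)
    then show ?thesis using Some by (simp add: multiplicity_unit_right)
  qed simp
  moreover have "C3 c \<noteq> 0" using c by (simp add: C3_def)
  moreover have "of_cplx c = ec 0 (C3 c)" unfolding ec_def using chart.ev_T(4)[OF charts[OF le0]] by simp
  ultimately show ?thesis using S by (simp add: lies_over_def)
qed

end

locale canonical_cover = cover +
  fixes \<eta> :: "'a form"
  assumes eta: "\<eta> \<in> rational_forms 3"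
    and sections: "module.span (\<lambda>c. form_scale (of_cplx c)) ((\<lambda>i. form_scale (s i) \<eta>) ` {..3})
      = {\<omega> \<in> rational_forms 3. \<omega> \<noteq> 0 \<longrightarrow> (\<forall>S\<in>prime_divisors X. form_ord 3 S \<omega> \<ge> 0)}"
    and base_point_free: "P \<in> X \<Longrightarrow> \<exists>i\<le>3. form_scale (s i) \<eta> \<noteq> 0 \<and>
      (\<forall>S\<in>prime_divisors X. P \<subseteq> S \<longrightarrow> form_ord 3 S (form_scale (s i) \<eta>) = 0)"
begin

lemma eta_nz: "\<eta> \<noteq> 0"
proof -
  obtain S e where "lies_over S None e" using ex_over[of None] by (auto simp: divisors_def)
  then have "S \<in> X" by (simp add: lies_over_def prime_divisors_def)
  then obtain i where "form_scale (s i) \<eta> \<noteq> 0" using base_point_free by blast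
  then show ?thesis by (auto simp: form_scale_def fun_eq_iff)
qed

definition h where "h = (SOME c. form_scale (s 0) \<eta> = form_scale c (Om 0))"

lemma h: "form_scale (s 0) \<eta> = form_scale h (Om 0)" "h \<noteq> 0"
proof -
  show h: "form_scale (s 0) \<eta> = form_scale h (Om 0)"
    unfolding h_def by (rule someI_ex) (intro form_eq_Om[OF eta eta_nz] rational_forms_scale eta)
  have "form_scale (s 0) \<eta> \<noteq> form_scale 0 \<eta>" using form_scale_inj[OF eta_nz] s_nz[of 0] by simp
  then show "h \<noteq> 0" using h by (auto simp: form_scale_simps)
qed

lemma s_eta: assumes "i \<le> 3" shows "form_scale (s i) \<eta> = form_scale (s i / s 0 * h) (Om 0)"
proof -
  have "form_scale (s i) \<eta> = form_scale (s i / s 0) (form_scale (s 0) \<eta>)" using s_nz[of 0] by (simp add: form_scale_simps)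
  then show ?thesis unfolding h(1) by (simp add: form_scale_simps)
qed

text \<open>Two expressions for the canonical divisor are compared: the pullback of a plane, and the pullback
  of minus four planes plus the ramification divisor.\<close>

lemma vl_h:
  assumes S: "lies_over S D e"
  shows "vl S h = 1 - e + (if D = None then 5 * e else 0)"
proof -
  have dvr: "is_dvr S" and SX: "S \<in> prime_divisors X" "S \<in> X" and e: "e > 0" and D: "D \<in> divisors"
    using S PD_dvr by (auto simp: lies_over_def prime_divisors_def)
  have ord: "form_ord 3 S (form_scale (s i) \<eta>) = vl S h + e * val D (Sv i) + e - 1 - (if D = None then 4 * e else 0)"
    if i: "i \<le> 3" for i
  proof -
    have nz: "s i / s 0 \<noteq> 0" using s_nz[OF i] s_nz[of 0] by simp
    have "vl S (s i / s 0) = e * val D (Sv i)" using S ec_Sv[OF i] Sv_nz unfolding lies_over_def by metis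
    then show ?thesis unfolding s_eta[OF i] using form_ord_over[OF eta eta_nz S, of "s i / s 0 * h"] nz h(2) vl_mult[OF dvr nz h(2)] by simp
  qed
  have ge: "form_ord 3 S (form_scale (s i) \<eta>) \<ge> 0" if i: "i \<le> 3" for i
  proof -
    have "form_scale (s i) \<eta> \<in> module.span (\<lambda>c. form_scale (of_cplx c)) ((\<lambda>i. form_scale (s i) \<eta>) ` {..3})"
      using i by (intro module.span_base[OF module_forms]) auto
    moreover have "form_scale (s i) \<eta> \<noteq> form_scale 0 \<eta>" using form_scale_inj[OF eta_nz] s_nz[OF i] by simp
    ultimately show ?thesis unfolding sections using SX by (simp add: form_scale_simps)
  qed
  \<comment> \<open>None of the four sections has negative order along \<open>S\<close> and one has
    order 0, so the least value of \<open>val D (Sv i)\<close> counts: -1 at infinity and 0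
    elsewhere. With the pole of order 4 this makes the 5.\<close>
  obtain i where i: "i \<le> 3" "form_ord 3 S (form_scale (s i) \<eta>) = 0" using base_point_free[OF SX(2)] SX(1) by blast
  show ?thesis
  proof (cases D)
    case None
    have "e * val D (Sv i) \<ge> e * (-1)" using None e by (intro mult_left_mono) (auto simp: tdeg_Sv)
    moreover have "e * val D (Sv 1) = - e" using None by (simp add: tdeg_Sv)
    ultimately show ?thesis using ord[OF i(1)] i(2) ord[of 1] ge[of 1] None by (simp add: tdeg_Sv)
  next
    case (Some p)
    have "e * val D (Sv i) \<ge> 0" using Some e by simp
    moreover have "e * val D (Sv 0) = 0" using Some by (simp add: Sv_def)
    ultimately show ?thesis using ord[OF i(1)] i(2) ord[of 0] ge[of 0] Some by (simp add: Sv_def[of 0])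
  qed
qed

lemma s_ratio_L: assumes "i \<le> 3" shows "s i / s 0 \<in> L"
  using ec_Sv[OF assms] chart.ev_L[OF charts[OF le0], of "Sv i"] unfolding ec_def by simp

text \<open>Such an \<open>f\<close> is a section of the pullback of \<open>O(1)\<close>, that is, of the canonical sheaf, and by
  hypothesis all of these come from projective space.\<close>

lemma section_in_L:
  assumes f: "\<And>S D e. lies_over S D e \<Longrightarrow> f \<noteq> 0 \<Longrightarrow> vl S f \<ge> (if D = None then - e else 0)"
  shows "f \<in> L"
proof (cases "f = 0")
  case True
  then show ?thesis using subr_0[OF L_subr] by simp
next
  case f0: False
  define \<omega> where "\<omega> = form_scale f (form_scale (s 0) \<eta>)"
  have eq: "\<omega> = form_scale (f * h) (Om 0)" unfolding \<omega>_def h(1) form_scale_simps ..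
  have "\<omega> \<in> {\<omega> \<in> rational_forms 3. \<omega> \<noteq> 0 \<longrightarrow> (\<forall>S\<in>prime_divisors X. form_ord 3 S \<omega> \<ge> 0)}"
  proof (intro CollectI conjI impI ballI)
    show "\<omega> \<in> rational_forms 3" unfolding \<omega>_def by (intro rational_forms_scale eta)
    fix S assume "S \<in> prime_divisors X"
    then obtain D e where S: "lies_over S D e" using PD_over by blast
    then have dvr: "is_dvr S" using PD_dvr by (simp add: lies_over_def)
    have "form_ord 3 S \<omega> = vl S f + vl S h + e - 1 - (if D = None then 4 * e else 0)"
      unfolding eq using form_ord_over[OF eta eta_nz S, of "f * h"] f0 h(2) vl_mult[OF dvr f0 h(2)] by simp
    then show "form_ord 3 S \<omega> \<ge> 0" using vl_h[OF S] f[OF S f0] by (simp split: if_splits)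
  qed
  then have "\<omega> \<in> module.span (\<lambda>c. form_scale (of_cplx c)) ((\<lambda>i. form_scale (s i) \<eta>) ` {..3})" unfolding sections .
  note mem = this
  define Q where "Q \<psi> = (\<exists>u\<in>L. \<psi> = form_scale u (form_scale (s 0) \<eta>))" for \<psi>
  have Q0: "Q 0" unfolding Q_def using subr_0[OF L_subr] form_scale_simps(4) by metis
  have Qs: "Q (form_scale (of_cplx c) x + y)" if x: "x \<in> (\<lambda>i. form_scale (s i) \<eta>) ` {..3}" and y: "Q y" for c x y
  proof -
    obtain i where i: "i \<le> 3" "x = form_scale (s i) \<eta>" using x by auto
    obtain u where u: "u \<in> L" "y = form_scale u (form_scale (s 0) \<eta>)" using y unfolding Q_def by blast
    have "form_scale (of_cplx c) x + y = form_scale (of_cplx c * (s i / s 0) + u) (form_scale (s 0) \<eta>)"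
      unfolding i(2) u(2) form_scale_simps using s_nz[of 0] by (simp add: distrib_right)
    moreover have "of_cplx c * (s i / s 0) + u \<in> L"
      by (intro subr_add[OF L_subr] subr_mult[OF L_subr] const s_ratio_L i u)
    ultimately show ?thesis unfolding Q_def by blast
  qed
  have "Q \<omega>" by (rule module.span_induct_alt[OF module_forms mem, where h = Q]) (rule Q0, rule Qs)
  then obtain u where u: "u \<in> L" "form_scale f (form_scale (s 0) \<eta>) = form_scale u (form_scale (s 0) \<eta>)" unfolding Q_def \<omega>_def by blast
  have "form_scale (s 0) \<eta> \<noteq> 0" using form_scale_inj[OF eta_nz, of "s 0" 0] s_nz[of 0] by (simp add: form_scale_simps)
  then have "f = u" using form_scale_inj u(2) by blast
  then show ?thesis using u(1) by simp
qed

text \<open>The functions whose divisor is at least that of \<open>h\<close> form a space stable under the Galois group.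
  It therefore contains an eigenvector, which by the preceding lemma differs from \<open>h\<close> by an element
  of \<open>L\<close>.\<close>

lemma h_E: "h \<in> E"
proof -
  define W where "W = {g. g = 0 \<or> (\<forall>S D e. lies_over S D e \<longrightarrow> vl S g \<ge> vl S h)}"
  have dvr: "is_dvr S" if "lies_over S D e" for S D e using that PD_dvr by (simp add: lies_over_def)
  have W0: "0 \<in> W" by (simp add: W_def)
  have "\<exists>ws. set ws \<subseteq> W \<inter> E \<and> h = sum_list ws"
  proof (rule eigen_decomposition)
    fix x y assume x: "x \<in> W" and y: "y \<in> W"
    show "x + y \<in> W"
    proof (cases "x = 0 \<or> y = 0 \<or> x + y = 0")
      case False
      have "vl S (x + y) \<ge> vl S h" if S: "lies_over S D e" for S D e
      proof -
        have "vl S x \<ge> vl S h" "vl S y \<ge> vl S h" using x y False S unfolding W_def by blast+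
        then show ?thesis using False by (intro vl_add_ge dvr[OF S]) auto
      qed
      then show ?thesis unfolding W_def by blast
    next
      case True
      then have "x + y \<in> {x, y, 0}" by auto
      then show ?thesis using x y W0 by auto
    qed
  next
    fix c x assume x: "x \<in> W"
    show "of_cplx c * x \<in> W"
    proof (cases "c = 0 \<or> x = 0")
      case False
      then have "vl S (of_cplx c * x) = vl S x" if "lies_over S D e" for S D e
        using vl_mult[OF dvr[OF that], of "of_cplx c" x] vl_const[OF that, of c] by simp
      moreover have "vl S x \<ge> vl S h" if "lies_over S D e" for S D e using x False that unfolding W_def by blast
      ultimately have "vl S (of_cplx c * x) \<ge> vl S h" if "lies_over S D e" for S D e using that by metis
      then show ?thesis unfolding W_def by blast
    qed (use W0 in auto)
  next
    fix \<sigma> x assume \<sigma>: "\<sigma> \<in> Gal" and x: "x \<in> W"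
    show "\<sigma> x \<in> W"
    proof (cases "x = 0")
      case False
      have "vl S (\<sigma> x) \<ge> vl S h" if S: "lies_over S D e" for S D e
      proof -
        \<comment> \<open>By \<open>vl_h\<close> the value of \<open>h\<close> depends on
          \<open>D\<close> and \<open>e\<close> only and is the same along conjugate divisors,
          although \<open>h\<close> is not yet known to be an eigenvector.\<close>
        note S' = PD_conjugate[OF S \<sigma>]
        have "vl S (\<sigma> x) = vl {x. \<sigma> x \<in> S} x" using S'(2)[OF False] by simp
        also have "\<dots> \<ge> vl {x. \<sigma> x \<in> S} h" using x False S'(1) unfolding W_def by blast
        finally show ?thesis using vl_h[OF S] vl_h[OF S'(1)] by simp
      qed
      then show ?thesis unfolding W_def by blast
    qed (simp add: W_def auto_simps(1)[OF \<sigma>])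
  qed (auto simp: W_def)
  then obtain ws where ws: "set ws \<subseteq> W \<inter> E" "h = sum_list ws" by blast
  then have "ws \<noteq> []" using h(2) by auto
  then obtain w where w: "w \<in> W" "w \<in> E" using ws(1) by (cases ws) auto
  have w0: "w \<noteq> 0" by (rule E_nz[OF w(2)])
  have "w / h \<in> L"
  proof (rule section_in_L)
    fix S D e assume S: "lies_over S D e"
    have "e > 0" using S by (simp add: lies_over_def)
    moreover have "vl S w \<ge> vl S h" using w(1) w0 S unfolding W_def by blast
    ultimately show "vl S (w / h) \<ge> (if D = None then - e else 0)" using vl_divide[OF dvr[OF S] w0 h(2)] by simp
  qed
  then have "w / (w / h) \<in> E" 
    by (intro E_divide[OF w(2)] L_in_E) (use w0 h(2) in simp_all)
  then show ?thesis using w0 h(2) by simp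
qed

end

text \<open>The zeros of a polynomial, counted with degrees, balance its pole at infinity.\<close>

lemma sum_dg_val:
  assumes F: "finite F" "None \<in> F" "F \<subseteq> divisors" and f: "f \<noteq> 0" "Some ` prime_factors f \<subseteq> F"
  shows "(\<Sum>D\<in>F. int (dg D) * val D f) = 0"
proof -
  define F' where "F' = {p. Some p \<in> F}"
  have F': "F = insert None (Some ` F')"
  proof (intro equalityI subsetI)
    fix D assume "D \<in> F" then show "D \<in> insert None (Some ` F')" by (cases D) (auto simp: F'_def)
  qed (use F in \<open>auto simp: F'_def\<close>)
  have fin: "finite F'" using F(1) unfolding F' by (simp add: finite_image_iff)
  have "(\<Sum>p\<in>F'. tdeg p * multiplicity p f) = tdeg f"
    using f F by (intro tdeg_eq_sum fin) (auto simp: F'_def divisors_def)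
  then have "(\<Sum>p\<in>F'. int (tdeg p) * int (multiplicity p f)) = int (tdeg f)" by (simp flip: of_nat_mult of_nat_sum)
  then show ?thesis unfolding F' using fin by (simp add: sum.reindex)
qed

context cover
begin

lemma V_power: "D \<in> divisors \<Longrightarrow> w \<in> E \<Longrightarrow> V D (w ^ n) = int n * V D w"
  unfolding V_def by (intro vl_power V_dvr[unfolded V_def] E_nz)

lemma V_power_N:
  assumes w: "w \<in> E"
  obtains f g where "f \<noteq> 0" "g \<noteq> 0" "\<And>D. D \<in> divisors \<Longrightarrow> int N * V D w = int (ram D) * (val D f - val D g)"
proof -
  obtain f g where fg: "g \<noteq> 0" "w ^ N = ec 0 f / ec 0 g" by (rule L_ec0E[OF E_power_N[OF w]])
  have f: "f \<noteq> 0" using fg E_nz[OF w] by (metis ec0_eq_0_iff div_0 power_not_zero)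
  have "int N * V D w = int (ram D) * (val D f - val D g)" if D: "D \<in> divisors" for D
  proof -
    have "V D (w ^ N) = V D (ec 0 f) - V D (ec 0 g)"
      unfolding V_def fg using fg f by (intro vl_divide V_dvr D) auto
    then show ?thesis using V_power[OF D w] V_ec[OF D] f fg(1) by (simp add: right_diff_distrib)
  qed
  then show thesis using that f fg(1) by blast
qed

lemma finite_support: assumes w: "w \<in> E" shows "finite {D \<in> divisors. V D w \<noteq> 0}"
proof -
  obtain f g where fg: "f \<noteq> 0" "g \<noteq> 0" "\<And>D. D \<in> divisors \<Longrightarrow> int N * V D w = int (ram D) * (val D f - val D g)"
    by (rule V_power_N[OF w]) blast
  have "{D \<in> divisors. V D w \<noteq> 0} \<subseteq> insert None (Some ` (prime_factors f \<union> prime_factors g))"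
  proof
    fix D assume "D \<in> {D \<in> divisors. V D w \<noteq> 0}"
    then have D: "D \<in> divisors" "V D w \<noteq> 0" by auto
    then have ne: "val D f \<noteq> val D g" using fg(3)[OF D(1)] N_pos by auto
    show "D \<in> insert None (Some ` (prime_factors f \<union> prime_factors g))"
    proof (cases D)
      case (Some p)
      then have p: "Factorial_Ring.prime p" using D by (auto simp: divisors_def)
      have "multiplicity p f > 0 \<or> multiplicity p g > 0" using ne Some by auto
      then show ?thesis using Some p by (auto simp: prime_factors_multiplicity)
    qed simp
  qed
  then show ?thesis by (rule finite_subset) auto
qed

text \<open>The N-th power of \<open>w\<close> is a quotient of two polynomials, to which
  \<open>sum_dg_val\<close> applies; the indices disappear on division by
  \<open>ram D\<close>.\<close>

lemma product_formula:
  assumes w: "w \<in> E" and F: "finite F" "None \<in> F" "F \<subseteq> divisors" "{D \<in> divisors. V D w \<noteq> 0} \<subseteq> F"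
  shows "(\<Sum>D\<in>F. real (dg D) * real_of_int (V D w) / real (ram D)) = 0"
proof -
  obtain f g where fg: "f \<noteq> 0" "g \<noteq> 0" "\<And>D. D \<in> divisors \<Longrightarrow> int N * V D w = int (ram D) * (val D f - val D g)"
    by (rule V_power_N[OF w]) blast
  define F2 where "F2 = F \<union> Some ` (prime_factors f \<union> prime_factors g)"
  have F2: "finite F2" "None \<in> F2" "F2 \<subseteq> divisors" using F by (auto simp: F2_def divisors_def)
  have "(\<Sum>D\<in>F2. int (dg D) * val D f) = 0" "(\<Sum>D\<in>F2. int (dg D) * val D g) = 0"
    using fg F2 by (intro sum_dg_val; auto simp: F2_def)+
  then have "(\<Sum>D\<in>F2. int (dg D) * (val D f - val D g)) = 0" by (simp add: right_diff_distrib sum_subtractf)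
  then have "real_of_int (\<Sum>D\<in>F2. int (dg D) * (val D f - val D g)) = 0" by (simp only: of_int_0)
  then have z: "(\<Sum>D\<in>F2. real (dg D) * real_of_int (val D f - val D g)) = 0" by simp
  have "real N * (\<Sum>D\<in>F2. real (dg D) * real_of_int (V D w) / real (ram D)) = 
    (\<Sum>D\<in>F2. real (dg D) * real_of_int (val D f - val D g))" unfolding sum_distrib_left
  proof (intro sum.cong refl)
    fix D assume "D \<in> F2"
    then have D: "D \<in> divisors" using F2 by auto
    have "real_of_int (int N * V D w) = real_of_int (int (ram D) * (val D f - val D g))" using fg(3)[OF D] by simp
    then have eq: "real N * real_of_int (V D w) = real (ram D) * real_of_int (val D f - val D g)" by simp
    have "real N * (real (dg D) * real_of_int (V D w) / real (ram D)) = real (dg D) * (real N * real_of_int (V D w)) / real (ram D)"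
      by simp
    then show "real N * (real (dg D) * real_of_int (V D w) / real (ram D)) = real (dg D) * real_of_int (val D f - val D g)"
      unfolding eq using ram_pos[OF D] by simp
  qed
  then have "(\<Sum>D\<in>F2. real (dg D) * real_of_int (V D w) / real (ram D)) = 0" unfolding z using N_pos by simp
  moreover have "(\<Sum>D\<in>F2. real (dg D) * real_of_int (V D w) / real (ram D)) = (\<Sum>D\<in>F. real (dg D) * real_of_int (V D w) / real (ram D))"
    using F2 F by (intro sum.mono_neutral_right) (auto simp: F2_def)
  ultimately show ?thesis by simp
qed

text \<open>A product of powers of prime polynomials has any prescribed values at finitely many of
  them; the value at infinity is then determined by the degrees.\<close>

lemma ex_twist:
  assumes "finite F'" "\<And>p. p \<in> F' \<Longrightarrow> Factorial_Ring.prime p"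
  shows "\<exists>u\<in>L. u \<noteq> 0 \<and> (\<forall>D\<in>divisors. V D u = int (ram D) * (\<Sum>p\<in>F'. n p * val D p))"
  using assms
proof (induction F' rule: finite_induct)
  case empty
  show ?case using V_1 subr_1[OF L_subr] by (intro bexI[of _ 1]) auto
next
  case (insert p F')
  then obtain u where u: "u \<in> L" "u \<noteq> 0" "\<And>D. D \<in> divisors \<Longrightarrow> V D u = int (ram D) * (\<Sum>p\<in>F'. n p * val D p)" by auto
  have "p \<noteq> 0" using insert.prems[of p] by (intro notI) simp
  then have p: "ec 0 p \<in> L" "ec 0 p \<in> E" "ec 0 p \<noteq> 0"
    using L_in_E[of "ec 0 p"] chart.ev_L[OF charts[OF le0], of p] unfolding ec_def[symmetric] by auto
  define v where "v = (if n p \<ge> 0 then ec 0 p ^ nat (n p) else inverse (ec 0 p ^ nat (- n p)))"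
  have v: "v \<in> L" "v \<noteq> 0" unfolding v_def using p by (auto intro: subr_power[OF L_subr] L_inverse)
  have "V D v = int (ram D) * (n p * val D p)" if D: "D \<in> divisors" for D
    unfolding v_def using V_inverse[OF D E_power[OF p(2)]] V_power[OF D p(2)] V_ec[OF D \<open>p \<noteq> 0\<close>] by simp
  then have "V D (u * v) = int (ram D) * (\<Sum>p\<in>insert p F'. n p * val D p)" if D: "D \<in> divisors" for D
    using V_mult[OF D L_in_E[OF u(1,2)] L_in_E[OF v]] u(3)[OF D] D insert(1,2) by (simp add: distrib_left)
  then show ?case using u v subr_mult[OF L_subr u(1) v(1)] by (intro bexI[of _ "u * v"]) auto
qed

end

context canonical_cover
begin

definition I :: "p3 option set" where "I = {D \<in> divisors. ram D \<ge> 2}"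

lemma V_h: "D \<in> divisors \<Longrightarrow> V D h = 1 - int (ram D) + (if D = None then 5 * int (ram D) else 0)"
  unfolding V_def by (rule vl_h[OF over_pick])

lemma None_divisor: "None \<in> divisors" by (simp add: divisors_def)

lemma finite_I: "finite I"
proof -
  have "I \<subseteq> insert None {D \<in> divisors. V D h \<noteq> 0}" using V_h by (auto simp: I_def)
  then show ?thesis by (rule finite_subset) (simp add: finite_support[OF h_E])
qed

definition supp :: "'a \<Rightarrow> p3 option set" where
  "supp w = insert None (I \<union> {D \<in> divisors. V D w \<noteq> 0})"

lemma supp:
  assumes "w \<in> E"
  shows "finite (supp w)" "None \<in> supp w" "supp w \<subseteq> divisors" "{D \<in> divisors. V D w \<noteq> 0} \<subseteq> supp w" "I \<subseteq> supp w"
  using finite_I finite_support[OF assms] by (auto simp: supp_def I_def None_divisor)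

definition l :: "'a \<Rightarrow> real" where
  "l w = (\<Sum>D\<in>I. real (dg D) * real_of_int (V D w mod int (ram D)) / real (ram D))"

text \<open>A residue is the value minus \<open>ram D\<close> times the integral quotient. By the
  product formula the values cancel, so only integers remain.\<close>

lemma l_expand:
  assumes w: "w \<in> E"
  shows "l w = - real_of_int (\<Sum>D\<in>supp w. int (dg D) * (V D w div int (ram D)))"
proof -
  have "l w = (\<Sum>D\<in>supp w. real (dg D) * real_of_int (V D w mod int (ram D)) / real (ram D))"
    unfolding l_def
  proof (intro sum.mono_neutral_left supp[OF w] ballI)
    fix D assume "D \<in> supp w - I"
    then have "D \<in> divisors" "\<not> ram D \<ge> 2" using supp[OF w] by (auto simp: I_def)
    then have "ram D = 1" using ram_pos[of D] by simp
    then show "real (dg D) * real_of_int (V D w mod int (ram D)) / real (ram D) = 0" by simp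
  qed
  also have "\<dots> = (\<Sum>D\<in>supp w. real (dg D) * real_of_int (V D w) / real (ram D) - real (dg D) * real_of_int (V D w div int (ram D)))"
  proof (intro sum.cong refl)
    fix D assume "D \<in> supp w"
    then have r: "real (ram D) > 0" using supp[OF w] ram_pos by auto
    have "V D w mod int (ram D) = V D w - int (ram D) * (V D w div int (ram D))" by (simp add: minus_mult_div_eq_mod)
    then have "real_of_int (V D w mod int (ram D)) = real_of_int (V D w) - real (ram D) * real_of_int (V D w div int (ram D))" by simp
    note eq = this
    show "real (dg D) * real_of_int (V D w mod int (ram D)) / real (ram D) = 
      real (dg D) * real_of_int (V D w) / real (ram D) - real (dg D) * real_of_int (V D w div int (ram D))"
      unfolding eq using r by (simp add: right_diff_distrib diff_divide_distrib)
  qed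
  also have "\<dots> = - real_of_int (\<Sum>D\<in>supp w. int (dg D) * (V D w div int (ram D)))"
    using product_formula[OF w supp(1-4)[OF w]] by (simp add: sum_subtractf)
  finally show ?thesis .
qed

text \<open>Otherwise some multiple of \<open>w\<close> by an element of \<open>L\<close> would be a section of the pullback of
  \<open>O(1)\<close>.\<close>

lemma l_ge_2:
  assumes w: "w \<in> E" "w \<notin> L"
  shows "l w \<ge> 2"
proof (rule ccontr)
  assume less: "\<not> l w \<ge> 2"
  define n where "n D = V D w div int (ram D)" for D
  define F' where "F' = {p. Some p \<in> supp w}"
  note sp = supp[OF w(1)]
  have F': "supp w = insert None (Some ` F')"
  proof (intro equalityI subsetI)
    fix D assume "D \<in> supp w" then show "D \<in> insert None (Some ` F')" by (cases D) (auto simp: F'_def)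
  qed (use sp in \<open>auto simp: F'_def\<close>)
  have fin: "finite F'" using sp(1) unfolding F' by (simp add: finite_image_iff)
  have prime: "Factorial_Ring.prime p" if "p \<in> F'" for p using that sp(3) by (auto simp: F'_def divisors_def)
  \<comment> \<open>\<open>u\<close> cancels the integral part of the divisor of \<open>w\<close>
    along all finite primes and collects it at infinity, where the total coefficient becomes
    \<open>- l w\<close>, hence at least -1.\<close>
  obtain u where u: "u \<in> L" "u \<noteq> 0" "\<And>D. D \<in> divisors \<Longrightarrow> V D u = int (ram D) * (\<Sum>p\<in>F'. - n (Some p) * val D p)"
    using ex_twist[OF fin prime, of "\<lambda>p. - n (Some p)"] by blast
  have sum: "(\<Sum>D\<in>supp w. int (dg D) * n D) = n None + (\<Sum>p\<in>F'. int (tdeg p) * n (Some p))"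
    unfolding F' using fin by (simp add: sum.reindex)
  have "l w = - real_of_int (n None + (\<Sum>p\<in>F'. int (tdeg p) * n (Some p)))"
    unfolding l_expand[OF w(1)] n_def[symmetric] sum ..
  then have "- real_of_int (n None + (\<Sum>p\<in>F'. int (tdeg p) * n (Some p))) < real_of_int 2" using less by linarith
  then have small: "- (n None + (\<Sum>p\<in>F'. int (tdeg p) * n (Some p))) \<le> 1" unfolding of_int_minus[symmetric] of_int_less_iff by linarith
  have "w * u \<in> L"
  proof (rule section_in_L)
    fix S D e assume S: "lies_over S D e"
    note o = overD[OF S]
    have wu: "w * u \<in> E" by (intro E_mult w L_in_E u)
    have vl: "vl S (w * u) = V D w + V D u" unfolding o(4)[OF wu] by (intro V_mult o(2) w(1) L_in_E u(1,2))
    have r: "int (ram D) > 0" using ram_pos[OF o(2)] by simp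
    have md: "V D w - int (ram D) * n D \<ge> 0" unfolding n_def minus_mult_div_eq_mod using r by simp
    show "vl S (w * u) \<ge> (if D = None then - e else 0)"
    proof (cases D)
      case None
      have "V D u = int (ram D) * (\<Sum>p\<in>F'. int (tdeg p) * n (Some p))"
        using u(3)[OF o(2)] None by (simp add: mult.commute)
      then have "vl S (w * u) = (V D w - int (ram D) * n D) + int (ram D) * (n None + (\<Sum>p\<in>F'. int (tdeg p) * n (Some p)))"
        unfolding vl None by (simp add: algebra_simps)
      moreover have "int (ram D) * (n None + (\<Sum>p\<in>F'. int (tdeg p) * n (Some p))) \<ge> int (ram D) * (- 1)"
        using small r by (intro mult_left_mono) linarith+
      ultimately show ?thesis using md None o(3) by simp
    next
      case (Some q)
      have q: "Factorial_Ring.prime q" using Some o(2) by (auto simp: divisors_def)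
      have "(\<Sum>p\<in>F'. - n (Some p) * val D p) = (\<Sum>p\<in>F'. if p = q then - n D else 0)"
      proof (intro sum.cong refl)
        fix p assume p: "p \<in> F'"
        show "- n (Some p) * val D p = (if p = q then - n D else 0)"
        proof (cases "p = q")
          case True
          have "multiplicity q q = 1" using q by (intro multiplicity_self) auto
          then show ?thesis using Some True by simp
        next
          case False
          then have "\<not> q dvd p" using primes_dvd_imp_eq[OF q prime[OF p]] by auto
          then show ?thesis using Some False by (simp add: not_dvd_imp_multiplicity_0)
        qed
      qed
      also have "\<dots> = (if q \<in> F' then - n D else 0)" using fin by simp
      finally have Vu: "V D u = int (ram D) * (if q \<in> F' then - n D else 0)" using u(3)[OF o(2)] by simp
      show ?thesis
      proof (cases "q \<in> F'")
        case True
        then show ?thesis using Vu vl md Some by simp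
      next
        case False
        then have "V D w = 0" using sp(4) o(2) Some by (auto simp: F'_def)
        then show ?thesis using Vu vl Some False by simp
      qed
    qed
  qed
  then have "(w * u) / u \<in> L" by (rule L_divide) (rule u(1))
  then show False using u(2) w(2) by simp
qed

text \<open>By \<open>vl_h\<close> the value of \<open>inverse h\<close> is
  \<open>ram D - 1\<close>, less \<open>5 * ram D\<close> at infinity: its residue is maximal
  everywhere, and the only nonzero quotient is -5 at infinity.\<close>

lemma l_inverse_h: "l (inverse h) = 5" "D \<in> divisors \<Longrightarrow> V D (inverse h) mod int (ram D) = int (ram D) - 1"
proof -
  have V: "V D (inverse h) = int (ram D) - 1 - (if D = None then 5 * int (ram D) else 0)" if "D \<in> divisors" for D
    using V_inverse[OF that h_E] V_h[OF that] by simp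
  show md: "V D (inverse h) mod int (ram D) = int (ram D) - 1" if D: "D \<in> divisors" for D
  proof -
    have "V D (inverse h) = (int (ram D) - 1) + int (ram D) * (if D = None then -5 else 0)" using V[OF D] by simp
    then have "V D (inverse h) mod int (ram D) = (int (ram D) - 1) mod int (ram D)" by (simp only: mod_mult_self2)
    also have "\<dots> = int (ram D) - 1" using ram_pos[OF D] by (intro mod_pos_pos_trivial) auto
    finally show ?thesis .
  qed
  have E: "inverse h \<in> E" by (rule E_inverse[OF h_E])
  note sp = supp[OF E]
  have dv: "V D (inverse h) div int (ram D) = (if D = None then -5 else 0)" if D: "D \<in> divisors" for D
  proof -
    have "int (ram D) * (V D (inverse h) div int (ram D)) = int (ram D) * (if D = None then -5 else 0)"
      unfolding minus_mod_eq_mult_div[symmetric] md[OF D] unfolding V[OF D] by simp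
    then show ?thesis unfolding mult_cancel_left using ram_pos[OF D] by simp
  qed
  have "(\<Sum>D\<in>supp (inverse h). int (dg D) * (V D (inverse h) div int (ram D))) = (\<Sum>D\<in>supp (inverse h). if D = None then -5 else 0)"
    using sp(3) dv by (intro sum.cong refl) auto
  also have "\<dots> = -5" using sp(1,2) by simp
  finally show "l (inverse h) = 5" unfolding l_expand[OF E] by simp
qed

end

section \<open>Kummer theory: the degree as the order of the group of eigenvectors modulo
  \<open>L\<close>\<close>

context abelian_ext
begin

definition GE :: "'k monoid" where "GE = \<lparr>carrier = E, monoid.mult = (*), one = 1\<rparr>"
definition cls :: "'k \<Rightarrow> 'k set" where "cls w = {u * w | u. u \<in> L \<and> u \<noteq> 0}"
definition Q :: "'k set monoid" where "Q = GE Mod {u \<in> L. u \<noteq> 0}"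
definition repr :: "'k set \<Rightarrow> 'k" where "repr x = (SOME w. w \<in> x)"

lemma GE_simps [simp]: "carrier GE = E" "x \<otimes>\<^bsub>GE\<^esub> y = x * y" "\<one>\<^bsub>GE\<^esub> = 1"
  by (simp_all add: GE_def)

lemma GE_comm_group: "comm_group GE"
proof (rule comm_groupI)
  fix x assume "x \<in> carrier GE"
  then show "\<exists>y\<in>carrier GE. y \<otimes>\<^bsub>GE\<^esub> x = \<one>\<^bsub>GE\<^esub>"
    using E_inverse E_nz by (intro bexI[of _ "inverse x"]) auto
qed (simp_all add: E_mult E_one mult.assoc mult.commute)

lemma L_subgroup: "subgroup {u \<in> L. u \<noteq> 0} GE"
proof (rule group.subgroupI)
  show "group GE" using GE_comm_group by (rule comm_group.axioms)
  show "{u \<in> L. u \<noteq> 0} \<subseteq> carrier GE" using L_in_E by auto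
  show "{u \<in> L. u \<noteq> 0} \<noteq> {}" using subr_1[OF L_subr] by (auto intro!: exI[of _ 1])
next
  fix u v assume u: "u \<in> {u \<in> L. u \<noteq> 0}" and v: "v \<in> {u \<in> L. u \<noteq> 0}"
  show "u \<otimes>\<^bsub>GE\<^esub> v \<in> {u \<in> L. u \<noteq> 0}" using u v subr_mult[OF L_subr, of u v] by simp
  have "inv\<^bsub>GE\<^esub> u = inverse u"
  proof (rule group.inv_equality)
    show "group GE" using GE_comm_group by (rule comm_group.axioms)
  qed (use u L_in_E E_inverse in auto)
  then show "inv\<^bsub>GE\<^esub> u \<in> {u \<in> L. u \<noteq> 0}" using u L_inverse by simp
qed

lemma r_coset_GE: "{u \<in> L. u \<noteq> 0} #>\<^bsub>GE\<^esub> w = cls w"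
  by (auto simp: r_coset_def cls_def)

lemma Q_comm_group: "comm_group Q"
  unfolding Q_def by (rule comm_group.abelian_FactGroup[OF GE_comm_group L_subgroup])

lemma carrier_Q: "carrier Q = cls ` E"
  unfolding Q_def carrier_FactGroup r_coset_GE by simp

lemma Q_mult: assumes "w \<in> E" "w' \<in> E" shows "cls w \<otimes>\<^bsub>Q\<^esub> cls w' = cls (w * w')"
proof -
  have "{u \<in> L. u \<noteq> 0} \<lhd> GE" using comm_group.normal_iff_subgroup[OF GE_comm_group] L_subgroup by blast
  from normal.rcos_sum[OF this, of w w'] show ?thesis
    unfolding r_coset_GE Q_def FactGroup_def using assms by simp
qed

lemma Q_one: "\<one>\<^bsub>Q\<^esub> = cls 1"
  unfolding Q_def FactGroup_def by (auto simp: cls_def)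

lemma cls_self: "w \<in> cls w"
  using subr_1[OF L_subr] unfolding cls_def by (intro CollectI exI[of _ 1]) auto

lemma cls_eq: assumes "w \<in> E" "w' \<in> E" "w / w' \<in> L" shows "cls w = cls w'"
proof -
  have sub: "cls w \<subseteq> cls w'" if "w \<in> E" "w' \<in> E" "w / w' \<in> L" for w w'
  proof
    fix x assume "x \<in> cls w"
    then obtain u where u: "u \<in> L" "u \<noteq> 0" "x = u * w" unfolding cls_def by blast
    have "x = (u * (w / w')) * w'" "u * (w / w') \<in> L" "u * (w / w') \<noteq> 0"
      using u that E_nz subr_mult[OF L_subr u(1) that(3)] by auto
    then show "x \<in> cls w'" unfolding cls_def by blast
  qed
  have "w' / w \<in> L" using L_inverse[OF assms(3)] by simp
  then show ?thesis using sub assms by blast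
qed

lemma repr_cls: assumes w: "w \<in> E" shows "\<exists>u\<in>L. u \<noteq> 0 \<and> repr (cls w) = u * w"
proof -
  have "repr (cls w) \<in> cls w" unfolding repr_def by (rule someI) (rule cls_self)
  then show ?thesis unfolding cls_def by blast
qed

lemma repr_E: "x \<in> carrier Q \<Longrightarrow> repr x \<in> E \<and> cls (repr x) = x"
proof -
  assume "x \<in> carrier Q"
  then obtain w where w: "w \<in> E" "x = cls w" unfolding carrier_Q by blast
  obtain u where u: "u \<in> L" "u \<noteq> 0" "repr x = u * w" using repr_cls[OF w(1)] w(2) by blast
  have "repr x \<in> E" unfolding u(3) by (intro E_mult L_in_E u w)
  moreover have "repr x / w = u" using u(3) E_nz[OF w(1)] by simp
  ultimately show ?thesis using cls_eq[of "repr x" w] w u by simp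
qed

definition chr :: "'k \<Rightarrow> ('k \<Rightarrow> 'k) \<Rightarrow> complex" where
  "chr w \<sigma> = (SOME c. \<sigma> w = of_cplx c * w)"

lemma chr: "w \<in> E \<Longrightarrow> \<sigma> \<in> Gal \<Longrightarrow> \<sigma> w = of_cplx (chr w \<sigma>) * w"
  unfolding chr_def by (rule someI_ex) (rule E_eigenvalue)

lemma chr_power_N: assumes w: "w \<in> E" "\<sigma> \<in> Gal" shows "chr w \<sigma> ^ N = 1"
proof -
  have "(\<sigma> ^^ n) w = of_cplx (chr w \<sigma> ^ n) * w" for n
  proof (induction n)
    case (Suc n)
    then show ?case using chr[OF w] fixedD[OF const w(2)]
      by (simp add: auto_mult[OF w(2)] of_cplx_mult mult_ac)
  qed simp
  from this[of N] have "of_cplx (chr w \<sigma> ^ N) * w = 1 * w" using N_exponent[OF w(2)] by simp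
  then have "of_cplx (chr w \<sigma> ^ N) = (of_cplx 1 :: 'k)" using E_nz[OF w(1)] by simp
  then show ?thesis by (simp only: of_cplx_eq_iff)
qed

text \<open>A class is determined by the eigenvalues of a representative, which are N-th roots of
  unity.\<close>

lemma finite_Q: "finite (carrier Q)"
proof -
  have "inj_on (\<lambda>x. restrict (chr (repr x)) Gal) (carrier Q)"
  proof (rule inj_onI)
    fix x y assume x: "x \<in> carrier Q" and y: "y \<in> carrier Q"
      and eq: "restrict (chr (repr x)) Gal = restrict (chr (repr y)) Gal"
    note x' = repr_E[OF x] and y' = repr_E[OF y]
    have "repr x / repr y \<in> L"
    proof (rule fixedI)
      fix \<sigma> assume s: "\<sigma> \<in> Gal"
      have c: "chr (repr x) \<sigma> = chr (repr y) \<sigma>" using fun_cong[OF eq, of \<sigma>] s by simp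
      have "\<sigma> (repr x / repr y) = \<sigma> (repr x) / \<sigma> (repr y)" by (rule auto_divide[OF s])
      also have "\<dots> = (of_cplx (chr (repr y) \<sigma>) * repr x) / (of_cplx (chr (repr y) \<sigma>) * repr y)"
        using chr[of "repr x" \<sigma>] chr[of "repr y" \<sigma>] x' y' s c by simp
      also have "\<dots> = repr x / repr y"
        using chr_power_N[of "repr y" \<sigma>] y' s N_pos by (cases "chr (repr y) \<sigma> = 0") (auto simp: power_0_left)
      finally show "\<sigma> (repr x / repr y) = repr x / repr y" .
    qed
    then show "x = y" using cls_eq x' y' by metis
  qed
  moreover have "(\<lambda>x. restrict (chr (repr x)) Gal) ` carrier Q \<subseteq> (\<Pi>\<^sub>E \<sigma>\<in>Gal. {c. c ^ N = 1})"
    using chr_power_N repr_E by auto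
  moreover have "finite (\<Pi>\<^sub>E \<sigma>\<in>Gal. {c::complex. c ^ N = 1})"
    using N_pos by (intro finite_PiE Gal_finite finite_roots_unity) auto
  ultimately show ?thesis by (meson finite_imageD finite_subset)
qed

text \<open>Some automorphism multiplies \<open>w\<close> by a constant other than 1 without
  changing the average.\<close>

lemma avg_eigen: assumes w: "w \<in> E" "w \<notin> L" shows "avg w = 0"
proof -
  obtain \<sigma> where s: "\<sigma> \<in> Gal" "\<sigma> w \<noteq> w" using fixedI w(2) by blast
  obtain c where c: "\<sigma> w = of_cplx c * w" using E_eigenvalue[OF w(1) s(1)] by blast
  have "bij_betw (\<lambda>\<tau>. \<tau> \<circ> \<sigma>) Gal Gal"
  proof -
    have "inj_on (\<lambda>\<tau>. \<tau> \<circ> \<sigma>) Gal"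
    proof (rule inj_onI)
      fix \<tau> \<tau>' assume t: "\<tau> \<in> Gal" "\<tau>' \<in> Gal" "\<tau> \<circ> \<sigma> = \<tau>' \<circ> \<sigma>"
      then have "\<sigma> (\<tau> x) = \<sigma> (\<tau>' x)" for x using Gal_comm[OF _ s(1)] by (metis comp_apply)
      then show "\<tau> = \<tau>'" using auto_inj[OF s(1)] by blast
    qed
    then show ?thesis using Gal_comp[OF _ s(1)] by (intro bij_betw_imageI endo_inj_surj Gal_finite) auto
  qed
  then have "(\<Sum>\<tau>\<in>Gal. (\<tau> \<circ> \<sigma>) w) = (\<Sum>\<tau>\<in>Gal. \<tau> w)" by (rule sum.reindex_bij_betw)
  then have "avg (\<sigma> w) = avg w" by (simp add: avg_def)
  then have "of_cplx c * avg w = avg w" unfolding c avg_mult[OF const] .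
  moreover have "of_cplx c \<noteq> (1::'k)" using c s(2) by auto
  ultimately show ?thesis by (metis mult_cancel_right1)
qed

lemma L_subfield: "subfield L whole_field"
proof -
  interpret F: field "whole_field :: 'k ring" by (rule whole_field_field)
  show ?thesis
  proof (rule F.subfieldI')
    show "subring L whole_field"
      by (rule F.subringI) (simp_all only: whole_field_simps whole_field_a_inv subset_UNIV subr_1[OF L_subr]
        subr_uminus[OF L_subr] subr_mult[OF L_subr] subr_add[OF L_subr])
    fix k :: 'k assume k: "k \<in> L - {\<zero>\<^bsub>whole_field\<^esub>}"
    have "inv\<^bsub>whole_field\<^esub> k = inverse k"
      using k by (intro F.comm_inv_char) auto
    then show "inv\<^bsub>whole_field\<^esub> k \<in> L" using k L_inverse by simp
  qed
qed

text \<open>Representatives of the classes form a basis. They span by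
  \<open>eigen_decomposition\<close>; they are independent because \<open>avg (z / w)\<close> reads
  off the coefficient of \<open>z\<close> at \<open>w\<close>.\<close>

lemma dim_eq: "ring.dim whole_field L UNIV = card (carrier Q)"
proof -
  interpret F: field "whole_field :: 'k ring" by (rule whole_field_field)
  have ext: "z \<in> F.line_extension L a W \<longleftrightarrow> (\<exists>k\<in>L. \<exists>v\<in>W. z = k * a + v)" for z a W
    using F.line_extension_mem_iff[of z L a W] by simp
  have Span: "F.Span L (a # as) = F.line_extension L a (F.Span L as)" for a as by simp
  obtain xs where xs: "set xs = carrier Q" "distinct xs" using finite_distinct_list[OF finite_Q] by blast
  have avg_Span: "avg (z / w) = 0"
    if "z \<in> F.Span L ws" "\<And>v. v \<in> set ws \<Longrightarrow> v \<in> E \<and> v / w \<notin> L" "w \<in> E" for z w ws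
    using that
  proof (induction ws arbitrary: z)
    case Nil
    then show ?case by (simp add: avg_0)
  next
    case (Cons a ws)
    then obtain k v where k: "k \<in> L" "v \<in> F.Span L ws" "z = k * a + v" unfolding Span ext by blast
    have "avg (z / w) = k * avg (a / w) + avg (v / w)"
      unfolding k(3) add_divide_distrib avg_add times_divide_eq_right[symmetric] avg_mult[OF k(1)] ..
    moreover have "avg (a / w) = 0" using Cons.prems by (intro avg_eigen E_divide) auto
    moreover have "avg (v / w) = 0" using Cons.prems by (intro Cons.IH k(2)) auto
    ultimately show ?case by simp
  qed
  have indep: "F.independent L (map repr ys)" if "set ys \<subseteq> carrier Q" "distinct ys" for ys
    using that
  proof (induction ys)
    case Nil
    show ?case by simp
  next
    case (Cons y ys)
    note y = repr_E[of y]
    have "repr y \<notin> F.Span L (map repr ys)"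
    proof
      assume m: "repr y \<in> F.Span L (map repr ys)"
      have "avg (repr y / repr y) = 0"
      proof (rule avg_Span[OF m])
        show "repr y \<in> E" using y Cons.prems by simp
        fix v assume "v \<in> set (map repr ys)"
        then obtain x where x: "x \<in> set ys" "v = repr x" by auto
        then have x': "repr x \<in> E" "cls (repr x) = x" "x \<noteq> y" using repr_E Cons.prems by auto
        have "cls (repr x) \<noteq> cls (repr y)" using x' y Cons.prems by auto
        then show "v \<in> E \<and> v / repr y \<notin> L" using cls_eq[of "repr x" "repr y"] x x' y Cons.prems by auto
      qed
      moreover have "repr y \<noteq> 0" using y Cons.prems E_nz by auto
      ultimately show False using avg_self[OF subr_1[OF L_subr]] by simp
    qed
    then show ?case using Cons by (auto intro!: F.li_Cons simp del: F.Span.simps)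
  qed
  have "F.Span L (map repr xs) = UNIV"
  proof -
    have sub: "set (map repr xs) \<subseteq> carrier whole_field" by simp
    note S = F.Span_subgroup_props[OF L_subfield sub] F.Span_smult_closed[OF L_subfield sub]
    have base: "a \<in> F.Span L as" if "a \<in> set as" for a as
      using F.Span_base_incl[OF L_subfield, of as] that by auto
    have E: "w \<in> F.Span L (map repr xs)" if w: "w \<in> E" for w
    proof -
      obtain u where u: "u \<in> L" "u \<noteq> 0" "repr (cls w) = u * w" using repr_cls[OF w] by blast
      have "cls w \<in> set xs" using w xs(1) carrier_Q by blast
      then have "repr (cls w) \<in> F.Span L (map repr xs)" by (intro base) simp
      then have "inverse u \<otimes>\<^bsub>whole_field\<^esub> repr (cls w) \<in> F.Span L (map repr xs)" using L_inverse[OF u(1)] by (intro S(5))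
      moreover have "inverse u \<otimes>\<^bsub>whole_field\<^esub> repr (cls w) = w" using u by simp
      ultimately show ?thesis by (simp only:)
    qed
    have "f \<in> F.Span L (map repr xs)" for f
    proof -
      obtain ws where ws: "set ws \<subseteq> UNIV \<inter> E" "f = sum_list ws" using eigen_decomposition[of UNIV f] by blast
      have "set ws \<subseteq> E \<Longrightarrow> sum_list ws \<in> F.Span L (map repr xs)"
      proof (induction ws)
        case Nil
        show ?case using S(2) by (simp del: F.Span.simps)
      next
        case (Cons w ws)
        then show ?case using S(3)[OF E Cons.IH, of w] by (simp del: F.Span.simps)
      qed
      then show ?thesis using ws by simp
    qed
    then show ?thesis by blast
  qed
  then have "F.dimension (length (map repr xs)) L UNIV"
    using F.dimensionI[OF L_subfield indep] xs by simp
  note dim = F.dimI[OF L_subfield this, unfolded over_def]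
  have "length (map repr xs) = card (carrier Q)" unfolding length_map distinct_card[OF xs(2), symmetric] xs(1) ..
  then show ?thesis unfolding dim .
qed

end

context canonical_cover
begin

lemma V_repr:
  assumes D: "D \<in> divisors" and w: "w \<in> E"
  shows "V D (repr (cls w)) mod int (ram D) = V D w mod int (ram D)"
proof -
  obtain u where u: "u \<in> L" "u \<noteq> 0" "repr (cls w) = u * w" using repr_cls[OF w] by blast
  obtain k where "V D u = int (ram D) * k" using V_L_dvd[OF D u(1,2)] by (elim dvdE)
  then show ?thesis using V_mult[OF D L_in_E[OF u(1,2)] w] u(3) by simp
qed

lemma l_cls:
  assumes "w \<in> E"
  shows "(\<Sum>D\<in>I. real (dg D) * real_of_int (V D (repr (cls w)) mod int (ram D)) / real (ram D)) = l w"
  unfolding l_def using V_repr[OF _ assms] by (intro sum.cong) (auto simp: I_def)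

text \<open>Residues do not depend on the representative, since values of elements of
  \<open>L\<close> are multiples of the index. The distinguished element is the class of
  \<open>inverse h\<close>; the condition on pairs is \<open>ex_pair\<close>, and the bound on
  \<open>l\<close> is \<open>l_ge_2\<close>.\<close>

lemma cover_data_Q: "cover_data Q I ram dg (\<lambda>D x. V D (repr x) mod int (ram D)) (cls (inverse h))"
proof (intro cover_data.intro cover_data_axioms.intro)
  show "comm_group Q" by (rule Q_comm_group)
  show "finite (carrier Q)" by (rule finite_Q)
  show "finite I" by (rule finite_I)
  show "cls (inverse h) \<in> carrier Q" unfolding carrier_Q by (intro imageI E_inverse h_E)
  have hE: "inverse h \<in> E" by (intro E_inverse h_E)
  fix D assume "D \<in> I"
  then have D: "D \<in> divisors" and r: "ram D \<ge> 2" by (auto simp: I_def)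
  show "2 \<le> ram D" by (rule r)
  show "1 \<le> dg D" using fm[OF D] by simp
  show "V D (repr (cls (inverse h))) mod int (ram D) = int (ram D) - 1"
    unfolding V_repr[OF D hE] by (rule l_inverse_h(2)[OF D])
  show "\<exists>x\<in>carrier Q. V D (repr x) mod int (ram D) = 1"
  proof -
    obtain w where w: "w \<in> E" "V D w = 1" using V_surj[OF D] by blast
    then have "V D (repr (cls w)) mod int (ram D) = 1" using V_repr[OF D w(1)] r by simp
    then show ?thesis unfolding carrier_Q by (rule bexI) (rule imageI[OF w(1)])
  qed
  show "\<exists>x\<in>carrier Q. V D (repr x) mod int (ram D) = 1 \<and> V D' (repr x) mod int (ram D') = 0" if D': "D' \<in> I" "D \<noteq> D'" for D'
  proof -
    have D1: "D' \<in> divisors" using D'(1) by (simp add: I_def)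
    obtain w where w: "w \<in> E" "V D w = 1" "V D' w = 0" using ex_pair[OF D D1 D'(2)] by blast
    then have "V D (repr (cls w)) mod int (ram D) = 1 \<and> V D' (repr (cls w)) mod int (ram D') = 0"
      using V_repr[OF D w(1)] V_repr[OF D1 w(1)] r by simp
    then show ?thesis unfolding carrier_Q by (rule bexI) (rule imageI[OF w(1)])
  qed
  fix x assume x: "x \<in> carrier Q"
  show "0 \<le> V D (repr x) mod int (ram D) \<and> V D (repr x) mod int (ram D) < int (ram D)" using r by simp
  fix y assume y: "y \<in> carrier Q"
  obtain w w' where w: "w \<in> E" "w' \<in> E" "x = cls w" "y = cls w'" using x y unfolding carrier_Q by blast
  show "V D (repr (x \<otimes>\<^bsub>Q\<^esub> y)) mod int (ram D) = (V D (repr x) mod int (ram D) + V D (repr y) mod int (ram D)) mod int (ram D)"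
    unfolding w(3,4) Q_mult[OF w(1,2)] V_repr[OF D w(1)] V_repr[OF D w(2)] V_repr[OF D E_mult[OF w(1,2)]] V_mult[OF D w(1,2)]
    by (simp add: mod_add_eq)
next
  fix x assume x: "x \<in> carrier Q"
  then obtain w where w: "w \<in> E" "x = cls w" unfolding carrier_Q by blast
  show "(\<Sum>D\<in>I. real (dg D) * real_of_int (V D (repr x) mod int (ram D)) / real (ram D)) \<in> \<int>"
    unfolding w(2) l_cls[OF w(1)] l_expand[OF w(1)] by (intro Ints_minus Ints_of_int)
  assume "x \<noteq> \<one>\<^bsub>Q\<^esub>"
  then have "w \<notin> L" using cls_eq[OF w(1) E_one] w(2) by (auto simp: Q_one)
  then show "(\<Sum>D\<in>I. real (dg D) * real_of_int (V D (repr x) mod int (ram D)) / real (ram D)) \<ge> 2"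
    unfolding w(2) l_cls[OF w(1)] by (rule l_ge_2[OF w(1)])
next
  have "(\<Sum>D\<in>I. real (dg D) * (real (ram D) - 1) / real (ram D)) = l (inverse h)"
    unfolding l_def using l_inverse_h(2) by (intro sum.cong) (auto simp: I_def)
  then show "(\<Sum>D\<in>I. real (dg D) * (real (ram D) - 1) / real (ram D)) = 5" using l_inverse_h(1) by simp
qed

theorem degree_power_of_two: "\<exists>m. ring.dim whole_field L UNIV = 2 ^ m \<and> 1 \<le> m \<and> m \<le> 5"
  unfolding dim_eq using cover_data.order_power_of_two[OF cover_data_Q] .

end

section \<open>From the definitions to the locales\<close>

lemma ev3_zero_everywhere:
  fixes f :: p3
  assumes "\<And>a b c. ev3 (\<lambda>x. x) a b c f = (0::complex)"
  shows "f = 0"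
proof (rule ccontr)
  assume "f \<noteq> 0"
  then have f2: "lead_coeff f \<noteq> 0" by simp
  then have "lead_coeff (lead_coeff f) \<noteq> 0" by simp
  then obtain c where c: "poly (lead_coeff (lead_coeff f)) c \<noteq> 0" using poly_all_0_iff_0 by blast
  have r: "rhom (\<lambda>x::complex. x)" by (simp add: rhom_def)
  define e1 where "e1 = evp (\<lambda>x::complex. x) c"
  have r1: "rhom e1" unfolding e1_def by (rule rhom_evp[OF r])
  have "e1 (lead_coeff (lead_coeff f)) \<noteq> 0" using c by (simp add: e1_def evp_def)
  then have "coeff (map_poly e1 (lead_coeff f)) (degree (lead_coeff f)) \<noteq> 0" by (simp add: coeff_map_poly rhomD(1)[OF r1])
  then have "map_poly e1 (lead_coeff f) \<noteq> 0" by auto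
  then obtain b where b: "poly (map_poly e1 (lead_coeff f)) b \<noteq> 0" using poly_all_0_iff_0 by blast
  define e2 where "e2 = evp e1 b"
  have r2: "rhom e2" unfolding e2_def by (rule rhom_evp[OF r1])
  have "coeff (map_poly e2 f) (degree f) \<noteq> 0" using b by (simp add: coeff_map_poly rhomD(1)[OF r2] e2_def evp_def)
  then have "map_poly e2 f \<noteq> 0" by auto
  then obtain a where "poly (map_poly e2 f) a \<noteq> 0" using poly_all_0_iff_0 by blast
  then have "ev3 (\<lambda>x. x) a b c f \<noteq> 0" unfolding ev3_def e1_def[symmetric] e2_def[symmetric] evp_def[of e2] .
  then show False using assms by simp
qed

lemma yc_ratio: "k \<le> 2 \<Longrightarrow> \<exists>j\<le>3. yc s i k = s j / s i"
  unfolding yc_def by (intro exI[of _ "if k < i then k else Suc k"]) auto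

lemma chart_ring_eq:
  assumes i: "i \<le> 3" and nz: "s i \<noteq> 0"
  shows "chart_ring 3 s i = range (evc s i)"
proof (intro equalityI subsetI)
  fix x assume "x \<in> chart_ring 3 s i"
  then show "x \<in> range (evc s i)" unfolding chart_ring_def
  proof (induction rule: generate_ring.induct)
    case one
    have "\<one>\<^bsub>whole_field\<^esub> = evc s i 1" by (simp add: evc_simps)
    then show ?case by (metis rangeI)
  next
    case (incl h)
    then consider c where "h = of_cplx c" | j where "j \<le> 3" "h = s j / s i" by auto
    then show ?case
    proof cases
      case 1
      then have "h = evc s i (C3 c)" by (simp add: evc_simps)
      then show ?thesis by (metis rangeI)
    next
      case 2
      then show ?thesis using s_ratio_range[where s = s, OF i _ nz, of j] by simp
    qed
  next
    case (a_inv h)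
    then obtain f where "h = evc s i f" by blast
    then have "\<ominus>\<^bsub>whole_field\<^esub> h = evc s i (- f)" by (simp add: evc_simps)
    then show ?case by (metis rangeI)
  next
    case (eng_add h1 h2)
    then obtain f g where "h1 = evc s i f" "h2 = evc s i g" by blast
    then have "h1 \<oplus>\<^bsub>whole_field\<^esub> h2 = evc s i (f + g)" by (simp add: evc_simps)
    then show ?case by (metis rangeI)
  next
    case (eng_mult h1 h2)
    then obtain f g where "h1 = evc s i f" "h2 = evc s i g" by blast
    then have "h1 \<otimes>\<^bsub>whole_field\<^esub> h2 = evc s i (f * g)" by (simp add: evc_simps)
    then show ?case by (metis rangeI)
  qed
next
  fix x assume "x \<in> range (evc s i)"
  then obtain f where "x = evc s i f" by blast
  define R where "R = chart_ring 3 s i"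
  have add: "a + b \<in> R" and mult: "a * b \<in> R" if "a \<in> R" "b \<in> R" for a b
    using generate_ring.eng_add[of a whole_field _ b] generate_ring.eng_mult[of a whole_field _ b] that
    unfolding R_def chart_ring_def by auto
  have y: "yc s i k \<in> R" if "k \<le> 2" for k
    using yc_ratio[OF that, of s i] unfolding R_def chart_ring_def by (auto intro: generate_ring.incl)
  have "evc s i f \<in> R"
  proof (induction f rule: p3_induct)
    case (C c)
    show ?case unfolding evc_simps R_def chart_ring_def by (intro generate_ring.incl) auto
  qed (simp_all only: evc_simps add mult y order_refl one_le_numeral zero_le_numeral le0)
  then show "x \<in> chart_ring 3 s i" using \<open>x = evc s i f\<close> by (simp add: R_def)
qed

lemma coordinate_field_frac:
  assumes i: "i \<le> 3" and nz: "s i \<noteq> 0" and inj: "\<And>f. evc s i f = 0 \<Longrightarrow> f = 0" and u: "u \<in> coordinate_field 3 s"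
  shows "\<exists>f g. g \<noteq> 0 \<and> u = evc s i f / evc s i g"
proof -
  have ne: "g \<noteq> 0 \<Longrightarrow> evc s i g \<noteq> 0" for g using inj by blast
  have frac: "\<exists>f g. g \<noteq> 0 \<and> evc s i p / evc s i q = evc s i f / evc s i g" if "q \<noteq> 0" for p q using that by blast
  show ?thesis using u unfolding coordinate_field_def
  proof (induction rule: generate_field.induct)
    case one
    show ?case by (intro exI[of _ 1]) (simp add: evc_simps)
  next
    case (incl h)
    then consider c where "h = of_cplx c" | j k where "j \<le> 3" "k \<le> 3" "s k \<noteq> 0" "h = s j / s k" by auto
    then show ?case
    proof cases
      case 1
      then show ?thesis by (intro exI[of _ "C3 c"] exI[of _ 1]) (simp add: evc_simps)
    next
      case 2
      obtain f where f: "s j / s i = evc s i f" using s_ratio_range[where s = s, OF i 2(1) nz] by blast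
      obtain g where g: "s k / s i = evc s i g" using s_ratio_range[where s = s, OF i 2(2) nz] by blast
      have "g \<noteq> 0"
      proof
        assume "g = 0"
        then have "s k / s i = 0" using g by (simp add: evc_simps)
        then show False using 2(3) nz by simp
      qed
      moreover have "h = (s j / s i) / (s k / s i)" using 2(4) nz by simp
      ultimately show ?thesis unfolding f g by blast
    qed
  next
    case (a_inv h)
    then obtain f g where fg: "g \<noteq> 0" "h = evc s i f / evc s i g" by blast
    then show ?case by (intro exI[of _ "- f"] exI[of _ g]) (simp add: evc_simps)
  next
    case (m_inv h)
    then obtain f g where fg: "g \<noteq> 0" "h = evc s i f / evc s i g" "h \<noteq> 0" by auto
    then have f: "f \<noteq> 0" by (auto simp: evc_simps)
    interpret F: field "whole_field :: 'a ring" by (rule whole_field_field)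
    have "inv\<^bsub>whole_field\<^esub> h = inverse h" using fg(3) by (intro F.comm_inv_char) auto
    also have "\<dots> = evc s i g / evc s i f" using fg(2) by simp
    finally show ?case using f by blast
  next
    case (eng_add h1 h2)
    then obtain f1 g1 f2 g2 where fg: "g1 \<noteq> 0" "h1 = evc s i f1 / evc s i g1" "g2 \<noteq> 0" "h2 = evc s i f2 / evc s i g2" by blast
    have "h1 + h2 = evc s i (f1 * g2 + f2 * g1) / evc s i (g1 * g2)"
      unfolding fg using add_frac_eq[OF ne[OF fg(1)] ne[OF fg(3)]] by (simp add: evc_simps)
    moreover have "g1 * g2 \<noteq> 0" using fg by simp
    ultimately show ?case unfolding whole_field_simps by blast
  next
    case (eng_mult h1 h2)
    then obtain f1 g1 f2 g2 where fg: "g1 \<noteq> 0" "h1 = evc s i f1 / evc s i g1" "g2 \<noteq> 0" "h2 = evc s i f2 / evc s i g2" by blast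
    have "h1 * h2 = evc s i (f1 * f2) / evc s i (g1 * g2)" unfolding fg by (simp add: evc_simps)
    moreover have "g1 * g2 \<noteq> 0" using fg by simp
    ultimately show ?case unfolding whole_field_simps by blast
  qed
qed

lemma abelian_ext_galois:
  fixes L :: "'k::complex_extension_field set"
  assumes G: "comm_group G" "finite (carrier G)" "G \<cong> galois_group L"
    and fixed: "{x. \<forall>\<sigma>\<in>carrier (galois_group L). \<sigma> x = x} = L" and const: "\<And>c. of_cplx c \<in> L"
  shows "abelian_ext L (carrier (galois_group L))"
proof -
  have iso: "\<sigma> \<in> carrier (galois_group L) \<longleftrightarrow> bij \<sigma> \<and> (\<forall>x y. \<sigma> (x * y) = \<sigma> x * \<sigma> y \<and> \<sigma> (x + y) = \<sigma> x + \<sigma> y) \<and> \<sigma> 1 = 1 \<and> (\<forall>x\<in>L. \<sigma> x = x)"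
    for \<sigma> :: "'k \<Rightarrow> 'k"
    by (auto simp: galois_group_def ring_iso_def ring_hom_def)
  obtain \<psi> where psi: "\<psi> \<in> iso G (galois_group L)" using G(3) unfolding is_iso_def by blast
  then have im: "\<psi> ` carrier G = carrier (galois_group L)"
    and hom: "\<And>x y. x \<in> carrier G \<Longrightarrow> y \<in> carrier G \<Longrightarrow> \<psi> (x \<otimes>\<^bsub>G\<^esub> y) = \<psi> x \<circ> \<psi> y"
    by (auto simp: iso_def hom_def bij_betw_def galois_group_def)
  show ?thesis
  proof
    show "finite (carrier (galois_group L))" using G(2) unfolding im[symmetric] by simp
    show "id \<in> carrier (galois_group L)" unfolding iso by simp
    show "{x. \<forall>\<sigma>\<in>carrier (galois_group L). \<sigma> x = x} = L" by (rule fixed)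
    show "of_cplx c \<in> L" for c by (rule const)
    fix \<sigma> \<tau> assume s: "\<sigma> \<in> carrier (galois_group L)" and t: "\<tau> \<in> carrier (galois_group L)"
    show "\<sigma> (x + y) = \<sigma> x + \<sigma> y" "\<sigma> (x * y) = \<sigma> x * \<sigma> y" "\<sigma> 1 = 1" for x y using s unfolding iso by blast+
    show "\<sigma> \<circ> \<tau> \<in> carrier (galois_group L)" using s t unfolding iso by (auto intro: bij_comp)
    obtain a b where ab: "a \<in> carrier G" "b \<in> carrier G" "\<sigma> = \<psi> a" "\<tau> = \<psi> b" using s t unfolding im[symmetric] by blast
    have "a \<otimes>\<^bsub>G\<^esub> b = b \<otimes>\<^bsub>G\<^esub> a"
      using comm_monoid.m_comm[OF comm_group.axioms(1)[OF G(1)] ab(1,2)] .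
    then show "\<sigma> \<circ> \<tau> = \<tau> \<circ> \<sigma>" unfolding ab(3,4) using hom ab(1,2) by metis
  qed
qed

lemma subr_subring: "subring B whole_field \<Longrightarrow> subr B"
  unfolding subr_def using subringE[of B whole_field] by simp

text \<open>Change of chart for the residues at a closed point: \<open>u\<close> is a unit because
  its residue \<open>1 / b\<close> is nonzero, so the residue of the quotient is the quotient of the
  residues.\<close>

lemma max_ideal_unit_quotient:
  assumes P: "subr P" "pideal (max_ideal P) P" "\<And>x. x \<in> P \<Longrightarrow> x \<notin> max_ideal P \<longleftrightarrow> unit_in P x"
    and const: "\<And>c. of_cplx c \<in> P"
    and u: "u \<in> P" "u - of_cplx (1 / b) \<in> max_ideal P" "b \<noteq> (0::complex)"
    and v: "v \<in> P" "v - of_cplx (a / b) \<in> max_ideal P"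
  shows "v / u \<in> P" "v / u - of_cplx a \<in> (max_ideal P :: 'k::complex_extension_field set)"
proof -
  note m = pidealD[OF P(2)]
  have "unit_in P u"
  proof (rule ccontr)
    assume "\<not> unit_in P u"
    then have "u \<in> max_ideal P" using P(3) u(1) by blast
    then have "u + (- 1) * (u - of_cplx (1 / b)) \<in> max_ideal P"
      using m(4,5) u(2) subr_uminus[OF P(1) subr_1[OF P(1)]] by blast
    then have "of_cplx b * of_cplx (1 / b) \<in> max_ideal P" by (intro m(5) const) simp
    moreover have "of_cplx b * of_cplx (1 / b) = (1::'k)" using u(3) by (simp flip: of_cplx_mult)
    ultimately show False using m(3) by simp
  qed
  then have inv: "inverse u \<in> P" "u \<noteq> 0" by (auto simp: unit_in_def)
  show "v / u \<in> P" using subr_mult[OF P(1) v(1) inv(1)] by (simp add: divide_inverse)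
  have "inverse u * ((v - of_cplx (a / b)) + of_cplx (- a) * (u - of_cplx (1 / b))) \<in> max_ideal P"
    by (intro m(5) m(4) inv const u v)
  moreover have "of_cplx (a / b) = (of_cplx a * of_cplx (1 / b) :: 'k)" by (simp flip: of_cplx_mult)
  then have "inverse u * ((v - of_cplx (a / b)) + of_cplx (- a) * (u - of_cplx (1 / b))) = v / u - of_cplx a"
    using inv(2) by (simp add: of_cplx_uminus field_simps)
  ultimately show "v / u - of_cplx a \<in> max_ideal P" by simp
qed

text \<open>Reduction modulo the maximal ideal commutes with evaluation, so a polynomial in the
  coordinates has its complex value as residue at the point.\<close>

lemma ev3_mod_max_ideal:
  assumes P: "subr P" "pideal m P" and const: "\<And>c. of_cplx c \<in> P"
    and y: "y1 \<in> P" "y2 \<in> P" "y3 \<in> P" "y1 - of_cplx a1 \<in> m" "y2 - of_cplx a2 \<in> m" "y3 - of_cplx a3 \<in> m"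
  shows "ev3 of_cplx y1 y2 y3 f \<in> P \<and> ev3 of_cplx y1 y2 y3 f - of_cplx (ev3 (\<lambda>x. x) a1 a2 a3 f) \<in> m"
proof -
  note m = pidealD[OF P(2)]
  have r: "rhom (\<lambda>x::complex. x)" by (simp add: rhom_def)
  note simps = evc_simps rhomD[OF rhom_ev3[OF r]] ev3_simps[OF r]
  show ?thesis
  proof (induction f rule: p3_induct)
    case (add f g)
    let ?a = "ev3 of_cplx y1 y2 y3 f" and ?b = "ev3 of_cplx y1 y2 y3 g"
      and ?c = "of_cplx (ev3 (\<lambda>x. x) a1 a2 a3 f)" and ?d = "of_cplx (ev3 (\<lambda>x. x) a1 a2 a3 g)"
    have "(?a - ?c) + (?b - ?d) \<in> m" using add by (intro m(4)) auto
    moreover have "(?a - ?c) + (?b - ?d) = (?a + ?b) - (?c + ?d)" by simp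
    ultimately show ?case unfolding simps of_cplx_add using subr_add[OF P(1), of ?a ?b] add by simp
  next
    case (mult f g)
    let ?a = "ev3 of_cplx y1 y2 y3 f" and ?b = "ev3 of_cplx y1 y2 y3 g"
      and ?c = "of_cplx (ev3 (\<lambda>x. x) a1 a2 a3 f)" and ?d = "of_cplx (ev3 (\<lambda>x. x) a1 a2 a3 g)"
    have "?b * (?a - ?c) + ?c * (?b - ?d) \<in> m" using mult by (intro m(4) m(5) const) auto
    moreover have "?b * (?a - ?c) + ?c * (?b - ?d) = ?a * ?b - ?c * ?d" by (simp add: algebra_simps)
    ultimately show ?case unfolding simps of_cplx_mult using subr_mult[OF P(1), of ?a ?b] mult by simp
  qed (simp_all add: simps y const m(2))
qed

theorem theorem3p6:
  fixes X :: "'k::complex_extension_field set set"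
    and \<phi> :: "nat \<Rightarrow> 'k"
    and G :: "('g, 'h) monoid_scheme"
  assumes "projective_variety X" and "variety_dim X = 3"
    and "gorenstein X" and "minimal X" and "general_type X"
    and "locally_factorial X" and "terminal_singularities X"
    and "abelian_cover G 3 \<phi> X"
    and "canonical_morphism 3 \<phi> X"
  shows "map_degree 3 \<phi> \<in> {2 ^ m | m. 1 \<le> m \<and> m \<le> 5}"
proof -
  define L where "L = coordinate_field 3 \<phi>"
  define Gal where "Gal = carrier (galois_group L)"
  note cov = assms(8)[unfolded abelian_cover_def, folded L_def]
  have normal: "normal_variety X" and fin: "finite_map 3 \<phi> X" and surj: "surjective_map 3 \<phi> X" using cov by auto
  have const: "of_cplx c \<in> L" for c unfolding L_def coordinate_field_def by (intro generate_field.incl) auto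
  interpret abelian_ext L Gal unfolding Gal_def using cov const by (intro abelian_ext_galois[of G]) auto
  have nz: "\<phi> i \<noteq> 0" if i: "i \<le> 3" for i
  proof -
    \<comment> \<open>Surjectivity is applied to the i-th coordinate point, where only the i-th
      coordinate can serve as denominator.\<close>
    define c where "c j = (if j = i then 1 else 0 :: complex)" for j
    have "\<exists>j\<le>3. c j \<noteq> 0" using i by (intro exI[of _ i]) (simp add: c_def)
    then obtain P where "maps_to 3 \<phi> P c" using surj unfolding surjective_map_def by metis
    then obtain j where "\<phi> j \<noteq> 0" "c j \<noteq> 0" unfolding maps_to_def by metis
    then show ?thesis by (simp add: c_def split: if_splits)
  qed
  define is_chart where "is_chart i B M \<longleftrightarrow> subring B whole_field \<and> chart_ring 3 \<phi> i \<subseteq> B \<and>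
        {P \<in> X. \<forall>j\<le>3. \<phi> j / \<phi> i \<in> P} = spec B \<and> finite M \<and> M \<subseteq> B \<and>
           B = {\<Sum>b\<in>M. c b * b | c. \<forall>b\<in>M. c b \<in> chart_ring 3 \<phi> i}" for i B M
  have "\<exists>B M. is_chart i B M" if i: "i \<le> 3" for i
  proof -
    note conjunct2[OF fin[unfolded finite_map_def], rule_format, OF i nz[OF i]]
    then show ?thesis unfolding is_chart_def by (elim exE conjE) (intro exI conjI)
  qed
  then obtain Bc Mc where "\<And>i. i \<le> 3 \<Longrightarrow> is_chart i (Bc i) (Mc i)" by metis
  note BM = this[unfolded is_chart_def]
  have subr: "subr (Bc i)" if "i \<le> 3" for i by (rule subr_subring[OF conjunct1[OF BM[OF that]]])
  have A: "range (evc \<phi> i) \<subseteq> Bc i" if "i \<le> 3" for i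
    using conjunct1[OF conjunct2[OF BM[OF that]]] unfolding chart_ring_eq[where s = \<phi>, OF that nz[OF that]] .
  have pts: "{P \<in> X. \<forall>j\<le>3. \<phi> j / \<phi> i \<in> P} = {localization (Bc i) q | q. pideal q (Bc i)}" if "i \<le> 3" for i
    using conjunct1[OF conjunct2[OF conjunct2[OF BM[OF that]]]] unfolding spec_def primeideal_iff[OF subr[OF that]] .
  \<comment> \<open>Surjectivity yields algebraic independence: a relation between the coordinates
    holds at every closed point, so the polynomial vanishes at every point of complex affine
    space.\<close>
  have inj: "f = 0" if i: "i \<le> 3" and f: "evc \<phi> i f = 0" for i f
  proof (rule ev3_zero_everywhere)
    fix a0 a1 a2 :: complex
    \<comment> \<open>Homogeneous coordinates of the affine point (a0, a1, a2), with 1 inserted at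
      position \<open>i\<close>.\<close>
    define c where "c j = (if j = i then 1 else if (if j < i then j else j - 1) = 0 then a0 else if (if j < i then j else j - 1) = 1 then a1 else a2)" for j :: nat
    have ci: "c i = 1" by (simp add: c_def)
    then have "\<exists>i\<le>3. c i \<noteq> 0" using i by (intro exI[of _ i]) simp
    then obtain P where P: "P \<in> X" "maps_to 3 \<phi> P c"
      using surj unfolding surjective_map_def closed_points_def by blast
    \<comment> \<open>The chart \<open>k\<close> that \<open>maps_to\<close> provides may differ
      from \<open>i\<close>; the residues are transferred to the chart \<open>i\<close>
      below.\<close>
    then obtain k where k: "k \<le> 3" "c k \<noteq> 0"
      "\<And>j. j \<le> 3 \<Longrightarrow> \<phi> j / \<phi> k \<in> P \<and> \<phi> j / \<phi> k - of_cplx (c j / c k) \<in> max_ideal P" unfolding maps_to_def by blast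
    then have "P \<in> {localization (Bc k) q | q. pideal q (Bc k)}" using P(1) unfolding pts[OF k(1), symmetric] by blast
    then obtain q where q: "pideal q (Bc k)" "P = localization (Bc k) q" by (elim CollectE exE conjE)
    note loc = local_max_ideal[OF subr[OF k(1)] q(1), folded q(2)] localization_subr(1,2)[OF subr[OF k(1)] q(1), folded q(2)]
    have cP: "of_cplx b \<in> P" for b
    proof -
      have "of_cplx b = evc \<phi> k (C3 b)" by (simp add: evc_simps)
      then show ?thesis using A[OF k(1)] loc(5) by auto
    qed
    have quot: "\<phi> j / \<phi> i \<in> P" "\<phi> j / \<phi> i - of_cplx (c j) \<in> max_ideal P" if j: "j \<le> 3" for j
    proof -
      have eq: "(\<phi> j / \<phi> k) / (\<phi> i / \<phi> k) = \<phi> j / \<phi> i" using nz[OF k(1)] by simp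
      note m = max_ideal_unit_quotient[OF loc(4,1,3) cP, of "\<phi> i / \<phi> k" "c k" "\<phi> j / \<phi> k" "c j", unfolded eq]
      show "\<phi> j / \<phi> i \<in> P" "\<phi> j / \<phi> i - of_cplx (c j) \<in> max_ideal P"
        using k(2) k(3)[OF i] k(3)[OF j] ci by (auto intro!: m)
    qed
    have y: "yc \<phi> i n \<in> P" "yc \<phi> i n - of_cplx (if n = 0 then a0 else if n = 1 then a1 else a2) \<in> max_ideal P" if "n \<le> 2" for n
    proof -
      define j where "j = (if n < i then n else Suc n)"
      have j: "j \<le> 3" "c j = (if n = 0 then a0 else if n = 1 then a1 else a2)" using that by (auto simp: j_def c_def)
      show "yc \<phi> i n \<in> P" "yc \<phi> i n - of_cplx (if n = 0 then a0 else if n = 1 then a1 else a2) \<in> max_ideal P"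
        unfolding yc_def j_def[symmetric] j(2)[symmetric] by (rule quot[OF j(1)])+
    qed
    have "evc \<phi> i f - of_cplx (ev3 (\<lambda>x. x) a0 a1 a2 f) \<in> max_ideal P"
      using ev3_mod_max_ideal[OF loc(4,1) cP y(1)[of 0] y(1)[of 1] y(1)[of 2], of a0 a1 a2 f] y(2)[of 0] y(2)[of 1] y(2)[of 2] by simp
    then have "- 1 * of_cplx (ev3 (\<lambda>x. x) a0 a1 a2 f) \<in> max_ideal P" unfolding f by simp
    then have m: "of_cplx (- ev3 (\<lambda>x. x) a0 a1 a2 f) \<in> max_ideal P" by (simp add: of_cplx_uminus)
    show "ev3 (\<lambda>x. x) a0 a1 a2 f = 0"
    proof (rule ccontr)
      assume "ev3 (\<lambda>x. x) a0 a1 a2 f \<noteq> 0"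
      then have "of_cplx (inverse (- ev3 (\<lambda>x. x) a0 a1 a2 f)) * of_cplx (- ev3 (\<lambda>x. x) a0 a1 a2 f) = (1 :: 'k)"
        by (simp flip: of_cplx_mult)
      then show False using pidealD(5)[OF loc(1) cP m] pidealD(3)[OF loc(1)] by metis
    qed
  qed
  have charts: "chart L Gal (yc \<phi> i 0) (yc \<phi> i 1) (yc \<phi> i 2) (Bc i) (Mc i)" if i: "i \<le> 3" for i
  proof (intro chart.intro chart_axioms.intro abelian_ext_axioms)
    have y: "yc \<phi> i k \<in> L" if "k \<le> 2" for k
      using yc_ratio[OF that, of \<phi> i] i nz[OF i] unfolding L_def coordinate_field_def by (auto intro!: generate_field.incl)
    show "yc \<phi> i 0 \<in> L" "yc \<phi> i 1 \<in> L" "yc \<phi> i 2 \<in> L" by (rule y; simp)+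
    show "evc \<phi> i f = 0 \<Longrightarrow> f = 0" for f by (rule inj[OF i])
    show "\<exists>f g. g \<noteq> 0 \<and> u = evc \<phi> i f / evc \<phi> i g" if "u \<in> L" for u
      by (rule coordinate_field_frac[where s = \<phi>, OF i nz[OF i] inj[OF i] that[unfolded L_def]])
    show "subr (Bc i)" "range (evc \<phi> i) \<subseteq> Bc i" by (rule subr[OF i], rule A[OF i])
    note bm = conjunct2[OF conjunct2[OF conjunct2[OF BM[OF i]]], unfolded chart_ring_eq[where s = \<phi>, OF i nz[OF i]]]
    show "finite (Mc i)" by (rule conjunct1[OF bm])
    show "Mc i \<subseteq> Bc i" by (rule conjunct1[OF conjunct2[OF bm]])
    show "Bc i = {\<Sum>b\<in>Mc i. c b * b | c. \<forall>b\<in>Mc i. c b \<in> range (evc \<phi> i)}"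
      by (rule conjunct2[OF conjunct2[OF bm]])
    fix q assume "pideal q (Bc i)"
    then have "localization (Bc i) q \<in> {P \<in> X. \<forall>j\<le>3. \<phi> j / \<phi> i \<in> P}" unfolding pts[OF i] by blast
    then have "localization (Bc i) q \<in> X" by simp
    then show "factorial_domain (sub (localization (Bc i) q))" "integrally_closed (localization (Bc i) q)"
      using assms(6) normal unfolding locally_factorial_def normal_variety_def by blast+
  qed
  have "cover L Gal X \<phi> Bc Mc"
  proof (rule cover.intro[OF abelian_ext_axioms], rule cover_axioms.intro)
    show "\<exists>i\<le>3. \<forall>j\<le>3. \<phi> j / \<phi> i \<in> P" if "P \<in> X" for P
      using conjunct1[OF fin[unfolded finite_map_def], unfolded regular_map_def, rule_format, OF that]
      by (elim exE conjE) (intro exI conjI)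
  qed (rule nz charts pts; assumption)+
  then interpret cover L Gal X \<phi> Bc Mc .
  obtain \<eta> where eta: "\<eta> \<in> rational_forms 3"
    "module.span (\<lambda>c. form_scale (of_cplx c)) ((\<lambda>i. form_scale (\<phi> i) \<eta>) ` {..3}) = canonical_sections X"
    "\<forall>P\<in>X. \<exists>i\<le>3. form_scale (\<phi> i) \<eta> \<noteq> 0 \<and>
       (\<forall>S\<in>prime_divisors X. P \<subseteq> S \<longrightarrow> div_form X (form_scale (\<phi> i) \<eta>) S = 0)"
    using assms(9) unfolding canonical_morphism_def assms(2) by blast
  have canonical: "canonical_cover L Gal X \<phi> Bc Mc \<eta>"
  proof (intro canonical_cover.intro canonical_cover_axioms.intro cover_axioms)
    show "\<eta> \<in> rational_forms 3" by (rule eta(1))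
    show "module.span (\<lambda>c. form_scale (of_cplx c)) ((\<lambda>i. form_scale (\<phi> i) \<eta>) ` {..3})
      = {\<omega> \<in> rational_forms 3. \<omega> \<noteq> 0 \<longrightarrow> (\<forall>S\<in>prime_divisors X. 0 \<le> form_ord 3 S \<omega>)}"
      using eta(2) unfolding canonical_sections_def div_form_def assms(2) .
    show "\<exists>i\<le>3. form_scale (\<phi> i) \<eta> \<noteq> 0 \<and>
       (\<forall>S\<in>prime_divisors X. P \<subseteq> S \<longrightarrow> form_ord 3 S (form_scale (\<phi> i) \<eta>) = 0)" if "P \<in> X" for P
      using eta(3) that unfolding div_form_def assms(2) by blast
  qed
  show ?thesis using canonical_cover.degree_power_of_two[OF canonical] unfolding map_degree_def L_def by auto
qed

end
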